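(* Let $n\ge 3$, let $k$ be a field whose characteristic does not divide $n!$, let $S=k[x_1,\dots,x_n]$, $R=S^{S_n}$, $z=\prod_{1\le i<j\le n}(x_i-x_j)$ and $\Delta=z^2\in R$. Let $\lambda\vdash n$, let $m=|\mathrm{ST}(\lambda)|$ be the dimension of the corresponding irreducible representation of $S_n$, let $T\in \mathrm{ST}(\lambda)$, and let $T_1<T_2<\dots<T_m$ be the elements of $\mathrm{ST}(\lambda)$ listed in increasing order (for the order on $\mathrm{ST}(\lambda)$ described in the context). Then, with respect to the $R$-bases $(H_T^{T_1},\dots,H_T^{T_m})$ of $M_T$ and $(F_{T'}^{T_1'},\dots,F_{T'}^{T_m'})$ of $N_{T'}$, the matrix factorization $(z|_{M_T},z|_{N_{T'}})$ of $\Delta$, where $z|_{M_T}:M_T\to N_{T'}$ and $z|_{N_{T'}}:N_{T'}\to M_T$ are multiplication by $z$, can be written explicitly as $(A,B)$, where $$A=\begin{bmatrix} g_1^1&\cdots&g_m^1\\ \vdots&\ddots&\vdots\\ g_1^m&\cdots&g_m^m\end{bmatrix},$$ the entries $g_i^j\in R$ are defined iteratively by $$g_i^j=\frac{\Bigl\langle F_T^{T_j},\ zH_T^{T_i}-g_i^1F_{T'}^{T_1'}-\cdots-g_i^{j-1}F_{T'}^{T_{j-1}'}\Bigr\rangle}{\Bigl\langle F_T^{T_j},F_{T'}^{T_j'}\Bigr\rangle},\qquad 1\le i\le m,\ 1\le j\le m,$$ and $B$ is an $m\times m$ matrix over $R$ obtained as the first syzygy of $A$ over $R/(\Delta)$,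 that is, $AB=BA=\Delta\cdot I_m$ and $\operatorname{Coker}(B)$ is isomorphic to the kernel of the natural surjection $(R/(\Delta))^m\to\operatorname{Coker}(A)$.
   Context: $S_n$ acts on $S$ by $(\pi\cdot f)(x_1,\dots,x_n)=f(x_{\pi(1)},\dots,x_{\pi(n)})$. Tableaux. A Young tableau $T$ of shape $\lambda\vdash n$ is a filling of the Young diagram of $\lambda$ (English convention) by $1,\dots,n$, each used once; it is standard if entries strictly increase along rows and down columns. $\mathrm{ST}(\lambda)$ is the set of standard tableaux of shape $\lambda$, $f^\lambda=|\mathrm{ST}(\lambda)|$. $\lambda'$ is the conjugate partition and $T'\in\mathrm{ST}(\lambda')$ the transpose of $T$. Index. For $P\in \mathrm{ST}(\lambda)$ the word $w(P)$ is obtained by reading each column from bottom to top, starting with the leftmost column. The index is defined inductively: $1$ has index $0$; if $j$ has index $p$ then $j+1$ has index $p$ if $j+1$ is to the right of $j$ in $w(P)$, and index $p+1$ if it is to the left. $i(P)$ is the filling of $\lambda$ obtained by replacing each entry of $P$ by its index, $\hat{i}(P)$ is the sequence of these $n$ indices in non-decreasing order, and $|\hat i(P)|$ is their sum. Order on $\mathrm{ST}(\lambda)$. Last letter order: if $q$ is the largest integer written in different positions in $S_1,S_2$, then $S_1$ precedes $S_2$ when the row of $q$ in $S_2$ is above the row of $q$ in $S_1$. The order $<$ used in the claim: $S_1<S_2$ if $|\hat i(S_1)|<|\hat i(S_2)|$; if these are equal, $S_1<S_2$ if $\hat i(S_1)<\hat i(S_2)$ in the reverse lexicographic order (compare the entries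 at the last position where the sequences differ; the smaller entry gives the smaller sequence); if $\hat i(S_1)=\hat i(S_2)$, $S_1<S_2$ if $S_1$ precedes $S_2$ in the last letter order. Young symmetrizers. $R(T)$ and $C(T)$ are the subgroups of $S_n$ preserving the rows, respectively columns, of $T$. Put $r_T=\sum_{\pi\in R(T)}\pi$, $c_T=\sum_{\rho\in C(T)}\mathrm{sgn}(\rho)\rho$, $\varepsilon_T=\frac{f^\lambda}{n!}c_Tr_T$, $\sigma_T=\frac{f^\lambda}{n!}r_Tc_T$. For $T,P\in \mathrm{ST}(\lambda)$ let $x_T^P=\prod_{c} x_{T(c)}^{\,i(P)(c)}$ over all cells $c$ of $\lambda$, $F_T^P=\varepsilon_T\cdot x_T^P$ and $H_T^P=\sigma_T\cdot x_T^P$. $M_T$ is the (free) $R$-submodule of $S$ generated by $\{H_T^P:P\in\mathrm{ST}(\lambda)\}$ and $N_{T'}$ the (free) $R$-submodule of $S$ generated by $\{F_{T'}^{P'}:P'\in\mathrm{ST}(\lambda')\}$. Multiplication by $z$ maps $M_T$ into $N_{T'}$ and $N_{T'}$ into $M_T$. Bilinear form. $\langle -,-\rangle:S\times S\to R$ is the $R$-bilinear form $\langle f,g\rangle=\frac1z\sum_{\pi\in S_n}\mathrm{sgn}(\pi)\,\pi(fg)$. The denominators $\langle F_T^{T_j},F_{T'}^{T_j'}\rangle$ are nonzero constants in $k$ (a known result of Ariki–Terasoma–Yamada). A matrix factorization of $\Delta$ is a pair $(\varphi,\psi)$ of $R$-linear maps $\varphi:F\to G$, $\psi:G\to F$ of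 free modules of the same finite rank with $\psi\varphi=\Delta\cdot 1_F$ and $\varphi\psi=\Delta\cdot1_G$.
   Formalization: The formal theorem assumes that (H_T^{T_1},…,H_T^{T_m}) is an R-basis of M_T; the text takes this for granted, but it fails for some shapes, e.g. λ=(3,3,1) with n=7, where these polynomials are linearly dependent over R and AB=Δ·I_m is impossible. *)

theory Defs
  imports
    "HOL-Library.Poly_Mapping"
    "HOL-Library.FuncSet"
    "HOL-Combinatorics.Permutations"
    "HOL-Algebra.QuotRing"
    "HOL-Algebra.Module"
    "Jordan_Normal_Form.Matrix"
begin

section \<open>Polynomials, the action of the symmetric group, and the discriminant\<close>

text \<open>
  A polynomial is a finitely supported map from exponent vectors to coefficients.  The type has
  variables \<open>x\<^sub>i\<close> for all natural numbers \<open>i\<close>; \<open>polys n\<close> is the subring \<open>S = k[x\<^sub>1, \<dots>, x\<^sub>n]\<close>.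
  The group \<open>S\<^sub>n\<close> is the set of all \<open>\<pi>\<close> with \<open>\<pi> permutes {1..n}\<close>, under composition.
\<close>

type_synonym 'k mpoly = "(nat \<Rightarrow>\<^sub>0 nat) \<Rightarrow>\<^sub>0 'k"

definition Const :: "'k::field \<Rightarrow> 'k mpoly" where
  "Const a = Poly_Mapping.single 0 a"

definition X :: "nat \<Rightarrow> 'k::field mpoly" where
  "X i = Poly_Mapping.single (Poly_Mapping.single i 1) 1"

definition polys :: "nat \<Rightarrow> 'k::field mpoly set" where
  "polys n = {f. \<forall>m \<in> Poly_Mapping.keys f. Poly_Mapping.keys m \<subseteq> {1..n}}"

text \<open>\<open>(\<pi> \<cdot> f)(x\<^sub>1, \<dots>, x\<^sub>n) = f(x\<^bsub>\<pi>(1)\<^esub>, \<dots>, x\<^bsub>\<pi>(n)\<^esub>)\<close>, by substitution in each monomial; this is a left action.\<close>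

definition perm_act :: "(nat \<Rightarrow> nat) \<Rightarrow> 'k::field mpoly \<Rightarrow> 'k mpoly" where
  "perm_act \<pi> f =
     (\<Sum>m \<in> Poly_Mapping.keys f. Const (Poly_Mapping.lookup f m) *
        (\<Prod>i \<in> Poly_Mapping.keys m. X (\<pi> i) ^ Poly_Mapping.lookup m i))"

definition sym_polys :: "nat \<Rightarrow> 'k::field mpoly set" where
  "sym_polys n = {f \<in> polys n. \<forall>\<pi>. \<pi> permutes {1..n} \<longrightarrow> perm_act \<pi> f = f}"

definition sym_ring :: "nat \<Rightarrow> 'k::field mpoly ring" where
  "sym_ring n = \<lparr>carrier = sym_polys n, monoid.mult = (*), one = 1, zero = 0, add = (+)\<rparr>"

text \<open>\<open>S\<close> as a module over \<open>sym_ring n\<close>.\<close>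

definition poly_module :: "nat \<Rightarrow> ('k::field mpoly, 'k mpoly) module" where
  "poly_module n =
     \<lparr>carrier = polys n, monoid.mult = (*), one = 1, zero = 0, add = (+), smult = (*)\<rparr>"

definition vandermonde :: "nat \<Rightarrow> 'k::field mpoly" where
  "vandermonde n = (\<Prod>i \<in> {1..n}. \<Prod>j \<in> {i<..n}. X i - X j)"

text \<open>
  \<open>f / g\<close> inside the domain \<open>S\<close>; it is only meaningful when \<open>g\<close> is nonzero and divides \<open>f\<close> in \<open>S\<close>.
\<close>

definition exact_quot :: "nat \<Rightarrow> 'k::field mpoly \<Rightarrow> 'k mpoly \<Rightarrow> 'k mpoly" where
  "exact_quot n f g = (THE h. h \<in> polys n \<and> h * g = f)"

definition form :: "nat \<Rightarrow> 'k::field mpoly \<Rightarrow> 'k mpoly \<Rightarrow> 'k mpoly" where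
  "form n f g =
     exact_quot n (\<Sum>\<pi> | \<pi> permutes {1..n}. of_int (sign \<pi>) * perm_act \<pi> (f * g))
       (vandermonde n)"


section \<open>Partitions and standard tableaux\<close>

definition is_partition :: "nat list \<Rightarrow> nat \<Rightarrow> bool" where
  "is_partition lam n \<longleftrightarrow> sorted_wrt (\<ge>) lam \<and> 0 \<notin> set lam \<and> sum_list lam = n"

text \<open>
  Cells are pairs (row, column), both counted from 0, with row 0 at the top.  A tableau is a
  function on the cells, extended by \<open>undefined\<close> outside the diagram.
\<close>

definition diagram :: "nat list \<Rightarrow> (nat \<times> nat) set" where
  "diagram lam = {(r, c). r < length lam \<and> c < lam ! r}"

type_synonym tableau = "nat \<times> nat \<Rightarrow> nat"

definition young_tableaux :: "nat list \<Rightarrow> tableau set" where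
  "young_tableaux lam =
     {T \<in> extensional (diagram lam). bij_betw T (diagram lam) {1..sum_list lam}}"

definition ST :: "nat list \<Rightarrow> tableau set" where
  "ST lam = {T \<in> young_tableaux lam.
     (\<forall>r c c'. c < c' \<and> (r, c') \<in> diagram lam \<longrightarrow> T (r, c) < T (r, c')) \<and>
     (\<forall>r r' c. r < r' \<and> (r', c) \<in> diagram lam \<longrightarrow> T (r, c) < T (r', c))}"

definition conj_partition :: "nat list \<Rightarrow> nat list" where
  "conj_partition lam =
     map (\<lambda>c. card {r. r < length lam \<and> c < lam ! r}) [0..<foldr max lam 0]"

definition transpose_tab :: "tableau \<Rightarrow> tableau" where
  "transpose_tab T = (\<lambda>(r, c). T (c, r))"

definition tab_word :: "nat list \<Rightarrow> tableau \<Rightarrow> nat list" where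
  "tab_word lam P =
     concat (map (\<lambda>c. map (\<lambda>r. P (r, c)) (rev [0..<conj_partition lam ! c]))
       [0..<length (conj_partition lam)])"

definition right_of :: "nat list \<Rightarrow> nat \<Rightarrow> nat \<Rightarrow> bool" where
  "right_of w a b \<longleftrightarrow> (\<exists>p q. q < p \<and> p < length w \<and> w ! p = a \<and> w ! q = b)"

text \<open>Index of a letter in a word; the letters start at 1 and the value at 0 is irrelevant.\<close>

fun letter_index :: "nat list \<Rightarrow> nat \<Rightarrow> nat" where
  "letter_index w 0 = 0"
| "letter_index w (Suc 0) = 0"
| "letter_index w (Suc (Suc j)) =
     letter_index w (Suc j) + (if right_of w (Suc (Suc j)) (Suc j) then 0 else 1)"

definition index_tab :: "nat list \<Rightarrow> tableau \<Rightarrow> nat \<times> nat \<Rightarrow> nat" where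
  "index_tab lam P c = letter_index (tab_word lam P) (P c)"

definition index_seq :: "nat list \<Rightarrow> tableau \<Rightarrow> nat list" where
  "index_seq lam P = sort (map (letter_index (tab_word lam P)) [1..<Suc (sum_list lam)])"

definition revlex_less :: "nat list \<Rightarrow> nat list \<Rightarrow> bool" where
  "revlex_less u v \<longleftrightarrow> length u = length v \<and>
     (\<exists>p < length u. u ! p < v ! p \<and> (\<forall>q. p < q \<and> q < length u \<longrightarrow> u ! q = v ! q))"

definition cell_of :: "nat list \<Rightarrow> tableau \<Rightarrow> nat \<Rightarrow> nat \<times> nat" where
  "cell_of lam P q = inv_into (diagram lam) P q"

definition last_letter_less :: "nat list \<Rightarrow> tableau \<Rightarrow> tableau \<Rightarrow> bool" where
  "last_letter_less lam P1 P2 \<longleftrightarrow>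
     (\<exists>q \<in> {1..sum_list lam}.
        cell_of lam P1 q \<noteq> cell_of lam P2 q \<and>
        (\<forall>q' \<in> {q<..sum_list lam}. cell_of lam P1 q' = cell_of lam P2 q') \<and>
        fst (cell_of lam P2 q) < fst (cell_of lam P1 q))"

definition tab_less :: "nat list \<Rightarrow> tableau \<Rightarrow> tableau \<Rightarrow> bool" where
  "tab_less lam P1 P2 \<longleftrightarrow>
     sum_list (index_seq lam P1) < sum_list (index_seq lam P2) \<or>
     sum_list (index_seq lam P1) = sum_list (index_seq lam P2) \<and>
       (revlex_less (index_seq lam P1) (index_seq lam P2) \<or>
        index_seq lam P1 = index_seq lam P2 \<and> last_letter_less lam P1 P2)"


section \<open>Young symmetrizers and higher Specht polynomials\<close>

text \<open>Elements of the group algebra \<open>k[S\<^sub>n]\<close> are given by their coefficient functions.\<close>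

type_synonym 'k group_alg = "(nat \<Rightarrow> nat) \<Rightarrow> 'k"

definition ga_mult :: "nat \<Rightarrow> 'k::field group_alg \<Rightarrow> 'k group_alg \<Rightarrow> 'k group_alg" where
  "ga_mult n a b = (\<lambda>\<tau>.
     \<Sum>(\<pi>, \<rho>) \<in> {(\<pi>, \<rho>). \<pi> permutes {1..n} \<and> \<rho> permutes {1..n} \<and> \<pi> \<circ> \<rho> = \<tau>}. a \<pi> * b \<rho>)"

definition ga_act :: "nat \<Rightarrow> 'k::field group_alg \<Rightarrow> 'k mpoly \<Rightarrow> 'k mpoly" where
  "ga_act n a f = (\<Sum>\<pi> | \<pi> permutes {1..n}. Const (a \<pi>) * perm_act \<pi> f)"

definition row_group :: "nat list \<Rightarrow> tableau \<Rightarrow> (nat \<Rightarrow> nat) set" where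
  "row_group lam T = {\<pi>. \<pi> permutes {1..sum_list lam} \<and>
     (\<forall>r. \<pi> ` {T (r, c) | c. (r, c) \<in> diagram lam} = {T (r, c) | c. (r, c) \<in> diagram lam})}"

definition col_group :: "nat list \<Rightarrow> tableau \<Rightarrow> (nat \<Rightarrow> nat) set" where
  "col_group lam T = {\<pi>. \<pi> permutes {1..sum_list lam} \<and>
     (\<forall>c. \<pi> ` {T (r, c) | r. (r, c) \<in> diagram lam} = {T (r, c) | r. (r, c) \<in> diagram lam})}"

definition row_sum :: "nat list \<Rightarrow> tableau \<Rightarrow> 'k::field group_alg" where
  "row_sum lam T = (\<lambda>\<pi>. if \<pi> \<in> row_group lam T then 1 else 0)"

definition col_sum :: "nat list \<Rightarrow> tableau \<Rightarrow> 'k::field group_alg" where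
  "col_sum lam T = (\<lambda>\<pi>. if \<pi> \<in> col_group lam T then of_int (sign \<pi>) else 0)"

definition young_eps :: "nat list \<Rightarrow> tableau \<Rightarrow> 'k::field group_alg" where
  "young_eps lam T = (\<lambda>\<tau>. of_nat (card (ST lam)) / of_nat (fact (sum_list lam)) *
     ga_mult (sum_list lam) (col_sum lam T) (row_sum lam T) \<tau>)"

definition young_sigma :: "nat list \<Rightarrow> tableau \<Rightarrow> 'k::field group_alg" where
  "young_sigma lam T = (\<lambda>\<tau>. of_nat (card (ST lam)) / of_nat (fact (sum_list lam)) *
     ga_mult (sum_list lam) (row_sum lam T) (col_sum lam T) \<tau>)"

definition tab_monom :: "nat list \<Rightarrow> tableau \<Rightarrow> tableau \<Rightarrow> 'k::field mpoly" where
  "tab_monom lam T P = (\<Prod>c \<in> diagram lam. X (T c) ^ index_tab lam P c)"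

definition F_poly :: "nat list \<Rightarrow> tableau \<Rightarrow> tableau \<Rightarrow> 'k::field mpoly" where
  "F_poly lam T P = ga_act (sum_list lam) (young_eps lam T) (tab_monom lam T P)"

definition H_poly :: "nat list \<Rightarrow> tableau \<Rightarrow> tableau \<Rightarrow> 'k::field mpoly" where
  "H_poly lam T P = ga_act (sum_list lam) (young_sigma lam T) (tab_monom lam T P)"

definition generated_submodule ::
    "('a, 'c) ring_scheme \<Rightarrow> ('a, 'b) module \<Rightarrow> 'b set \<Rightarrow> ('a, 'b) module" where
  "generated_submodule R M B = M\<lparr>carrier := (\<lambda>N. submodule N R M) hull B\<rparr>"

text \<open>
  The generators of \<open>M_module lam T\<close> are not linearly independent over \<open>R\<close> for every shape (they
  are dependent for \<open>lam = [3, 3, 1]\<close>), so that they form a basis has to be stated separately.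
\<close>

definition M_module :: "nat list \<Rightarrow> tableau \<Rightarrow> ('k::field mpoly, 'k mpoly) module" where
  "M_module lam T = generated_submodule (sym_ring (sum_list lam)) (poly_module (sum_list lam))
     (H_poly lam T ` ST lam)"

text \<open>For a tableau \<open>T\<close> of shape \<open>lam\<close>, the module \<open>N\<^bsub>T'\<^esub>\<close> is \<open>N_module (conj_partition lam) (transpose_tab T)\<close>.\<close>

definition N_module :: "nat list \<Rightarrow> tableau \<Rightarrow> ('k::field mpoly, 'k mpoly) module" where
  "N_module lam T = generated_submodule (sym_ring (sum_list lam)) (poly_module (sum_list lam))
     (F_poly lam T ` ST lam)"

text \<open>
  \<open>g_coeff lam T Ts i j\<close> is \<open>g\<^sub>i\<^sup>j\<close>, for the tableaux listed in \<open>Ts\<close>; both indices start at 0.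
\<close>

function g_coeff :: "nat list \<Rightarrow> tableau \<Rightarrow> tableau list \<Rightarrow> nat \<Rightarrow> nat \<Rightarrow> 'k::field mpoly" where
  "g_coeff lam T Ts i j =
     exact_quot (sum_list lam)
       (form (sum_list lam) (F_poly lam T (Ts ! j))
          (vandermonde (sum_list lam) * H_poly lam T (Ts ! i) -
           (\<Sum>l<j. g_coeff lam T Ts i l *
              F_poly (conj_partition lam) (transpose_tab T) (transpose_tab (Ts ! l)))))
       (form (sum_list lam) (F_poly lam T (Ts ! j))
          (F_poly (conj_partition lam) (transpose_tab T) (transpose_tab (Ts ! j))))"
  by pat_completeness auto
termination by (relation "measure (\<lambda>(lam, T, Ts, i, j). j)") auto


section \<open>Modules, bases and matrix factorizations\<close>

definition linear_maps ::
    "('a, 'c) ring_scheme \<Rightarrow> ('a, 'b) module \<Rightarrow> ('a, 'd) module \<Rightarrow> ('b \<Rightarrow> 'd) set" where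
  "linear_maps R M N = {h \<in> carrier M \<rightarrow> carrier N.
     (\<forall>x \<in> carrier M. \<forall>y \<in> carrier M. h (x \<oplus>\<^bsub>M\<^esub> y) = h x \<oplus>\<^bsub>N\<^esub> h y) \<and>
     (\<forall>a \<in> carrier R. \<forall>x \<in> carrier M. h (a \<odot>\<^bsub>M\<^esub> x) = a \<odot>\<^bsub>N\<^esub> h x)}"

definition modules_isomorphic ::
    "('a, 'c) ring_scheme \<Rightarrow> ('a, 'b) module \<Rightarrow> ('a, 'd) module \<Rightarrow> bool" where
  "modules_isomorphic R M N \<longleftrightarrow>
     (\<exists>h \<in> linear_maps R M N. bij_betw h (carrier M) (carrier N))"

definition module_basis :: "('a, 'c) ring_scheme \<Rightarrow> ('a, 'b) module \<Rightarrow> 'b list \<Rightarrow> bool" where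
  "module_basis R M bs \<longleftrightarrow> set bs \<subseteq> carrier M \<and>
     (\<forall>x \<in> carrier M. \<exists>!a. a \<in> {..<length bs} \<rightarrow>\<^sub>E carrier R \<and>
        x = (\<Oplus>\<^bsub>M\<^esub> i \<in> {..<length bs}. a i \<odot>\<^bsub>M\<^esub> (bs ! i)))"

definition free_of_rank :: "('a, 'c) ring_scheme \<Rightarrow> ('a, 'b) module \<Rightarrow> nat \<Rightarrow> bool" where
  "free_of_rank R M r \<longleftrightarrow> module R M \<and> (\<exists>bs. length bs = r \<and> module_basis R M bs)"

definition matrix_factorization ::
    "('a, 'c) ring_scheme \<Rightarrow> 'a \<Rightarrow> ('a, 'b) module \<Rightarrow> ('a, 'd) module \<Rightarrow>
     ('b \<Rightarrow> 'd) \<Rightarrow> ('d \<Rightarrow> 'b) \<Rightarrow> bool" where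
  "matrix_factorization R d F G \<phi> \<psi> \<longleftrightarrow>
     (\<exists>r. free_of_rank R F r \<and> free_of_rank R G r) \<and>
     \<phi> \<in> linear_maps R F G \<and> \<psi> \<in> linear_maps R G F \<and>
     (\<forall>x \<in> carrier F. \<psi> (\<phi> x) = d \<odot>\<^bsub>F\<^esub> x) \<and>
     (\<forall>y \<in> carrier G. \<phi> (\<psi> y) = d \<odot>\<^bsub>G\<^esub> y)"

text \<open>
  \<open>A\<close> is the matrix over \<open>R\<close> of \<open>h\<close> with respect to \<open>bs\<close> and \<open>cs\<close>: column \<open>i\<close> holds the
  coordinates of \<open>h (bs ! i)\<close>.
\<close>

definition represents ::
    "('a, 'c) ring_scheme \<Rightarrow> ('a, 'd) module \<Rightarrow> 'b list \<Rightarrow> 'd list \<Rightarrow> ('b \<Rightarrow> 'd) \<Rightarrow> 'a mat \<Rightarrow> bool"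
  where
  "represents R N bs cs h A \<longleftrightarrow>
     A \<in> carrier_mat (length cs) (length bs) \<and>
     (\<forall>j < length cs. \<forall>i < length bs. A $$ (j, i) \<in> carrier R) \<and>
     (\<forall>i < length bs. h (bs ! i) = (\<Oplus>\<^bsub>N\<^esub> j \<in> {..<length cs}. A $$ (j, i) \<odot>\<^bsub>N\<^esub> (cs ! j)))"


section \<open>Cokernels and the first syzygy over a residue ring\<close>

definition free_module :: "('a, 'c) ring_scheme \<Rightarrow> nat \<Rightarrow> ('a, 'a vec) module" where
  "free_module R r =
     \<lparr>carrier = {v \<in> carrier_vec r. \<forall>i < r. v $ i \<in> carrier R},
      monoid.mult = undefined, one = undefined,
      zero = vec r (\<lambda>_. \<zero>\<^bsub>R\<^esub>),
      add = (\<lambda>u v. vec r (\<lambda>i. u $ i \<oplus>\<^bsub>R\<^esub> v $ i)),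
      smult = (\<lambda>a v. vec r (\<lambda>i. a \<otimes>\<^bsub>R\<^esub> v $ i))\<rparr>"

definition quotient_module :: "('a, 'b) module \<Rightarrow> 'b set \<Rightarrow> ('a, 'b set) module" where
  "quotient_module M N =
     \<lparr>carrier = a_rcosets\<^bsub>M\<^esub> N,
      monoid.mult = undefined, one = undefined,
      zero = N,
      add = (\<lambda>U V. U <+>\<^bsub>M\<^esub> V),
      smult = (\<lambda>a U. \<Union>x \<in> U. N +>\<^bsub>M\<^esub> (a \<odot>\<^bsub>M\<^esub> x))\<rparr>"

definition restrict_scalars :: "('a \<Rightarrow> 'e) \<Rightarrow> ('e, 'b) module \<Rightarrow> ('a, 'b) module" where
  "restrict_scalars h M =
     \<lparr>carrier = carrier M, monoid.mult = monoid.mult M, one = one M, zero = zero M, add = add M,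
      smult = (\<lambda>a x. h a \<odot>\<^bsub>M\<^esub> x)\<rparr>"

text \<open>
  In the following, \<open>R\<close> is a subring of a commutative ring type, so that the matrix operations of
  the type are those over \<open>R\<close>.
\<close>

definition mat_image :: "'a::comm_ring_1 ring \<Rightarrow> 'a mat \<Rightarrow> 'a vec set" where
  "mat_image R A = {A *\<^sub>v v | v. v \<in> carrier (free_module R (dim_col A))}"

definition coker :: "'a::comm_ring_1 ring \<Rightarrow> 'a mat \<Rightarrow> ('a, 'a vec set) module" where
  "coker R A = quotient_module (free_module R (dim_row A)) (mat_image R A)"

definition residue_class :: "'a ring \<Rightarrow> 'a \<Rightarrow> 'a \<Rightarrow> 'a set" where
  "residue_class R d x = (PIdl\<^bsub>R\<^esub> d) +>\<^bsub>R\<^esub> x"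

text \<open>\<open>(R/(d))\<^sup>r\<close>, regarded as an \<open>R\<close>-module.\<close>

definition free_residue_module :: "'a ring \<Rightarrow> 'a \<Rightarrow> nat \<Rightarrow> ('a, 'a set vec) module" where
  "free_residue_module R d r =
     restrict_scalars (residue_class R d) (free_module (R Quot (PIdl\<^bsub>R\<^esub> d)) r)"

text \<open>
  The natural surjection \<open>(R/(d))\<^sup>r \<rightarrow> Coker A\<close> sends the vector of residue classes of \<open>v\<close> to the
  class of \<open>v\<close>.  If \<open>d R\<^sup>r\<close> is contained in the image of \<open>A\<close> (that is, if the map exists), all the
  cosets in the union below are equal.
\<close>

definition natural_surj :: "'a::comm_ring_1 ring \<Rightarrow> 'a \<Rightarrow> 'a mat \<Rightarrow> 'a set vec \<Rightarrow> 'a vec set" where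
  "natural_surj R d A V =
     \<Union>{mat_image R A +>\<^bsub>free_module R (dim_row A)\<^esub> v | v.
         v \<in> carrier (free_module R (dim_row A)) \<and> map_vec (residue_class R d) v = V}"

definition natural_kernel :: "'a::comm_ring_1 ring \<Rightarrow> 'a \<Rightarrow> 'a mat \<Rightarrow> ('a, 'a set vec) module" where
  "natural_kernel R d A =
     (free_residue_module R d (dim_row A))
       \<lparr>carrier := {V \<in> carrier (free_residue_module R d (dim_row A)).
          natural_surj R d A V = \<zero>\<^bsub>coker R A\<^esub>}\<rparr>"

definition first_syzygy :: "'a::comm_ring_1 ring \<Rightarrow> 'a \<Rightarrow> nat \<Rightarrow> 'a mat \<Rightarrow> 'a mat \<Rightarrow> bool" where
  "first_syzygy R d m A B \<longleftrightarrow>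
     A * B = d \<cdot>\<^sub>m 1\<^sub>m m \<and> B * A = d \<cdot>\<^sub>m 1\<^sub>m m \<and>
     modules_isomorphic R (coker R B) (natural_kernel R d A)"

end

theory Submission
  imports Defs "HOL-Algebra.Sym_Groups"
begin

text \<open>
  A tableau \<open>T\<close> is encoded by the two functions giving the row and the column of each label.
  Multiplication by \<open>z\<close> turns invariants into anti-invariants, so it exchanges the symmetrizer
  $r_T c_T$ of \<open>T\<close> with the symmetrizer $c_{T'} r_{T'}$ of its transpose.  The pairing of $F_T^P$
  with $F_{T'}^{Q'}$ is a nonzero constant for \<open>P = Q\<close> and vanishes for \<open>P < Q\<close>: it is a
  combination of antisymmetrized monomials, and for \<open>P < Q\<close> each of these monomials has two equal
  exponents.  Triangularity makes the $F_{T'}^{Q'}$ independent over \<open>R\<close>; since Garnir relations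
  bound the rank of the image of the symmetrizer by the number of standard tableaux, they form a
  basis of the image of $c_{T'} r_{T'}$ on \<open>S\<close>.  The images of $c_T r_T$ and $r_T c_T$ have the
  same dimension in each degree, so the $H_T^P$, being independent, span the image of $r_T c_T$.
  Hence \<open>z\<close> maps each of the two modules into the other, and triangularity recovers the coordinates
  of $z H_T^{T_i}$ by the recursion for $g_i^j$.  Finally, \<open>v \<mapsto> A v\<close> identifies
  the cokernel of \<open>B\<close> with $A R^m / z^2 R^m$, the kernel of the natural surjection.
\<close>

text \<open>For the F the diagonal of the pairing consists of constants, so a Gram-Schmidt reduction
  stays inside R; by the rank bound the remainder is orthogonal to the whole image of the other
  symmetrizer, and adjointness with quasi-idempotence kills it. For the H, whose independence is a
  hypothesis, the column antisymmetrizer embeds the image of r c into that of c r; replacing there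
  each basis element by the H of the same degree gives an injective endomorphism of a
  finite-dimensional space in each degree. The vanishing for P < Q rests on the fact that the
  fillings i(P) and i(P') add up to the values 0, ..., n-1, each taken once: n distinct exponents
  cannot have a smaller sum, and equality forces P and Q to agree letter by letter, from n
  downwards.\<close>

section \<open>Polynomials as finitely supported maps: induction and constants\<close>

lemma mpoly_induct [case_names single add]:
  fixes f :: "'a \<Rightarrow>\<^sub>0 'b::comm_monoid_add"
  assumes "\<And>m c. P (Poly_Mapping.single m c)" "\<And>f g. P f \<Longrightarrow> P g \<Longrightarrow> P (f + g)"
  shows "P f"
proof (induction f rule: update_induct)
  case const
  show ?case using assms(1)[of undefined 0] by simp
next
  case (update f a b)
  have "Poly_Mapping.update a b f = f + Poly_Mapping.single a b"
    using update(1,2)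
    by (intro poly_mapping_eqI)
       (auto simp: lookup_update lookup_add lookup_single when_def in_keys_iff)
  then show ?case using assms update by simp
qed

lemma poly_eq_sum_single:
  "f = (\<Sum>m\<in>Poly_Mapping.keys f. Poly_Mapping.single m (Poly_Mapping.lookup f m))"
  by (rule poly_mapping_eqI) (auto simp: lookup_sum lookup_single when_def in_keys_iff)

lemma Const_add: "Const (a + b) = Const a + Const b"
  and Const_mult: "Const (a * b) = Const a * Const b"
  and Const_0 [simp]: "Const 0 = 0" and Const_1 [simp]: "Const 1 = 1"
  by (simp_all add: Const_def single_add mult_single)

lemma Const_eq_iff [simp]: "Const a = Const b \<longleftrightarrow> a = b"
proof
  assume "Const a = Const b"
  then have "Poly_Mapping.lookup (Const a) 0 = Poly_Mapping.lookup (Const b) 0" by simp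
  then show "a = b" by (simp add: Const_def)
qed simp

lemma Const_eq_0_iff [simp]: "Const a = 0 \<longleftrightarrow> a = 0"
  using Const_eq_iff[of a 0] by (simp del: Const_eq_iff)

lemma Const_of_int: "Const (of_int i) = of_int i"
  and Const_of_nat: "Const (of_nat j) = of_nat j"
  by (simp_all add: Const_def)

lemma lookup_Const_mult: "Poly_Mapping.lookup (Const c * f) m = c * Poly_Mapping.lookup f m"
  by (induction f rule: mpoly_induct)
     (auto simp: Const_def mult_single lookup_single when_def distrib_left lookup_add)


subsection \<open>Substitution and the action of permutations\<close>

definition monom_eval :: "(nat \<Rightarrow> 'k::field mpoly) \<Rightarrow> (nat \<Rightarrow>\<^sub>0 nat) \<Rightarrow> 'k mpoly" where
  "monom_eval \<phi> m = (\<Prod>i\<in>Poly_Mapping.keys m. \<phi> i ^ Poly_Mapping.lookup m i)"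

text \<open>Permutations act by substituting variables for variables. The general form also covers
  the non-injective specialization \<open>X i := X j\<close>, which detects divisibility by
  \<open>X i - X j\<close>.\<close>

definition subst :: "(nat \<Rightarrow> 'k::field mpoly) \<Rightarrow> 'k mpoly \<Rightarrow> 'k mpoly" where
  "subst \<phi> f = (\<Sum>m\<in>Poly_Mapping.keys f. Const (Poly_Mapping.lookup f m) * monom_eval \<phi> m)"

lemma perm_act_subst: "perm_act \<pi> = subst (\<lambda>i. X (\<pi> i))"
  by (simp add: fun_eq_iff perm_act_def subst_def monom_eval_def)

lemma monom_eval_superset:
  assumes "finite A" "Poly_Mapping.keys m \<subseteq> A"
  shows "monom_eval \<phi> m = (\<Prod>i\<in>A. \<phi> i ^ Poly_Mapping.lookup m i)"
  unfolding monom_eval_def using assms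
  by (intro prod.mono_neutral_left) (auto simp: in_keys_iff)

lemma monom_eval_add: "monom_eval \<phi> (m + m') = monom_eval \<phi> m * monom_eval \<phi> m'"
proof -
  let ?A = "Poly_Mapping.keys m \<union> Poly_Mapping.keys m'"
  have "Poly_Mapping.keys (m + m') \<subseteq> ?A" by (rule keys_add)
  then show ?thesis
    by (simp add: monom_eval_superset[of ?A] lookup_add power_add prod.distrib)
qed

lemma monom_eval_0 [simp]: "monom_eval \<phi> 0 = 1"
  by (simp add: monom_eval_def)

lemma monom_eval_single: "monom_eval \<phi> (Poly_Mapping.single i k) = \<phi> i ^ k"
  by (simp add: monom_eval_def)

lemma subst_superset:
  assumes "finite A" "Poly_Mapping.keys f \<subseteq> A"
  shows "subst \<phi> f = (\<Sum>m\<in>A. Const (Poly_Mapping.lookup f m) * monom_eval \<phi> m)"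
  unfolding subst_def using assms
  by (intro sum.mono_neutral_left) (auto simp: in_keys_iff)

lemma subst_add: "subst \<phi> (f + g) = subst \<phi> f + subst \<phi> g"
proof -
  let ?A = "Poly_Mapping.keys f \<union> Poly_Mapping.keys g"
  have "Poly_Mapping.keys (f + g) \<subseteq> ?A" by (rule keys_add)
  then show ?thesis
    by (simp add: subst_superset[of ?A] lookup_add Const_add sum.distrib distrib_right)
qed

lemma subst_single: "subst \<phi> (Poly_Mapping.single m c) = Const c * monom_eval \<phi> m"
  by (simp add: subst_def)

lemma subst_0 [simp]: "subst \<phi> 0 = 0" and subst_1 [simp]: "subst \<phi> 1 = 1"
  and subst_Const [simp]: "subst \<phi> (Const c) = Const c"
  and subst_X [simp]: "subst \<phi> (X i) = \<phi> i"
  by (simp_all add: subst_single Const_def X_def monom_eval_single subst_single[of _ 0 1, simplified])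
     (simp_all add: subst_def)

lemma subst_mult: "subst \<phi> (f * g) = subst \<phi> f * subst \<phi> g"
proof (induction f rule: mpoly_induct)
  case (single m c)
  show ?case
    by (induction g rule: mpoly_induct)
       (simp_all add: mult_single subst_single monom_eval_add Const_mult subst_add distrib_left)
qed (simp add: subst_add distrib_right)

lemma subst_uminus: "subst \<phi> (- f) = - subst \<phi> f"
proof -
  have "subst \<phi> (- f) + subst \<phi> f = 0" using subst_add[of \<phi> "- f" f] by simp
  then show ?thesis by (simp add: eq_neg_iff_add_eq_0)
qed

lemma subst_diff: "subst \<phi> (f - g) = subst \<phi> f - subst \<phi> g"
  using subst_add[of \<phi> f "- g"] by (simp add: subst_uminus)

lemma subst_sum: "subst \<phi> (sum f A) = (\<Sum>x\<in>A. subst \<phi> (f x))"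
  by (induction A rule: infinite_finite_induct) (auto simp: subst_add)

lemma subst_prod: "subst \<phi> (prod f A) = (\<Prod>x\<in>A. subst \<phi> (f x))"
  by (induction A rule: infinite_finite_induct) (auto simp: subst_mult)

lemma subst_power: "subst \<phi> (f ^ k) = subst \<phi> f ^ k"
  by (induction k) (auto simp: subst_mult)

lemma subst_subst: "subst \<phi> (subst \<psi> f) = subst (\<lambda>i. subst \<phi> (\<psi> i)) f"
  by (simp add: subst_def[of \<psi>] subst_sum subst_mult monom_eval_def subst_prod subst_power)
     (simp add: subst_def monom_eval_def)

lemma monom_eval_X [simp]: "monom_eval X m = Poly_Mapping.single m 1"
proof (induction m rule: mpoly_induct)
  case (single i k)
  have "X i ^ k = Poly_Mapping.single (Poly_Mapping.single i k) (1::'a::field)" for k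
    by (induction k) (auto simp: X_def mult_single single_add[symmetric] simp del: single_add)
  then show ?case by (simp add: monom_eval_single)
next
  case (add f g)
  then show ?case by (simp add: monom_eval_add mult_single)
qed

lemma subst_X_id [simp]: "subst X f = f"
  by (subst (2) poly_eq_sum_single) (simp add: subst_def Const_def mult_single)

lemma perm_act_add: "perm_act \<pi> (f + g) = perm_act \<pi> f + perm_act \<pi> g"
  and perm_act_mult: "perm_act \<pi> (f * g) = perm_act \<pi> f * perm_act \<pi> g"
  and perm_act_diff: "perm_act \<pi> (f - g) = perm_act \<pi> f - perm_act \<pi> g"
  and perm_act_uminus: "perm_act \<pi> (- f) = - perm_act \<pi> f"
  and perm_act_sum: "perm_act \<pi> (sum h A) = (\<Sum>x\<in>A. perm_act \<pi> (h x))"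
  and perm_act_prod: "perm_act \<pi> (prod h A) = (\<Prod>x\<in>A. perm_act \<pi> (h x))"
  and perm_act_power: "perm_act \<pi> (f ^ k) = perm_act \<pi> f ^ k"
  and perm_act_0 [simp]: "perm_act \<pi> 0 = 0" and perm_act_1 [simp]: "perm_act \<pi> 1 = 1"
  and perm_act_Const [simp]: "perm_act \<pi> (Const c) = Const c"
  and perm_act_X [simp]: "perm_act \<pi> (X i) = X (\<pi> i)"
  and perm_act_id [simp]: "perm_act id f = f"
  by (simp_all add: perm_act_subst subst_add subst_mult subst_diff subst_uminus subst_sum
      subst_prod subst_power)

lemma perm_act_of_int [simp]: "perm_act \<pi> (of_int i) = of_int i"
  using perm_act_Const[of \<pi> "of_int i"] by (simp only: Const_of_int)

lemma perm_act_comp: "perm_act \<pi> (perm_act \<rho> f) = perm_act (\<pi> \<circ> \<rho>) f"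
  by (simp add: perm_act_subst subst_subst)


subsection \<open>The subrings of polynomials and of symmetric polynomials\<close>

lemma polys_Const [simp]: "Const c \<in> polys n"
  and polys_0 [simp]: "0 \<in> polys n" and polys_1 [simp]: "1 \<in> polys n"
  by (auto simp: polys_def Const_def)

lemma polys_X [simp]: "i \<in> {1..n} \<Longrightarrow> X i \<in> polys n"
  by (auto simp: polys_def X_def)

lemma polys_add: "f \<in> polys n \<Longrightarrow> g \<in> polys n \<Longrightarrow> f + g \<in> polys n"
  using keys_add[of f g] by (auto simp: polys_def)

lemma polys_uminus: "f \<in> polys n \<Longrightarrow> - f \<in> polys n"
  by (auto simp: polys_def)

lemma polys_diff: "f \<in> polys n \<Longrightarrow> g \<in> polys n \<Longrightarrow> f - g \<in> polys n"
  using polys_add[of f n "- g"] polys_uminus[of g n] by simp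

lemma polys_mult:
  assumes "f \<in> polys n" "g \<in> polys n"
  shows "f * g \<in> polys n"
proof -
  have "Poly_Mapping.keys m \<subseteq> {1..n}" if m: "m \<in> Poly_Mapping.keys (f * g)" for m
  proof -
    obtain a b where "m = a + b" "a \<in> Poly_Mapping.keys f" "b \<in> Poly_Mapping.keys g"
      using keys_mult[of f g] m by auto
    moreover have "Poly_Mapping.keys a \<subseteq> {1..n}" "Poly_Mapping.keys b \<subseteq> {1..n}"
      using assms calculation unfolding polys_def by blast+
    ultimately show ?thesis using keys_add[of a b] by blast
  qed
  then show ?thesis by (auto simp: polys_def)
qed

lemma polys_power: "f \<in> polys n \<Longrightarrow> f ^ k \<in> polys n"
  by (induction k) (auto simp: polys_mult)

lemma polys_sum: "(\<And>x. x \<in> A \<Longrightarrow> h x \<in> polys n) \<Longrightarrow> sum h A \<in> polys n"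
  by (induction A rule: infinite_finite_induct) (auto simp: polys_add)

lemma polys_prod: "(\<And>x. x \<in> A \<Longrightarrow> h x \<in> polys n) \<Longrightarrow> prod h A \<in> polys n"
  by (induction A rule: infinite_finite_induct) (auto simp: polys_mult)

lemma polys_of_int [simp]: "of_int i \<in> polys n"
  using polys_Const[of "of_int i" n] by (simp only: Const_of_int)

lemma polys_subst:
  assumes "f \<in> polys n" "\<And>i. i \<in> {1..n} \<Longrightarrow> \<phi> i \<in> polys n'"
  shows "subst \<phi> f \<in> polys n'"
  unfolding subst_def monom_eval_def
proof (intro polys_sum polys_mult polys_prod polys_power polys_Const assms(2))
  fix m i
  assume "m \<in> Poly_Mapping.keys f" "i \<in> Poly_Mapping.keys m"
  then show "i \<in> {1..n}" using assms(1) unfolding polys_def by blast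
qed

lemma polys_perm_act:
  assumes "\<pi> permutes {1..n}" "f \<in> polys n"
  shows "perm_act \<pi> f \<in> polys n"
  unfolding perm_act_subst using assms permutes_in_image[OF assms(1)]
  by (intro polys_subst[of _ n]) (auto intro!: polys_X simp del: atLeastAtMost_iff)

lemmas polys_closed = polys_add polys_uminus polys_diff polys_mult polys_power polys_sum
  polys_prod polys_perm_act

text \<open>Written as \<open>subst X f\<close>, the polynomial is a sum of products of constants
  and of variables that occur in it, and those all have index in \<open>{1..n}\<close>.\<close>

lemma polys_induct [consumes 1, case_names Const X add mult]:
  assumes "f \<in> polys n" "\<And>c. P (Const c)" "\<And>i. i \<in> {1..n} \<Longrightarrow> P (X i)"
    "\<And>f g. P f \<Longrightarrow> P g \<Longrightarrow> P (f + g)" "\<And>f g. P f \<Longrightarrow> P g \<Longrightarrow> P (f * g)"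
  shows "P f"
proof -
  have pw: "P (g ^ k)" if "P g" for g k
    using assms(2)[of 1] assms(5) that by (induction k) auto
  have pr: "P (prod h A)" if "\<And>x. x \<in> A \<Longrightarrow> P (h x)" for h and A :: "nat set"
    using that assms(2)[of 1] assms(5) by (induction A rule: infinite_finite_induct) auto
  have sm: "P (sum h A)" if "\<And>x. x \<in> A \<Longrightarrow> P (h x)" for h and A :: "(nat \<Rightarrow>\<^sub>0 nat) set"
    using that assms(2)[of 0] assms(4) by (induction A rule: infinite_finite_induct) auto
  have "P (subst X f)"
    unfolding subst_def monom_eval_def
  proof (intro sm assms(5) assms(2) pr pw assms(3))
    fix m i
    assume "m \<in> Poly_Mapping.keys f" "i \<in> Poly_Mapping.keys m"
    then show "i \<in> {1..n}" using assms(1) unfolding polys_def by blast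
  qed
  then show ?thesis by simp
qed

lemma sym_polys_imp_polys: "f \<in> sym_polys n \<Longrightarrow> f \<in> polys n"
  by (simp add: sym_polys_def)

lemma sym_polys_perm_act: "f \<in> sym_polys n \<Longrightarrow> \<pi> permutes {1..n} \<Longrightarrow> perm_act \<pi> f = f"
  by (simp add: sym_polys_def)

lemma sym_polys_0 [simp]: "0 \<in> sym_polys n" and sym_polys_1 [simp]: "1 \<in> sym_polys n"
  and sym_polys_Const [simp]: "Const c \<in> sym_polys n"
  and sym_polys_add: "f \<in> sym_polys n \<Longrightarrow> g \<in> sym_polys n \<Longrightarrow> f + g \<in> sym_polys n"
  and sym_polys_mult: "f \<in> sym_polys n \<Longrightarrow> g \<in> sym_polys n \<Longrightarrow> f * g \<in> sym_polys n"
  and sym_polys_uminus: "f \<in> sym_polys n \<Longrightarrow> - f \<in> sym_polys n"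
  and sym_polys_diff: "f \<in> sym_polys n \<Longrightarrow> g \<in> sym_polys n \<Longrightarrow> f - g \<in> sym_polys n"
  by (auto simp: sym_polys_def polys_closed perm_act_add perm_act_mult perm_act_uminus perm_act_diff)

lemma sym_polys_sum: "(\<And>x. x \<in> A \<Longrightarrow> h x \<in> sym_polys n) \<Longrightarrow> sum h A \<in> sym_polys n"
  by (induction A rule: infinite_finite_induct) (auto simp: sym_polys_add)

lemmas sym_polys_closed = sym_polys_add sym_polys_mult sym_polys_uminus sym_polys_diff sym_polys_sum


subsection \<open>Homogeneous components\<close>

definition tdeg :: "(nat \<Rightarrow>\<^sub>0 nat) \<Rightarrow> nat" where
  "tdeg m = (\<Sum>i\<in>Poly_Mapping.keys m. Poly_Mapping.lookup m i)"

definition homog :: "nat \<Rightarrow> 'k::field mpoly \<Rightarrow> bool" where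
  "homog d f \<longleftrightarrow> (\<forall>m\<in>Poly_Mapping.keys f. tdeg m = d)"

text \<open>The grading serves two purposes: a quotient of two homogeneous polynomials of equal
  degree is recognized as a constant, and each degree of S is a finite-dimensional space over
  k.\<close>

definition hcomp :: "nat \<Rightarrow> 'k::field mpoly \<Rightarrow> 'k mpoly" where
  "hcomp d f = (\<Sum>m\<in>{m\<in>Poly_Mapping.keys f. tdeg m = d}. Poly_Mapping.single m (Poly_Mapping.lookup f m))"

lemma tdeg_superset:
  assumes "finite A" "Poly_Mapping.keys m \<subseteq> A"
  shows "tdeg m = (\<Sum>i\<in>A. Poly_Mapping.lookup m i)"
  unfolding tdeg_def using assms by (intro sum.mono_neutral_left) (auto simp: in_keys_iff)

lemma tdeg_add: "tdeg (m + m') = tdeg m + tdeg m'"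
proof -
  let ?A = "Poly_Mapping.keys m \<union> Poly_Mapping.keys m'"
  have "Poly_Mapping.keys (m + m') \<subseteq> ?A" by (rule keys_add)
  then show ?thesis by (simp add: tdeg_superset[of ?A] lookup_add sum.distrib)
qed

lemma lookup_hcomp:
  "Poly_Mapping.lookup (hcomp d f) m = (if tdeg m = d then Poly_Mapping.lookup f m else 0)"
  by (auto simp: hcomp_def lookup_sum lookup_single when_def in_keys_iff)

lemma hcomp_add: "hcomp d (f + g) = hcomp d f + hcomp d g"
  and hcomp_0 [simp]: "hcomp d 0 = 0"
  by (auto intro!: poly_mapping_eqI simp: lookup_hcomp lookup_add)

lemma hcomp_sum: "hcomp d (sum f A) = (\<Sum>x\<in>A. hcomp d (f x))"
  by (induction A rule: infinite_finite_induct) (auto simp: hcomp_add)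

lemma homog_hcomp [simp]: "homog d (hcomp d f)"
  by (auto simp: homog_def in_keys_iff lookup_hcomp split: if_splits)

lemma hcomp_homog: "homog d f \<Longrightarrow> hcomp e f = (if e = d then f else 0)"
  by (rule poly_mapping_eqI) (auto simp: lookup_hcomp homog_def in_keys_iff)

lemma sum_hcomp:
  assumes "finite D" "tdeg ` Poly_Mapping.keys f \<subseteq> D"
  shows "f = (\<Sum>d\<in>D. hcomp d f)"
proof (rule poly_mapping_eqI)
  fix m
  have "Poly_Mapping.lookup f m = 0" if "tdeg m \<notin> D"
    using assms(2) that by (metis image_subset_iff in_keys_iff)
  then show "Poly_Mapping.lookup f m = Poly_Mapping.lookup (\<Sum>d\<in>D. hcomp d f) m"
    using assms(1) by (auto simp: lookup_sum lookup_hcomp)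
qed

lemma homog_mult:
  assumes "homog d f" "homog e g"
  shows "homog (d + e) (f * g)"
  using assms keys_mult[of f g] by (fastforce simp: homog_def tdeg_add)

lemma homog_add: "homog d f \<Longrightarrow> homog d g \<Longrightarrow> homog d (f + g)"
  using keys_add[of f g] by (auto simp: homog_def)

lemma homog_0 [simp]: "homog d 0"
  by (simp add: homog_def)

lemma homog_uminus: "homog d f \<Longrightarrow> homog d (- f)"
  by (simp add: homog_def)

lemma homog_diff: "homog d f \<Longrightarrow> homog d g \<Longrightarrow> homog d (f - g)"
  using homog_add[of d f "- g"] homog_uminus[of d g] by simp

lemma homog_sum: "(\<And>x. x \<in> A \<Longrightarrow> homog d (h x)) \<Longrightarrow> homog d (sum h A)"
  by (induction A rule: infinite_finite_induct) (auto simp: homog_add)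

lemma homog_Const [simp]: "homog 0 (Const c)"
  by (simp add: homog_def Const_def tdeg_def)

lemma homog_X [simp]: "homog 1 (X i)"
  by (simp add: homog_def X_def tdeg_def)

lemma homog_1 [simp]: "homog 0 1"
  using homog_Const[of 1] by (simp only: Const_1)

lemma homog_Const_mult: "homog d f \<Longrightarrow> homog d (Const c * f)"
  using homog_mult[of 0 "Const c" d f] by simp

lemma homog_power: "homog d f \<Longrightarrow> homog (d * k) (f ^ k)"
  by (induction k) (auto dest: homog_mult)

lemma homog_prod:
  "(\<And>x. x \<in> A \<Longrightarrow> homog (e x) (h x)) \<Longrightarrow> homog (sum e A) (prod h A)"
  by (induction A rule: infinite_finite_induct) (auto simp: homog_mult)

lemma homog_monom_eval:
  assumes "\<And>i. homog 1 (\<phi> i)"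
  shows "homog (tdeg m) (monom_eval \<phi> m)"
  unfolding monom_eval_def tdeg_def
  by (rule homog_prod) (use homog_power[OF assms] in simp)

lemma homog_subst:
  assumes "homog d f" "\<And>i. homog 1 (\<phi> i)"
  shows "homog d (subst \<phi> f)"
  unfolding subst_def
  by (intro homog_sum homog_Const_mult)
     (use assms(1) homog_monom_eval[of \<phi>, OF assms(2)] in \<open>auto simp: homog_def[of d f]\<close>)

lemma homog_perm_act: "homog d f \<Longrightarrow> homog d (perm_act \<pi> f)"
  unfolding perm_act_subst by (rule homog_subst) (simp_all del: One_nat_def)

text \<open>Split f into its components: an operator that raises degrees by e sends only the
  component of degree d into degree \<open>d + e\<close>.\<close>

lemma hcomp_comm:
  assumes add: "\<And>f g. L (f + g) = L f + L g" and z: "L 0 = 0"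
    and hom: "\<And>d f. homog d f \<Longrightarrow> homog (d + e) (L f)"
  shows "hcomp (d + e) (L f) = L (hcomp d f)"
proof -
  \<comment> \<open>The degree d is inserted by hand so that the sum over D has a term for it even
    when f has no component of degree d.\<close>
  define D where "D = insert d (tdeg ` Poly_Mapping.keys f)"
  have "L (sum h A) = (\<Sum>x\<in>A. L (h x))" for h :: "nat \<Rightarrow> 'a mpoly" and A
    by (induction A rule: infinite_finite_induct) (auto simp: add z)
  then have "L f = (\<Sum>i\<in>D. L (hcomp i f))"
    using sum_hcomp[of D f] by (metis D_def finite.insertI finite_imageI finite_keys subset_insertI)
  also have "hcomp (d + e) \<dots> = (\<Sum>i\<in>D. if i = d then L (hcomp i f) else 0)"
    unfolding hcomp_sum by (intro sum.cong refl) (auto simp: hcomp_homog[OF hom[OF homog_hcomp]])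
  also have "\<dots> = L (hcomp d f)" by (auto simp: D_def sum.delta)
  finally show ?thesis .
qed

lemma hcomp_perm_act: "hcomp d (perm_act \<pi> f) = perm_act \<pi> (hcomp d f)"
  using hcomp_comm[of "perm_act \<pi>" 0 d f] by (simp add: perm_act_add homog_perm_act)

lemma hcomp_mult_homog:
  assumes "homog e g"
  shows "hcomp (d + e) (f * g) = hcomp d f * g"
  using hcomp_comm[of "\<lambda>f. f * g" e d f] assms by (simp add: distrib_right homog_mult)

lemma hcomp_mult_homog_less:
  assumes "homog e g" "d < e"
  shows "hcomp d (f * g) = 0"
proof (rule poly_mapping_eqI)
  fix m
  have False if deg: "tdeg m = d" and m: "m \<in> Poly_Mapping.keys (f * g)"
  proof -
    obtain a b where "m = a + b" "b \<in> Poly_Mapping.keys g"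
      using keys_mult[of f g] m by blast
    then show False using assms deg by (auto simp: homog_def tdeg_add)
  qed
  then show "Poly_Mapping.lookup (hcomp d (f * g)) m = Poly_Mapping.lookup 0 m"
    by (auto simp: lookup_hcomp in_keys_iff)
qed

lemma polys_hcomp: "f \<in> polys n \<Longrightarrow> hcomp d f \<in> polys n"
  by (auto simp: polys_def in_keys_iff lookup_hcomp split: if_splits)

lemma sym_polys_hcomp: "f \<in> sym_polys n \<Longrightarrow> hcomp d f \<in> sym_polys n"
  by (simp add: sym_polys_def polys_hcomp flip: hcomp_perm_act)


declare One_nat_def [simp del]

subsection \<open>Alternating polynomials\<close>

abbreviation perms :: "nat \<Rightarrow> (nat \<Rightarrow> nat) set" where
  "perms n \<equiv> {\<pi>. \<pi> permutes {1..n}}"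

abbreviation sg :: "(nat \<Rightarrow> nat) \<Rightarrow> 'k::field mpoly" where
  "sg \<pi> \<equiv> of_int (sign \<pi>)"

text \<open>The numerator of \<open>form\<close>: the pairing of f and g is
  \<open>alt_sum n (f * g)\<close> divided by \<open>vandermonde n\<close>. Most arguments stay with
  the numerator, where no divisibility has to be carried along.\<close>

definition alt_sum :: "nat \<Rightarrow> 'k::field mpoly \<Rightarrow> 'k mpoly" where
  "alt_sum n f = (\<Sum>\<pi>\<in>perms n. sg \<pi> * perm_act \<pi> f)"

definition alternating :: "nat \<Rightarrow> 'k::field mpoly \<Rightarrow> bool" where
  "alternating n f \<longleftrightarrow> (\<forall>\<pi>. \<pi> permutes {1..n} \<longrightarrow> perm_act \<pi> f = sg \<pi> * f)"

lemma finite_perms [simp]: "finite (perms n)"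
  by (simp add: finite_permutations)

lemma permutes_imp_permutation: "\<pi> permutes {1..n::nat} \<Longrightarrow> permutation \<pi>"
  unfolding permutation_permutes by (intro exI[of _ "{1..n}"]) simp

lemma sign_comp:
  assumes "\<pi> permutes {1..n::nat}" "\<rho> permutes {1..n}"
  shows "sign (\<pi> \<circ> \<rho>) = sign \<pi> * sign \<rho>"
  using assms by (intro sign_compose permutes_imp_permutation)

lemma sign_inv_permutes: "\<pi> permutes {1..n::nat} \<Longrightarrow> sign (Hilbert_Choice.inv \<pi>) = sign \<pi>"
  by (intro sign_inverse permutes_imp_permutation)

lemma sg_comp:
  assumes "\<pi> permutes {1..n}" "\<rho> permutes {1..n}"
  shows "sg (\<pi> \<circ> \<rho>) = (sg \<pi> * sg \<rho> :: 'k::field mpoly)"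
  by (simp add: sign_comp[OF assms])

lemma sg_idem [simp]: "sg \<pi> * (sg \<pi> :: 'k::field mpoly) = 1"
  "sg \<pi> * (sg \<pi> * f) = (f :: 'k::field mpoly)"
proof -
  show *: "sg \<pi> * (sg \<pi> :: 'k::field mpoly) = 1"
    by (metis of_int_1 of_int_mult sign_idempotent)
  show "sg \<pi> * (sg \<pi> * f) = f" by (simp add: mult.assoc[symmetric] *)
qed

lemma sg_ne_0 [simp]: "(sg \<pi> :: 'k::field mpoly) \<noteq> 0"
  using sg_idem(1)[of \<pi>] by (metis mult_zero_left zero_neq_one)

lemma alt_sum_add: "alt_sum n (f + g) = alt_sum n f + alt_sum n g"
  by (simp add: alt_sum_def perm_act_add distrib_left sum.distrib)

lemma alt_sum_0 [simp]: "alt_sum n 0 = 0"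
  by (simp add: alt_sum_def)

lemma alt_sum_diff: "alt_sum n (f - g) = alt_sum n f - alt_sum n g"
  by (simp add: alt_sum_def perm_act_diff right_diff_distrib sum_subtractf)

lemma alt_sum_sum: "alt_sum n (sum h A) = (\<Sum>x\<in>A. alt_sum n (h x))"
  by (induction A rule: infinite_finite_induct) (auto simp: alt_sum_add)

lemma alt_sum_sym_mult: "a \<in> sym_polys n \<Longrightarrow> alt_sum n (a * f) = a * alt_sum n f"
  by (simp add: alt_sum_def perm_act_mult sym_polys_perm_act sum_distrib_left algebra_simps)

lemma alt_sum_sg: "alt_sum n (sg \<pi> * f) = sg \<pi> * alt_sum n f"
  by (simp add: alt_sum_def perm_act_mult sum_distrib_left algebra_simps)

lemma alt_sum_Const: "alt_sum n (Const c * f) = Const c * alt_sum n f"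
  by (rule alt_sum_sym_mult) simp

lemma polys_alt_sum: "f \<in> polys n \<Longrightarrow> alt_sum n f \<in> polys n"
  unfolding alt_sum_def by (intro polys_closed) auto

lemma alt_sum_perm_act:
  assumes "\<rho> permutes {1..n}"
  shows "alt_sum n (perm_act \<rho> f) = sg \<rho> * alt_sum n f"
proof -
  have "alt_sum n f = (\<Sum>\<pi>\<in>perms n. sg (\<pi> \<circ> \<rho>) * perm_act (\<pi> \<circ> \<rho>) f)"
    unfolding alt_sum_def by (rule sum_permutations_compose_right[OF assms])
  also have "\<dots> = sg \<rho> * alt_sum n (perm_act \<rho> f)"
    unfolding alt_sum_def sum_distrib_left
    by (intro sum.cong refl) (use assms in \<open>simp add: sg_comp perm_act_comp algebra_simps del: of_int_mult\<close>)
  finally show ?thesis by simp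
qed

lemma alternating_alt_sum: "alternating n (alt_sum n f)"
  unfolding alternating_def
proof (intro allI impI)
  fix \<rho> assume \<rho>: "\<rho> permutes {1..n}"
  have "alt_sum n f = (\<Sum>\<pi>\<in>perms n. sg (\<rho> \<circ> \<pi>) * perm_act (\<rho> \<circ> \<pi>) f)"
    unfolding alt_sum_def by (rule setum_permutations_compose_left[OF \<rho>])
  also have "\<dots> = sg \<rho> * perm_act \<rho> (alt_sum n f)"
    unfolding alt_sum_def sum_distrib_left perm_act_sum
    by (intro sum.cong refl)
       (use \<rho> in \<open>simp add: sg_comp perm_act_comp perm_act_mult algebra_simps del: of_int_mult\<close>)
  finally show "perm_act \<rho> (alt_sum n f) = sg \<rho> * alt_sum n f" by (metis sg_idem(2))
qed

lemma X_eq_iff [simp]: "(X i :: 'k::field mpoly) = X j \<longleftrightarrow> i = j"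
proof
  assume "(X i :: 'k mpoly) = X j"
  then have "Poly_Mapping.keys (X i :: 'k mpoly) = Poly_Mapping.keys (X j :: 'k mpoly)" by simp
  then have "Poly_Mapping.single i (1::nat) = Poly_Mapping.single j 1" by (simp add: X_def)
  then have "Poly_Mapping.keys (Poly_Mapping.single i (1::nat)) = Poly_Mapping.keys (Poly_Mapping.single j (1::nat))"
    by simp
  then show "i = j" by simp
qed simp

section \<open>Independence of the permutation operators and nondegeneracy of averages\<close>

text \<open>Dedekind's argument for the independence of distinct automorphisms, with coefficients in
  the polynomial ring.\<close>

lemma perm_act_independent:
  fixes a :: "(nat \<Rightarrow> nat) \<Rightarrow> 'k::field mpoly"
  assumes "G \<subseteq> perms n" "\<And>h. h \<in> polys n \<Longrightarrow> (\<Sum>\<pi>\<in>G. a \<pi> * perm_act \<pi> h) = 0" "\<pi> \<in> G"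
  shows "a \<pi> = 0"
proof -
  have "finite G" using assms(1) by (rule finite_subset) (rule finite_perms)
  then show ?thesis using assms
  proof (induction G arbitrary: a \<pi>)
    case (insert \<sigma> G)
    have *: "a \<tau> = 0" if \<tau>: "\<tau> \<in> G" for \<tau>
    proof -
      have "\<tau> \<noteq> \<sigma>" using insert.hyps \<tau> by auto
      then obtain i where i: "\<tau> i \<noteq> \<sigma> i" by auto
      have "\<tau> permutes {1..n}" "\<sigma> permutes {1..n}" using insert.prems(1) \<tau> by auto
      then have "i \<in> {1..n}" using i by (metis permutes_not_in)
      \<comment> \<open>These are the coefficients of the relation for \<open>h * X i\<close> minus
        \<open>X (\<sigma> i)\<close> times the relation for h. The new factor vanishes at \<sigma>,
        which leaves a relation over G, and is nonzero at \<tau> by the choice of i.\<close>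
      define b where "b \<pi> = a \<pi> * (X (\<pi> i) - X (\<sigma> i))" for \<pi>
      have "b \<tau> = 0"
      proof (rule insert.IH[of b \<tau>])
        show "G \<subseteq> perms n" using insert.prems(1) by auto
        fix h :: "'k mpoly" assume h: "h \<in> polys n"
        have "0 = (\<Sum>\<pi>\<in>insert \<sigma> G. a \<pi> * perm_act \<pi> (h * X i)) -
            X (\<sigma> i) * (\<Sum>\<pi>\<in>insert \<sigma> G. a \<pi> * perm_act \<pi> h)"
          using insert.prems(2)[OF h] insert.prems(2)[OF polys_mult[OF h polys_X[OF \<open>i \<in> {1..n}\<close>]]]
          by simp
        also have "\<dots> = (\<Sum>\<pi>\<in>insert \<sigma> G. a \<pi> * perm_act \<pi> (h * X i) - X (\<sigma> i) * (a \<pi> * perm_act \<pi> h))"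
          by (simp only: sum_distrib_left sum_subtractf)
        also have "\<dots> = (\<Sum>\<pi>\<in>insert \<sigma> G. b \<pi> * perm_act \<pi> h)"
          by (rule sum.cong[OF refl]) (simp add: b_def perm_act_mult algebra_simps)
        also have "\<dots> = (\<Sum>\<pi>\<in>G. b \<pi> * perm_act \<pi> h)"
          using insert.hyps by (simp add: b_def)
        finally show "(\<Sum>\<pi>\<in>G. b \<pi> * perm_act \<pi> h) = 0" by simp
      qed fact
      moreover have "X (\<tau> i) - X (\<sigma> i) \<noteq> (0 :: 'k mpoly)"
        using i by simp
      ultimately show ?thesis by (simp add: b_def)
    qed
    moreover have "a \<sigma> = 0"
      using insert.prems(2)[of 1] insert.hyps * by simp
    ultimately show ?case using insert.prems(3) by auto
  qed simp
qed

text \<open>The hypothesis is a relation between the permutation operators whose coefficient at the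
  identity is f.\<close>

lemma alt_sum_nondegenerate:
  assumes "\<And>h. h \<in> polys n \<Longrightarrow> alt_sum n (h * f) = 0"
  shows "f = 0"
proof -
  have "sg id * perm_act id f = 0"
    by (rule perm_act_independent[of "perms n" n "\<lambda>\<pi>. sg \<pi> * perm_act \<pi> f"])
       (use assms in \<open>auto simp: alt_sum_def perm_act_mult algebra_simps permutes_id\<close>)
  then show ?thesis by simp
qed

text \<open>The unsigned version; it allows a nonzero coefficient in S to be turned into a nonzero
  invariant after multiplication by a suitable polynomial.\<close>

lemma trace_nondegenerate:
  assumes "\<And>h. h \<in> polys n \<Longrightarrow> (\<Sum>\<pi>\<in>perms n. perm_act \<pi> (f * h)) = 0"
  shows "f = 0"
proof -
  have "perm_act id f = 0"
    by (rule perm_act_independent[of "perms n" n "\<lambda>\<pi>. perm_act \<pi> f"])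
       (use assms in \<open>auto simp: perm_act_mult permutes_id\<close>)
  then show ?thesis by simp
qed

lemma trace_in_sym_polys:
  assumes "f \<in> polys n"
  shows "(\<Sum>\<pi>\<in>perms n. perm_act \<pi> f) \<in> sym_polys n"
  unfolding sym_polys_def
proof (intro CollectI conjI allI impI)
  show "(\<Sum>\<pi>\<in>perms n. perm_act \<pi> f) \<in> polys n" using assms by (intro polys_closed) auto
  fix \<rho> assume \<rho>: "\<rho> permutes {1..n}"
  have "(\<Sum>\<pi>\<in>perms n. perm_act \<pi> f) = (\<Sum>\<pi>\<in>perms n. perm_act (\<rho> \<circ> \<pi>) f)"
    by (rule setum_permutations_compose_left[OF \<rho>])
  also have "\<dots> = perm_act \<rho> (\<Sum>\<pi>\<in>perms n. perm_act \<pi> f)"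
    by (simp only: perm_act_sum perm_act_comp)
  finally show "perm_act \<rho> (\<Sum>\<pi>\<in>perms n. perm_act \<pi> f) = (\<Sum>\<pi>\<in>perms n. perm_act \<pi> f)" ..
qed

section \<open>Divisibility by differences of variables\<close>

lemma X_diff_dvd_subst_diff:
  assumes "f \<in> polys n" "i \<in> {1..n}" "j \<in> {1..n}"
  shows "\<exists>h\<in>polys n. f - subst (X(i := X j)) f = (X i - X j) * h"
proof -
  \<comment> \<open>Membership is carried through the induction because the cofactor of a product
    contains the factors themselves.\<close>
  have "f \<in> polys n \<and> (\<exists>h\<in>polys n. f - subst (X(i := X j)) f = (X i - X j) * h)" (is "?P f")
    using assms(1)
  proof (induction f rule: polys_induct)
    case (Const c)
    show ?case by (auto intro: bexI[of _ 0])
  next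
    case (X a)
    then show ?case by (cases "a = i") (auto intro: bexI[of _ 0] bexI[of _ 1])
  next
    case (add f g)
    then obtain h k where "h \<in> polys n" "k \<in> polys n"
      "f - subst (X(i := X j)) f = (X i - X j) * h" "g - subst (X(i := X j)) g = (X i - X j) * k"
      by blast
    moreover from this have "f + g - subst (X(i := X j)) (f + g) = (X i - X j) * (h + k)"
      by (simp only: subst_add add_diff_add distrib_left)
    ultimately show ?case using add
      by (intro conjI bexI[of _ "h + k"]) (auto simp: polys_closed simp del: fun_upd_apply)
  next
    case (mult f g)
    then obtain h k where hk: "h \<in> polys n" "k \<in> polys n"
      "f - subst (X(i := X j)) f = (X i - X j) * h" "g - subst (X(i := X j)) g = (X i - X j) * k"
      by blast
    have *: "a * b - a' * b' = D * (h * b + k * (a - D * h))"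
      if "a - a' = D * h" "b - b' = D * k" for a b a' b' D h k :: "'a mpoly"
    proof -
      have *: "a' = a - D * h" "b' = b - D * k" using that by (simp_all add: algebra_simps)
      show ?thesis unfolding * by (simp add: algebra_simps)
    qed
    have "f * g - subst (X(i := X j)) (f * g) = (X i - X j) * (h * g + k * (f - (X i - X j) * h))"
      unfolding subst_mult using hk(3,4) by (rule *)
    then show ?case using mult hk assms(2,3)
      by (intro conjI bexI[of _ "h * g + k * (f - (X i - X j) * h)"]) (auto intro!: polys_closed polys_X simp del: fun_upd_apply)
  qed
  then show ?thesis by blast
qed


text \<open>The differences are split off one at a time. Each next one still divides the cofactor,
  because the specialization \<open>X i := X j\<close> annihilates none of the differences already
  removed.\<close>

lemma prod_X_diff_dvd:
  fixes f :: "'k::field mpoly"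
  assumes "finite A" "A \<subseteq> {(i, j). i \<in> {1..n} \<and> j \<in> {1..n} \<and> i < j}" "f \<in> polys n"
    "\<And>i j. (i, j) \<in> A \<Longrightarrow> subst (X(i := X j)) f = 0"
  shows "\<exists>h\<in>polys n. f = (\<Prod>(i, j)\<in>A. X i - X j) * h"
  using assms
proof (induction A)
  case (insert p A)
  obtain i j where p: "p = (i, j)" by (cases p)
  obtain h where h: "h \<in> polys n" "f = (\<Prod>(i, j)\<in>A. X i - X j) * h"
    using insert.IH insert.prems by (meson insert_subset insertCI)
  let ?\<phi> = "X(i := X j) :: nat \<Rightarrow> 'k mpoly"
  have "subst ?\<phi> f = 0" using insert.prems(3)[of i j] p by (simp del: fun_upd_apply)
  \<comment> \<open>All pairs are increasing and \<open>(a, b)\<close> differs from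
    \<open>(i, j)\<close>, so a and b stay distinct after i is replaced by j.\<close>
  moreover have "(\<Prod>(a, b)\<in>A. subst ?\<phi> (X a - X b)) \<noteq> 0"
  proof -
    have "subst ?\<phi> (X a - X b) \<noteq> 0" if ab: "(a, b) \<in> A" for a b
    proof -
      have "a < b" "i < j" "(a, b) \<noteq> (i, j)"
        using insert.prems(1) insert.hyps ab p by auto
      then show ?thesis by (auto simp: subst_diff)
    qed
    then show ?thesis using insert.hyps(1) by (auto simp: prod_zero_iff)
  qed
  ultimately have "subst ?\<phi> h = 0"
    by (simp add: h(2) subst_mult subst_prod case_prod_unfold)
  then obtain k where "k \<in> polys n" "h = (X i - X j) * k"
    using X_diff_dvd_subst_diff[OF h(1), of i j] insert.prems(1) p by auto
  then have "f = (\<Prod>(i, j)\<in>insert p A. X i - X j) * k"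
    using insert.hyps p by (simp add: h(2) mult.assoc mult.left_commute)
  then show ?case using \<open>k \<in> polys n\<close> by blast
qed (auto intro: bexI[of _ f])

lemma vandermonde_prod_pairs:
  "vandermonde n = (\<Prod>(i, j)\<in>Sigma {1..n} (\<lambda>i. {i<..n}). X i - X j)"
  unfolding vandermonde_def by (rule prod.Sigma) auto

lemma vandermonde_ne_0 [simp]: "vandermonde n \<noteq> (0 :: 'k::field mpoly)"
  unfolding vandermonde_prod_pairs by (subst prod_zero_iff) auto

lemma polys_vandermonde [simp]: "vandermonde n \<in> polys n"
  unfolding vandermonde_def by (intro polys_prod polys_diff polys_X) auto

lemma homog_vandermonde: "homog (\<Sum>i<n. i) (vandermonde n)"
proof -
  have "homog (\<Sum>i\<in>{1..n}. \<Sum>j\<in>{i<..n}. 1) (vandermonde n)"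
    unfolding vandermonde_def by (intro homog_prod homog_diff homog_X)
  also have "(\<Sum>i\<in>{1..n}. \<Sum>j\<in>{i<..n}. 1) = (\<Sum>i\<in>{1..n}. n - i)" by simp
  also have "\<dots> = (\<Sum>i<n. i)"
    by (rule sum.reindex_bij_witness[of _ "\<lambda>i. n - i" "\<lambda>i. n - i"]) auto
  finally show ?thesis .
qed

section \<open>Monomials and their antisymmetrizations\<close>

definition mon :: "nat \<Rightarrow> (nat \<Rightarrow> nat) \<Rightarrow> 'k::field mpoly" where
  "mon n \<alpha> = (\<Prod>x\<in>{1..n}. X x ^ \<alpha> x)"

lemma mon_single:
  obtains m where "(mon n \<alpha> :: 'k::field mpoly) = Poly_Mapping.single m 1"
    "\<And>x. Poly_Mapping.lookup m x = (if x \<in> {1..n} then \<alpha> x else 0)"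
proof -
  define m where "m = (\<Sum>x\<in>{1..n}. Poly_Mapping.single x (\<alpha> x))"
  have l: "Poly_Mapping.lookup m x = (if x \<in> {1..n} then \<alpha> x else 0)" for x
    by (simp add: m_def lookup_sum lookup_single when_def sum.delta)
  have "Poly_Mapping.keys m \<subseteq> {1..n}" by (auto simp: in_keys_iff l split: if_splits)
  then have "monom_eval X m = (mon n \<alpha> :: 'k mpoly)"
    by (subst monom_eval_superset[of "{1..n}"]) (auto simp: mon_def l)
  then have "(mon n \<alpha> :: 'k mpoly) = Poly_Mapping.single m 1" by simp
  then show thesis using l by (rule that)
qed

lemma mon_cong: "(\<And>x. x \<in> {1..n} \<Longrightarrow> \<alpha> x = \<beta> x) \<Longrightarrow> mon n \<alpha> = mon n \<beta>"
  unfolding mon_def by (intro prod.cong) auto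

lemma polys_mon [simp]: "mon n \<alpha> \<in> polys n"
  unfolding mon_def by (intro polys_prod polys_power polys_X) auto

lemma homog_mon: "homog (\<Sum>x\<in>{1..n}. \<alpha> x) (mon n \<alpha>)"
  unfolding mon_def by (rule homog_prod) (use homog_power[OF homog_X] in \<open>simp del: One_nat_def\<close>)

lemma mon_mult: "mon n \<alpha> * mon n \<beta> = mon n (\<lambda>x. \<alpha> x + \<beta> x)"
  by (simp add: mon_def power_add prod.distrib)

lemma perm_act_mon:
  assumes "\<pi> permutes {1..n}"
  shows "perm_act \<pi> (mon n \<alpha>) = mon n (\<lambda>x. \<alpha> (Hilbert_Choice.inv \<pi> x))"
proof -
  have "(mon n (\<lambda>x. \<alpha> (Hilbert_Choice.inv \<pi> x)) :: 'a mpoly) = (\<Prod>x\<in>{1..n}. X (\<pi> x) ^ \<alpha> (Hilbert_Choice.inv \<pi> (\<pi> x)))"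
    unfolding mon_def by (subst prod.permute[OF assms]) (simp add: o_def)
  also have "\<dots> = perm_act \<pi> (mon n \<alpha>)"
    by (simp add: mon_def perm_act_prod perm_act_power permutes_inverses[OF assms])
  finally show ?thesis by simp
qed

lemma mon_eq_iff: "(mon n \<alpha> :: 'k::field mpoly) = mon n \<beta> \<longleftrightarrow> (\<forall>x\<in>{1..n}. \<alpha> x = \<beta> x)"
proof
  assume eq: "(mon n \<alpha> :: 'k mpoly) = mon n \<beta>"
  obtain a where a: "(mon n \<alpha> :: 'k mpoly) = Poly_Mapping.single a 1"
    "\<And>x. Poly_Mapping.lookup a x = (if x \<in> {1..n} then \<alpha> x else 0)" using mon_single[of n \<alpha>] by blast
  obtain b where b: "(mon n \<beta> :: 'k mpoly) = Poly_Mapping.single b 1"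
    "\<And>x. Poly_Mapping.lookup b x = (if x \<in> {1..n} then \<beta> x else 0)" using mon_single[of n \<beta>] by blast
  have "Poly_Mapping.keys (Poly_Mapping.single a (1::'k)) = Poly_Mapping.keys (Poly_Mapping.single b (1::'k))"
    using eq a(1) b(1) by simp
  then have "a = b" by simp
  show "\<forall>x\<in>{1..n}. \<alpha> x = \<beta> x"
    using a(2) b(2) \<open>a = b\<close> by metis
qed (auto intro: mon_cong)

text \<open>The exponents 0, ..., n-1 are distinct, so no permutation except the identity fixes the
  monomial and its own coefficient in the alternating sum is exactly 1, whatever the
  characteristic.\<close>

lemma alt_sum_mon_delta_ne_0: "alt_sum n (mon n (\<lambda>x. x - 1)) \<noteq> (0 :: 'k::field mpoly)"
proof
  let ?\<delta> = "\<lambda>x::nat. x - 1"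
  let ?m = "mon n ?\<delta> :: 'k mpoly"
  obtain a where a: "?m = Poly_Mapping.single a 1" by (rule mon_single)
  have "Poly_Mapping.lookup (sg \<pi> * perm_act \<pi> ?m) a = (if \<pi> = id then 1 else 0)"
    if \<pi>: "\<pi> permutes {1..n}" for \<pi>
  proof (cases "\<pi> = id")
    case True
    then show ?thesis using a by simp
  next
    case False
    obtain b where b: "mon n (\<lambda>x. ?\<delta> (Hilbert_Choice.inv \<pi> x)) = Poly_Mapping.single b (1 :: 'k)"
      by (rule mon_single)
    have "a \<noteq> b"
    proof
      assume "a = b"
      then have "?m = mon n (\<lambda>x. ?\<delta> (Hilbert_Choice.inv \<pi> x))" using a b by simp
      then have *: "x - 1 = Hilbert_Choice.inv \<pi> x - 1" if "x \<in> {1..n}" for x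
        using that by (simp only: mon_eq_iff)
      have "Hilbert_Choice.inv \<pi> x = x" for x
      proof (cases "x \<in> {1..n}")
        case True
        then have "Hilbert_Choice.inv \<pi> x \<in> {1..n}"
          using permutes_in_image[OF permutes_inv[OF \<pi>]] by blast
        then show ?thesis using True *[OF True] by auto
      next
        case False
        then show ?thesis using permutes_inv[OF \<pi>] by (metis permutes_not_in)
      qed
      then have "\<pi> x = x" for x using permutes_inverses[OF \<pi>] by metis
      then show False using False by auto
    qed
    then show ?thesis
      using \<pi> False by (simp add: perm_act_mon b lookup_Const_mult lookup_single flip: Const_of_int)
  qed
  then have "Poly_Mapping.lookup (alt_sum n ?m) a = (\<Sum>\<pi>\<in>perms n. if \<pi> = id then 1 else 0)"
    unfolding alt_sum_def lookup_sum by (intro sum.cong) auto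
  also have "\<dots> = 1" by (simp add: sum.delta permutes_id)
  finally show "alt_sum n ?m = 0 \<Longrightarrow> False" by simp
qed

lemma homog_0_Const:
  assumes "homog 0 f"
  shows "f = Const (Poly_Mapping.lookup f 0)"
proof (rule poly_mapping_eqI)
  fix m
  have "m = 0" if "m \<in> Poly_Mapping.keys f"
  proof -
    have "tdeg m = 0" using assms that by (simp add: homog_def)
    then have "Poly_Mapping.lookup m i = 0" for i
      by (cases "i \<in> Poly_Mapping.keys m") (auto simp: tdeg_def in_keys_iff)
    then show ?thesis by (intro poly_mapping_eqI) simp
  qed
  then show "Poly_Mapping.lookup f m = Poly_Mapping.lookup (Const (Poly_Mapping.lookup f 0)) m"
    by (cases "m \<in> Poly_Mapping.keys f") (auto simp: Const_def lookup_single when_def in_keys_iff)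
qed

lemma homog_alt_sum: "homog d f \<Longrightarrow> homog d (alt_sum n f)"
  unfolding alt_sum_def Const_of_int[symmetric]
  by (intro homog_sum homog_Const_mult homog_perm_act)

text \<open>A component of f in a positive degree would give the product a nonzero component outside
  degree d.\<close>

lemma homog_factor:
  fixes f g :: "'k::field mpoly"
  assumes "homog d (f * g)" "homog d g" "g \<noteq> 0"
  shows "\<exists>c. f = Const c"
proof -
  have "hcomp e f = 0" if "e \<noteq> 0" for e
    using hcomp_mult_homog[OF assms(2), of e f] hcomp_homog[OF assms(1), of "e + d"] assms(3) that
    by simp
  then have "homog 0 f"
    by (metis homog_def in_keys_iff lookup_hcomp lookup_zero)
  then show ?thesis using homog_0_Const by blast
qed

text \<open>The parameter \<open>K\<close> only carries the coefficient field. The two assumptions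
  together make 2 invertible, so that \<open>f = - f\<close> implies \<open>f = 0\<close>, and they
  make the order of every subgroup of the symmetric group invertible.\<close>

locale good_char =
  fixes n :: nat and K :: "'k::field itself"
  assumes n_ge_2: "n \<ge> 2" and fact_ne_0: "of_nat (fact n) \<noteq> (0::'k)"
begin

lemma of_nat_dvd_fact_ne_0: "j dvd fact n \<Longrightarrow> of_nat j \<noteq> (0::'k)"
  using fact_ne_0 by (auto simp: dvd_def)

lemma two_ne_0: "(2::'k) \<noteq> 0"
proof -
  have "2 dvd (fact n :: nat)" using n_ge_2 by (intro dvd_fact) auto
  then show ?thesis using of_nat_dvd_fact_ne_0[of 2] by simp
qed

lemma mpoly_eq_neg_self: "f = - f \<Longrightarrow> f = (0 :: 'k mpoly)"
proof -
  assume "f = - f"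
  then have "f + f = 0" by (metis add.right_inverse)
  moreover have "Const 2 * f = f + f"
    using Const_add[of "1::'k" 1] by (simp only: one_add_one[symmetric] Const_1 distrib_right mult_1)
  ultimately have "Const 2 * f = 0" by (simp only:)
  moreover have "Const 2 \<noteq> (0 :: 'k mpoly)" using two_ne_0 Const_eq_0_iff[of "2::'k"] by blast
  ultimately show ?thesis by (metis mult_eq_0_iff)
qed

text \<open>The specialization \<open>X i := X j\<close> does not see the transposition of i and j,
  while f changes sign under it; hence the specialization of f is its own negative.\<close>

lemma alternating_vandermonde_dvd:
  fixes f :: "'k mpoly"
  assumes "f \<in> polys n" "alternating n f"
  shows "\<exists>h\<in>polys n. f = h * vandermonde n"
proof -
  have "\<exists>h\<in>polys n. f = vandermonde n * h"
    unfolding vandermonde_prod_pairs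
  proof (rule prod_X_diff_dvd)
    fix i j assume "(i, j) \<in> Sigma {1..n} (\<lambda>i. {i<..n})"
    then have ij: "i \<in> {1..n}" "j \<in> {1..n}" "i < j" by auto
    let ?\<phi> = "X(i := X j) :: nat \<Rightarrow> 'k mpoly"
    have "transpose i j permutes {1..n}" using ij by (intro permutes_swap_id)
    then have "perm_act (transpose i j) f = - f"
      using assms(2) ij by (simp add: alternating_def sign_swap_id)
    moreover have "subst ?\<phi> (perm_act (transpose i j) f) = subst ?\<phi> f"
    proof -
      have "(\<lambda>a. ?\<phi> (transpose i j a)) = ?\<phi>" using ij by (auto simp: fun_eq_iff transpose_def)
      then show ?thesis by (simp add: perm_act_subst subst_subst del: fun_upd_apply)
    qed
    ultimately show "subst ?\<phi> f = 0"
      by (intro mpoly_eq_neg_self) (simp add: subst_uminus)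
  qed (use assms in auto)
  then show ?thesis by (auto simp: mult.commute)
qed

text \<open>The Vandermonde determinant up to a scalar: the alternating sum is divisible by the
  product of differences and has the same degree 0 + 1 + ... + (n-1), so the quotient is
  constant.\<close>

lemma alt_sum_mon_delta: "\<exists>c\<noteq>0. alt_sum n (mon n (\<lambda>x. x - 1)) = Const c * (vandermonde n :: 'k mpoly)"
proof -
  let ?f = "alt_sum n (mon n (\<lambda>x. x - 1)) :: 'k mpoly"
  obtain h where h: "h \<in> polys n" "?f = h * vandermonde n"
    using alternating_vandermonde_dvd[of ?f] alternating_alt_sum polys_alt_sum[OF polys_mon] by blast
  have "(\<Sum>x\<in>{1..n}. x - 1) = (\<Sum>i<n. i)"
    by (rule sum.reindex_bij_witness[of _ Suc "\<lambda>i. i - 1"]) auto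
  then have "homog (\<Sum>i<n. i) ?f"
    using homog_alt_sum[OF homog_mon[of "\<lambda>x. x - 1" n]] by simp
  then obtain c where "h = Const c" using homog_factor[of "\<Sum>i<n. i" h "vandermonde n"] homog_vandermonde h by auto
  then show ?thesis using h alt_sum_mon_delta_ne_0[of n, where 'k='k] by auto
qed

text \<open>Being a nonzero multiple of an alternating sum, the product inherits the sign rule; its
  factors need not be traced through a permutation.\<close>

lemma alternating_vandermonde: "alternating n (vandermonde n :: 'k mpoly)"
proof -
  obtain c where c: "c \<noteq> 0" "alt_sum n (mon n (\<lambda>x. x - 1)) = Const c * (vandermonde n :: 'k mpoly)"
    using alt_sum_mon_delta by blast
  have "vandermonde n = Const (1 / c) * (Const c * (vandermonde n :: 'k mpoly))"
    using c(1) by (simp add: mult.assoc[symmetric] Const_mult[symmetric])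
  then have "vandermonde n = Const (1 / c) * alt_sum n (mon n (\<lambda>x. x - 1) :: 'k mpoly)"
    using c by simp
  then show ?thesis
    using alternating_alt_sum[of n "mon n (\<lambda>x. x - 1) :: 'k mpoly"]
    by (simp add: alternating_def perm_act_mult algebra_simps)
qed

lemma perm_act_vandermonde:
  "\<pi> permutes {1..n} \<Longrightarrow> perm_act \<pi> (vandermonde n) = sg \<pi> * (vandermonde n :: 'k mpoly)"
  using alternating_vandermonde by (simp add: alternating_def)

lemma vandermonde_sq_sym: "(vandermonde n :: 'k mpoly) ^ 2 \<in> sym_polys n"
proof -
  have "perm_act \<pi> ((vandermonde n :: 'k mpoly) ^ 2) = vandermonde n ^ 2" if "\<pi> permutes {1..n}" for \<pi>
    using that
    by (simp only: perm_act_power perm_act_vandermonde power_mult_distrib power2_eq_square[of "sg \<pi>"]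
        sg_idem mult_1)
  then show ?thesis by (simp add: sym_polys_def polys_power)
qed

text \<open>A quotient of two alternating polynomials is invariant, so the pairing takes its values
  in R.\<close>

lemma alt_sum_eq_sym_mult_vandermonde:
  fixes f :: "'k mpoly"
  assumes "f \<in> polys n"
  shows "\<exists>h\<in>sym_polys n. alt_sum n f = h * vandermonde n"
proof -
  obtain h where h: "h \<in> polys n" "alt_sum n f = h * vandermonde n"
    using alternating_vandermonde_dvd alternating_alt_sum polys_alt_sum[OF assms] by blast
  have "perm_act \<pi> h = h" if \<pi>: "\<pi> permutes {1..n}" for \<pi>
  proof -
    have "perm_act \<pi> h * (sg \<pi> * vandermonde n) = sg \<pi> * (h * vandermonde n)"
      using alternating_alt_sum[of n f] h \<pi>
      by (simp add: alternating_def perm_act_mult perm_act_vandermonde)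
    then have "(sg \<pi> * vandermonde n) * perm_act \<pi> h = (sg \<pi> * vandermonde n) * h"
      by (simp add: algebra_simps)
    then show ?thesis by simp
  qed
  then show ?thesis using h by (auto simp: sym_polys_def)
qed

text \<open>The transposition of two variables with equal exponents fixes the monomial and negates
  its alternating sum.\<close>

lemma alt_sum_mon_not_inj:
  assumes "\<not> inj_on \<alpha> {1..n}"
  shows "alt_sum n (mon n \<alpha>) = (0 :: 'k mpoly)"
proof -
  obtain x y where xy: "x \<in> {1..n}" "y \<in> {1..n}" "x \<noteq> y" "\<alpha> x = \<alpha> y"
    using assms by (auto simp: inj_on_def)
  have tr: "transpose x y permutes {1..n}" using xy by (intro permutes_swap_id)
  have "(\<lambda>a. \<alpha> (transpose x y a)) = \<alpha>" using xy by (auto simp: fun_eq_iff transpose_def)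
  then have "perm_act (transpose x y) (mon n \<alpha>) = (mon n \<alpha> :: 'k mpoly)"
    using perm_act_mon[OF tr, of \<alpha>] by simp
  then have "alt_sum n (mon n \<alpha>) = - (alt_sum n (mon n \<alpha>) :: 'k mpoly)"
    using alt_sum_perm_act[OF tr, of "mon n \<alpha> :: 'k mpoly"] xy by (simp add: sign_swap_id)
  then show ?thesis by (rule mpoly_eq_neg_self)
qed

text \<open>The exponents are 0, ..., n-1 in some order, so this is a permuted copy of the
  Vandermonde monomial.\<close>

lemma alt_sum_mon_bij:
  assumes "\<theta> permutes {1..n}"
  shows "\<exists>c\<noteq>0. alt_sum n (mon n (\<lambda>x. \<theta> x - 1)) = Const c * (vandermonde n :: 'k mpoly)"
proof -
  obtain c where c: "c \<noteq> 0" "alt_sum n (mon n (\<lambda>x. x - 1)) = Const c * (vandermonde n :: 'k mpoly)"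
    using alt_sum_mon_delta by blast
  have inv: "Hilbert_Choice.inv \<theta> permutes {1..n}" using assms by (rule permutes_inv)
  have "mon n (\<lambda>x. \<theta> x - 1) = perm_act (Hilbert_Choice.inv \<theta>) (mon n (\<lambda>x. x - 1) :: 'k mpoly)"
    by (simp add: perm_act_mon[OF inv] inv_inv_eq permutes_bij[OF assms])
  then have "alt_sum n (mon n (\<lambda>x. \<theta> x - 1)) = sg (Hilbert_Choice.inv \<theta>) * (Const c * (vandermonde n :: 'k mpoly))"
    by (simp only: alt_sum_perm_act[OF inv] c)
  then show ?thesis using c(1)
    by (intro exI[of _ "of_int (sign (Hilbert_Choice.inv \<theta>)) * c"])
       (auto simp: Const_mult Const_of_int mult.assoc sign_def)
qed

lemma exact_quot_eq:
  assumes "h \<in> polys n" "g \<noteq> 0"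
  shows "exact_quot n (h * g) g = (h :: 'k mpoly)"
  unfolding exact_quot_def using assms by (intro the_equality) auto

lemma form_eq:
  assumes "alt_sum n (f * g) = h * vandermonde n" "h \<in> polys n"
  shows "form n f g = (h :: 'k mpoly)"
  using exact_quot_eq[OF assms(2), of "vandermonde n"] assms(1)
  by (simp add: form_def alt_sum_def)

end


subsection \<open>Row and column groups\<close>

text \<open>Lagrange's theorem, in the form that makes the orders of stabilizers invertible in
  k.\<close>

lemma card_perm_subgroup_dvd_fact:
  assumes "G \<subseteq> perms n" "id \<in> G"
    "\<And>\<pi> \<rho>. \<pi> \<in> G \<Longrightarrow> \<rho> \<in> G \<Longrightarrow> \<pi> \<circ> \<rho> \<in> G" "\<And>\<pi>. \<pi> \<in> G \<Longrightarrow> Hilbert_Choice.inv \<pi> \<in> G"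
  shows "card G dvd fact n"
proof -
  interpret group "sym_group n" by (rule sym_group_is_group)
  have "subgroup G (sym_group n)"
  proof (rule subgroupI)
    show "G \<subseteq> carrier (sym_group n)" "G \<noteq> {}" using assms by (auto simp: sym_group_def)
    show "inv\<^bsub>sym_group n\<^esub> \<pi> \<in> G" if "\<pi> \<in> G" for \<pi>
      using sym_group_inv_equality[of \<pi> n] assms that by (auto simp: sym_group_def)
    show "\<pi> \<otimes>\<^bsub>sym_group n\<^esub> \<rho> \<in> G" if "\<pi> \<in> G" "\<rho> \<in> G" for \<pi> \<rho>
      using assms that by (auto simp: sym_group_def)
  qed
  then have "card (rcosets\<^bsub>sym_group n\<^esub> G) * card G = order (sym_group n)"
    by (intro lagrange_finite) (simp_all add: sym_group_def)
  then show ?thesis by (metis dvd_triv_right order_def sym_group_card_carrier)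
qed

text \<open>The Young subgroup of the partition of the labels into the fibres of c. One definition
  serves as row group and as column group, so transposition of a tableau is an exchange of
  arguments.\<close>

definition grp :: "nat \<Rightarrow> (nat \<Rightarrow> nat) \<Rightarrow> (nat \<Rightarrow> nat) set" where
  "grp n c = {\<pi>. \<pi> permutes {1..n} \<and> (\<forall>x\<in>{1..n}. c (\<pi> x) = c x)}"

definition symm :: "nat \<Rightarrow> (nat \<Rightarrow> nat) \<Rightarrow> 'k::field mpoly \<Rightarrow> 'k mpoly" where
  "symm n c f = (\<Sum>\<pi>\<in>grp n c. perm_act \<pi> f)"

definition alt :: "nat \<Rightarrow> (nat \<Rightarrow> nat) \<Rightarrow> 'k::field mpoly \<Rightarrow> 'k mpoly" where
  "alt n c f = (\<Sum>\<pi>\<in>grp n c. sg \<pi> * perm_act \<pi> f)"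

lemma grp_permutes: "\<pi> \<in> grp n c \<Longrightarrow> \<pi> permutes {1..n}"
  by (simp add: grp_def)

lemma finite_grp [simp]: "finite (grp n c)"
  by (rule finite_subset[OF _ finite_perms[of n]]) (auto simp: grp_def)

lemma grp_id [simp]: "id \<in> grp n c"
  by (simp add: grp_def permutes_id)

lemma grp_comp: "\<pi> \<in> grp n c \<Longrightarrow> \<rho> \<in> grp n c \<Longrightarrow> \<pi> \<circ> \<rho> \<in> grp n c"
  unfolding grp_def mem_Collect_eq
  by (metis comp_apply permutes_compose permutes_in_image)

lemma grp_inv: "\<pi> \<in> grp n c \<Longrightarrow> Hilbert_Choice.inv \<pi> \<in> grp n c"
  unfolding grp_def mem_Collect_eq
  by (metis permutes_in_image permutes_inv permutes_inverses(1))

lemma sum_grp_right: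
  assumes "\<rho> \<in> grp n c"
  shows "(\<Sum>\<pi>\<in>grp n c. h (\<pi> \<circ> \<rho>)) = (\<Sum>\<pi>\<in>grp n c. h \<pi>)"
  using permutes_inv_o[OF grp_permutes[OF assms]] assms
  by (intro sum.reindex_bij_witness[of _ "\<lambda>\<pi>. \<pi> \<circ> Hilbert_Choice.inv \<rho>" "\<lambda>\<pi>. \<pi> \<circ> \<rho>"])
     (auto simp: comp_assoc grp_comp grp_inv)

lemma sum_grp_left:
  assumes "\<rho> \<in> grp n c"
  shows "(\<Sum>\<pi>\<in>grp n c. h (\<rho> \<circ> \<pi>)) = (\<Sum>\<pi>\<in>grp n c. h \<pi>)"
  using permutes_inv_o[OF grp_permutes[OF assms]] assms
  by (intro sum.reindex_bij_witness[of _ "\<lambda>\<pi>. Hilbert_Choice.inv \<rho> \<circ> \<pi>" "\<lambda>\<pi>. \<rho> \<circ> \<pi>"])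
     (auto simp: comp_assoc[symmetric] grp_comp grp_inv)

lemma sum_grp_inv: "(\<Sum>\<pi>\<in>grp n c. h (Hilbert_Choice.inv \<pi>)) = (\<Sum>\<pi>\<in>grp n c. h \<pi>)"
  by (intro sum.reindex_bij_witness[of _ Hilbert_Choice.inv Hilbert_Choice.inv])
     (auto simp: grp_inv inv_inv_eq[OF permutes_bij[OF grp_permutes]])

lemma symm_add: "symm n c (f + g) = symm n c f + symm n c g"
  and alt_add: "alt n c (f + g) = alt n c f + alt n c g"
  and symm_0 [simp]: "symm n c 0 = 0" and alt_0 [simp]: "alt n c 0 = 0"
  and symm_uminus: "symm n c (- f) = - symm n c f"
  and symm_diff: "symm n c (f - g) = symm n c f - symm n c g"
  and alt_diff: "alt n c (f - g) = alt n c f - alt n c g"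
  by (simp_all add: symm_def alt_def perm_act_add perm_act_uminus perm_act_diff distrib_left
      right_diff_distrib sum.distrib sum_negf sum_subtractf)

lemma symm_sum: "symm n c (sum h A) = (\<Sum>x\<in>A. symm n c (h x))"
  by (induction A rule: infinite_finite_induct) (auto simp: symm_add)

lemma alt_sum': "alt n c (sum h A) = (\<Sum>x\<in>A. alt n c (h x))"
  by (induction A rule: infinite_finite_induct) (auto simp: alt_add)

lemma symm_sym_mult: "a \<in> sym_polys n \<Longrightarrow> symm n c (a * f) = a * symm n c f"
  by (simp add: symm_def perm_act_mult sym_polys_perm_act[OF _ grp_permutes] sum_distrib_left)

lemma alt_sym_mult: "a \<in> sym_polys n \<Longrightarrow> alt n c (a * f) = a * alt n c f"
  by (simp add: alt_def perm_act_mult sym_polys_perm_act[OF _ grp_permutes] sum_distrib_left mult.left_commute)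

lemma of_int_sym_polys [simp]: "of_int i \<in> sym_polys n"
  using sym_polys_Const[of "of_int i" n] by (simp only: Const_of_int)

lemma polys_symm: "f \<in> polys n \<Longrightarrow> symm n c f \<in> polys n"
  unfolding symm_def by (intro polys_closed) (auto dest: grp_permutes)

lemma polys_alt: "f \<in> polys n \<Longrightarrow> alt n c f \<in> polys n"
  unfolding alt_def by (intro polys_closed polys_of_int) (auto dest: grp_permutes)

lemma homog_symm: "homog d f \<Longrightarrow> homog d (symm n c f)"
  unfolding symm_def by (intro homog_sum homog_perm_act)

lemma homog_alt: "homog d f \<Longrightarrow> homog d (alt n c f)"
  unfolding alt_def Const_of_int[symmetric] by (intro homog_sum homog_Const_mult homog_perm_act)

lemma symm_perm_act: "\<rho> \<in> grp n c \<Longrightarrow> symm n c (perm_act \<rho> f) = symm n c f"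
  using sum_grp_right[of \<rho> n c "\<lambda>\<pi>. perm_act \<pi> f"] by (simp add: symm_def perm_act_comp)

lemma perm_act_symm: "\<rho> \<in> grp n c \<Longrightarrow> perm_act \<rho> (symm n c f) = symm n c f"
  using sum_grp_left[of \<rho> n c "\<lambda>\<pi>. perm_act \<pi> f"] by (simp add: symm_def perm_act_sum perm_act_comp)

lemma alt_perm_act:
  assumes "\<rho> \<in> grp n c"
  shows "alt n c (perm_act \<rho> f) = sg \<rho> * alt n c f"
proof -
  have "sg \<rho> * alt n c f = sg \<rho> * (\<Sum>\<pi>\<in>grp n c. sg (\<pi> \<circ> \<rho>) * perm_act (\<pi> \<circ> \<rho>) f)"
    unfolding alt_def by (simp only: sum_grp_right[OF assms, of "\<lambda>\<pi>. sg \<pi> * perm_act \<pi> f"])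
  also have "\<dots> = alt n c (perm_act \<rho> f)"
    unfolding alt_def sum_distrib_left
  proof (intro sum.cong refl)
    fix \<pi> assume \<pi>: "\<pi> \<in> grp n c"
    show "sg \<rho> * (sg (\<pi> \<circ> \<rho>) * perm_act (\<pi> \<circ> \<rho>) f) = sg \<pi> * perm_act \<pi> (perm_act \<rho> f)"
      by (simp add: sg_comp[OF grp_permutes[OF \<pi>] grp_permutes[OF assms]] perm_act_comp mult.left_commute mult.assoc)
  qed
  finally show ?thesis by simp
qed

lemma perm_act_alt:
  assumes "\<rho> \<in> grp n c"
  shows "perm_act \<rho> (alt n c f) = sg \<rho> * alt n c f"
proof -
  have "sg \<rho> * alt n c f = sg \<rho> * (\<Sum>\<pi>\<in>grp n c. sg (\<rho> \<circ> \<pi>) * perm_act (\<rho> \<circ> \<pi>) f)"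
    unfolding alt_def by (simp only: sum_grp_left[OF assms, of "\<lambda>\<pi>. sg \<pi> * perm_act \<pi> f"])
  also have "\<dots> = perm_act \<rho> (alt n c f)"
    unfolding alt_def sum_distrib_left perm_act_sum
  proof (intro sum.cong refl)
    fix \<pi> assume \<pi>: "\<pi> \<in> grp n c"
    show "sg \<rho> * (sg (\<rho> \<circ> \<pi>) * perm_act (\<rho> \<circ> \<pi>) f) = perm_act \<rho> (sg \<pi> * perm_act \<pi> f)"
      by (simp add: sg_comp[OF grp_permutes[OF assms] grp_permutes[OF \<pi>]] perm_act_comp perm_act_mult mult.assoc)
  qed
  finally show ?thesis by simp
qed

text \<open>Moving \<pi> from one factor to its inverse on the other costs the sign of \<pi>. The
  adjoint of a symmetrizer is therefore the antisymmetrizer of the same group, which is why T is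
  paired with its transpose.\<close>

lemma alt_sum_symm_adjoint: "alt_sum n (symm n c f * g) = alt_sum n (f * alt n c g)"
proof -
  have "alt_sum n (perm_act \<pi> f * g) = alt_sum n (f * (sg (Hilbert_Choice.inv \<pi>) * perm_act (Hilbert_Choice.inv \<pi>) g))"
    if "\<pi> \<in> grp n c" for \<pi>
  proof -
    have \<pi>: "\<pi> permutes {1..n}" using that by (rule grp_permutes)
    have "perm_act \<pi> f * g = perm_act \<pi> (f * perm_act (Hilbert_Choice.inv \<pi>) g)"
      by (simp add: perm_act_mult perm_act_comp permutes_inv_o[OF \<pi>])
    then have "alt_sum n (perm_act \<pi> f * g) = sg \<pi> * alt_sum n (f * perm_act (Hilbert_Choice.inv \<pi>) g)"
      by (simp add: alt_sum_perm_act[OF \<pi>])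
    then show ?thesis
      by (simp add: sign_inv_permutes[OF \<pi>] alt_sum_sg mult.left_commute[of f])
  qed
  then have "alt_sum n (symm n c f * g) =
    (\<Sum>\<pi>\<in>grp n c. alt_sum n (f * (sg (Hilbert_Choice.inv \<pi>) * perm_act (Hilbert_Choice.inv \<pi>) g)))"
    by (simp add: symm_def sum_distrib_right alt_sum_sum)
  also have "\<dots> = alt_sum n (f * alt n c g)"
    unfolding sum_grp_inv[of "\<lambda>\<pi>. alt_sum n (f * (sg \<pi> * perm_act \<pi> g))"]
    by (simp add: alt_def sum_distrib_left alt_sum_sum)
  finally show ?thesis .
qed

lemma alt_sum_alt_adjoint: "alt_sum n (alt n c f * g) = alt_sum n (f * symm n c g)"
  using alt_sum_symm_adjoint[of n c g f] by (simp add: mult.commute)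

text \<open>The Young symmetrizers $c_T r_T$ and $r_T c_T$, up to the factor $f^\lambda / n!$, where a
  tableau is given by the functions assigning to each label its row and its column.  Exchanging
  the two functions transposes the tableau.\<close>

definition ysym :: "nat \<Rightarrow> (nat \<Rightarrow> nat) \<Rightarrow> (nat \<Rightarrow> nat) \<Rightarrow> 'k::field mpoly \<Rightarrow> 'k mpoly" where
  "ysym n rw cl f = alt n cl (symm n rw f)"

definition ysig :: "nat \<Rightarrow> (nat \<Rightarrow> nat) \<Rightarrow> (nat \<Rightarrow> nat) \<Rightarrow> 'k::field mpoly \<Rightarrow> 'k mpoly" where
  "ysig n rw cl f = symm n rw (alt n cl f)"

lemma ysym_add: "ysym n rw cl (f + g) = ysym n rw cl f + ysym n rw cl g"
  and ysym_0 [simp]: "ysym n rw cl 0 = 0"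
  and ysym_diff: "ysym n rw cl (f - g) = ysym n rw cl f - ysym n rw cl g"
  and ysym_sum: "ysym n rw cl (sum h A) = (\<Sum>x\<in>A. ysym n rw cl (h x))"
  and ysym_sym_mult: "a \<in> sym_polys n \<Longrightarrow> ysym n rw cl (a * f) = a * ysym n rw cl f"
  and polys_ysym: "f \<in> polys n \<Longrightarrow> ysym n rw cl f \<in> polys n"
  and homog_ysym: "homog d f \<Longrightarrow> homog d (ysym n rw cl f)"
  by (simp_all add: ysym_def symm_add alt_add symm_diff alt_diff symm_sum alt_sum' symm_sym_mult
      alt_sym_mult polys_symm polys_alt homog_symm homog_alt)

lemma ysig_add: "ysig n rw cl (f + g) = ysig n rw cl f + ysig n rw cl g"
  and ysig_0 [simp]: "ysig n rw cl 0 = 0"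
  and ysig_sum: "ysig n rw cl (sum h A) = (\<Sum>x\<in>A. ysig n rw cl (h x))"
  and ysig_sym_mult: "a \<in> sym_polys n \<Longrightarrow> ysig n rw cl (a * f) = a * ysig n rw cl f"
  and polys_ysig: "f \<in> polys n \<Longrightarrow> ysig n rw cl f \<in> polys n"
  and homog_ysig: "homog d f \<Longrightarrow> homog d (ysig n rw cl f)"
  by (simp_all add: ysig_def symm_add alt_add symm_sum alt_sum' symm_sym_mult
      alt_sym_mult polys_symm polys_alt homog_symm homog_alt)

lemma alt_sum_ysym_adjoint: "alt_sum n (ysym n rw cl f * g) = alt_sum n (f * ysym n cl rw g)"
  by (simp add: ysym_def alt_sum_alt_adjoint alt_sum_symm_adjoint)

context good_char
begin

lemma symm_vandermonde_mult: "symm n c (vandermonde n * f) = vandermonde n * alt n c (f :: 'k mpoly)"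
  by (simp add: symm_def alt_def perm_act_mult perm_act_vandermonde[OF grp_permutes] sum_distrib_left algebra_simps)

lemma alt_vandermonde_mult: "alt n c (vandermonde n * f) = vandermonde n * symm n c (f :: 'k mpoly)"
proof -
  have "sg \<pi> * perm_act \<pi> (vandermonde n * f) = vandermonde n * perm_act \<pi> f" if "\<pi> \<in> grp n c" for \<pi>
    by (simp add: perm_act_mult perm_act_vandermonde[OF grp_permutes[OF that]] mult.assoc)
  then show ?thesis by (simp add: symm_def alt_def sum_distrib_left)
qed

lemma vandermonde_mult_ysig: "vandermonde n * ysig n rw cl f = ysym n cl rw (vandermonde n * (f :: 'k mpoly))"
  by (simp add: ysig_def ysym_def symm_vandermonde_mult alt_vandermonde_mult)

lemma vandermonde_mult_ysym: "vandermonde n * ysym n cl rw f = ysig n rw cl (vandermonde n * (f :: 'k mpoly))"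
  by (simp add: ysig_def ysym_def symm_vandermonde_mult alt_vandermonde_mult)

lemma of_nat_mpoly_ne_0: "j dvd fact n \<Longrightarrow> of_nat j \<noteq> (0 :: 'k mpoly)"
  unfolding Const_of_nat[symmetric] Const_eq_0_iff by (rule of_nat_dvd_fact_ne_0)

lemma transpose_perms: "x \<in> {1..n} \<Longrightarrow> y \<in> {1..n} \<Longrightarrow> transpose x y permutes {1..n}"
  by (rule permutes_swap_id)

lemma transpose_grp:
  "x \<in> {1..n} \<Longrightarrow> y \<in> {1..n} \<Longrightarrow> c x = c y \<Longrightarrow> transpose x y \<in> grp n c"
  by (auto simp: grp_def transpose_perms transpose_def)

end


subsection \<open>Garnir relations and the rank of the image of a Young symmetrizer\<close>

lemma comp_transpose_comp:
  assumes "\<tau> permutes S"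
  shows "transpose x y \<circ> \<tau> = \<tau> \<circ> transpose (Hilbert_Choice.inv \<tau> x) (Hilbert_Choice.inv \<tau> y)"
proof
  fix u
  have b: "bij \<tau>" by (rule permutes_bij[OF assms])
  show "(transpose x y \<circ> \<tau>) u = (\<tau> \<circ> transpose (Hilbert_Choice.inv \<tau> x) (Hilbert_Choice.inv \<tau> y)) u"
    using permutes_inverses[OF assms] by (auto simp: transpose_def)
qed

text \<open>Gaussian elimination without denominators: more vectors than coordinates are dependent
  over S.\<close>

lemma polys_linear_dependence:
  fixes v :: "'i \<Rightarrow> 'j \<Rightarrow> 'k::field mpoly"
  assumes "finite J" "finite I" "card J < card I" "\<And>i j. i \<in> I \<Longrightarrow> j \<in> J \<Longrightarrow> v i j \<in> polys n"
  shows "\<exists>s. (\<forall>i\<in>I. s i \<in> polys n) \<and> (\<exists>i\<in>I. s i \<noteq> 0) \<and> (\<forall>j\<in>J. (\<Sum>i\<in>I. s i * v i j) = 0)"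
  using assms
proof (induction J arbitrary: I v rule: finite_induct)
  case empty
  then have "I \<noteq> {}" by auto
  then show ?case by (intro exI[of _ "\<lambda>_. 1"]) auto
next
  case (insert j0 J)
  show ?case
  proof (cases "\<forall>i\<in>I. v i j0 = 0")
    case True
    have "card J < card I" using insert by simp
    then obtain s where "\<forall>i\<in>I. s i \<in> polys n" "\<exists>i\<in>I. s i \<noteq> 0" "\<forall>j\<in>J. (\<Sum>i\<in>I. s i * v i j) = 0"
      using insert.IH[of I v] insert.prems by blast
    then show ?thesis using True by (intro exI[of _ s]) auto
  next
    case False
    then obtain p where p: "p \<in> I" "v p j0 \<noteq> 0" by auto
    \<comment> \<open>Cross-multiplication with the pivot row p clears the coordinate
      \<open>j0\<close>.\<close>
    define v' where "v' i j = v p j0 * v i j - v i j0 * v p j" for i j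
    have "card J < card (I - {p})" using insert p by simp
    moreover have "v' i j \<in> polys n" if "i \<in> I - {p}" "j \<in> J" for i j
      unfolding v'_def using insert.prems(3) p that by (intro polys_closed) auto
    ultimately obtain s where s: "\<forall>i\<in>I-{p}. s i \<in> polys n" "\<exists>i\<in>I-{p}. s i \<noteq> 0"
      "\<forall>j\<in>J. (\<Sum>i\<in>I-{p}. s i * v' i j) = 0"
      using insert.IH[of "I - {p}" v'] insert.prems by blast
    \<comment> \<open>The other coefficients absorb the factor \<open>v p j0\<close>, and the
      coefficient of the pivot row is chosen to restore the cleared coordinate.\<close>
    define s' where "s' i = (if i = p then - (\<Sum>i\<in>I-{p}. s i * v i j0) else s i * v p j0)" for i
    have split: "(\<Sum>i\<in>I. s' i * v i j) =
        (\<Sum>i\<in>I-{p}. s i * v p j0 * v i j) - (\<Sum>i\<in>I-{p}. s i * v i j0 * v p j)" for j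
    proof -
      have "(\<Sum>i\<in>I. s' i * v i j) = s' p * v p j + (\<Sum>i\<in>I-{p}. s' i * v i j)"
        using p insert.prems(1) by (intro sum.remove) auto
      also have "(\<Sum>i\<in>I-{p}. s' i * v i j) = (\<Sum>i\<in>I-{p}. s i * v p j0 * v i j)"
        by (intro sum.cong) (auto simp: s'_def)
      finally show ?thesis by (simp add: s'_def sum_distrib_right)
    qed
    have "(\<Sum>i\<in>I. s' i * v i j) = 0" if "j \<in> insert j0 J" for j
    proof (cases "j = j0")
      case True
      show ?thesis unfolding split True
        by (simp add: mult.assoc mult.commute[of "v p j0"])
    next
      case False
      then have "(\<Sum>i\<in>I-{p}. s i * v' i j) = 0" using s(3) that by auto
      then show ?thesis unfolding split
        by (simp add: v'_def right_diff_distrib sum_subtractf mult.assoc)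
    qed
    moreover have "\<exists>i\<in>I. s' i \<noteq> 0" using s(2) p by (auto simp: s'_def)
    moreover have "\<forall>i\<in>I. s' i \<in> polys n"
      using s(1) p insert.prems(3) by (auto simp: s'_def intro!: polys_closed)
    ultimately show ?thesis by blast
  qed
qed

lemma sum_less_if_separated:
  fixes P Q :: "nat set"
  assumes "finite P" "finite Q" "card P = card Q" "Q \<noteq> {}" "\<And>p q. p \<in> P \<Longrightarrow> q \<in> Q \<Longrightarrow> q < p"
  shows "\<Sum>Q < \<Sum>P"
proof -
  have "Max Q \<in> Q" using assms by simp
  have "\<Sum>Q \<le> card Q * Max Q" using sum_bounded_above[of Q "\<lambda>x. x" "Max Q"] assms by simp
  also have "\<dots> < card P * Suc (Max Q)" using assms by (simp add: card_gt_0_iff)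
  also have "\<dots> \<le> \<Sum>P"
    using sum_bounded_below[of P "Suc (Max Q)" "\<lambda>x. x"] assms \<open>Max Q \<in> Q\<close> by (simp add: Suc_le_eq)
  finally show ?thesis .
qed

lemma disjoint_cancel: "A \<union> Y = A \<union> B \<Longrightarrow> A \<inter> Y = {} \<Longrightarrow> A \<inter> B = {} \<Longrightarrow> Y = B"
  by blast

text \<open>With \<open>rw\<close> and \<open>cl\<close> describing a fixed tableau T, these
  permutations encode the standard tableaux P of the same shape: \<tau> sends the label of T in a
  cell to the entry of P in that cell.\<close>

definition std_perms :: "nat \<Rightarrow> (nat \<Rightarrow> nat) \<Rightarrow> (nat \<Rightarrow> nat) \<Rightarrow> (nat \<Rightarrow> nat) set" where
  "std_perms n rw cl = {\<tau>. \<tau> permutes {1..n} \<and> (\<forall>x\<in>{1..n}. \<forall>y\<in>{1..n}.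
     (rw x = rw y \<and> cl x < cl y \<longrightarrow> \<tau> x < \<tau> y) \<and> (cl x = cl y \<and> rw x < rw y \<longrightarrow> \<tau> x < \<tau> y))}"

text \<open>Labels occupy distinct cells, and the set of occupied cells is closed under moving up
  and left, as in a Young diagram. Both assumptions are symmetric in rows and columns, and the
  labelling itself may be nonstandard.\<close>

locale tab = good_char n K for n :: nat and K :: "'k::field itself" +
  fixes rw cl :: "nat \<Rightarrow> nat"
  assumes cell_inj: "inj_on (\<lambda>x. (rw x, cl x)) {1..n}"
    and cell_down: "\<lbrakk>x \<in> {1..n}; r \<le> rw x; c \<le> cl x\<rbrakk> \<Longrightarrow> \<exists>y\<in>{1..n}. rw y = r \<and> cl y = c"
begin

lemma tab_transposed: "tab TYPE('k) n cl rw"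
proof (intro tab.intro good_char_axioms tab_axioms.intro)
  show "inj_on (\<lambda>x. (cl x, rw x)) {1..n}"
  proof (rule inj_onI)
    fix x y assume "x \<in> {1..n}" "y \<in> {1..n}" "(cl x, rw x) = (cl y, rw y)"
    then show "x = y" using inj_onD[OF cell_inj, of x y] by simp
  qed
next
  fix x r c assume "x \<in> {1..n}" "r \<le> cl x" "c \<le> rw x"
  then obtain y where "y \<in> {1..n}" "rw y = c" "cl y = r" using cell_down by metis
  then show "\<exists>y\<in>{1..n}. cl y = r \<and> rw y = c" by auto
qed

lemma cell_eq: "x \<in> {1..n} \<Longrightarrow> y \<in> {1..n} \<Longrightarrow> rw x = rw y \<Longrightarrow> cl x = cl y \<Longrightarrow> x = y"
  using inj_onD[OF cell_inj, of x y] by simp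

text \<open>The hypothesis says that no rearrangement within the columns spreads the entries in G
  over distinct rows. After the column antisymmetrizer is expanded over \<rho>, each inner sum over
  the permutations of G vanishes separately.\<close>

lemma garnir_relation:
  fixes f :: "'k mpoly"
  assumes \<tau>: "\<tau> permutes {1..n}" and G: "G \<subseteq> {1..n}"
    and coll: "\<And>\<rho>. \<rho> \<in> grp n cl \<Longrightarrow> \<exists>x\<in>G. \<exists>y\<in>G. x \<noteq> y \<and>
      rw (Hilbert_Choice.inv (\<tau> \<circ> \<rho>) x) = rw (Hilbert_Choice.inv (\<tau> \<circ> \<rho>) y)"
  shows "(\<Sum>g | g permutes G. sg g * perm_act (g \<circ> \<tau>) (ysym n rw cl f)) = 0"
proof -
  have fin: "finite {g. g permutes G}" using G by (intro finite_permutations) (auto intro: finite_subset)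
  have gp: "g permutes {1..n}" if "g permutes G" for g using permutes_subset[OF that G] .
  have "(\<Sum>g | g permutes G. sg g * perm_act (g \<circ> (\<tau> \<circ> \<rho>)) (symm n rw f)) = 0"
    if \<rho>: "\<rho> \<in> grp n cl" for \<rho>
  proof -
    let ?\<sigma> = "\<tau> \<circ> \<rho>"
    let ?S = "\<Sum>g | g permutes G. sg g * perm_act (g \<circ> ?\<sigma>) (symm n rw f)"
    have \<sigma>: "?\<sigma> permutes {1..n}" using permutes_compose[OF grp_permutes[OF \<rho>] \<tau>] .
    obtain x y where xy: "x \<in> G" "y \<in> G" "x \<noteq> y"
      "rw (Hilbert_Choice.inv ?\<sigma> x) = rw (Hilbert_Choice.inv ?\<sigma> y)" using coll[OF \<rho>] by blast
    \<comment> \<open>Conjugation by \<open>?\<sigma>\<close> turns \<open>?t\<close> into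
      \<open>?t'\<close>, which lies in the row group and fixes \<open>symm n rw f\<close>.
      Replacing g by \<open>g \<circ> ?t\<close> thus changes the inner sum only by a sign.\<close>
    let ?t = "transpose x y" and ?t' = "transpose (Hilbert_Choice.inv ?\<sigma> x) (Hilbert_Choice.inv ?\<sigma> y)"
    have t: "?t permutes G" using xy by (intro permutes_swap_id)
    have t': "?t' \<in> grp n rw"
      using xy G permutes_in_image[OF permutes_inv[OF \<sigma>]] by (intro transpose_grp) blast+
    have "perm_act (g \<circ> ?t \<circ> ?\<sigma>) (symm n rw f) = perm_act (g \<circ> ?\<sigma>) (symm n rw f)" for g
    proof -
      have "g \<circ> ?t \<circ> ?\<sigma> = (g \<circ> ?\<sigma>) \<circ> ?t'"
        using comp_transpose_comp[OF \<sigma>, of x y] by (simp add: comp_assoc)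
      then have "perm_act (g \<circ> ?t \<circ> ?\<sigma>) (symm n rw f) = perm_act (g \<circ> ?\<sigma>) (perm_act ?t' (symm n rw f))"
        by (simp only: perm_act_comp)
      then show ?thesis by (simp only: perm_act_symm[OF t'])
    qed
    moreover have "sg (g \<circ> ?t) = - (sg g :: 'k mpoly)" if "g permutes G" for g
      using gp[OF that] gp[OF t] xy(3) by (simp add: sign_comp sign_swap_id)
    ultimately have "(\<Sum>g | g permutes G. sg (g \<circ> ?t) * perm_act (g \<circ> ?t \<circ> ?\<sigma>) (symm n rw f)) = - ?S"
      unfolding sum_negf[symmetric] by (intro sum.cong refl) simp
    moreover have "?S = (\<Sum>g | g permutes G. sg (g \<circ> ?t) * perm_act (g \<circ> ?t \<circ> ?\<sigma>) (symm n rw f))"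
      by (rule sum_permutations_compose_right[OF t])
    ultimately show "?S = 0" by (intro mpoly_eq_neg_self) simp
  qed
  note inner = this
  have "(\<Sum>g | g permutes G. sg g * perm_act (g \<circ> \<tau>) (ysym n rw cl f)) =
    (\<Sum>g | g permutes G. \<Sum>\<rho>\<in>grp n cl. sg \<rho> * (sg g * perm_act (g \<circ> (\<tau> \<circ> \<rho>)) (symm n rw f)))"
    unfolding ysym_def alt_def perm_act_sum sum_distrib_left
    by (intro sum.cong refl)
       (simp add: perm_act_mult perm_act_comp comp_assoc mult.left_commute)
  also have "\<dots> = (\<Sum>\<rho>\<in>grp n cl. sg \<rho> * (\<Sum>g | g permutes G. sg g * perm_act (g \<circ> (\<tau> \<circ> \<rho>)) (symm n rw f)))"
    unfolding sum_distrib_left by (rule sum.swap)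
  also have "\<dots> = 0" using inner by (intro sum.neutral) simp
  finally show ?thesis .
qed

text \<open>Straightening, stated for an arbitrary function L with column antisymmetry and Garnir
  relations, so that it applies to whole S-linear combinations of symmetrized polynomials. Every
  step replaces \<tau> by fillings of larger weight until only standard ones remain.\<close>

lemma garnir_vanish:
  fixes L :: "(nat \<Rightarrow> nat) \<Rightarrow> 'k mpoly"
  assumes col: "\<And>\<tau> \<rho>. \<tau> permutes {1..n} \<Longrightarrow> \<rho> \<in> grp n cl \<Longrightarrow> L (\<tau> \<circ> \<rho>) = sg \<rho> * L \<tau>"
    and gar: "\<And>\<tau> G. \<lbrakk>\<tau> permutes {1..n}; G \<subseteq> {1..n};
      \<And>\<rho>. \<rho> \<in> grp n cl \<Longrightarrow> \<exists>x\<in>G. \<exists>y\<in>G. x \<noteq> y \<and>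
        rw (Hilbert_Choice.inv (\<tau> \<circ> \<rho>) x) = rw (Hilbert_Choice.inv (\<tau> \<circ> \<rho>) y)\<rbrakk>
      \<Longrightarrow> (\<Sum>g | g permutes G. sg g * L (g \<circ> \<tau>)) = 0"
    and std: "\<And>\<tau>. \<tau> \<in> std_perms n rw cl \<Longrightarrow> L \<tau> = 0"
    and "\<tau> permutes {1..n}"
  shows "L \<tau> = 0"
proof -
  \<comment> \<open>W weighs the entries by column and U by row. The induction increases W, or keeps
    W and increases U; both are bounded by replacing every entry by n.\<close>
  define W where "W \<tau> = (\<Sum>u\<in>{1..n}. \<tau> u * cl u)" for \<tau> :: "nat \<Rightarrow> nat"
  define U where "U \<tau> = (\<Sum>u\<in>{1..n}. \<tau> u * rw u)" for \<tau> :: "nat \<Rightarrow> nat"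
  define BW where "BW = (\<Sum>u\<in>{1..n}. n * cl u)"
  define BU where "BU = (\<Sum>u\<in>{1..n}. n * rw u)"
  have le_n: "\<tau> u \<le> n" if "\<tau> permutes {1..n}" "u \<in> {1..n}" for \<tau> u
    using permutes_in_image[OF that(1), of u] that(2) by auto
  have W_le: "W \<tau> \<le> BW" if "\<tau> permutes {1..n}" for \<tau>
    unfolding W_def BW_def using le_n[OF that] by (intro sum_mono mult_right_mono) auto
  have U_le: "U \<tau> \<le> BU" if "\<tau> permutes {1..n}" for \<tau>
    unfolding U_def BU_def using le_n[OF that] by (intro sum_mono mult_right_mono) auto
  have "\<tau> permutes {1..n} \<longrightarrow> L \<tau> = 0"
  proof (induction \<tau> rule: wf_induct[OF wf_measures[of "[\<lambda>\<tau>. BW - W \<tau>, \<lambda>\<tau>. BU - U \<tau>]"]])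
    case (1 \<tau>)
    show ?case
    proof
      assume \<tau>: "\<tau> permutes {1..n}"
      have IH_W: "L \<tau>' = 0" if "\<tau>' permutes {1..n}" "W \<tau> < W \<tau>'" for \<tau>'
        using 1 that W_le[OF that(1)] W_le[OF \<tau>] by (auto simp: in_measures)
      have IH_U: "L \<tau>' = 0" if "\<tau>' permutes {1..n}" "W \<tau> = W \<tau>'" "U \<tau> < U \<tau>'" for \<tau>'
        using 1 that U_le[OF that(1)] U_le[OF \<tau>] by (auto simp: in_measures)
      consider (column) x y where "x \<in> {1..n}" "y \<in> {1..n}" "cl x = cl y" "rw x < rw y" "\<tau> y < \<tau> x"
        | (row) x y where "x \<in> {1..n}" "y \<in> {1..n}" "rw x = rw y" "cl x < cl y" "\<tau> y < \<tau> x"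
            "\<And>u v. \<lbrakk>u \<in> {1..n}; v \<in> {1..n}; cl u = cl v; rw u < rw v\<rbrakk> \<Longrightarrow> \<tau> u < \<tau> v"
        | (standard) "\<tau> \<in> std_perms n rw cl"
      proof -
        have ne: "\<tau> u \<noteq> \<tau> v" if "rw u \<noteq> rw v \<or> cl u \<noteq> cl v" for u v
          using permutes_inj[OF \<tau>] that by (metis injD)
        show thesis
        proof (cases "\<forall>u\<in>{1..n}. \<forall>v\<in>{1..n}. cl u = cl v \<and> rw u < rw v \<longrightarrow> \<tau> u < \<tau> v")
          case False
          then show thesis using column ne by (metis linorder_neqE_nat less_irrefl)
        next
          case c: True
          show thesis
          proof (cases "\<forall>u\<in>{1..n}. \<forall>v\<in>{1..n}. rw u = rw v \<and> cl u < cl v \<longrightarrow> \<tau> u < \<tau> v")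
            case True
            then show thesis using standard c \<tau> by (auto simp: std_perms_def)
          next
            case False
            then obtain u v where uv: "u \<in> {1..n}" "v \<in> {1..n}" "rw u = rw v" "cl u < cl v" "\<not> \<tau> u < \<tau> v"
              by auto
            moreover have "\<tau> v < \<tau> u" using uv ne[of u v] by auto
            ultimately show thesis using row[of u v] c by auto
          qed
        qed
      qed
      then show "L \<tau> = 0"
      proof cases
        case column
        \<comment> \<open>Undoing a descent within a column keeps W and increases U, because the
          larger entry moves to the lower row.\<close>
        let ?t = "transpose x y"
        have t: "?t \<in> grp n cl" using column by (intro transpose_grp)
        have W_t: "W (\<tau> \<circ> ?t) = W \<tau>"
        proof -
          have "W \<tau> = (\<Sum>u\<in>{1..n}. \<tau> (?t u) * cl (?t u))"
            unfolding W_def by (subst sum.permute[OF grp_permutes[OF t]]) (simp add: o_def)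
          also have "\<dots> = W (\<tau> \<circ> ?t)"
            unfolding W_def using t by (intro sum.cong) (auto simp: grp_def)
          finally show ?thesis ..
        qed
        have U_split: "U \<sigma> = \<sigma> x * rw x + (\<sigma> y * rw y + (\<Sum>u\<in>{1..n}-{x}-{y}. \<sigma> u * rw u))" for \<sigma>
        proof -
          have "x \<noteq> y" using column by auto
          then show ?thesis unfolding U_def using column(1,2)
            by (simp add: sum.remove[of "{1..n}" x] sum.remove[of "{1..n}-{x}" y])
        qed
        have "(\<Sum>u\<in>{1..n}-{x}-{y}. \<tau> (?t u) * rw u) = (\<Sum>u\<in>{1..n}-{x}-{y}. \<tau> u * rw u)"
          by (intro sum.cong) (auto simp: transpose_def)
        moreover have "\<tau> x * rw x + \<tau> y * rw y < \<tau> y * rw x + \<tau> x * rw y"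
        proof -
          obtain a where a: "\<tau> x = \<tau> y + a" "a > 0" using column(5) by (metis less_imp_add_positive)
          obtain b where b: "rw y = rw x + b" "b > 0" using column(4) by (metis less_imp_add_positive)
          show ?thesis using a b by (simp add: algebra_simps)
        qed
        ultimately have "U \<tau> < U (\<tau> \<circ> ?t)"
          unfolding U_split by simp
        moreover have "\<tau> \<circ> ?t permutes {1..n}" using permutes_compose[OF grp_permutes[OF t] \<tau>] .
        ultimately have "L (\<tau> \<circ> ?t) = 0" using IH_U W_t by simp
        then have "sg ?t * L \<tau> = 0" using col[OF \<tau> t] by simp
        then show ?thesis by simp
      next
        case row
        \<comment> \<open>The cells of the Garnir relation: the column of x from x downwards, and
          the column of y from the top to the same row. Together they number one more than the
          column of x, and as columns already increase, every entry in \<open>UA\<close> exceeds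
          every entry in \<open>UB\<close>.\<close>
        define UA where "UA = {u\<in>{1..n}. cl u = cl x \<and> rw x \<le> rw u}"
        define UB where "UB = {u\<in>{1..n}. cl u = cl y \<and> rw u \<le> rw x}"
        define A where "A = \<tau> ` UA"
        define B where "B = \<tau> ` UB"
        define G where "G = A \<union> B"
        have sub: "UA \<subseteq> {1..n}" "UB \<subseteq> {1..n}" "UA \<inter> UB = {}" using row(4) by (auto simp: UA_def UB_def)
        have fin: "finite UA" "finite UB" "finite A" "finite B"
          by (auto simp: UA_def UB_def A_def B_def)
        have inj: "inj \<tau>" by (rule permutes_inj[OF \<tau>])
        have AB: "A \<inter> B = {}" using sub(3) inj by (auto simp: A_def B_def inj_def)
        have GI: "G \<subseteq> {1..n}" using sub permutes_in_image[OF \<tau>] by (auto simp: G_def A_def B_def)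
        have sep: "b < a" if ab: "a \<in> A" "b \<in> B" for a b
        proof -
          obtain u v where u: "u \<in> UA" "a = \<tau> u" and v: "v \<in> UB" "b = \<tau> v"
            using ab unfolding A_def B_def by blast
          have "\<tau> x \<le> \<tau> u"
          proof (cases "rw u = rw x")
            case True
            then have "u = x" using u row(1) True cell_eq[of u x] by (auto simp: UA_def)
            then show ?thesis by simp
          next
            case False
            then show ?thesis using u row(1) row(6)[of x u] by (auto simp: UA_def)
          qed
          moreover have "\<tau> v \<le> \<tau> y"
          proof (cases "rw v = rw y")
            case True
            then have "v = y" using v row(2) True cell_eq[of v y] by (auto simp: UB_def)
            then show ?thesis by simp
          next
            case False
            then show ?thesis using v row(2,3) row(6)[of v y] by (auto simp: UB_def)
          qed
          ultimately show ?thesis using row(5) u v by auto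
        qed
        have card_col: "card {u\<in>{1..n}. cl u = c \<and> rw u \<le> rw x} = Suc (rw x)"
          if w: "w \<in> {1..n}" "rw w = rw x" "cl w = c" for w c
        proof -
          have "bij_betw rw {u\<in>{1..n}. cl u = c \<and> rw u \<le> rw x} {..rw x}"
            unfolding bij_betw_def
          proof
            show "inj_on rw {u\<in>{1..n}. cl u = c \<and> rw u \<le> rw x}" using cell_eq by (auto simp: inj_on_def)
            show "rw ` {u\<in>{1..n}. cl u = c \<and> rw u \<le> rw x} = {..rw x}"
            proof (intro equalityI subsetI)
              fix r assume "r \<in> {..rw x}"
              then obtain u where "u \<in> {1..n}" "rw u = r" "cl u = c" using cell_down[OF w(1), of r c] w by auto
              then show "r \<in> rw ` {u\<in>{1..n}. cl u = c \<and> rw u \<le> rw x}" using \<open>r \<in> _\<close> by auto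
            qed auto
          qed
          then show ?thesis by (simp add: bij_betw_same_card)
        qed
        define C where "C = {u\<in>{1..n}. cl u = cl x}"
        have "card UA + card {u\<in>{1..n}. cl u = cl x \<and> rw u \<le> rw x} =
          card C + card (UA \<inter> {u\<in>{1..n}. cl u = cl x \<and> rw u \<le> rw x})"
        proof -
          have "C = UA \<union> {u\<in>{1..n}. cl u = cl x \<and> rw u \<le> rw x}" by (auto simp: C_def UA_def)
          then show ?thesis
            using card_Un_Int[of UA "{u\<in>{1..n}. cl u = cl x \<and> rw u \<le> rw x}"] fin by simp
        qed
        moreover have "UA \<inter> {u\<in>{1..n}. cl u = cl x \<and> rw u \<le> rw x} = {x}"
          using row(1) cell_eq[of _ x] by (auto simp: UA_def)
        moreover have "card UB = Suc (rw x)" unfolding UB_def using card_col[of y] row by simp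
        ultimately have card_UAB: "card UA + card UB = Suc (card C)"
          using card_col[of x] row(1) by simp
        have card_G: "card G = Suc (card C)"
          using AB fin card_UAB inj by (simp add: G_def card_Un_disjoint A_def B_def card_image inj_on_subset[OF inj])
        have coll: "\<exists>a\<in>G. \<exists>b\<in>G. a \<noteq> b \<and> rw (Hilbert_Choice.inv (\<tau> \<circ> \<rho>) a) = rw (Hilbert_Choice.inv (\<tau> \<circ> \<rho>) b)"
          if \<rho>: "\<rho> \<in> grp n cl" for \<rho>
        proof -
          let ?f = "\<lambda>q. rw (Hilbert_Choice.inv (\<tau> \<circ> \<rho>) q)"
          \<comment> \<open>The row of a cell in the column of y also occurs in the column of x,
            which lies further left. So \<open>card C + 1\<close> entries use at most
            \<open>card C\<close> rows, and two of them collide.\<close>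
          have "?f ` G \<subseteq> rw ` C"
          proof
            fix r assume "r \<in> ?f ` G"
            then obtain u where u: "u \<in> UA \<union> UB" "r = ?f (\<tau> u)" by (auto simp: G_def A_def B_def)
            define v where "v = Hilbert_Choice.inv \<rho> u"
            have "Hilbert_Choice.inv (\<tau> \<circ> \<rho>) (\<tau> u) = v"
              using permutes_inverses[OF \<tau>] \<tau> grp_permutes[OF \<rho>]
              by (simp add: v_def o_inv_distrib permutes_bij)
            then have r: "r = rw v" using u by simp
            have v: "v \<in> {1..n}" "cl v = cl u"
              using grp_inv[OF \<rho>] u sub permutes_in_image[OF permutes_inv[OF grp_permutes[OF \<rho>]], of u]
              by (auto simp: v_def grp_def)
            have "cl x \<le> cl v" using v(2) u row(4) by (auto simp: UA_def UB_def)
            then obtain w where "w \<in> {1..n}" "rw w = rw v" "cl w = cl x"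
              using cell_down[OF v(1), of "rw v" "cl x"] by auto
            then show "r \<in> rw ` C" using r by (auto simp: C_def intro!: rev_image_eqI)
          qed
          then have "card (?f ` G) \<le> card C"
            using card_mono[of "rw ` C" "?f ` G"] card_image_le[of C rw] by (simp add: C_def)
          then have "card (?f ` G) < card G" using card_G by simp
          then have "\<not> inj_on ?f G" by (rule pigeonhole)
          then show ?thesis by (auto simp: inj_on_def)
        qed
        have zero: "(\<Sum>g | g permutes G. sg g * L (g \<circ> \<tau>)) = 0" using gar[OF \<tau> GI coll] .
        have gI: "g permutes {1..n}" if "g permutes G" for g using permutes_subset[OF that GI] .
        \<comment> \<open>Such a g preserves B as well and hence acts as an element of the column
          group on the cells; its sign cancels against the sign in the relation.\<close>
        have fix_A: "sg g * L (g \<circ> \<tau>) = L \<tau>" if g: "g permutes G" "g ` A = A" for g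
        proof -
          define \<rho> where "\<rho> = Hilbert_Choice.inv \<tau> \<circ> g \<circ> \<tau>"
          have g\<tau>: "g \<circ> \<tau> = \<tau> \<circ> \<rho>" using permutes_inv_o[OF \<tau>] by (simp add: \<rho>_def comp_assoc[symmetric])
          have "g ` B = B"
          proof -
            have "g ` G = G" by (rule permutes_image[OF g(1)])
            moreover have "g ` A \<inter> g ` B = {}" 
              using AB image_Int[OF permutes_inj[OF g(1)], of A B] by simp
            ultimately show ?thesis using g(2) AB disjoint_cancel[of A "g ` B" B] by (simp add: G_def image_Un)
          qed
          have "cl (\<rho> u) = cl u" if u: "u \<in> {1..n}" for u
          proof -
            have iv: "Hilbert_Choice.inv \<tau> (\<tau> w) = w" for w using permutes_inverses[OF \<tau>] by simp
            consider "u \<in> UA" | "u \<in> UB" | "\<tau> u \<notin> G" 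
              using inj_image_mem_iff[OF inj] by (auto simp: G_def A_def B_def)
            then show ?thesis
            proof cases
              case 1
              then have "g (\<tau> u) \<in> \<tau> ` UA" using g(2) by (auto simp: A_def)
              then show ?thesis using 1 iv by (auto simp: \<rho>_def UA_def)
            next
              case 2
              then have "g (\<tau> u) \<in> \<tau> ` UB" using \<open>g ` B = B\<close> by (auto simp: B_def)
              then show ?thesis using 2 iv by (auto simp: \<rho>_def UB_def)
            next
              case 3
              then have "g (\<tau> u) = \<tau> u" using g(1) by (simp add: permutes_not_in)
              then show ?thesis using iv by (simp add: \<rho>_def)
            qed
          qed
          moreover have p: "\<rho> permutes {1..n}"
            unfolding \<rho>_def by (intro permutes_compose \<tau> permutes_inv gI g(1))
          ultimately have \<rho>: "\<rho> \<in> grp n cl" by (simp add: grp_def)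
          have "sign g * sign \<tau> = sign \<tau> * sign \<rho>"
            using sign_comp[OF gI[OF g(1)] \<tau>] sign_comp[OF \<tau> p] g\<tau> by simp
          then have "sign \<rho> = sign g" by (simp add: sign_def split: if_splits)
          then show ?thesis using g\<tau> col[OF \<tau> \<rho>] by simp
        qed
        \<comment> \<open>Otherwise g carries entries of A, larger than all of B, into the
          right-hand column, and W increases.\<close>
        have move_A: "L (g \<circ> \<tau>) = 0" if g: "g permutes G" "g ` A \<noteq> A" for g
        proof (rule IH_W)
          show "g \<circ> \<tau> permutes {1..n}" using permutes_compose[OF \<tau> gI[OF g(1)]] .
          have W_split: "W (h \<circ> \<tau>) = cl x * (\<Sum>a\<in>A. h a) + cl y * (\<Sum>b\<in>B. h b) +
            (\<Sum>u\<in>{1..n}-UA-UB. h (\<tau> u) * cl u)" for h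
          proof -
            have un: "{1..n} = UA \<union> (UB \<union> ({1..n} - UA - UB))" using sub by blast
            have "W (h \<circ> \<tau>) = (\<Sum>u\<in>UA \<union> (UB \<union> ({1..n} - UA - UB)). h (\<tau> u) * cl u)"
              unfolding W_def by (rule sum.cong[OF un]) simp
            also have "\<dots> = (\<Sum>u\<in>UA. h (\<tau> u) * cl u) + (\<Sum>u\<in>UB \<union> ({1..n} - UA - UB). h (\<tau> u) * cl u)"
              using sub(3) fin by (intro sum.union_disjoint) auto
            also have "(\<Sum>u\<in>UB \<union> ({1..n} - UA - UB). h (\<tau> u) * cl u) =
              (\<Sum>u\<in>UB. h (\<tau> u) * cl u) + (\<Sum>u\<in>{1..n} - UA - UB. h (\<tau> u) * cl u)"
              using fin by (intro sum.union_disjoint) auto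
            also have "(\<Sum>u\<in>UA. h (\<tau> u) * cl u) = cl x * (\<Sum>a\<in>A. h a)"
              unfolding A_def sum.reindex[OF inj_on_subset[OF inj subset_UNIV]] sum_distrib_left
              by (intro sum.cong) (auto simp: UA_def)
            also have "(\<Sum>u\<in>UB. h (\<tau> u) * cl u) = cl y * (\<Sum>b\<in>B. h b)"
              unfolding B_def sum.reindex[OF inj_on_subset[OF inj subset_UNIV]] sum_distrib_left
              by (intro sum.cong) (auto simp: UB_def)
            finally show ?thesis by (simp only: add.assoc)
          qed
          have rest: "(\<Sum>u\<in>{1..n}-UA-UB. g (\<tau> u) * cl u) = (\<Sum>u\<in>{1..n}-UA-UB. \<tau> u * cl u)"
          proof (intro sum.cong refl)
            fix u assume "u \<in> {1..n} - UA - UB"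
            then have "\<tau> u \<notin> G" 
              using inj_image_mem_iff[OF inj] by (auto simp: G_def A_def B_def)
            then show "g (\<tau> u) * cl u = \<tau> u * cl u" using g(1) by (simp add: permutes_not_in)
          qed
          have ginj: "inj_on g S" for S using permutes_inj[OF g(1)] by (rule inj_on_subset) simp
          have gB: "g ` B \<noteq> B"
          proof
            assume "g ` B = B"
            moreover have "g ` G = G" by (rule permutes_image[OF g(1)])
            moreover have "g ` A \<inter> g ` B = {}" 
              using AB image_Int[OF permutes_inj[OF g(1)], of A B] by simp
            ultimately show False
              using g(2) AB disjoint_cancel[of B "g ` A" A] by (simp add: G_def image_Un Un_commute Int_commute)
          qed
          have gBG: "g ` B \<subseteq> G" using permutes_image[OF g(1)] by (auto simp: G_def)
          have cgB: "card (g ` B) = card B" by (rule card_image[OF ginj])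
          \<comment> \<open>P is what the right-hand column gains and Q what it loses; they have
            equal size, P lies in A and Q in B, so the sum of that column grows.\<close>
          define P where "P = g ` B - B"
          define Q where "Q = B - g ` B"
          have PQ: "card P = card Q"
            using card_Int_Diff[of "g ` B" B] card_Int_Diff[of B "g ` B"] fin cgB
            unfolding P_def Q_def by (simp add: Int_commute)
          have "Q \<noteq> {}" 
          proof
            assume "Q = {}"
            then have "B \<subseteq> g ` B" by (auto simp: Q_def)
            then show False using card_subset_eq[of "g ` B" B] cgB gB fin by simp
          qed
          have "\<Sum>Q < \<Sum>P"
            using PQ \<open>Q \<noteq> {}\<close> sep gBG fin
            by (intro sum_less_if_separated) (auto simp: P_def Q_def G_def)
          moreover have "\<Sum>(g ` B) = \<Sum>P + \<Sum>(g ` B \<inter> B)"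
            unfolding P_def using sum.Int_Diff[of "g ` B" "\<lambda>x. x" B] fin by simp
          moreover have "\<Sum>B = \<Sum>Q + \<Sum>(g ` B \<inter> B)"
            unfolding Q_def using sum.Int_Diff[of B "\<lambda>x. x" "g ` B"] fin by (simp add: Int_commute)
          moreover have "\<Sum>(g ` B) = (\<Sum>b\<in>B. g b)" by (simp add: sum.reindex[OF ginj])
          ultimately have SB: "\<Sum>B < (\<Sum>b\<in>B. g b)" by simp
          have "(\<Sum>a\<in>A. g a) + (\<Sum>b\<in>B. g b) = (\<Sum>q\<in>G. g q)"
            unfolding G_def using AB fin by (simp add: sum.union_disjoint)
          also have "\<dots> = \<Sum>G" by (subst (2) sum.permute[OF g(1)]) (simp add: o_def)
          also have "\<dots> = \<Sum>A + \<Sum>B" unfolding G_def using AB fin by (simp add: sum.union_disjoint)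
          finally have SAB: "(\<Sum>a\<in>A. g a) + (\<Sum>b\<in>B. g b) = \<Sum>A + \<Sum>B" .
          have arith: "c * a + d * b < c * a' + d * b'" if "a' + b' = a + b" "b < b'" "c < d" for a a' b b' c d :: nat
          proof -
            obtain e where e: "b' = b + e" "e > 0" using \<open>b < b'\<close> by (metis less_imp_add_positive)
            then have "a = a' + e" using that by simp
            then show ?thesis using e \<open>c < d\<close> by (simp add: algebra_simps)
          qed
          have "W \<tau> = W (id \<circ> \<tau>)" by simp
          also have "\<dots> < W (g \<circ> \<tau>)"
            unfolding W_split using arith[OF SAB SB row(4)] rest by simp
          finally show "W \<tau> < W (g \<circ> \<tau>)" .
        qed
        let ?H = "{g. g permutes G \<and> g ` A = A}"
        have finG: "finite {g. g permutes G}" using GI by (intro finite_permutations) (auto intro: finite_subset)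
        have "(\<Sum>g | g permutes G. sg g * L (g \<circ> \<tau>)) = (\<Sum>g\<in>?H. L \<tau>)"
          using finG by (intro sum.mono_neutral_cong_right) (auto simp: fix_A move_A)
        \<comment> \<open>Only the permutations preserving A survive, each contributing the same
          \<open>L \<tau>\<close>; their number divides n! and can be cancelled.\<close>
        then have "of_nat (card ?H) * L \<tau> = 0" using zero by simp
        moreover have "card ?H dvd fact n"
        proof (rule card_perm_subgroup_dvd_fact)
          show "?H \<subseteq> perms n" using gI by auto
          show "id \<in> ?H" by (simp add: permutes_id)
          show "\<pi> \<circ> \<rho> \<in> ?H" if "\<pi> \<in> ?H" "\<rho> \<in> ?H" for \<pi> \<rho>
          proof -
            have "(\<pi> \<circ> \<rho>) ` A = \<pi> ` (\<rho> ` A)" by (simp only: image_comp)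
            then show ?thesis using that by (simp add: permutes_compose)
          qed
          show "Hilbert_Choice.inv \<pi> \<in> ?H" if \<pi>: "\<pi> \<in> ?H" for \<pi>
          proof -
            have p: "\<pi> permutes G" and A: "\<pi> ` A = A" using \<pi> by auto
            have "Hilbert_Choice.inv \<pi> ` (\<pi> ` A) = A"
              unfolding image_comp permutes_inv_o(2)[OF p] by simp
            then show ?thesis unfolding A using permutes_inv[OF p] by blast
          qed
        qed
        then have "of_nat (card ?H) \<noteq> (0 :: 'k mpoly)" by (rule of_nat_mpoly_ne_0)
        ultimately show ?thesis by simp
      next
        case standard
        then show ?thesis by (rule std)
      qed
    qed
  qed
  then show ?thesis using assms(4) by simp
qed

text \<open>The translates by standard permutations serve as coordinates. Elimination gives a
  dependence over S in these coordinates, straightening extends it to the translates by all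
  permutations, and averaging makes its coefficients invariant.\<close>

lemma ysym_rank:
  fixes h :: "nat \<Rightarrow> 'k mpoly"
  assumes "finite I" "card (std_perms n rw cl) < card I" "\<And>i. i \<in> I \<Longrightarrow> h i \<in> polys n"
  shows "\<exists>r. (\<forall>i\<in>I. r i \<in> sym_polys n) \<and> (\<exists>i\<in>I. r i \<noteq> 0) \<and> (\<Sum>i\<in>I. r i * ysym n rw cl (h i)) = 0"
proof -
  let ?e = "ysym n rw cl :: 'k mpoly \<Rightarrow> 'k mpoly"
  have std_sub: "std_perms n rw cl \<subseteq> perms n" by (auto simp: std_perms_def)
  have "\<exists>s. (\<forall>i\<in>I. s i \<in> polys n) \<and> (\<exists>i\<in>I. s i \<noteq> 0) \<and>
    (\<forall>\<tau>\<in>std_perms n rw cl. (\<Sum>i\<in>I. s i * perm_act \<tau> (?e (h i))) = 0)"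
  proof (rule polys_linear_dependence)
    show "finite (std_perms n rw cl)" by (rule finite_subset[OF std_sub]) simp
    show "perm_act \<tau> (?e (h i)) \<in> polys n" if "i \<in> I" "\<tau> \<in> std_perms n rw cl" for i \<tau>
      using std_sub that assms(3) by (intro polys_perm_act polys_ysym) auto
  qed (use assms in auto)
  then obtain s where s: "\<forall>i\<in>I. s i \<in> polys n" "\<exists>i\<in>I. s i \<noteq> 0"
    "\<forall>\<tau>\<in>std_perms n rw cl. (\<Sum>i\<in>I. s i * perm_act \<tau> (?e (h i))) = 0" by blast
  define L where "L \<tau> = (\<Sum>i\<in>I. s i * perm_act \<tau> (?e (h i)))" for \<tau>
  have L0: "L \<tau> = 0" if "\<tau> permutes {1..n}" for \<tau>
  proof (rule garnir_vanish[OF _ _ _ that])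
    fix \<tau> \<rho> assume "\<tau> permutes {1..n}" and \<rho>: "\<rho> \<in> grp n cl"
    have "perm_act (\<tau> \<circ> \<rho>) (?e f) = sg \<rho> * perm_act \<tau> (?e f)" for f
    proof -
      have "perm_act (\<tau> \<circ> \<rho>) (?e f) = perm_act \<tau> (perm_act \<rho> (?e f))" by (simp add: perm_act_comp)
      then show ?thesis by (simp add: ysym_def perm_act_alt[OF \<rho>] perm_act_mult)
    qed
    then show "L (\<tau> \<circ> \<rho>) = sg \<rho> * L \<tau>" by (simp add: L_def sum_distrib_left mult.left_commute)
  next
    fix \<tau> G assume *: "\<tau> permutes {1..n}" "G \<subseteq> {1..n}"
      "\<And>\<rho>. \<rho> \<in> grp n cl \<Longrightarrow> \<exists>x\<in>G. \<exists>y\<in>G. x \<noteq> y \<and>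
        rw (Hilbert_Choice.inv (\<tau> \<circ> \<rho>) x) = rw (Hilbert_Choice.inv (\<tau> \<circ> \<rho>) y)"
    have "(\<Sum>g | g permutes G. sg g * L (g \<circ> \<tau>)) =
      (\<Sum>g | g permutes G. \<Sum>i\<in>I. s i * (sg g * perm_act (g \<circ> \<tau>) (?e (h i))))"
      unfolding L_def sum_distrib_left by (simp add: mult.left_commute)
    also have "\<dots> = (\<Sum>i\<in>I. s i * (\<Sum>g | g permutes G. sg g * perm_act (g \<circ> \<tau>) (?e (h i))))"
      unfolding sum_distrib_left by (rule sum.swap)
    also have "\<dots> = 0" using garnir_relation[OF *] by (intro sum.neutral) auto
    finally show "(\<Sum>g | g permutes G. sg g * L (g \<circ> \<tau>)) = 0" .
  next
    fix \<tau> assume "\<tau> \<in> std_perms n rw cl"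
    then show "L \<tau> = 0" using s(3) by (simp add: L_def)
  qed
  obtain i0 where i0: "i0 \<in> I" "s i0 \<noteq> 0" using s(2) by blast
  \<comment> \<open>The auxiliary factor q prevents the average of the nonzero coefficient from
    vanishing.\<close>
  then obtain q where q: "q \<in> polys n" "(\<Sum>\<rho>\<in>perms n. perm_act \<rho> (s i0 * q)) \<noteq> 0"
    using trace_nondegenerate[of n "s i0"] by blast
  define r where "r i = (\<Sum>\<rho>\<in>perms n. perm_act \<rho> (s i * q))" for i
  have "(\<Sum>i\<in>I. r i * ?e (h i)) = (\<Sum>\<rho>\<in>perms n. \<Sum>i\<in>I. perm_act \<rho> (s i * q) * ?e (h i))"
    unfolding r_def sum_distrib_right by (rule sum.swap)
  \<comment> \<open>Pulling \<rho> out of the product leaves the relation L at the inverse of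
    \<rho>; this is where its vanishing at all permutations, and not only at the standard ones, is
    used.\<close>
  also have "\<dots> = (\<Sum>\<rho>\<in>perms n. perm_act \<rho> (q * L (Hilbert_Choice.inv \<rho>)))"
  proof (intro sum.cong refl)
    fix \<rho> assume "\<rho> \<in> perms n"
    then show "(\<Sum>i\<in>I. perm_act \<rho> (s i * q) * ?e (h i)) = perm_act \<rho> (q * L (Hilbert_Choice.inv \<rho>))"
      by (simp add: L_def perm_act_mult perm_act_sum perm_act_comp permutes_inv_o sum_distrib_left algebra_simps)
  qed
  also have "\<dots> = 0" by (intro sum.neutral) (auto simp: L0 permutes_inv)
  finally have "(\<Sum>i\<in>I. r i * ?e (h i)) = 0" .
  moreover have "\<forall>i\<in>I. r i \<in> sym_polys n"
    unfolding r_def using s(1) q(1) by (auto intro!: trace_in_sym_polys polys_mult)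
  ultimately show ?thesis using i0(1) q(2) by (auto simp: r_def)
qed

end


subsection \<open>Young symmetrizers are quasi-idempotent\<close>

text \<open>An initial segment is the unique set of its size with the least sum: whatever S has in
  place of missing elements is larger. It is applied to rows within a column and to exponents of
  monomials.\<close>

lemma down_closed_sum_less:
  fixes S S0 :: "nat set"
  assumes "finite S" "finite S0" "card S = card S0" "\<And>p q. q \<in> S0 \<Longrightarrow> p \<le> q \<Longrightarrow> p \<in> S0"
  shows "S = S0 \<or> \<Sum>S0 < \<Sum>S"
proof (cases "S0 - S = {}")
  case True
  then show ?thesis using card_subset_eq[of S S0] assms by auto
next
  case False
  have "card (S - S0) = card (S0 - S)"
    using card_Int_Diff[of S S0] card_Int_Diff[of S0 S] assms by (simp add: Int_commute)
  moreover have "q < p" if "p \<in> S - S0" "q \<in> S0 - S" for p q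
    using assms(4)[of q p] that by (meson DiffE not_less)
  ultimately have "\<Sum>(S0 - S) < \<Sum>(S - S0)"
    using assms(1,2) False by (intro sum_less_if_separated) auto
  then show ?thesis
    using sum.Int_Diff[of S "\<lambda>x. x" S0] sum.Int_Diff[of S0 "\<lambda>x. x" S] assms(1,2)
    by (simp add: Int_commute)
qed

lemma sum_perm_act_vector_space: "Vector_Spaces.vector_space (\<lambda>c (f :: 'k::field mpoly). Const c * f)"
  by unfold_locales (simp_all add: algebra_simps Const_add Const_mult)

context tab
begin

text \<open>Let f give the row of each label in the tableau permuted by \<pi>. It is injective on
  every column of T, so its sum over a column is at least that of the rows 0, 1, ... of the column.
  The totals agree, so equality holds in each column, and the labels can be rearranged inside the
  columns to reach their rows.\<close>

lemma perm_factorization: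
  assumes \<pi>: "\<pi> permutes {1..n}"
    and no: "\<And>x y. \<lbrakk>x \<in> {1..n}; y \<in> {1..n}; x \<noteq> y; cl x = cl y\<rbrakk>
      \<Longrightarrow> rw (Hilbert_Choice.inv \<pi> x) \<noteq> rw (Hilbert_Choice.inv \<pi> y)"
  shows "\<exists>\<rho>\<in>grp n cl. \<exists>\<sigma>\<in>grp n rw. \<pi> = \<rho> \<circ> \<sigma>"
proof -
  let ?I = "{1..n}"
  define f where "f x = rw (Hilbert_Choice.inv \<pi> x)" for x
  define C where "C c = {x\<in>?I. cl x = c}" for c
  have finC: "finite (C c)" for c by (simp add: C_def)
  have injf: "inj_on f (C c)" for c
  proof (rule inj_onI)
    fix x y assume "x \<in> C c" "y \<in> C c" "f x = f y"
    then show "x = y" using no[of x y] by (auto simp: C_def f_def)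
  qed
  have injr: "inj_on rw (C c)" for c
  proof (rule inj_onI)
    fix x y assume "x \<in> C c" "y \<in> C c" "rw x = rw y"
    then show "x = y" using cell_eq[of x y] by (simp add: C_def)
  qed
  have alt: "f ` C c = rw ` C c \<or> \<Sum>(rw ` C c) < \<Sum>(f ` C c)" for c
  proof (rule down_closed_sum_less)
    show "card (f ` C c) = card (rw ` C c)" by (simp add: card_image injf injr)
    fix p q assume "q \<in> rw ` C c" "p \<le> q"
    then obtain x where x: "x \<in> C c" "p \<le> rw x" by auto
    then obtain y where "y \<in> ?I" "rw y = p" "cl y = c" using cell_down[of x p c] by (auto simp: C_def)
    then show "p \<in> rw ` C c" by (auto simp: C_def)
  qed (simp_all add: finC)
  have sums: "\<Sum>(f ` C c) = sum f (C c)" "\<Sum>(rw ` C c) = sum rw (C c)" for c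
    by (simp_all add: sum.reindex injf injr)
  have grp: "(\<Sum>c\<in>cl ` ?I. sum g (C c)) = sum g ?I" for g :: "nat \<Rightarrow> nat"
    unfolding C_def by (rule sum.group) auto
  have total: "sum f ?I = sum rw ?I"
    unfolding f_def using sum.permute[OF permutes_inv[OF \<pi>], of rw] by (simp add: o_def)
  have eq: "f ` C c = rw ` C c" if c: "c \<in> cl ` ?I" for c
  proof (rule ccontr)
    assume "f ` C c \<noteq> rw ` C c"
    then have "sum rw (C c) < sum f (C c)" using alt[of c] sums by simp
    moreover have "sum rw (C d) \<le> sum f (C d)" for d using alt[of d] sums[of d] by (metis less_imp_le order_refl)
    ultimately have "(\<Sum>c\<in>cl ` ?I. sum rw (C c)) < (\<Sum>c\<in>cl ` ?I. sum f (C c))"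
      using c by (intro sum_strict_mono_ex1) auto
    then show False using grp total by simp
  qed
  have "\<exists>y\<in>?I. cl y = cl x \<and> rw y = f x" if x: "x \<in> ?I" for x
  proof -
    have "f x \<in> f ` C (cl x)" using x by (simp add: C_def)
    also have "f ` C (cl x) = rw ` C (cl x)" using eq x by blast
    finally show ?thesis by (auto simp: C_def)
  qed
  then obtain d where d: "\<And>x. x \<in> ?I \<Longrightarrow> d x \<in> ?I \<and> cl (d x) = cl x \<and> rw (d x) = f x" by metis
  define \<delta> where "\<delta> x = (if x \<in> ?I then d x else x)" for x
  have "inj_on \<delta> ?I"
  proof (rule inj_onI)
    fix x y assume xy: "x \<in> ?I" "y \<in> ?I" "\<delta> x = \<delta> y"
    then have "cl x = cl y" "f x = f y" using d[of x] d[of y] by (simp_all add: \<delta>_def)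
    then show "x = y" using no[of x y] xy by (auto simp: f_def)
  qed
  moreover have sub: "\<delta> ` ?I \<subseteq> ?I"
  proof
    fix y assume "y \<in> \<delta> ` ?I"
    then obtain x where "x \<in> ?I" "y = d x" by (auto simp: \<delta>_def)
    then show "y \<in> ?I" using d by blast
  qed
  ultimately have "bij_betw \<delta> ?I ?I" by (simp add: bij_betw_def endo_inj_surj)
  then have \<delta>p: "\<delta> permutes ?I" by (rule bij_imp_permutes) (auto simp: \<delta>_def)
  have \<delta>: "\<delta> \<in> grp n cl"
    unfolding grp_def mem_Collect_eq
  proof (intro conjI ballI \<delta>p)
    fix x assume "x \<in> ?I"
    then show "cl (\<delta> x) = cl x" using d[of x] by (simp add: \<delta>_def)
  qed
  have "\<delta> \<circ> \<pi> \<in> grp n rw"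
    unfolding grp_def mem_Collect_eq
  proof (intro conjI ballI)
    show "\<delta> \<circ> \<pi> permutes ?I" by (rule permutes_compose[OF \<pi> \<delta>p])
    fix x assume "x \<in> ?I"
    then have "\<pi> x \<in> ?I" using permutes_in_image[OF \<pi>] by blast
    then have "rw (\<delta> (\<pi> x)) = f (\<pi> x)" using d[of "\<pi> x"] by (simp add: \<delta>_def)
    then show "rw ((\<delta> \<circ> \<pi>) x) = rw x" by (simp add: f_def permutes_inverses[OF \<pi>])
  qed
  moreover have "\<pi> = Hilbert_Choice.inv \<delta> \<circ> (\<delta> \<circ> \<pi>)"
    by (simp add: comp_assoc[symmetric] permutes_inv_o[OF \<delta>p])
  ultimately show ?thesis using grp_inv[OF \<delta>] by blast
qed

text \<open>The two cases are von Neumann's: either some transposition lies both in the column group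
  and, conjugated by \<open>\<pi>\<close>, in the row group, or \<open>\<pi>\<close> factors through the two groups.\<close>

lemma alt_perm_act_symm:
  assumes \<pi>: "\<pi> permutes {1..n}"
  shows "\<exists>s::int. \<forall>f :: 'k mpoly. alt n cl (perm_act \<pi> (symm n rw f)) = of_int s * ysym n rw cl f"
proof (cases "\<exists>x\<in>{1..n}. \<exists>y\<in>{1..n}. x \<noteq> y \<and> cl x = cl y \<and>
    rw (Hilbert_Choice.inv \<pi> x) = rw (Hilbert_Choice.inv \<pi> y)")
  case True
  then obtain x y where xy: "x \<in> {1..n}" "y \<in> {1..n}" "x \<noteq> y" "cl x = cl y"
    "rw (Hilbert_Choice.inv \<pi> x) = rw (Hilbert_Choice.inv \<pi> y)" by blast
  let ?t = "transpose x y" and ?t' = "transpose (Hilbert_Choice.inv \<pi> x) (Hilbert_Choice.inv \<pi> y)"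
  have t: "?t \<in> grp n cl" using xy by (intro transpose_grp)
  have t': "?t' \<in> grp n rw"
    using xy permutes_in_image[OF permutes_inv[OF \<pi>]] by (intro transpose_grp) blast+
  have "alt n cl (perm_act \<pi> (symm n rw f)) = 0" for f :: "'k mpoly"
  proof (rule mpoly_eq_neg_self)
    have "alt n cl (perm_act \<pi> (symm n rw f)) = alt n cl (perm_act \<pi> (perm_act ?t' (symm n rw f)))"
      by (simp only: perm_act_symm[OF t'])
    also have "\<dots> = alt n cl (perm_act ?t (perm_act \<pi> (symm n rw f)))"
      by (simp only: perm_act_comp comp_transpose_comp[OF \<pi>])
    also have "\<dots> = - alt n cl (perm_act \<pi> (symm n rw f))"
      unfolding alt_perm_act[OF t] using xy(3) by (simp add: sign_swap_id)
    finally show "alt n cl (perm_act \<pi> (symm n rw f)) = - alt n cl (perm_act \<pi> (symm n rw f))" .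
  qed
  then show ?thesis by (intro exI[of _ 0]) simp
next
  case False
  then obtain \<rho> \<sigma> where r: "\<rho> \<in> grp n cl" "\<sigma> \<in> grp n rw" "\<pi> = \<rho> \<circ> \<sigma>"
    using perm_factorization[OF \<pi>] by blast
  have "alt n cl (perm_act \<pi> (symm n rw f)) = of_int (sign \<rho>) * ysym n rw cl f" for f :: "'k mpoly"
    by (simp add: r(3) perm_act_comp[symmetric] perm_act_symm[OF r(2)] alt_perm_act[OF r(1)] ysym_def)
  then show ?thesis by blast
qed

text \<open>The same dichotomy with the row symmetrizer outside. The factorization is applied to the
  inverse of \<pi>, so that inverting it back puts the row permutation first.\<close>

lemma symm_perm_act_alt:
  assumes \<pi>: "\<pi> permutes {1..n}"
  shows "\<exists>s::int. \<forall>f :: 'k mpoly. symm n rw (perm_act \<pi> (alt n cl f)) = of_int s * ysig n rw cl f"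
proof (cases "\<exists>x\<in>{1..n}. \<exists>y\<in>{1..n}. x \<noteq> y \<and> cl x = cl y \<and> rw (\<pi> x) = rw (\<pi> y)")
  case True
  then obtain x y where xy: "x \<in> {1..n}" "y \<in> {1..n}" "x \<noteq> y" "cl x = cl y" "rw (\<pi> x) = rw (\<pi> y)"
    by blast
  let ?t = "transpose x y" and ?t' = "transpose (\<pi> x) (\<pi> y)"
  have t: "?t \<in> grp n cl" using xy by (intro transpose_grp)
  have t': "?t' \<in> grp n rw"
    using xy permutes_in_image[OF \<pi>] by (intro transpose_grp) blast+
  have comm: "?t' \<circ> \<pi> = \<pi> \<circ> ?t"
    using comp_transpose_comp[OF \<pi>, of "\<pi> x" "\<pi> y"] by (simp add: permutes_inverses[OF \<pi>])
  have "symm n rw (perm_act \<pi> (alt n cl f)) = 0" for f :: "'k mpoly"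
  proof (rule mpoly_eq_neg_self)
    have "symm n rw (perm_act \<pi> (alt n cl f)) = symm n rw (perm_act ?t' (perm_act \<pi> (alt n cl f)))"
      by (simp only: symm_perm_act[OF t'])
    also have "\<dots> = symm n rw (perm_act \<pi> (perm_act ?t (alt n cl f)))"
      by (simp only: perm_act_comp comm)
    also have "\<dots> = - symm n rw (perm_act \<pi> (alt n cl f))"
      unfolding perm_act_alt[OF t] using xy(3) by (simp add: sign_swap_id perm_act_uminus symm_uminus)
    finally show "symm n rw (perm_act \<pi> (alt n cl f)) = - symm n rw (perm_act \<pi> (alt n cl f))" .
  qed
  then show ?thesis by (intro exI[of _ 0]) simp
next
  case False
  have "\<exists>\<rho>\<in>grp n cl. \<exists>\<sigma>\<in>grp n rw. Hilbert_Choice.inv \<pi> = \<rho> \<circ> \<sigma>"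
  proof (rule perm_factorization[OF permutes_inv[OF \<pi>]])
    fix x y assume "x \<in> {1..n}" "y \<in> {1..n}" "x \<noteq> y" "cl x = cl y"
    then have "rw (\<pi> x) \<noteq> rw (\<pi> y)" using False by blast
    then show "rw (Hilbert_Choice.inv (Hilbert_Choice.inv \<pi>) x) \<noteq> rw (Hilbert_Choice.inv (Hilbert_Choice.inv \<pi>) y)"
      by (simp add: inv_inv_eq[OF permutes_bij[OF \<pi>]])
  qed
  then obtain \<rho> \<sigma> where r: "\<rho> \<in> grp n cl" "\<sigma> \<in> grp n rw" "Hilbert_Choice.inv \<pi> = \<rho> \<circ> \<sigma>"
    by blast
  have "\<pi> = Hilbert_Choice.inv (Hilbert_Choice.inv \<pi>)" by (simp add: inv_inv_eq permutes_bij[OF \<pi>])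
  also have "\<dots> = Hilbert_Choice.inv \<sigma> \<circ> Hilbert_Choice.inv \<rho>"
    unfolding r(3) using r(1,2) by (intro o_inv_distrib permutes_bij[OF grp_permutes])
  finally have \<pi>_eq: "\<pi> = Hilbert_Choice.inv \<sigma> \<circ> Hilbert_Choice.inv \<rho>" .
  have "symm n rw (perm_act \<pi> (alt n cl f)) = of_int (sign (Hilbert_Choice.inv \<rho>)) * ysig n rw cl f"
    for f :: "'k mpoly"
    by (simp add: \<pi>_eq perm_act_comp[symmetric] perm_act_alt[OF grp_inv[OF r(1)]]
        symm_perm_act[OF grp_inv[OF r(2)]] symm_sym_mult ysig_def)
  then show ?thesis by blast
qed

text \<open>In c r c r the inner product r c is a signed sum of permutations, and c \<pi> r is an
  integer multiple of c r for each of them. The integer depends on the groups alone and not on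
  f.\<close>

lemma ysym_ysym_int: "\<exists>s::int. \<forall>f :: 'k mpoly. ysym n rw cl (ysym n rw cl f) = of_int s * ysym n rw cl f"
proof -
  have "\<forall>\<pi>. \<exists>s::int. \<pi> permutes {1..n} \<longrightarrow>
      (\<forall>f :: 'k mpoly. alt n cl (perm_act \<pi> (symm n rw f)) = of_int s * ysym n rw cl f)"
    using alt_perm_act_symm by meson
  then obtain s where s: "\<And>\<pi> f. \<pi> permutes {1..n} \<Longrightarrow>
      alt n cl (perm_act \<pi> (symm n rw f)) = of_int (s \<pi> :: int) * ysym n rw cl (f :: 'k mpoly)" by metis
  have "ysym n rw cl (ysym n rw cl f) =
      of_int (\<Sum>\<sigma>\<in>grp n rw. \<Sum>\<rho>\<in>grp n cl. sign \<rho> * s (\<sigma> \<circ> \<rho>)) * ysym n rw cl f" for f :: "'k mpoly"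
  proof -
    have *: "symm n rw (alt n cl g) = (\<Sum>\<sigma>\<in>grp n rw. \<Sum>\<rho>\<in>grp n cl. sg \<rho> * perm_act (\<sigma> \<circ> \<rho>) g)"
      for g :: "'k mpoly"
      by (simp add: symm_def alt_def perm_act_sum perm_act_mult perm_act_comp)
    have "ysym n rw cl (ysym n rw cl f) =
        alt n cl (\<Sum>\<sigma>\<in>grp n rw. \<Sum>\<rho>\<in>grp n cl. sg \<rho> * perm_act (\<sigma> \<circ> \<rho>) (symm n rw f))"
      by (simp only: ysym_def *)
    also have "\<dots> = (\<Sum>\<sigma>\<in>grp n rw. \<Sum>\<rho>\<in>grp n cl. sg \<rho> * (of_int (s (\<sigma> \<circ> \<rho>)) * ysym n rw cl f))"
      unfolding alt_sum'
    proof (intro sum.cong refl)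
      fix \<sigma> \<rho> assume "\<sigma> \<in> grp n rw" "\<rho> \<in> grp n cl"
      then have "\<sigma> \<circ> \<rho> permutes {1..n}" by (intro permutes_compose grp_permutes)
      then show "alt n cl (sg \<rho> * perm_act (\<sigma> \<circ> \<rho>) (symm n rw f)) =
          sg \<rho> * (of_int (s (\<sigma> \<circ> \<rho>)) * ysym n rw cl f)"
        using s by (simp add: alt_sym_mult)
    qed
    finally show ?thesis by (simp add: sum_distrib_right mult.assoc)
  qed
  then show ?thesis by blast
qed

text \<open>The coefficient of the identity in c r is 1, since a label keeping both its row and its
  column is fixed and so the identity factors in only one way. Independence of the permutation
  operators then excludes that c r vanishes on S.\<close>

lemma ysym_nonzero: "\<exists>h\<in>polys n. ysym n rw cl h \<noteq> (0 :: 'k mpoly)"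
proof (rule ccontr)
  assume "\<not> ?thesis"
  then have zero: "ysym n rw cl h = 0" if "h \<in> polys n" for h :: "'k mpoly" using that by blast
  \<comment> \<open>The coefficient of \<tau> in the group algebra element c r, regarded as a
    constant polynomial.\<close>
  define a :: "(nat \<Rightarrow> nat) \<Rightarrow> 'k mpoly" where
    "a \<tau> = (\<Sum>(\<rho>, \<sigma>)\<in>{p\<in>grp n cl \<times> grp n rw. fst p \<circ> snd p = \<tau>}. sg \<rho>)" for \<tau>
  have "a id = 0"
  proof (rule perm_act_independent[of "perms n" n a])
    fix h :: "'k mpoly" assume h: "h \<in> polys n"
    have "0 = ysym n rw cl h" using zero[OF h] by simp
    also have "\<dots> = (\<Sum>(\<rho>, \<sigma>)\<in>grp n cl \<times> grp n rw. sg \<rho> * perm_act (\<rho> \<circ> \<sigma>) h)"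
      by (simp add: ysym_def alt_def symm_def perm_act_sum perm_act_comp sum_distrib_left sum.cartesian_product)
    also have "\<dots> = (\<Sum>\<tau>\<in>perms n. \<Sum>p\<in>{p\<in>grp n cl \<times> grp n rw. fst p \<circ> snd p = \<tau>}.
        sg (fst p) * perm_act (fst p \<circ> snd p) h)"
      unfolding case_prod_unfold
      by (rule sum.group[symmetric]) (auto intro: permutes_compose dest!: grp_permutes)
    also have "\<dots> = (\<Sum>\<tau>\<in>perms n. a \<tau> * perm_act \<tau> h)"
      unfolding a_def sum_distrib_right case_prod_unfold
      by (intro sum.cong refl) auto
    finally show "(\<Sum>\<tau>\<in>perms n. a \<tau> * perm_act \<tau> h) = 0" by simp
  qed (auto simp: permutes_id)
  moreover have "{p\<in>grp n cl \<times> grp n rw. fst p \<circ> snd p = id} = {(id, id)}"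
  proof (intro equalityI subsetI)
    fix p assume "p \<in> {p\<in>grp n cl \<times> grp n rw. fst p \<circ> snd p = id}"
    then obtain \<rho> \<sigma> where p: "p = (\<rho>, \<sigma>)" "\<rho> \<in> grp n cl" "\<sigma> \<in> grp n rw" "\<rho> \<circ> \<sigma> = id"
      by (cases p) auto
    have pt: "\<rho> (\<sigma> x) = x" for x using fun_cong[OF p(4), of x] by simp
    have "\<sigma> x = x" for x
    proof (cases "x \<in> {1..n}")
      case True
      have s: "\<sigma> x \<in> {1..n}" using permutes_in_image[OF grp_permutes[OF p(3)]] True by blast
      have "rw (\<sigma> x) = rw x" using p(3) True by (simp add: grp_def)
      moreover have "cl (\<sigma> x) = cl (\<rho> (\<sigma> x))" using p(2) s by (simp add: grp_def)
      ultimately show ?thesis using cell_eq[OF s True] pt by simp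
    next
      case False
      then show ?thesis using grp_permutes[OF p(3)] by (simp add: permutes_not_in)
    qed
    then have "\<sigma> = id" by auto
    then show "p \<in> {(id, id)}" using p by simp
  qed auto
  ultimately show False by (simp add: a_def)
qed

text \<open>Maschke averaging of a linear projection onto the span of the orbit of \<open>ysym n rw cl w\<close> shows
  that the square of the symmetrizer does not vanish.\<close>

lemma ysym_square_nonzero: "\<exists>f :: 'k mpoly. ysym n rw cl (ysym n rw cl f) \<noteq> 0"
proof (rule ccontr)
  let ?e = "ysym n rw cl :: 'k mpoly \<Rightarrow> 'k mpoly"
  assume "\<not> ?thesis"
  then have sq: "?e (?e f) = 0" for f by blast
  \<comment> \<open>Since r \<pi> c is a multiple of r c, the product e \<pi> e is a multiple of the
    square of e, hence zero. So e annihilates the whole span V of the orbit.\<close>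
  have epe: "?e (perm_act \<pi> (?e f)) = 0" if \<pi>: "\<pi> permutes {1..n}" for \<pi> f
  proof -
    obtain s :: int where "\<And>f :: 'k mpoly. symm n rw (perm_act \<pi> (alt n cl f)) = of_int s * ysig n rw cl f"
      using symm_perm_act_alt[OF \<pi>] by blast
    then have "?e (perm_act \<pi> (?e f)) = of_int s * ?e (?e f)"
      by (simp add: ysym_def ysig_def alt_sym_mult)
    then show ?thesis using sq by simp
  qed
  obtain w where w: "?e w \<noteq> 0" using ysym_nonzero by blast
  let ?sc = "\<lambda>c (f :: 'k mpoly). Const c * f"
  interpret mp: Vector_Spaces.vector_space ?sc by (rule sum_perm_act_vector_space)
  interpret mpp: vector_space_pair ?sc ?sc by unfold_locales
  define V where "V = mp.span {perm_act \<pi> (?e w) | \<pi>. \<pi> permutes {1..n}}"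
  have "Vector_Spaces.linear ?sc ?sc (\<lambda>x. x)"
    by unfold_locales simp_all
  \<comment> \<open>P is a linear projection onto V with no relation to the group action; averaging
    it below yields the equivariant map q.\<close>
  then obtain P where P: "P ` UNIV \<subseteq> V" "Vector_Spaces.linear ?sc ?sc P" "\<And>v. v \<in> V \<Longrightarrow> P v = v"
    using mpp.linear_exists_left_inverse_on[of "\<lambda>x. x" V] mp.subspace_span unfolding V_def by auto
  have eV: "?e (perm_act \<pi> v) = 0" if v: "v \<in> V" and \<pi>: "\<pi> permutes {1..n}" for v \<pi>
    using v unfolding V_def
  proof (induction rule: mp.span_induct_alt)
    case base
    show ?case by simp
  next
    case (step c x y)
    then obtain \<pi>' where \<pi>': "x = perm_act \<pi>' (?e w)" "\<pi>' permutes {1..n}" by blast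
    have "?e (perm_act \<pi> x) = 0"
      using epe[OF permutes_compose[OF \<pi>'(2) \<pi>]] by (simp add: \<pi>'(1) perm_act_comp)
    then show ?case using step by (simp add: perm_act_add perm_act_mult ysym_add ysym_sym_mult)
  qed
  \<comment> \<open>The average of P without the factor 1/n!. It commutes with permutations and has
    values in V, so it sends w to something killed by e, yet it multiplies \<open>?e w\<close> by
    n!.\<close>
  define q where "q f = (\<Sum>\<pi>\<in>perms n. perm_act (Hilbert_Choice.inv \<pi>) (P (perm_act \<pi> f)))" for f
  have eq0: "?e (q f) = 0" for f
    unfolding q_def ysym_sum using P(1) by (intro sum.neutral) (auto intro!: eV permutes_inv)
  have q_add: "q (f + g) = q f + q g" for f g
    by (simp add: q_def perm_act_add mpp.linear_add[OF P(2)] sum.distrib) 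
  have q_scale: "q (Const c * f) = Const c * q f" for c f
    by (simp add: q_def perm_act_mult mpp.linear_scale[OF P(2)] sum_distrib_left)
  have q_sum: "q (sum h A) = (\<Sum>x\<in>A. q (h x))" for h and A :: "(nat \<Rightarrow> nat) set"
    using q_scale[of 0 0] by (induction A rule: infinite_finite_induct) (simp_all add: q_add)
  have q_perm: "q (perm_act \<rho> f) = perm_act \<rho> (q f)" if \<rho>: "\<rho> permutes {1..n}" for \<rho> f
  proof -
    have "q f = (\<Sum>\<pi>\<in>perms n. perm_act (Hilbert_Choice.inv (\<pi> \<circ> \<rho>)) (P (perm_act (\<pi> \<circ> \<rho>) f)))"
      unfolding q_def by (rule sum_permutations_compose_right[OF \<rho>])
    also have "\<dots> = (\<Sum>\<pi>\<in>perms n. perm_act (Hilbert_Choice.inv \<rho> \<circ> Hilbert_Choice.inv \<pi>) (P (perm_act (\<pi> \<circ> \<rho>) f)))"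
      using \<rho> by (intro sum.cong refl) (simp add: o_inv_distrib permutes_bij)
    finally have "perm_act \<rho> (q f) =
        (\<Sum>\<pi>\<in>perms n. perm_act (\<rho> \<circ> (Hilbert_Choice.inv \<rho> \<circ> Hilbert_Choice.inv \<pi>)) (P (perm_act (\<pi> \<circ> \<rho>) f)))"
      by (simp add: perm_act_sum perm_act_comp)
    then show ?thesis
      by (simp add: comp_assoc[symmetric] permutes_inv_o[OF \<rho>] q_def perm_act_comp)
  qed
  have q_sg: "q (sg \<pi> * f) = sg \<pi> * q f" for \<pi> f
    using q_scale[of "of_int (sign \<pi>)"] by (simp only: Const_of_int)
  have "?e (q w) = q (?e w)"
    by (simp add: ysym_def alt_def symm_def q_sum q_sg q_perm grp_permutes[THEN q_perm])
  moreover have "q (?e w) = of_nat (fact n) * ?e w"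
  proof -
    have "perm_act (Hilbert_Choice.inv \<pi>) (P (perm_act \<pi> (?e w))) = ?e w" if \<pi>: "\<pi> permutes {1..n}" for \<pi>
    proof -
      have "perm_act \<pi> (?e w) \<in> V" unfolding V_def by (rule mp.span_base) (use \<pi> in blast)
      then show ?thesis by (simp add: P(3) perm_act_comp permutes_inv_o[OF \<pi>])
    qed
    then have "q (?e w) = (\<Sum>\<pi>\<in>perms n. ?e w)" unfolding q_def by (intro sum.cong) auto
    then show ?thesis by (simp add: card_permutations)
  qed
  ultimately have "of_nat (fact n) * ?e w = 0" using eq0 by simp
  then show False using w of_nat_mpoly_ne_0[of "fact n"] by simp
qed

lemma ysym_quasi_idempotent:
  obtains \<kappa> :: 'k where "\<kappa> \<noteq> 0" "\<And>f. ysym n rw cl (ysym n rw cl f) = Const \<kappa> * ysym n rw cl f"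
proof -
  obtain s :: int where s: "\<And>f :: 'k mpoly. ysym n rw cl (ysym n rw cl f) = of_int s * ysym n rw cl f"
    using ysym_ysym_int by blast
  have "of_int s \<noteq> (0 :: 'k mpoly)" using ysym_square_nonzero s by (metis mult_zero_left)
  then show thesis using that[of "of_int s"] s by (simp add: Const_of_int flip: Const_eq_0_iff)
qed

text \<open>Multiplication by the Vandermonde polynomial intertwines r c with the c r of the
  transposed tableau, so the scalar carries over after cancellation.\<close>

lemma ysig_quasi_idempotent:
  obtains \<kappa> :: 'k where "\<kappa> \<noteq> 0" "\<And>f. ysig n rw cl (ysig n rw cl f) = Const \<kappa> * ysig n rw cl f"
proof -
  interpret tr: tab n "TYPE('k)" cl rw by (rule tab_transposed)
  obtain \<kappa> :: 'k where k: "\<kappa> \<noteq> 0" "\<And>f. ysym n cl rw (ysym n cl rw f) = Const \<kappa> * ysym n cl rw f"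
    using tr.ysym_quasi_idempotent by blast
  have "ysig n rw cl (ysig n rw cl f) = Const \<kappa> * ysig n rw cl f" for f
  proof -
    have "vandermonde n * ysig n rw cl (ysig n rw cl f) = vandermonde n * (Const \<kappa> * ysig n rw cl f)"
      by (simp add: vandermonde_mult_ysig k(2) mult.left_commute[of _ "Const \<kappa>"])
    then show ?thesis by simp
  qed
  then show thesis using that k(1) by blast
qed

end


subsection \<open>Index fillings and the pairing of higher Specht polynomials\<close>

text \<open>If \<open>k\<close> assigns to each letter of a standard tableau its column, then \<open>desc k q\<close> is the index
  of the letter \<open>q\<close>.\<close>

fun desc :: "(nat \<Rightarrow> nat) \<Rightarrow> nat \<Rightarrow> nat" where
  "desc k 0 = 0"
| "desc k (Suc 0) = 0"
| "desc k (Suc (Suc j)) = desc k (Suc j) + (if k (Suc j) < k (Suc (Suc j)) then 0 else 1)"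

lemma desc_Suc: "0 < j \<Longrightarrow> desc k (Suc j) = desc k j + (if k j < k (Suc j) then 0 else 1)"
  by (cases j) auto

lemma desc_mono: "i \<le> j \<Longrightarrow> desc k i \<le> desc k j"
proof (induction j)
  case (Suc j)
  have "desc k j \<le> desc k (Suc j)" by (cases j) auto
  then show ?case using Suc by (cases "i = Suc j") auto
qed simp

lemma desc_eq_imp_increasing:
  assumes "desc k q = desc k t" "0 < q" "q \<le> j" "j < t"
  shows "k j < k (Suc j)"
proof -
  have "desc k q \<le> desc k j" "desc k j \<le> desc k (Suc j)" "desc k (Suc j) \<le> desc k t"
    using assms(2-4) by (simp_all add: desc_mono del: desc.simps)
  then have "desc k (Suc j) = desc k j" using assms(1) by simp
  then show ?thesis using desc_Suc[of j k] assms by (auto split: if_splits)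
qed

lemma decreasing_chain:
  fixes h :: "nat \<Rightarrow> nat"
  assumes "\<And>j. q \<le> j \<Longrightarrow> j < t \<Longrightarrow> h (Suc j) \<le> h j" "q \<le> t"
  shows "h t \<le> h q"
  using assms(2,1)
proof (induction rule: dec_induct)
  case (step m)
  then have "h (Suc m) \<le> h m" by simp
  also have "h m \<le> h q" using step by simp
  finally show ?case .
qed simp

text \<open>For a monotone f the last positions already carry the largest values: elements brought
  in by s from below k are worth at most \<open>f k\<close>, those driven out at least
  \<open>f k\<close>.\<close>

lemma top_sum_perm_le:
  fixes f :: "nat \<Rightarrow> nat"
  assumes s: "s permutes {1..n}" and mono: "\<And>i j. 1 \<le> i \<Longrightarrow> i \<le> j \<Longrightarrow> j \<le> n \<Longrightarrow> f i \<le> f j"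
    and k: "1 \<le> k" "k \<le> n"
  shows "(\<Sum>q\<in>{k..n}. f (s q)) \<le> (\<Sum>q\<in>{k..n}. f q)"
proof -
  define K where "K = {k..n}"
  define S where "S = s ` K"
  have fin: "finite K" "finite S" by (simp_all add: K_def S_def)
  have inj: "inj_on s K" using permutes_inj[OF s] by (rule inj_on_subset) simp
  have SI: "S \<subseteq> {1..n}" using permutes_in_image[OF s] k unfolding S_def K_def by fastforce
  have cSK: "card (S - K) = card (K - S)"
    using card_Int_Diff[of S K] card_Int_Diff[of K S] fin card_image[OF inj] by (simp add: Int_commute S_def)
  have "sum f (S - K) \<le> card (S - K) * f k"
  proof -
    have "sum f (S - K) \<le> of_nat (card (S - K)) * f k"
    proof (rule sum_bounded_above)
      fix i assume "i \<in> S - K"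
      then show "f i \<le> f k" using SI k by (intro mono) (auto simp: K_def)
    qed
    then show ?thesis by simp
  qed
  also have "\<dots> = card (K - S) * f k" by (simp only: cSK)
  also have "\<dots> \<le> sum f (K - S)"
  proof -
    have "of_nat (card (K - S)) * f k \<le> sum f (K - S)"
    proof (rule sum_bounded_below)
      fix i assume "i \<in> K - S"
      then show "f k \<le> f i" using k by (intro mono) (auto simp: K_def)
    qed
    then show ?thesis by simp
  qed
  finally have "sum f S \<le> sum f K"
    using sum.Int_Diff[of S f K] sum.Int_Diff[of K f S] fin by (simp add: Int_commute)
  also have "sum f S = (\<Sum>q\<in>K. f (s q))" unfolding S_def by (simp add: sum.reindex[OF inj])
  finally show ?thesis by (simp add: K_def)
qed

text \<open>The permutation s matches the letters satisfying L with those satisfying M. Removing the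
  letters above t, where the two properties agree, leaves equally many up to t, so one set is empty
  exactly when the other is.\<close>

lemma count_transfer:
  fixes n t :: nat
  assumes s: "s permutes {1..n}" and LM: "\<And>q. q \<in> {1..n} \<Longrightarrow> L q \<longleftrightarrow> M (s q)"
    and above: "\<And>q. q \<in> {t<..n} \<Longrightarrow> L q \<longleftrightarrow> M q" and t: "t \<le> n"
  shows "(\<exists>q\<in>{1..t}. L q) \<longleftrightarrow> (\<exists>q\<in>{1..t}. M q)"
proof -
  have "s ` {q\<in>{1..n}. L q} = {q\<in>{1..n}. M q}"
  proof (intro equalityI subsetI)
    fix q assume "q \<in> s ` {q\<in>{1..n}. L q}"
    then obtain p where "p \<in> {1..n}" "L p" "q = s p" by auto
    then show "q \<in> {q\<in>{1..n}. M q}" using LM[of p] permutes_in_image[OF s, of p] by simp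
  next
    fix q assume q: "q \<in> {q\<in>{1..n}. M q}"
    define p where "p = Hilbert_Choice.inv s q"
    have p: "s p = q" "p \<in> {1..n}"
      using q permutes_inverses[OF s] permutes_in_image[OF permutes_inv[OF s], of q] by (simp_all add: p_def)
    then have "L p" using LM[of p] q by simp
    then show "q \<in> s ` {q\<in>{1..n}. L q}" using p by blast
  qed
  then have card_eq: "card {q\<in>{1..n}. L q} = card {q\<in>{1..n}. M q}"
    using card_image[OF inj_on_subset[OF permutes_inj[OF s] subset_UNIV], of "{q\<in>{1..n}. L q}"] by simp
  have split: "card {q\<in>{1..n}. N q} = card {q\<in>{1..t}. N q} + card {q\<in>{t<..n}. N q}" for N
  proof -
    have "{q\<in>{1..n}. N q} = {q\<in>{1..t}. N q} \<union> {q\<in>{t<..n}. N q}" using t by auto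
    then show ?thesis by (simp add: card_Un_disjoint disjoint_iff)
  qed
  have "{q\<in>{t<..n}. L q} = {q\<in>{t<..n}. M q}" using above by blast
  then have "card {q\<in>{1..t}. L q} = card {q\<in>{1..t}. M q}"
    using split[of L] split[of M] card_eq by simp
  then have "{q\<in>{1..t}. L q} = {} \<longleftrightarrow> {q\<in>{1..t}. M q} = {}"
    using card_0_eq[of "{q\<in>{1..t}. L q}"] card_0_eq[of "{q\<in>{1..t}. M q}"] by simp
  then show ?thesis by blast
qed

abbreviation letter_desc :: "(nat \<Rightarrow> nat) \<Rightarrow> (nat \<Rightarrow> nat) \<Rightarrow> nat \<Rightarrow> nat" where
  "letter_desc c \<pi> \<equiv> desc (\<lambda>q. c (Hilbert_Choice.inv \<pi> q))"

text \<open>The monomial of the tableau encoded by \<pi>: the variable with label x receives the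
  index of the letter \<open>\<pi> x\<close> in the same cell. With row numbers in place of c it is
  the monomial of the transposed pair.\<close>

definition spec_mon :: "nat \<Rightarrow> (nat \<Rightarrow> nat) \<Rightarrow> (nat \<Rightarrow> nat) \<Rightarrow> 'k::field mpoly" where
  "spec_mon n c \<pi> = mon n (\<lambda>x. letter_desc c \<pi> (\<pi> x))"

lemma std_perms_permutes: "\<pi> \<in> std_perms n rw cl \<Longrightarrow> \<pi> permutes {1..n}"
  by (simp add: std_perms_def)

lemma std_perms_transposed: "std_perms n cl rw = std_perms n rw cl"
proof -
  have *: "(\<forall>x\<in>S. \<forall>y\<in>S. A x y \<and> B x y) \<longleftrightarrow> (\<forall>x\<in>S. \<forall>y\<in>S. B x y \<and> A x y)" for S :: "nat set" and A B
    by blast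
  show ?thesis unfolding std_perms_def by (subst *) (rule refl)
qed

lemma perm_inv_in: "\<pi> permutes {1..n} \<Longrightarrow> q \<in> {1..n} \<Longrightarrow> Hilbert_Choice.inv \<pi> q \<in> {1..n}"
  by (simp only: permutes_in_image[OF permutes_inv])

text \<open>The counterpart of \<open>tab_less\<close> for encoded tableaux. Indices weakly increase
  with the letter, so the sorted index sequence is compared letter by letter.\<close>

definition perm_less :: "nat \<Rightarrow> (nat \<Rightarrow> nat) \<Rightarrow> (nat \<Rightarrow> nat) \<Rightarrow> (nat \<Rightarrow> nat) \<Rightarrow> (nat \<Rightarrow> nat) \<Rightarrow> bool" where
  "perm_less n rw cl P Q \<longleftrightarrow>
     (\<Sum>q\<in>{1..n}. letter_desc cl P q) < (\<Sum>q\<in>{1..n}. letter_desc cl Q q) \<or>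
     (\<Sum>q\<in>{1..n}. letter_desc cl P q) = (\<Sum>q\<in>{1..n}. letter_desc cl Q q) \<and>
     ((\<exists>p\<in>{1..n}. letter_desc cl P p < letter_desc cl Q p \<and>
         (\<forall>q\<in>{p<..n}. letter_desc cl P q = letter_desc cl Q q)) \<or>
      (\<forall>q\<in>{1..n}. letter_desc cl P q = letter_desc cl Q q) \<and>
      (\<exists>t\<in>{1..n}. rw (Hilbert_Choice.inv Q t) < rw (Hilbert_Choice.inv P t) \<and>
         (\<forall>q\<in>{t<..n}. Hilbert_Choice.inv P q = Hilbert_Choice.inv Q q)))"

context tab
begin

lemma std_mono:
  assumes \<pi>: "\<pi> \<in> std_perms n rw cl" and ab: "a \<in> {1..n}" "b \<in> {1..n}" "rw a \<le> rw b" "cl a \<le> cl b" "a \<noteq> b"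
  shows "\<pi> a < \<pi> b"
proof -
  have row: "\<pi> x < \<pi> y" if "x \<in> {1..n}" "y \<in> {1..n}" "rw x = rw y" "cl x < cl y" for x y
    using \<pi> that unfolding std_perms_def by blast
  have col: "\<pi> x < \<pi> y" if "x \<in> {1..n}" "y \<in> {1..n}" "cl x = cl y" "rw x < rw y" for x y
    using \<pi> that unfolding std_perms_def by blast
  obtain y where y: "y \<in> {1..n}" "rw y = rw a" "cl y = cl b"
    using cell_down[OF ab(2), of "rw a" "cl b"] ab by auto
  have 1: "a = y \<or> \<pi> a < \<pi> y"
  proof (cases "cl a = cl b")
    case True
    then show ?thesis using cell_eq[OF ab(1) y(1)] y by simp
  next
    case False
    then show ?thesis using row[OF ab(1) y(1)] ab(4) y by simp
  qed
  have 2: "y = b \<or> \<pi> y < \<pi> b"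
  proof (cases "rw a = rw b")
    case True
    then show ?thesis using cell_eq[OF y(1) ab(2)] y by simp
  next
    case False
    then show ?thesis using col[OF y(1) ab(2)] ab(3) y by simp
  qed
  show ?thesis using 1 2 ab(5) by auto
qed

text \<open>If the next letter were both strictly right and strictly below, the cell in the row of j
  and the column of j+1 would need a letter strictly between them; if it were neither, it would
  precede j.\<close>

lemma std_step:
  assumes \<pi>: "\<pi> \<in> std_perms n rw cl" and j: "1 \<le> j" "j < n"
  shows "cl (Hilbert_Choice.inv \<pi> j) < cl (Hilbert_Choice.inv \<pi> (Suc j)) \<longleftrightarrow>
    \<not> rw (Hilbert_Choice.inv \<pi> j) < rw (Hilbert_Choice.inv \<pi> (Suc j))"
proof -
  let ?a = "Hilbert_Choice.inv \<pi> j" and ?b = "Hilbert_Choice.inv \<pi> (Suc j)"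
  have p: "\<pi> permutes {1..n}" using \<pi> by (rule std_perms_permutes)
  have ab: "?a \<in> {1..n}" "?b \<in> {1..n}" "\<pi> ?a = j" "\<pi> ?b = Suc j"
    using perm_inv_in[OF p] j permutes_inverses[OF p] by auto
  have "False" if lt: "cl ?a < cl ?b" "rw ?a < rw ?b"
  proof -
    obtain y where y: "y \<in> {1..n}" "rw y = rw ?a" "cl y = cl ?b"
      using cell_down[OF ab(2) less_imp_le[OF lt(2)], of "cl ?b"] by auto
    have "\<pi> ?a < \<pi> y" using y lt ab by (intro std_mono[OF \<pi>]) auto
    moreover have "\<pi> y < \<pi> ?b" using y lt ab by (intro std_mono[OF \<pi>]) auto
    ultimately show False using ab by simp
  qed
  moreover have "cl ?a < cl ?b \<or> rw ?a < rw ?b"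
  proof (rule ccontr)
    assume "\<not> (cl ?a < cl ?b \<or> rw ?a < rw ?b)"
    moreover have "?b \<noteq> ?a" using ab by auto
    ultimately have "\<pi> ?b < \<pi> ?a" using ab by (intro std_mono[OF \<pi>]) auto
    then show False using ab by simp
  qed
  ultimately show ?thesis by blast
qed

text \<open>By the alternative for consecutive letters, each step raises exactly one of the two
  indices, that of P or that of its transpose.\<close>

lemma desc_complement:
  assumes \<pi>: "\<pi> \<in> std_perms n rw cl" and q: "1 \<le> q" "q \<le> n"
  shows "letter_desc cl \<pi> q + letter_desc rw \<pi> q = q - 1"
  using q
proof (induction q)
  case (Suc q)
  show ?case
  proof (cases "q = 0")
    case False
    then have "letter_desc cl \<pi> q + letter_desc rw \<pi> q = q - 1" using Suc by simp
    moreover have "q \<ge> 1" using False by simp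
    ultimately show ?thesis
      using Suc.prems std_step[OF \<pi>, of q] desc_Suc[of q "\<lambda>q. cl (Hilbert_Choice.inv \<pi> q)"]
        desc_Suc[of q "\<lambda>q. rw (Hilbert_Choice.inv \<pi> q)"] by (auto split: if_splits)
  qed (simp add: One_nat_def)
qed simp

text \<open>E collects the exponents of one monomial in the pairing of P with Q after row and column
  permutations, and its injectivity means that this monomial survives antisymmetrization. The three
  conclusions answer the three clauses of the order: total index, reverse lexicographic comparison,
  last letter. The third also shows, for \<open>P = Q\<close>, that the survivors come exactly from
  permutations preserving the fillings.\<close>

lemma index_filling_rigidity:
  assumes P: "P \<in> std_perms n rw cl" and Q: "Q \<in> std_perms n rw cl"
    and \<sigma>: "\<sigma> \<in> grp n rw" and \<rho>: "\<rho> \<in> grp n cl"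
  defines "E \<equiv> \<lambda>x. letter_desc cl P (P (Hilbert_Choice.inv \<sigma> x)) + letter_desc rw Q (Q (Hilbert_Choice.inv \<rho> x))"
  assumes inj: "inj_on E {1..n}"
  shows "(\<Sum>q\<in>{1..n}. letter_desc cl Q q) \<le> (\<Sum>q\<in>{1..n}. letter_desc cl P q)"
    and "\<lbrakk>(\<Sum>q\<in>{1..n}. letter_desc cl P q) = (\<Sum>q\<in>{1..n}. letter_desc cl Q q); k \<in> {1..n}\<rbrakk> \<Longrightarrow>
      (\<Sum>q\<in>{k..n}. letter_desc cl Q q) \<le> (\<Sum>q\<in>{k..n}. letter_desc cl P q)"
    and "\<lbrakk>\<And>q. q \<in> {1..n} \<Longrightarrow> letter_desc cl P q = letter_desc cl Q q;
      \<And>t. \<lbrakk>t \<in> {1..n}; \<And>q. q \<in> {t<..n} \<Longrightarrow> Hilbert_Choice.inv P q = Hilbert_Choice.inv Q q\<rbrakk>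
        \<Longrightarrow> rw (Hilbert_Choice.inv Q t) \<le> rw (Hilbert_Choice.inv P t)\<rbrakk>
      \<Longrightarrow> P = Q \<and> (\<forall>x\<in>{1..n}. letter_desc cl P (P (Hilbert_Choice.inv \<sigma> x)) = letter_desc cl P (P x) \<and>
        letter_desc rw Q (Q (Hilbert_Choice.inv \<rho> x)) = letter_desc rw Q (Q x))"
proof -
  let ?I = "{1..n}"
  \<comment> \<open>The indices of P, of Q and of the transpose of Q; the last two add up to q-1 at
    the letter q.\<close>
  define a where "a = letter_desc cl P"
  define aQ where "aQ = letter_desc cl Q"
  define b where "b = letter_desc rw Q"
  have pP: "P permutes ?I" and pQ: "Q permutes ?I" and p\<sigma>: "\<sigma> permutes ?I" and p\<rho>: "\<rho> permutes ?I"
    using P Q \<sigma> \<rho> by (auto dest: std_perms_permutes grp_permutes)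
  have comp: "aQ q + b q = q - 1" if "q \<in> ?I" for q
    using desc_complement[OF Q] that by (simp add: aQ_def b_def)
  have E: "E x = a (P (Hilbert_Choice.inv \<sigma> x)) + b (Q (Hilbert_Choice.inv \<rho> x))" for x
    by (simp add: E_def a_def b_def)
  have pA: "P \<circ> Hilbert_Choice.inv \<sigma> permutes ?I" "Q \<circ> Hilbert_Choice.inv \<rho> permutes ?I"
    using pP pQ p\<sigma> p\<rho> by (auto intro: permutes_compose permutes_inv)
  have sumE: "sum E ?I = sum a ?I + sum b ?I"
    using sum.permute[OF pA(1), of a] sum.permute[OF pA(2), of b] by (simp add: E sum.distrib o_def)
  have tri: "(\<Sum>q\<in>?I. q - 1) = \<Sum>{..<n}"
    by (rule sum.reindex_bij_witness[of _ Suc "\<lambda>i. i - 1"]) auto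
  have sumQ: "sum aQ ?I + sum b ?I = \<Sum>{..<n}"
    using comp by (simp add: tri[symmetric] sum.distrib[symmetric] del: sum.distrib)
  \<comment> \<open>Distinct exponents sum to at least 0 + ... + (n-1), with equality only if they
    are exactly these numbers.\<close>
  have alt: "E ` ?I = {..<n} \<or> \<Sum>{..<n} < sum E ?I"
    using down_closed_sum_less[of "E ` ?I" "{..<n}"] inj by (auto simp: card_image sum.reindex)
  then have "\<Sum>{..<n} \<le> sum E ?I" using sum.reindex[OF inj, of "\<lambda>x. x"] by auto
  then show 1: "(\<Sum>q\<in>?I. letter_desc cl Q q) \<le> (\<Sum>q\<in>?I. letter_desc cl P q)"
    using sumE sumQ unfolding a_def[symmetric] aQ_def[symmetric] by simp
  \<comment> \<open>When the totals agree, the exponents are 0, ..., n-1; the shift by one makes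
    \<theta> a permutation of the labels. Then \<open>X q\<close> is the label with exponent q-1,
    and s and u give the letters of P and Q that contribute its two summands.\<close>
  define \<theta> where "\<theta> x = (if x \<in> ?I then Suc (E x) else x)" for x
  define X where "X = Hilbert_Choice.inv \<theta>"
  define s where "s = P \<circ> Hilbert_Choice.inv \<sigma> \<circ> X"
  define u where "u = Q \<circ> Hilbert_Choice.inv \<rho> \<circ> X"
  have main: "\<theta> permutes ?I \<and> s permutes ?I \<and> u permutes ?I \<and> (\<forall>q\<in>?I. a (s q) + b (u q) = q - 1)"
    if eq: "sum a ?I = sum aQ ?I"
  proof -
    have img: "E ` ?I = {..<n}" using alt sumE sumQ eq by simp
    have "bij_betw \<theta> ?I ?I"
      unfolding bij_betw_def
    proof
      show "inj_on \<theta> ?I"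
      proof (rule inj_onI)
        fix x y assume xy: "x \<in> ?I" "y \<in> ?I" "\<theta> x = \<theta> y"
        then have "E x = E y" by (simp add: \<theta>_def)
        then show "x = y" using inj_onD[OF inj] xy by blast
      qed
      have "\<theta> ` ?I = Suc ` (E ` ?I)" unfolding image_image by (intro image_cong) (simp_all add: \<theta>_def)
      also have "\<dots> = ?I"
        unfolding img by (simp add: image_Suc_lessThan)
      finally show "\<theta> ` ?I = ?I" .
    qed
    then have \<theta>: "\<theta> permutes ?I" by (rule bij_imp_permutes) (auto simp: \<theta>_def)
    have "a (s q) + b (u q) = q - 1" if q: "q \<in> ?I" for q
    proof -
      have "X q \<in> ?I" unfolding X_def using \<theta> q by (rule perm_inv_in)
      moreover have "\<theta> (X q) = q" by (simp add: X_def permutes_inverses[OF \<theta>])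
      ultimately have "Suc (E (X q)) = q" by (simp add: \<theta>_def)
      then show ?thesis by (simp add: E s_def u_def)
    qed
    moreover have "s permutes ?I" "u permutes ?I"
      using pA permutes_inv[OF \<theta>] by (auto simp: s_def u_def X_def intro: permutes_compose)
    ultimately show ?thesis using \<theta> by blast
  qed
  have top: "(\<Sum>q\<in>{k..n}. a (s q)) \<le> (\<Sum>q\<in>{k..n}. a q)" "(\<Sum>q\<in>{k..n}. b (u q)) \<le> (\<Sum>q\<in>{k..n}. b q)"
    if "s permutes ?I" "u permutes ?I" "k \<in> ?I" for k
    using that by (auto intro!: top_sum_perm_le simp: a_def b_def desc_mono)
  have tot: "(\<Sum>q\<in>{k..n}. aQ q) + (\<Sum>q\<in>{k..n}. b q) = (\<Sum>q\<in>{k..n}. q - 1)" if "k \<in> ?I" for k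
    unfolding sum.distrib[symmetric] using comp that by (intro sum.cong) auto
  show 2: "(\<Sum>q\<in>{k..n}. letter_desc cl Q q) \<le> (\<Sum>q\<in>{k..n}. letter_desc cl P q)"
    if eq: "(\<Sum>q\<in>?I. letter_desc cl P q) = (\<Sum>q\<in>?I. letter_desc cl Q q)" and k: "k \<in> ?I"
  proof -
    have m: "s permutes ?I" "u permutes ?I" "\<And>q. q \<in> ?I \<Longrightarrow> a (s q) + b (u q) = q - 1"
      using main eq unfolding a_def aQ_def by blast+
    have "(\<Sum>q\<in>{k..n}. a (s q)) + (\<Sum>q\<in>{k..n}. b (u q)) = (\<Sum>q\<in>{k..n}. q - 1)"
      unfolding sum.distrib[symmetric] using m(3) k by (intro sum.cong) auto
    then have "(\<Sum>q\<in>{k..n}. aQ q) \<le> (\<Sum>q\<in>{k..n}. a q)"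
      using top[OF m(1,2) k] tot[OF k] by linarith
    then show ?thesis by (simp add: a_def aQ_def)
  qed
  assume same: "\<And>q. q \<in> ?I \<Longrightarrow> letter_desc cl P q = letter_desc cl Q q"
    and row_le: "\<And>t. \<lbrakk>t \<in> ?I; \<And>q. q \<in> {t<..n} \<Longrightarrow> Hilbert_Choice.inv P q = Hilbert_Choice.inv Q q\<rbrakk>
        \<Longrightarrow> rw (Hilbert_Choice.inv Q t) \<le> rw (Hilbert_Choice.inv P t)"
  have aaQ: "a q = aQ q" if "q \<in> ?I" for q using same that by (simp add: a_def aQ_def)
  have m: "\<theta> permutes ?I" "s permutes ?I" "u permutes ?I" "\<And>q. q \<in> ?I \<Longrightarrow> a (s q) + b (u q) = q - 1"
    using main aaQ by (auto intro: sum.cong)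
  have ab: "a q + b q = q - 1" if "q \<in> ?I" for q using comp aaQ that by simp
  \<comment> \<open>Both tail sums are bounded by those of the unpermuted indices, while their sums
    agree; so both bounds are equalities.\<close>
  have tops: "(\<Sum>q\<in>{k..n}. a (s q)) = (\<Sum>q\<in>{k..n}. a q) \<and> (\<Sum>q\<in>{k..n}. b (u q)) = (\<Sum>q\<in>{k..n}. b q)"
    if "1 \<le> k" for k
  proof (cases "k \<le> n")
    case True
    then have k: "k \<in> ?I" using that by simp
    have "(\<Sum>q\<in>{k..n}. a (s q)) + (\<Sum>q\<in>{k..n}. b (u q)) = (\<Sum>q\<in>{k..n}. a q) + (\<Sum>q\<in>{k..n}. b q)"
      unfolding sum.distrib[symmetric] using m(4) ab that by (intro sum.cong) auto
    then show ?thesis using top[OF m(2,3) k] by linarith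
  qed simp
  have pt: "a (s q) = a q \<and> b (u q) = b q" if q: "q \<in> ?I" for q
  proof -
    have "(\<Sum>i\<in>{q..n}. h i) = h q + (\<Sum>i\<in>{Suc q..n}. h i)" for h :: "nat \<Rightarrow> nat"
      using q by (simp add: sum.atLeast_Suc_atMost)
    then show ?thesis using tops[of q] tops[of "Suc q"] q by simp
  qed
  have row_of_s: "rw (Hilbert_Choice.inv P (s q)) = rw (X q)" if "q \<in> ?I" for q
  proof -
    have "X q \<in> ?I" unfolding X_def using m(1) that by (rule perm_inv_in)
    then show ?thesis using grp_inv[OF \<sigma>] by (simp add: s_def permutes_inverses[OF pP] grp_def)
  qed
  have col_of_u: "cl (Hilbert_Choice.inv Q (u q)) = cl (X q)" if "q \<in> ?I" for q
  proof -
    have "X q \<in> ?I" unfolding X_def using m(1) that by (rule perm_inv_in)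
    then show ?thesis using grp_inv[OF \<rho>] by (simp add: u_def permutes_inverses[OF pQ] grp_def)
  qed
  \<comment> \<open>Downward step: \<open>X t\<close> is the label with exponent t-1, and it is
    shown to occupy the cell of the letter t in P and in Q, once this is known for all larger
    letters.\<close>
  have letter_step: "X t = Hilbert_Choice.inv P t \<and> Hilbert_Choice.inv Q t = Hilbert_Choice.inv P t"
    if t: "t \<in> ?I" and above: "\<And>q. q \<in> {t<..n} \<Longrightarrow> X q = Hilbert_Choice.inv P q \<and> Hilbert_Choice.inv Q q = Hilbert_Choice.inv P q"
    for t
  proof -
    define p where "p = Hilbert_Choice.inv P t"
    define w where "w = Hilbert_Choice.inv Q t"
    define x where "x = X t"
    have in_I: "p \<in> ?I" "w \<in> ?I" "x \<in> ?I"
      unfolding p_def w_def x_def X_def using pP pQ m(1) t by (auto intro!: perm_inv_in simp del: atLeastAtMost_iff)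
    have val: "P p = t" "Q w = t" "\<theta> x = t"
      by (simp_all add: p_def w_def x_def X_def permutes_inverses[OF pP] permutes_inverses[OF pQ] permutes_inverses[OF m(1)])
    \<comment> \<open>The cells of letters above t are the same for P, Q and X, so none of the three
      cells p, w, x is one of them. Hence t is maximal among the letters that P and Q place in these
      cells.\<close>
    have upper: "\<not> t < P y \<and> \<not> t < Q y" if y: "y \<in> {p, w, x}" for y
    proof -
      have yI: "y \<in> ?I" using y in_I by blast
      have ne: False if q: "q \<in> {t<..n}" and yq: "P y = q \<or> Q y = q" for q
      proof -
        have inv_eq: "Hilbert_Choice.inv Q q = Hilbert_Choice.inv P q" "X q = Hilbert_Choice.inv P q"
          using above[OF q] by simp_all
        have "y = Hilbert_Choice.inv P q"
          using yq inv_eq(1) permutes_inverses(2)[OF pP, of y] permutes_inverses(2)[OF pQ, of y] by metis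
        then have "P y = q" "Q y = q" "\<theta> y = q"
          using permutes_inverses(1)[OF pP, of q] permutes_inverses(1)[OF pQ, of q]
            permutes_inverses(1)[OF m(1), of q] inv_eq unfolding X_def by simp_all
        then show False using y val q by auto
      qed
      have "P y \<in> ?I" "Q y \<in> ?I"
        using permutes_in_image[OF pP, of y] permutes_in_image[OF pQ, of y] yI by (simp_all only:)
      then show ?thesis using ne[of "P y"] ne[of "Q y"] by simp blast
    qed
    have cornerP: "y = p" if "y \<in> {w, x}" "rw p \<le> rw y" "cl p \<le> cl y" for y
      using std_mono[OF P, of p y] upper[of y] in_I val that by auto
    have cornerQ: "y = w" if "y \<in> {p, x}" "rw w \<le> rw y" "cl w \<le> cl y" for y
      using std_mono[OF Q, of w y] upper[of y] in_I val that by auto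
    have rwp: "rw w \<le> rw p" unfolding p_def w_def using t above by (intro row_le) auto
    have t_le: "t \<le> n" using t by simp
    \<comment> \<open>The map s preserves the index and carries the row of \<open>X q\<close> to a
      row of P. So up to t, X and P meet the same rows among letters with the index of t.\<close>
    have row_transfer: "(\<exists>q\<in>{1..t}. a q = a t \<and> rw (X q) = r) \<longleftrightarrow>
        (\<exists>q\<in>{1..t}. a q = a t \<and> rw (Hilbert_Choice.inv P q) = r)" for r
      using m(2) _ _ t_le by (rule count_transfer) (use pt row_of_s above in auto)
    have col_transfer: "(\<exists>q\<in>{1..t}. b q = b t \<and> cl (X q) = c) \<longleftrightarrow>
        (\<exists>q\<in>{1..t}. b q = b t \<and> cl (Hilbert_Choice.inv Q q) = c)" for c
      using m(3) _ _ t_le by (rule count_transfer) (use pt col_of_u above in auto)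
    \<comment> \<open>Between letters of equal transposed index each step goes strictly down in Q,
      and therefore weakly to the left.\<close>
    have stepQ: "cl (Hilbert_Choice.inv Q t) \<le> cl (Hilbert_Choice.inv Q q)" if "q \<in> {1..t}" "b q = b t" for q
    proof (rule decreasing_chain[where h = "\<lambda>q. cl (Hilbert_Choice.inv Q q)"])
      fix j assume j: "q \<le> j" "j < t"
      then have "rw (Hilbert_Choice.inv Q j) < rw (Hilbert_Choice.inv Q (Suc j))"
        using that desc_eq_imp_increasing[of "\<lambda>q. rw (Hilbert_Choice.inv Q q)" q t j] by (simp add: b_def)
      then show "cl (Hilbert_Choice.inv Q (Suc j)) \<le> cl (Hilbert_Choice.inv Q j)"
        using std_step[OF Q, of j] j that t by simp
    qed (use that in simp)
    have stepP: "rw (Hilbert_Choice.inv P t) \<le> rw (Hilbert_Choice.inv P q)" if "q \<in> {1..t}" "a q = a t" for q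
    proof (rule decreasing_chain[where h = "\<lambda>q. rw (Hilbert_Choice.inv P q)"])
      fix j assume j: "q \<le> j" "j < t"
      then have "cl (Hilbert_Choice.inv P j) < cl (Hilbert_Choice.inv P (Suc j))"
        using that desc_eq_imp_increasing[of "\<lambda>q. cl (Hilbert_Choice.inv P q)" q t j] by (simp add: a_def)
      then show "rw (Hilbert_Choice.inv P (Suc j)) \<le> rw (Hilbert_Choice.inv P j)"
        using std_step[OF P, of j] j that t by simp
    qed (use that in simp)
    have mono: "a i \<le> a j" "b i \<le> b j" if "i \<le> j" for i j using that by (simp_all add: a_def b_def desc_mono)
    \<comment> \<open>The two indices add up to q-1, so one of them jumps from t-1 to t, and t is
      then the first letter with that index. For t = 1 this is trivial.\<close>
    consider (desc) "\<And>q. q \<in> {1..t} \<Longrightarrow> a q = a t \<Longrightarrow> q = t" | (asc) "\<And>q. q \<in> {1..t} \<Longrightarrow> b q = b t \<Longrightarrow> q = t"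
    proof (cases "t = 1")
      case True
      then show thesis using desc by auto
    next
      case False
      then have t1: "t - 1 \<in> ?I" "Suc (t - 1) = t" using t by auto
      have "a t + b t = t - 1" "a (t - 1) + b (t - 1) = t - 1 - 1" using ab[OF t] ab[OF t1(1)] by simp_all
      moreover have "t - 1 \<ge> 1" using t1 by simp
      moreover have lt: "q \<le> t - 1" if "q \<in> {1..t}" "q \<noteq> t" for q using that by auto
      ultimately have "a (t - 1) < a t \<or> b (t - 1) < b t" by linarith
      then show thesis
      proof
        assume "a (t - 1) < a t"
        then have "q = t" if "q \<in> {1..t}" "a q = a t" for q
          using mono(1)[of q "t - 1"] lt[of q] that \<open>a (t - 1) < a t\<close> by (cases "q = t") auto
        then show thesis by (rule desc)
      next
        assume "b (t - 1) < b t"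
        then have "q = t" if "q \<in> {1..t}" "b q = b t" for q
          using mono(2)[of q "t - 1"] lt[of q] that \<open>b (t - 1) < b t\<close> by (cases "q = t") auto
        then show thesis by (rule asc)
      qed
    qed
    \<comment> \<open>If the index of P jumps, t is the only candidate in the row transfer, so x
      lies in the row of p; the column chain of Q puts w weakly to the left of x, and maximality of
      t in the corners forces the three cells together. If the index of the transpose jumps, the
      roles of rows and columns are exchanged.\<close>
    then have "x = p \<and> w = p"
    proof cases
      case desc
      have tt: "t \<in> {1..t}" using t by simp
      have "\<exists>q\<in>{1..t}. a q = a t \<and> rw (Hilbert_Choice.inv P q) = rw p" using tt unfolding p_def by blast
      then obtain q where q: "q \<in> {1..t}" "a q = a t" "rw (X q) = rw p" using row_transfer[of "rw p"] by blast
      then have rx: "rw x = rw p" using desc[OF q(1,2)] by (simp add: x_def)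
      have "\<exists>q\<in>{1..t}. b q = b t \<and> cl (X q) = cl x" using tt unfolding x_def by blast
      then obtain q' where q': "q' \<in> {1..t}" "b q' = b t" "cl (Hilbert_Choice.inv Q q') = cl x"
        using col_transfer[of "cl x"] by blast
      then have cx: "cl w \<le> cl x" using stepQ[OF q'(1,2)] by (simp add: w_def)
      have "cl x \<le> cl p" using cornerP[of x] rx by (cases "cl p \<le> cl x") simp_all
      then have "p = w" using cornerQ[of p] rwp cx by simp
      then show ?thesis using cornerP[of x] rx cx by simp
    next
      case asc
      have tt: "t \<in> {1..t}" using t by simp
      have "\<exists>q\<in>{1..t}. b q = b t \<and> cl (Hilbert_Choice.inv Q q) = cl w" using tt unfolding w_def by blast
      then obtain q where q: "q \<in> {1..t}" "b q = b t" "cl (X q) = cl w" using col_transfer[of "cl w"] by blast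
      then have cx: "cl x = cl w" using asc[OF q(1,2)] by (simp add: x_def)
      have "\<exists>q\<in>{1..t}. a q = a t \<and> rw (X q) = rw x" using tt unfolding x_def by blast
      then obtain q' where q': "q' \<in> {1..t}" "a q' = a t" "rw (Hilbert_Choice.inv P q') = rw x"
        using row_transfer[of "rw x"] by blast
      then have rx: "rw p \<le> rw x" using stepP[OF q'(1,2)] by (simp add: p_def)
      have "rw x \<le> rw w" using cornerQ[of x] cx by (cases "rw w \<le> rw x") simp_all
      then have r: "rw p \<le> rw w" "rw p \<le> rw x" using rx rwp by linarith+
      have "p = w"
      proof (cases "cl w \<le> cl p")
        case True
        show ?thesis by (rule cornerQ[OF _ rwp True]) simp
      next
        case False
        have "w = p" by (rule cornerP[OF _ r(1)]) (use False in simp_all)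
        then show ?thesis ..
      qed
      moreover have "x = p" by (rule cornerP[OF _ r(2)]) (use cx \<open>p = w\<close> in simp_all)
      ultimately show ?thesis by simp
    qed
    then show ?thesis by (simp add: x_def p_def w_def)
  qed
  \<comment> \<open>The induction runs from t = n, where the range is empty, down to t = 0.\<close>
  have all: "\<forall>q\<in>{t<..n}. X q = Hilbert_Choice.inv P q \<and> Hilbert_Choice.inv Q q = Hilbert_Choice.inv P q"
    if "t \<le> n" for t
    using that
  proof (induction rule: inc_induct)
    case (step t)
    have *: "X (Suc t) = Hilbert_Choice.inv P (Suc t) \<and> Hilbert_Choice.inv Q (Suc t) = Hilbert_Choice.inv P (Suc t)"
    proof (rule letter_step)
      show "Suc t \<in> ?I" using step.hyps by simp
    qed (use step.IH in blast)
    show ?case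
    proof
      fix q assume "q \<in> {t<..n}"
      then show "X q = Hilbert_Choice.inv P q \<and> Hilbert_Choice.inv Q q = Hilbert_Choice.inv P q"
        using * step.IH by (cases "q = Suc t") simp_all
    qed
  qed simp
  have invs: "X q = Hilbert_Choice.inv P q \<and> Hilbert_Choice.inv Q q = Hilbert_Choice.inv P q" for q
  proof (cases "q \<in> ?I")
    case True
    then show ?thesis using all[of 0] by simp
  next
    case False
    then show ?thesis
      using permutes_inv[OF pP] permutes_inv[OF pQ] permutes_inv[OF m(1)] by (simp add: X_def permutes_not_in del: atLeastAtMost_iff)
  qed
  have PQ: "P = Q"
  proof -
    have "Hilbert_Choice.inv P = Hilbert_Choice.inv Q" using invs by auto
    then have "Hilbert_Choice.inv (Hilbert_Choice.inv P) = Hilbert_Choice.inv (Hilbert_Choice.inv Q)" by simp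
    then show ?thesis by (simp add: inv_inv_eq permutes_bij[OF pP] permutes_bij[OF pQ])
  qed
  have "letter_desc cl P (P (Hilbert_Choice.inv \<sigma> x)) = letter_desc cl P (P x) \<and>
        letter_desc rw Q (Q (Hilbert_Choice.inv \<rho> x)) = letter_desc rw Q (Q x)" if x: "x \<in> ?I" for x
  proof -
    have q: "P x \<in> ?I" using permutes_in_image[OF pP] x by blast
    have "X (P x) = x" using invs[of "P x"] permutes_inverses[OF pP] by simp
    then show ?thesis using pt[OF q] PQ by (simp add: s_def u_def a_def b_def)
  qed
  with PQ show "P = Q \<and> (\<forall>x\<in>?I. letter_desc cl P (P (Hilbert_Choice.inv \<sigma> x)) = letter_desc cl P (P x) \<and>
        letter_desc rw Q (Q (Hilbert_Choice.inv \<rho> x)) = letter_desc rw Q (Q x))" by blast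
qed

text \<open>Each clause of the order contradicts the corresponding conclusion of the rigidity
  lemma.\<close>

lemma perm_less_not_inj:
  assumes P: "P \<in> std_perms n rw cl" and Q: "Q \<in> std_perms n rw cl" and less: "perm_less n rw cl P Q"
    and \<sigma>: "\<sigma> \<in> grp n rw" and \<rho>: "\<rho> \<in> grp n cl"
  shows "\<not> inj_on (\<lambda>x. letter_desc cl P (P (Hilbert_Choice.inv \<sigma> x)) +
    letter_desc rw Q (Q (Hilbert_Choice.inv \<rho> x))) {1..n}"
proof
  assume "inj_on (\<lambda>x. letter_desc cl P (P (Hilbert_Choice.inv \<sigma> x)) +
    letter_desc rw Q (Q (Hilbert_Choice.inv \<rho> x))) {1..n}"
  note rigid = index_filling_rigidity[OF P Q \<sigma> \<rho> this]
  have eq: "(\<Sum>q\<in>{1..n}. letter_desc cl P q) = (\<Sum>q\<in>{1..n}. letter_desc cl Q q)"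
    using less rigid(1) unfolding perm_less_def by linarith
  from less consider (revlex) p where "p \<in> {1..n}" "letter_desc cl P p < letter_desc cl Q p"
      "\<And>q. q \<in> {p<..n} \<Longrightarrow> letter_desc cl P q = letter_desc cl Q q"
    | (last) t where "\<And>q. q \<in> {1..n} \<Longrightarrow> letter_desc cl P q = letter_desc cl Q q" "t \<in> {1..n}"
      "rw (Hilbert_Choice.inv Q t) < rw (Hilbert_Choice.inv P t)"
      "\<And>q. q \<in> {t<..n} \<Longrightarrow> Hilbert_Choice.inv P q = Hilbert_Choice.inv Q q"
    unfolding perm_less_def using eq by (metis less_irrefl)
  then show False
  proof cases
    case revlex
    have "(\<Sum>q\<in>{Suc p..n}. letter_desc cl P q) = (\<Sum>q\<in>{Suc p..n}. letter_desc cl Q q)"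
      using revlex(3) by (intro sum.cong) auto
    then have "(\<Sum>q\<in>{p..n}. letter_desc cl P q) < (\<Sum>q\<in>{p..n}. letter_desc cl Q q)"
      using revlex(1,2) by (simp add: sum.atLeast_Suc_atMost)
    then show False using rigid(2)[OF eq revlex(1)] by simp
  next
    case last
    have "P = Q"
    proof (rule conjunct1[OF rigid(3)])
      fix t' assume t': "t' \<in> {1..n}"
        "\<And>q. q \<in> {t'<..n} \<Longrightarrow> Hilbert_Choice.inv P q = Hilbert_Choice.inv Q q"
      \<comment> \<open>The row comparison is wanted at every t' above which P and Q agree. They
        disagree at t, which excludes t' < t, and agree above t, which settles t' > t.\<close>
      consider "t' < t" | "t' = t" | "t < t'" by linarith
      then show "rw (Hilbert_Choice.inv Q t') \<le> rw (Hilbert_Choice.inv P t')"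
      proof cases
        case 1
        then show ?thesis using t'(2)[of t] last(2,3) by simp
      next
        case 2
        then show ?thesis using last(3) by simp
      next
        case 3
        then show ?thesis using last(4)[of t'] t'(1) by simp
      qed
    qed (rule last(1))
    then show False using last(3) by simp
  qed
qed

text \<open>Adjointness moves one symmetrizer onto the other, where quasi-idempotence absorbs it;
  moving back only its outer half leaves a product of two unsigned symmetrizations. The absence of
  signs prevents cancellation among the diagonal terms.\<close>

lemma alt_sum_ysym_mon:
  obtains \<kappa> :: 'k where "\<kappa> \<noteq> 0"
    "\<And>\<alpha> \<beta>. alt_sum n (ysym n rw cl (mon n \<alpha>) * ysym n cl rw (mon n \<beta>)) = Const \<kappa> *
      (\<Sum>\<sigma>\<in>grp n rw. \<Sum>\<rho>\<in>grp n cl.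
        alt_sum n (mon n (\<lambda>x. \<alpha> (Hilbert_Choice.inv \<sigma> x) + \<beta> (Hilbert_Choice.inv \<rho> x))))"
proof -
  interpret tr: tab n "TYPE('k)" cl rw by (rule tab_transposed)
  obtain \<kappa> :: 'k where k: "\<kappa> \<noteq> 0" "\<And>f. ysym n cl rw (ysym n cl rw f) = Const \<kappa> * ysym n cl rw f"
    using tr.ysym_quasi_idempotent by blast
  have "alt_sum n (ysym n rw cl (mon n \<alpha>) * ysym n cl rw (mon n \<beta>)) = Const \<kappa> *
      (\<Sum>\<sigma>\<in>grp n rw. \<Sum>\<rho>\<in>grp n cl.
        alt_sum n (mon n (\<lambda>x. \<alpha> (Hilbert_Choice.inv \<sigma> x) + \<beta> (Hilbert_Choice.inv \<rho> x))))" for \<alpha> \<beta>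
  proof -
    have "alt_sum n (ysym n rw cl (mon n \<alpha>) * ysym n cl rw (mon n \<beta>)) =
        alt_sum n (mon n \<alpha> * (Const \<kappa> * ysym n cl rw (mon n \<beta>)))"
      by (simp only: alt_sum_ysym_adjoint k(2))
    also have "\<dots> = Const \<kappa> * alt_sum n (mon n \<alpha> * alt n rw (symm n cl (mon n \<beta>)))"
      by (simp only: mult.left_commute[of "mon n \<alpha>"] alt_sum_Const ysym_def)
    also have "\<dots> = Const \<kappa> * alt_sum n (symm n rw (mon n \<alpha>) * symm n cl (mon n \<beta>))"
      by (simp only: alt_sum_symm_adjoint)
    also have "symm n rw (mon n \<alpha>) * symm n cl (mon n \<beta>) = (\<Sum>\<sigma>\<in>grp n rw. \<Sum>\<rho>\<in>grp n cl.
        mon n (\<lambda>x. \<alpha> (Hilbert_Choice.inv \<sigma> x) + \<beta> (Hilbert_Choice.inv \<rho> x)))"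
      unfolding symm_def sum_product
      by (intro sum.cong refl) (simp only: perm_act_mon[OF grp_permutes] mon_mult)
    finally show ?thesis by (simp only: alt_sum_sum)
  qed
  then show thesis using that k(1) by blast
qed

lemma pairing_zero:
  assumes "P \<in> std_perms n rw cl" "Q \<in> std_perms n rw cl" "perm_less n rw cl P Q"
  shows "alt_sum n (ysym n rw cl (spec_mon n cl P) * ysym n cl rw (spec_mon n rw Q)) = (0 :: 'k mpoly)"
proof -
  obtain \<kappa> :: 'k where k: "\<And>\<alpha> \<beta>. alt_sum n (ysym n rw cl (mon n \<alpha>) * ysym n cl rw (mon n \<beta>)) = Const \<kappa> *
      (\<Sum>\<sigma>\<in>grp n rw. \<Sum>\<rho>\<in>grp n cl.
        alt_sum n (mon n (\<lambda>x. \<alpha> (Hilbert_Choice.inv \<sigma> x) + \<beta> (Hilbert_Choice.inv \<rho> x))))"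
    using alt_sum_ysym_mon by blast
  have "(\<Sum>\<sigma>\<in>grp n rw. \<Sum>\<rho>\<in>grp n cl. alt_sum n (mon n (\<lambda>x. letter_desc cl P (P (Hilbert_Choice.inv \<sigma> x)) +
      letter_desc rw Q (Q (Hilbert_Choice.inv \<rho> x))))) = (0 :: 'k mpoly)"
    by (intro sum.neutral ballI alt_sum_mon_not_inj perm_less_not_inj[OF assms])
  then show ?thesis unfolding spec_mon_def k by (simp only: mult_zero_right)
qed

text \<open>Only permutations preserving the two index fillings contribute, and all contribute the
  same nonzero constant. The constant obtained is this one times \<kappa> and the orders of two
  stabilizers, which divide n!.\<close>

lemma pairing_diagonal:
  assumes P: "P \<in> std_perms n rw cl"
  obtains c :: 'k where "c \<noteq> 0"
    "alt_sum n (ysym n rw cl (spec_mon n cl P) * ysym n cl rw (spec_mon n rw P)) = Const c * vandermonde n"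
proof -
  define \<alpha> where "\<alpha> = (\<lambda>x. letter_desc cl P (P x))"
  define \<beta> where "\<beta> = (\<lambda>x. letter_desc rw P (P x))"
  \<comment> \<open>The stabilizer of a filling \<gamma> inside the row or column group.\<close>
  define S where "S c \<gamma> = {\<sigma>\<in>grp n c. \<forall>x\<in>{1..n}. \<gamma> (Hilbert_Choice.inv \<sigma> x) = \<gamma> x}" for c \<gamma> :: "nat \<Rightarrow> nat"
  have p: "P permutes {1..n}" using P by (rule std_perms_permutes)
  obtain \<kappa> :: 'k where k: "\<kappa> \<noteq> 0" "\<And>\<alpha> \<beta>. alt_sum n (ysym n rw cl (mon n \<alpha>) * ysym n cl rw (mon n \<beta>)) = Const \<kappa> *
      (\<Sum>\<sigma>\<in>grp n rw. \<Sum>\<rho>\<in>grp n cl.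
        alt_sum n (mon n (\<lambda>x. \<alpha> (Hilbert_Choice.inv \<sigma> x) + \<beta> (Hilbert_Choice.inv \<rho> x))))"
    using alt_sum_ysym_mon by blast
  obtain c :: 'k where c: "c \<noteq> 0" "alt_sum n (mon n (\<lambda>x. P x - 1)) = Const c * vandermonde n"
    using alt_sum_mon_bij[OF p] by blast
  have val: "alt_sum n (mon n (\<lambda>x. \<alpha> (Hilbert_Choice.inv \<sigma> x) + \<beta> (Hilbert_Choice.inv \<rho> x))) =
      (if \<sigma> \<in> S rw \<alpha> \<and> \<rho> \<in> S cl \<beta> then Const c * vandermonde n else (0 :: 'k mpoly))"
    if \<sigma>: "\<sigma> \<in> grp n rw" and \<rho>: "\<rho> \<in> grp n cl" for \<sigma> \<rho>
  proof (cases "\<sigma> \<in> S rw \<alpha> \<and> \<rho> \<in> S cl \<beta>")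
    case True
    have "mon n (\<lambda>x. \<alpha> (Hilbert_Choice.inv \<sigma> x) + \<beta> (Hilbert_Choice.inv \<rho> x)) = (mon n (\<lambda>x. P x - 1) :: 'k mpoly)"
    proof (rule mon_cong)
      fix x assume x: "x \<in> {1..n}"
      have "P x \<in> {1..n}" using permutes_in_image[OF p] x by blast
      then have "\<alpha> x + \<beta> x = P x - 1" using desc_complement[OF P, of "P x"] by (simp add: \<alpha>_def \<beta>_def)
      then show "\<alpha> (Hilbert_Choice.inv \<sigma> x) + \<beta> (Hilbert_Choice.inv \<rho> x) = P x - 1"
        using True x by (simp add: S_def)
    qed
    then show ?thesis using True c(2) by simp
  next
    case False
    have "\<not> inj_on (\<lambda>x. letter_desc cl P (P (Hilbert_Choice.inv \<sigma> x)) +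
      letter_desc rw P (P (Hilbert_Choice.inv \<rho> x))) {1..n}"
    proof
      assume "inj_on (\<lambda>x. letter_desc cl P (P (Hilbert_Choice.inv \<sigma> x)) +
        letter_desc rw P (P (Hilbert_Choice.inv \<rho> x))) {1..n}"
      from index_filling_rigidity(3)[OF P P \<sigma> \<rho> this refl order_refl]
      have "\<sigma> \<in> S rw \<alpha> \<and> \<rho> \<in> S cl \<beta>" using \<sigma> \<rho> by (simp add: S_def \<alpha>_def \<beta>_def)
      then show False using False by blast
    qed
    then have "alt_sum n (mon n (\<lambda>x. \<alpha> (Hilbert_Choice.inv \<sigma> x) + \<beta> (Hilbert_Choice.inv \<rho> x))) = (0 :: 'k mpoly)"
      unfolding \<alpha>_def \<beta>_def by (rule alt_sum_mon_not_inj)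
    then show ?thesis by (simp only: if_not_P[OF False])
  qed
  have sub: "S c \<gamma> \<subseteq> grp n c" for c \<gamma> unfolding S_def by (rule Collect_subset)
  have fin: "finite (S c \<gamma>)" for c \<gamma> by (rule finite_subset[OF sub]) simp
  have cardS: "card (S d \<gamma>) dvd fact n" for d \<gamma>
  proof (rule card_perm_subgroup_dvd_fact)
    show "S d \<gamma> \<subseteq> perms n" using sub[of d \<gamma>] grp_permutes[of _ n d] by blast
    show "id \<in> S d \<gamma>" by (simp add: S_def)
    fix \<pi> assume \<pi>: "\<pi> \<in> S d \<gamma>"
    then have \<pi>p: "\<pi> permutes {1..n}" using sub[of d \<gamma>] grp_permutes[of \<pi> n d] by blast
    show "Hilbert_Choice.inv \<pi> \<in> S d \<gamma>"
      unfolding S_def mem_Collect_eq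
    proof (intro conjI ballI)
      show "Hilbert_Choice.inv \<pi> \<in> grp n d" using \<pi> sub[of d \<gamma>] grp_inv[of \<pi> n d] by blast
      fix x assume "x \<in> {1..n}"
      then have "\<pi> x \<in> {1..n}" using permutes_in_image[OF \<pi>p] by blast
      then have "\<gamma> (Hilbert_Choice.inv \<pi> (\<pi> x)) = \<gamma> (\<pi> x)" using \<pi> unfolding S_def by blast
      then show "\<gamma> (Hilbert_Choice.inv (Hilbert_Choice.inv \<pi>) x) = \<gamma> x"
        by (simp add: permutes_inverses[OF \<pi>p] inv_inv_eq[OF permutes_bij[OF \<pi>p]])
    qed
    fix \<rho> assume \<rho>: "\<rho> \<in> S d \<gamma>"
    then have \<rho>p: "\<rho> permutes {1..n}" using sub[of d \<gamma>] grp_permutes[of \<rho> n d] by blast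
    show "\<pi> \<circ> \<rho> \<in> S d \<gamma>"
      unfolding S_def mem_Collect_eq
    proof (intro conjI ballI)
      show "\<pi> \<circ> \<rho> \<in> grp n d" using \<pi> \<rho> sub[of d \<gamma>] grp_comp[of \<pi> n d \<rho>] by blast
      fix x assume x: "x \<in> {1..n}"
      then have "Hilbert_Choice.inv \<pi> x \<in> {1..n}" by (rule perm_inv_in[OF \<pi>p])
      then have "\<gamma> (Hilbert_Choice.inv \<rho> (Hilbert_Choice.inv \<pi> x)) = \<gamma> (Hilbert_Choice.inv \<pi> x)"
        using \<rho> unfolding S_def by blast
      also have "\<dots> = \<gamma> x" using \<pi> x unfolding S_def by blast
      finally show "\<gamma> (Hilbert_Choice.inv (\<pi> \<circ> \<rho>) x) = \<gamma> x"
        by (simp add: o_inv_distrib permutes_bij[OF \<pi>p] permutes_bij[OF \<rho>p])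
    qed
  qed
  have "(\<Sum>\<sigma>\<in>grp n rw. \<Sum>\<rho>\<in>grp n cl.
      alt_sum n (mon n (\<lambda>x. \<alpha> (Hilbert_Choice.inv \<sigma> x) + \<beta> (Hilbert_Choice.inv \<rho> x)))) =
      (\<Sum>\<sigma>\<in>grp n rw. \<Sum>\<rho>\<in>grp n cl.
        if \<sigma> \<in> S rw \<alpha> \<and> \<rho> \<in> S cl \<beta> then Const c * vandermonde n else (0 :: 'k mpoly))"
    by (intro sum.cong refl val)
  also have "\<dots> = (\<Sum>\<sigma>\<in>S rw \<alpha>. \<Sum>\<rho>\<in>S cl \<beta>. Const c * vandermonde n)"
  proof -
    have restr: "(\<Sum>x\<in>grp n d. if x \<in> S d \<gamma> then v else 0) = (\<Sum>x\<in>S d \<gamma>. v)" for v :: "'k mpoly" and d \<gamma>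
      using sum.inter_restrict[of "grp n d" "\<lambda>_. v" "S d \<gamma>"] Int_absorb1[OF sub[of d \<gamma>]] by simp
    have "(\<Sum>\<rho>\<in>grp n cl. if \<sigma> \<in> S rw \<alpha> \<and> \<rho> \<in> S cl \<beta> then v else 0) =
        (if \<sigma> \<in> S rw \<alpha> then (\<Sum>\<rho>\<in>S cl \<beta>. v) else 0)" for \<sigma> and v :: "'k mpoly"
      unfolding restr[of cl \<beta>, symmetric] by (cases "\<sigma> \<in> S rw \<alpha>") (simp_all only: simp_thms if_True if_False sum.neutral_const)
    then show ?thesis by (simp only: restr[of rw \<alpha>])
  qed
  also have "\<dots> = of_nat (card (S rw \<alpha>)) * (of_nat (card (S cl \<beta>)) * (Const c * vandermonde n))" by simp
  finally have "alt_sum n (ysym n rw cl (spec_mon n cl P) * ysym n cl rw (spec_mon n rw P)) =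
      Const \<kappa> * (of_nat (card (S rw \<alpha>)) * (of_nat (card (S cl \<beta>)) * (Const c * (vandermonde n :: 'k mpoly))))"
    unfolding spec_mon_def k(2) \<alpha>_def[symmetric] \<beta>_def[symmetric] by simp
  also have "\<dots> = Const (\<kappa> * (of_nat (card (S rw \<alpha>)) * (of_nat (card (S cl \<beta>)) * c))) * vandermonde n"
    by (simp only: Const_mult Const_of_nat mult.assoc)
  finally show thesis
    by (rule that[rotated]) (use k(1) c(1) of_nat_dvd_fact_ne_0[OF cardS] in simp)
qed

end


subsection \<open>Bases of the images of Young symmetrizers over the symmetric polynomials\<close>

definition sym_indep :: "nat \<Rightarrow> nat \<Rightarrow> (nat \<Rightarrow> 'k::field mpoly) \<Rightarrow> bool" where
  "sym_indep n m V \<longleftrightarrow> (\<forall>r. (\<forall>j<m. r j \<in> sym_polys n) \<and> (\<Sum>j<m. r j * V j) = 0 \<longrightarrow> (\<forall>j<m. r j = 0))"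

definition sym_span :: "nat \<Rightarrow> nat \<Rightarrow> (nat \<Rightarrow> 'k::field mpoly) \<Rightarrow> 'k mpoly set" where
  "sym_span n m V = {\<Sum>j<m. r j * V j | r. \<forall>j<m. r j \<in> sym_polys n}"

lemma sym_indepD:
  assumes "sym_indep n m V" "\<forall>j<m. r j \<in> sym_polys n" "(\<Sum>j<m. r j * V j) = 0" "j < m"
  shows "r j = 0"
  by (rule assms(1)[unfolded sym_indep_def, THEN spec[of _ r], THEN mp, OF conjI[OF assms(2,3)], THEN spec[of _ j],
      THEN mp, OF assms(4)])

lemma sym_span_0: "0 \<in> sym_span n m V"
  unfolding sym_span_def by (intro CollectI exI[of _ "\<lambda>_. 0"]) simp

lemma sym_span_add:
  assumes "f \<in> sym_span n m V" "g \<in> sym_span n m V"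
  shows "f + g \<in> sym_span n m V"
proof -
  obtain r s where "\<forall>j<m. r j \<in> sym_polys n" "f = (\<Sum>j<m. r j * V j)"
    "\<forall>j<m. s j \<in> sym_polys n" "g = (\<Sum>j<m. s j * V j)"
    using assms unfolding sym_span_def by blast
  then show ?thesis unfolding sym_span_def
    by (intro CollectI exI[of _ "\<lambda>j. r j + s j"]) (simp add: sym_polys_add distrib_right sum.distrib)
qed

lemma sym_span_sum: "(\<And>x. x \<in> A \<Longrightarrow> h x \<in> sym_span n m V) \<Longrightarrow> sum h A \<in> sym_span n m V"
  by (induction A rule: infinite_finite_induct) (simp_all add: sym_span_0 sym_span_add)

lemma sym_indep_rev: "sym_indep n m (\<lambda>j. V (m - Suc j)) \<Longrightarrow> sym_indep n m V"
  unfolding sym_indep_def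
proof (intro allI impI)
  fix r j assume *: "\<forall>r. (\<forall>j<m. r j \<in> sym_polys n) \<and> (\<Sum>j<m. r j * V (m - Suc j)) = 0 \<longrightarrow> (\<forall>j<m. r j = 0)"
    and r: "(\<forall>j<m. r j \<in> sym_polys n) \<and> (\<Sum>j<m. r j * V j) = 0" and "j < m"
  have A: "\<forall>j<m. r (m - Suc j) \<in> sym_polys n" using r by simp
  have B: "(\<Sum>j<m. r (m - Suc j) * V (m - Suc j)) = 0"
    using r sum.nat_diff_reindex[of "\<lambda>j. r j * V j" m] by simp
  have "\<forall>j<m. r (m - Suc j) = 0"
    by (rule *[THEN spec[of _ "\<lambda>j. r (m - Suc j)"], THEN mp, OF conjI[OF A B]])
  then have "r (m - Suc (m - Suc j)) = 0" using \<open>j < m\<close> by (metis diff_Suc_less less_nat_zero_code neq0_conv)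
  then show "r j = 0" using \<open>j < m\<close> by simp
qed

lemma sym_span_rev: "sym_span n m (\<lambda>j. V (m - Suc j)) \<subseteq> sym_span n m V"
proof
  fix f assume "f \<in> sym_span n m (\<lambda>j. V (m - Suc j))"
  then obtain r where r: "\<forall>j<m. r j \<in> sym_polys n" "f = (\<Sum>j<m. r j * V (m - Suc j))"
    unfolding sym_span_def by blast
  have "f = (\<Sum>j<m. r (m - Suc j) * V j)"
    unfolding r(2) by (subst sum.nat_diff_reindex[symmetric]) (intro sum.cong, auto)
  then show "f \<in> sym_span n m V" unfolding sym_span_def using r(1)
    by (intro CollectI exI[of _ "\<lambda>j. r (m - Suc j)"]) simp
qed

context good_char
begin

text \<open>Constants on the diagonal and zeros for j < l; the entries with j > l are arbitrary
  elements of R times \<open>vandermonde n\<close> whenever U and V consist of polynomials.\<close>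

definition triangular_pairing :: "nat \<Rightarrow> (nat \<Rightarrow> 'k mpoly) \<Rightarrow> (nat \<Rightarrow> 'k mpoly) \<Rightarrow> bool" where
  "triangular_pairing m U V \<longleftrightarrow>
     (\<forall>j<m. \<exists>c\<noteq>0. alt_sum n (U j * V j) = Const c * vandermonde n) \<and>
     (\<forall>l<m. \<forall>j<l. alt_sum n (U j * V l) = 0)"

text \<open>Exchanging U and V transposes the pairing matrix, and reversing the enumeration restores
  the shape. This makes results about V available for U.\<close>

lemma triangular_pairing_rev:
  assumes "triangular_pairing m U V"
  shows "triangular_pairing m (\<lambda>j. V (m - Suc j)) (\<lambda>j. U (m - Suc j))"
  unfolding triangular_pairing_def
proof (intro conjI allI impI)
  fix j assume "j < m"
  then have "m - Suc j < m" by simp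
  then show "\<exists>c\<noteq>0. alt_sum n (V (m - Suc j) * U (m - Suc j)) = Const c * vandermonde n"
    using assms unfolding triangular_pairing_def by (simp add: mult.commute)
next
  fix l j assume "l < m" "j < l"
  then have "m - Suc l < m - Suc j" "m - Suc j < m" by simp_all
  then show "alt_sum n (V (m - Suc j) * U (m - Suc l)) = 0"
    using assms unfolding triangular_pairing_def by (simp add: mult.commute)
qed

lemma triangular_pairing_indep:
  assumes tri: "triangular_pairing m U V"
  shows "sym_indep n m V"
  unfolding sym_indep_def
proof (intro allI impI, elim conjE)
  fix r j assume r: "\<forall>j<m. r j \<in> sym_polys n" and sum: "(\<Sum>j<m. r j * V j) = 0"
  show "j < m \<Longrightarrow> r j = 0"
  proof (induction j rule: less_induct)
    case (less j)
    obtain c where c: "c \<noteq> 0" "alt_sum n (U j * V j) = Const c * vandermonde n"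
      using tri less.prems unfolding triangular_pairing_def by blast
    have "0 = alt_sum n (U j * (\<Sum>l<m. r l * V l))" using sum by simp
    also have "\<dots> = (\<Sum>l<m. r l * alt_sum n (U j * V l))"
      unfolding sum_distrib_left alt_sum_sum
    proof (intro sum.cong refl)
      fix l assume "l \<in> {..<m}"
      then have "alt_sum n (r l * (U j * V l)) = r l * alt_sum n (U j * V l)"
        using r by (intro alt_sum_sym_mult) simp
      then show "alt_sum n (U j * (r l * V l)) = r l * alt_sum n (U j * V l)"
        by (simp add: mult.left_commute)
    qed
    also have "\<dots> = (\<Sum>l<m. if l = j then r j * (Const c * vandermonde n) else 0)"
    proof (intro sum.cong refl)
      fix l assume l: "l \<in> {..<m}"
      consider "l < j" | "l = j" | "j < l" by linarith
      then show "r l * alt_sum n (U j * V l) = (if l = j then r j * (Const c * vandermonde n) else 0)"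
      proof cases
        case 1
        then show ?thesis using less.IH[of l] l by simp
      next
        case 2
        then show ?thesis using c by simp
      next
        case 3
        then show ?thesis using tri l unfolding triangular_pairing_def by simp
      qed
    qed
    also have "\<dots> = r j * (Const c * vandermonde n)" using less.prems by simp
    finally show "r j = 0" using c(1) by simp
  qed
qed

text \<open>Gram-Schmidt over R: since the diagonal entries are constants, the coefficients remain
  invariant polynomials. Subtracting a multiple of \<open>V J\<close> does not disturb orthogonality
  to the earlier U.\<close>

lemma triangular_pairing_reduce:
  assumes tri: "triangular_pairing m U V" and UV: "\<And>j. U j \<in> polys n" "\<And>j. V j \<in> polys n"
    and f: "f \<in> polys n"
  shows "J \<le> m \<Longrightarrow> \<exists>r. (\<forall>l. r l \<in> sym_polys n) \<and> (\<forall>j<J. alt_sum n (U j * (f - (\<Sum>l<J. r l * V l))) = 0)"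
proof (induction J)
  case 0
  then show ?case by (intro exI[of _ "\<lambda>_. 0"]) simp
next
  case (Suc J)
  then obtain r where r: "\<forall>l. r l \<in> sym_polys n" "\<forall>j<J. alt_sum n (U j * (f - (\<Sum>l<J. r l * V l))) = 0"
    by auto
  define g where "g = f - (\<Sum>l<J. r l * V l)"
  have "g \<in> polys n" unfolding g_def using f UV r(1) by (intro polys_closed) (auto intro: sym_polys_imp_polys)
  then obtain h where h: "h \<in> sym_polys n" "alt_sum n (U J * g) = h * vandermonde n"
    using alt_sum_eq_sym_mult_vandermonde[OF polys_mult[OF UV(1)]] by blast
  obtain c where c: "c \<noteq> 0" "alt_sum n (U J * V J) = Const c * vandermonde n"
    using tri Suc.prems unfolding triangular_pairing_def by (meson Suc_le_lessD)
  \<comment> \<open>The quotient of the pairing of \<open>U J\<close> with g by the diagonal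
    constant c.\<close>
  define s where "s = Const (1 / c) * h"
  have s: "s \<in> sym_polys n" unfolding s_def using h(1) by (intro sym_polys_mult) simp_all
  have *: "alt_sum n (U j * (g - s * V J)) = alt_sum n (U j * g) - s * alt_sum n (U j * V J)" for j
  proof -
    have "U j * (g - s * V J) = U j * g - s * (U j * V J)" by (simp add: algebra_simps)
    then show ?thesis using alt_sum_sym_mult[OF s, of "U j * V J"] by (simp add: alt_sum_diff)
  qed
  have "s * alt_sum n (U J * V J) = h * vandermonde n"
  proof -
    have "Const (1 / c) * Const c = 1" using c(1) by (simp add: Const_mult[symmetric])
    then show ?thesis by (simp add: c(2) s_def algebra_simps)
  qed
  then have J: "alt_sum n (U J * (g - s * V J)) = 0" by (simp add: * h(2))
  have lower: "alt_sum n (U j * (g - s * V J)) = 0" if "j < J" for j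
    using tri that Suc.prems r(2) unfolding * triangular_pairing_def by (simp add: g_def)
  have eq: "f - (\<Sum>l<Suc J. (r(J := s)) l * V l) = g - s * V J"
    by (simp add: g_def)
  show ?case
  proof (intro exI[of _ "r(J := s)"] conjI allI impI)
    show "(r(J := s)) l \<in> sym_polys n" for l using r(1) s by simp
    show "alt_sum n (U j * (f - (\<Sum>l<Suc J. (r(J := s)) l * V l))) = 0" if "j < Suc J" for j
      unfolding eq using J lower that by (cases "j = J") simp_all
  qed
qed

end

context tab
begin

text \<open>Reduction leaves a remainder g in the image that is orthogonal to the chosen U. It is
  then orthogonal to the whole image of c r, so adjointness and nondegeneracy give
  \<open>ysym n cl rw g = 0\<close>, and quasi-idempotence gives \<open>g = 0\<close>.\<close>

lemma ysym_span:
  assumes m: "m = card (std_perms n rw cl)"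
    and ab: "\<And>j. a j \<in> polys n" "\<And>j. b j \<in> polys n"
    and tri: "triangular_pairing m (\<lambda>j. ysym n rw cl (a j)) (\<lambda>j. ysym n cl rw (b j))"
    and f: "f \<in> polys n"
  shows "ysym n cl rw f \<in> sym_span n m (\<lambda>j. ysym n cl rw (b j))"
proof -
  interpret tr: tab n "TYPE('k)" cl rw by (rule tab_transposed)
  let ?U = "\<lambda>j. ysym n rw cl (a j)" and ?V = "\<lambda>j. ysym n cl rw (b j)"
  have indepU: "sym_indep n m ?U"
    using triangular_pairing_indep[OF triangular_pairing_rev[OF tri]] by (rule sym_indep_rev)
  obtain r where r: "\<forall>l. r l \<in> sym_polys n"
    "\<forall>j<m. alt_sum n (?U j * (ysym n cl rw f - (\<Sum>l<m. r l * ?V l))) = 0"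
    using triangular_pairing_reduce[OF tri _ _ polys_ysym[OF f, of cl rw] order_refl] ab polys_ysym by blast
  define g where "g = ysym n cl rw f - (\<Sum>l<m. r l * ?V l)"
  have g: "g = ysym n cl rw (f - (\<Sum>l<m. r l * b l))"
    using r(1) by (simp add: g_def ysym_diff ysym_sum ysym_sym_mult)
  have orth: "alt_sum n (ysym n rw cl h * g) = 0" if h: "h \<in> polys n" for h
  proof -
    \<comment> \<open>The m elements U together with one more element of the image exceed the rank.
      In the resulting relation the last coefficient is nonzero because the U are independent, so
      orthogonality passes to the new element.\<close>
    define h' where "h' i = (if i < m then a i else h)" for i
    have h': "h' i \<in> polys n" for i using h ab(1) by (simp add: h'_def)
    have "card (std_perms n rw cl) < card {..m}" using m by simp
    then have "\<exists>r. (\<forall>i\<in>{..m}. r i \<in> sym_polys n) \<and> (\<exists>i\<in>{..m}. r i \<noteq> 0) \<and>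
        (\<Sum>i\<in>{..m}. r i * ysym n rw cl (h' i)) = 0"
      using h' by (intro ysym_rank) simp_all
    then obtain s where s: "\<forall>i\<in>{..m}. s i \<in> sym_polys n" "\<exists>i\<in>{..m}. s i \<noteq> 0"
      "(\<Sum>i\<in>{..m}. s i * ysym n rw cl (h' i)) = 0" by blast
    have split: "(\<Sum>i\<in>{..m}. s i * ysym n rw cl (h' i)) = (\<Sum>i<m. s i * ?U i) + s m * ysym n rw cl h"
    proof -
      have "(\<Sum>i<m. s i * ysym n rw cl (h' i)) = (\<Sum>i<m. s i * ?U i)"
        by (intro sum.cong refl) (simp add: h'_def)
      moreover have "h' m = h" by (simp add: h'_def)
      ultimately show ?thesis by (simp only: lessThan_Suc_atMost[symmetric] sum.lessThan_Suc)
    qed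
    have "s m \<noteq> 0"
    proof
      assume "s m = 0"
      then have "(\<Sum>i<m. s i * ?U i) = 0" using s(3) unfolding split by simp
      moreover have "\<forall>i<m. s i \<in> sym_polys n" using s(1) by simp
      ultimately have "s i = 0" if "i < m" for i using sym_indepD[OF indepU] that by blast
      moreover obtain i where "i \<le> m" "s i \<noteq> 0" using s(2) by auto
      ultimately show False using \<open>s m = 0\<close> by (cases "i = m") auto
    qed
    have "0 = alt_sum n (((\<Sum>i<m. s i * ?U i) + s m * ysym n rw cl h) * g)"
      using s(3) unfolding split by simp
    also have "\<dots> = (\<Sum>i<m. alt_sum n (s i * (?U i * g))) + alt_sum n (s m * (ysym n rw cl h * g))"
      by (simp add: distrib_right alt_sum_add sum_distrib_right alt_sum_sum mult.assoc)
    also have "(\<Sum>i<m. alt_sum n (s i * (?U i * g))) = 0"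
    proof (rule sum.neutral, rule ballI)
      fix i assume i: "i \<in> {..<m}"
      then have "s i \<in> sym_polys n" using s(1) by simp
      then have "alt_sum n (s i * (?U i * g)) = s i * alt_sum n (?U i * g)" by (rule alt_sum_sym_mult)
      moreover have "alt_sum n (?U i * g) = 0" using r(2) i by (simp add: g_def)
      ultimately show "alt_sum n (s i * (?U i * g)) = 0" by simp
    qed
    also have "0 + alt_sum n (s m * (ysym n rw cl h * g)) = s m * alt_sum n (ysym n rw cl h * g)"
      using s(1) by (simp add: alt_sum_sym_mult)
    finally show ?thesis using \<open>s m \<noteq> 0\<close> by simp
  qed
  have "ysym n cl rw g = 0"
    by (rule alt_sum_nondegenerate[of n]) (use orth in \<open>simp add: alt_sum_ysym_adjoint\<close>)
  moreover obtain \<kappa> :: 'k where "\<kappa> \<noteq> 0" "\<And>f. ysym n cl rw (ysym n cl rw f) = Const \<kappa> * ysym n cl rw f"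
    using tr.ysym_quasi_idempotent by blast
  ultimately have "g = 0" using g by simp
  then have "ysym n cl rw f = (\<Sum>l<m. r l * ?V l)" by (simp add: g_def)
  then show ?thesis unfolding sym_span_def using r(1) by blast
qed

end

subsection \<open>The images of the two Young symmetrizers in each degree\<close>

text \<open>The ambient space is infinite-dimensional and \<phi> is linear only on V. A basis C of V
  is finite, and an injective image of it with a further vector outside its span would be too large
  an independent set in V.\<close>

lemma (in vector_space) injective_endomorphism_surj:
  assumes V: "subspace V" and B: "finite B" "V \<subseteq> span B"
    and add: "\<And>x y. x \<in> V \<Longrightarrow> y \<in> V \<Longrightarrow> \<phi> (x + y) = \<phi> x + \<phi> y"
    and scale: "\<And>c x. x \<in> V \<Longrightarrow> \<phi> (c *s x) = c *s \<phi> x"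
    and into: "\<And>x. x \<in> V \<Longrightarrow> \<phi> x \<in> V" and inj: "\<And>x. x \<in> V \<Longrightarrow> \<phi> x = 0 \<Longrightarrow> x = 0"
  shows "V \<subseteq> \<phi> ` V"
proof -
  interpret pair: vector_space_pair scale scale by unfold_locales
  have "Vector_Spaces.linear scale scale (\<lambda>x. x)" by unfold_locales simp_all
  then obtain P where P: "P ` UNIV \<subseteq> V" "Vector_Spaces.linear scale scale P" "\<And>v. v \<in> V \<Longrightarrow> P v = v"
    using pair.linear_exists_left_inverse_on[of "\<lambda>x. x" V] V by auto
  \<comment> \<open>Composition with a projection onto V extends the restriction of \<phi> to a
    linear map on the whole space.\<close>
  define \<psi> where "\<psi> x = \<phi> (P x)" for x
  have PV: "P x \<in> V" for x using P(1) by blast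
  have lin: "Vector_Spaces.linear scale scale \<psi>"
    unfolding \<psi>_def by unfold_locales
      (simp_all add: pair.linear_add[OF P(2)] pair.linear_scale[OF P(2)] add scale PV)
  have \<psi>V: "\<psi> x = \<phi> x" if "x \<in> V" for x using that P(3) by (simp add: \<psi>_def)
  obtain C where C: "C \<subseteq> V" "independent C" "V \<subseteq> span C" using maximal_independent_subset[of V] by blast
  have spC: "span C = V" using C V by (metis span_minimal subset_antisym)
  have finC: "finite C" using independent_span_bound[OF B(1) C(2)] C(1) B(2) by blast
  have injV: "inj_on \<psi> V"
  proof (rule inj_onI)
    fix x y assume xy: "x \<in> V" "y \<in> V" "\<psi> x = \<psi> y"
    have "x - y \<in> V" using subspace_diff[OF V] xy by blast
    moreover have "\<phi> (x - y) = 0"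
      using xy \<psi>V[OF \<open>x - y \<in> V\<close>] pair.linear_diff[OF lin, of x y] by simp
    ultimately show "x = y" using inj[of "x - y"] by simp
  qed
  have ind: "independent (\<psi> ` C)"
    using pair.linear_independent_injective_image[OF lin C(2)] injV spC by simp
  have cardC: "card (\<psi> ` C) = card C" using injV C(1) by (intro card_image) (rule inj_on_subset)
  have sub: "\<psi> ` C \<subseteq> V" using C(1) into \<psi>V by force
  have "V \<subseteq> span (\<psi> ` C)"
  proof
    fix v assume v: "v \<in> V"
    show "v \<in> span (\<psi> ` C)"
    proof (rule ccontr)
      assume nv: "v \<notin> span (\<psi> ` C)"
      then have "independent (insert v (\<psi> ` C))" using ind by (rule independent_insertI)
      moreover have "insert v (\<psi> ` C) \<subseteq> span C" using v sub spC by blast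
      ultimately have "card (insert v (\<psi> ` C)) \<le> card C" using independent_span_bound[OF finC] by blast
      moreover have "v \<notin> \<psi> ` C" using nv span_base by blast
      ultimately show False using finC cardC by simp
    qed
  qed
  also have "span (\<psi> ` C) = \<psi> ` V" using pair.linear_span_image[OF lin, of C] spC by simp
  also have "\<psi> ` V = \<phi> ` V" using \<psi>V by (rule image_cong[OF refl])
  finally show ?thesis .
qed

lemma finite_homog_monomials: "finite {m :: nat \<Rightarrow>\<^sub>0 nat. Poly_Mapping.keys m \<subseteq> {1..n} \<and> tdeg m = d}"
proof (rule inj_on_finite[of Poly_Mapping.lookup])
  show "inj_on Poly_Mapping.lookup {m :: nat \<Rightarrow>\<^sub>0 nat. Poly_Mapping.keys m \<subseteq> {1..n} \<and> tdeg m = d}"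
    by (rule inj_onI) (rule poly_mapping_eqI, simp)
  show "finite {f :: nat \<Rightarrow> nat. \<forall>x. (x \<in> {1..n} \<longrightarrow> f x \<in> {..d}) \<and> (x \<notin> {1..n} \<longrightarrow> f x = 0)}"
    by (rule finite_set_of_finite_funs) simp_all
  show "Poly_Mapping.lookup ` {m :: nat \<Rightarrow>\<^sub>0 nat. Poly_Mapping.keys m \<subseteq> {1..n} \<and> tdeg m = d} \<subseteq>
      {f. \<forall>x. (x \<in> {1..n} \<longrightarrow> f x \<in> {..d}) \<and> (x \<notin> {1..n} \<longrightarrow> f x = 0)}"
  proof (intro image_subsetI CollectI allI conjI impI)
    fix m :: "nat \<Rightarrow>\<^sub>0 nat" and x
    assume m: "m \<in> {m. Poly_Mapping.keys m \<subseteq> {1..n} \<and> tdeg m = d}"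
    show "Poly_Mapping.lookup m x = 0" if "x \<notin> {1..n}"
      using m that unfolding mem_Collect_eq by (meson in_keys_iff subsetD)
    show "Poly_Mapping.lookup m x \<in> {..d}"
    proof (cases "x \<in> Poly_Mapping.keys m")
      case True
      then have "Poly_Mapping.lookup m x \<le> tdeg m"
        unfolding tdeg_def by (intro member_le_sum) simp_all
      then show ?thesis using m by simp
    qed (simp add: in_keys_iff)
  qed
qed

context tab
begin

text \<open>The antisymmetrizer c sends r c f to c r (c f), which expands in the U; replacing each U
  by the H with the same argument defines an endomorphism \<Phi>. It is injective and preserves
  degrees, hence is surjective in every degree, and its values lie in the span of the H.\<close>

lemma ysig_span:
  fixes a :: "nat \<Rightarrow> 'k mpoly" and f :: "'k mpoly"
  assumes a: "\<And>j. a j \<in> polys n" "\<And>j. homog (e j) (a j)"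
    and indepU: "sym_indep n m (\<lambda>j. ysym n rw cl (a j))"
    and spanU: "\<And>f. f \<in> polys n \<Longrightarrow> ysym n rw cl f \<in> sym_span n m (\<lambda>j. ysym n rw cl (a j))"
    and indepH: "sym_indep n m (\<lambda>j. ysig n rw cl (a j))"
    and f: "f \<in> polys n"
  shows "ysig n rw cl f \<in> sym_span n m (\<lambda>j. ysig n rw cl (a j))"
proof -
  let ?U = "\<lambda>j. ysym n rw cl (a j)" and ?H = "\<lambda>j. ysig n rw cl (a j)"
  let ?sc = "\<lambda>c (f :: 'k mpoly). Const c * f"
  interpret mp: Vector_Spaces.vector_space ?sc by (rule sum_perm_act_vector_space)
  obtain \<kappa> :: 'k where k: "\<kappa> \<noteq> 0" "\<And>f. ysig n rw cl (ysig n rw cl f) = Const \<kappa> * ysig n rw cl f"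
    using ysig_quasi_idempotent by blast
  define W where "W = ysig n rw cl ` (polys n :: 'k mpoly set)"
  \<comment> \<open>The coordinates are chosen by \<open>SOME\<close>; independence of the U makes
    them unique, which is what gives linearity of \<Phi>.\<close>
  define cf where "cf v = (SOME r. (\<forall>j<m. r j \<in> sym_polys n) \<and> alt n cl v = (\<Sum>j<m. r j * ?U j))" for v :: "'k mpoly"
  have cf: "\<forall>j<m. cf v j \<in> sym_polys n" "alt n cl v = (\<Sum>j<m. cf v j * ?U j)" if v: "v \<in> W" for v
  proof -
    obtain f where f: "f \<in> polys n" "v = ysig n rw cl f" using v unfolding W_def by blast
    have "alt n cl v = ysym n rw cl (alt n cl f)" by (simp add: f(2) ysig_def ysym_def)
    then have "\<exists>r. (\<forall>j<m. r j \<in> sym_polys n) \<and> alt n cl v = (\<Sum>j<m. r j * ?U j)"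
      using spanU[OF polys_alt[OF f(1)]] unfolding sym_span_def by auto
    from someI_ex[OF this]
    show "\<forall>j<m. cf v j \<in> sym_polys n" "alt n cl v = (\<Sum>j<m. cf v j * ?U j)" unfolding cf_def by blast+
  qed
  have uniq: "\<forall>j<m. cf v j = r j"
    if v: "v \<in> W" "\<forall>j<m. r j \<in> sym_polys n" "alt n cl v = (\<Sum>j<m. r j * ?U j)" for v r
  proof -
    have "(\<Sum>j<m. (cf v j - r j) * ?U j) = 0"
      using cf(2)[OF v(1)] v(3) by (simp add: left_diff_distrib sum_subtractf)
    moreover have "\<forall>j<m. cf v j - r j \<in> sym_polys n" using cf(1)[OF v(1)] v(2) by (simp add: sym_polys_diff)
    ultimately have "cf v j - r j = 0" if "j < m" for j
      using sym_indepD[OF indepU, of "\<lambda>j. cf v j - r j" j] that by simp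
    then show ?thesis by simp
  qed
  define \<Phi> where "\<Phi> v = (\<Sum>j<m. cf v j * ?H j)" for v
  have \<Phi>_span: "\<Phi> v \<in> sym_span n m ?H" if "v \<in> W" for v
    unfolding \<Phi>_def sym_span_def using cf(1)[OF that] by blast
  have W_add: "v + w \<in> W" if vw: "v \<in> W" "w \<in> W" for v w
  proof -
    obtain f g where "f \<in> polys n" "g \<in> polys n" "v = ysig n rw cl f" "w = ysig n rw cl g"
      using vw unfolding W_def by blast
    then show ?thesis unfolding W_def by (intro image_eqI[of _ _ "f + g"]) (simp_all add: ysig_add polys_add)
  qed
  have W_scale: "Const c * v \<in> W" if v: "v \<in> W" for v c
  proof -
    obtain f where "f \<in> polys n" "v = ysig n rw cl f" using v unfolding W_def by blast
    then show ?thesis unfolding W_def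
      by (intro image_eqI[of _ _ "Const c * f"]) (simp_all add: ysig_sym_mult polys_mult)
  qed
  have \<Phi>_add: "\<Phi> (v + w) = \<Phi> v + \<Phi> w" if vw: "v \<in> W" "w \<in> W" for v w
  proof -
    have "\<forall>j<m. cf (v + w) j = cf v j + cf w j"
      using cf[OF vw(1)] cf[OF vw(2)]
      by (intro uniq W_add vw) (simp_all add: sym_polys_add alt_add distrib_right sum.distrib)
    then show ?thesis by (simp add: \<Phi>_def distrib_right sum.distrib)
  qed
  have \<Phi>_scale: "\<Phi> (Const c * v) = Const c * \<Phi> v" if v: "v \<in> W" for v c
  proof -
    have "\<forall>j<m. cf (Const c * v) j = Const c * cf v j"
      using cf[OF v] by (intro uniq W_scale v)
        (simp_all add: sym_polys_mult alt_sym_mult sum_distrib_left mult.assoc)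
    then show ?thesis by (simp add: \<Phi>_def sum_distrib_left mult.assoc)
  qed
  \<comment> \<open>Independence of the H makes the coordinates vanish, so c v = 0; then r c v = 0,
    which is a nonzero multiple of v on the image of r c.\<close>
  have \<Phi>_inj: "v = 0" if v: "v \<in> W" "\<Phi> v = 0" for v
  proof -
    obtain f where f: "f \<in> polys n" "v = ysig n rw cl f" using v(1) unfolding W_def by blast
    have "cf v j = 0" if "j < m" for j
      using sym_indepD[OF indepH cf(1)[OF v(1)] _ that] v(2) by (simp add: \<Phi>_def)
    then have "alt n cl v = 0" using cf(2)[OF v(1)] by simp
    then have "ysig n rw cl v = 0" by (simp add: ysig_def)
    then show ?thesis using k f(2) by simp
  qed
  have homog_case: "ysig n rw cl f \<in> sym_span n m ?H" if f: "f \<in> polys n" "homog d f" for f d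
  proof -
    define V where "V = {v \<in> W. homog d v}"
    have VW: "V \<subseteq> W" unfolding V_def by (rule Collect_subset)
    have "mp.subspace V"
      unfolding mp.subspace_def V_def
    proof (intro conjI ballI allI CollectI)
      show "0 \<in> W" unfolding W_def by (rule image_eqI[of _ _ 0]) simp_all
    qed (use W_add W_scale in \<open>simp_all add: homog_add homog_Const_mult\<close>)
    moreover have "finite ((\<lambda>m. Poly_Mapping.single m (1::'k)) ` {m. Poly_Mapping.keys m \<subseteq> {1..n} \<and> tdeg m = d})"
      by (intro finite_imageI finite_homog_monomials)
    moreover have "V \<subseteq> mp.span ((\<lambda>m. Poly_Mapping.single m (1::'k)) ` {m. Poly_Mapping.keys m \<subseteq> {1..n} \<and> tdeg m = d})"
    proof
      fix v assume v: "v \<in> V"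
      then have vp: "v \<in> polys n" "homog d v" unfolding V_def W_def by (auto intro: polys_ysig)
      have "v = (\<Sum>m\<in>Poly_Mapping.keys v. Const (Poly_Mapping.lookup v m) * Poly_Mapping.single m 1)"
        by (subst (1) poly_eq_sum_single) (simp add: Const_def mult_single)
      also have "\<dots> \<in> mp.span ((\<lambda>m. Poly_Mapping.single m (1::'k)) ` {m. Poly_Mapping.keys m \<subseteq> {1..n} \<and> tdeg m = d})"
        using vp unfolding polys_def homog_def
        by (intro mp.span_sum mp.span_scale mp.span_base imageI CollectI) blast
      finally show "v \<in> mp.span ((\<lambda>m. Poly_Mapping.single m (1::'k)) ` {m. Poly_Mapping.keys m \<subseteq> {1..n} \<and> tdeg m = d})" .
    qed
    moreover have "\<Phi> v \<in> V" if v: "v \<in> V" for v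
    proof -
      have vW: "v \<in> W" and hv: "homog d v" using v unfolding V_def by blast+
      \<comment> \<open>Degree comparison identifies the coordinates of a homogeneous v with their
        components of degree \<open>d - e j\<close>. The case \<open>e j > d\<close> is set to 0
        separately because of truncated subtraction.\<close>
      define s where "s j = (if e j \<le> d then hcomp (d - e j) (cf v j) else 0)" for j
      have hU: "homog (e j) (?U j)" for j using a(2) by (rule homog_ysym)
      have "alt n cl v = hcomp d (alt n cl v)" using hcomp_homog[OF homog_alt[OF hv], of d n cl] by simp
      also have "\<dots> = (\<Sum>j<m. hcomp d (cf v j * ?U j))" by (subst cf(2)[OF vW]) (rule hcomp_sum)
      also have "\<dots> = (\<Sum>j<m. s j * ?U j)"
      proof (intro sum.cong refl)
        fix j
        show "hcomp d (cf v j * ?U j) = s j * ?U j"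
        proof (cases "e j \<le> d")
          case True
          then show ?thesis using hcomp_mult_homog[OF hU, of "d - e j" j "cf v j"] by (simp add: s_def)
        next
          case False
          then show ?thesis using hcomp_mult_homog_less[OF hU, of d j "cf v j"] by (simp add: s_def)
        qed
      qed
      finally have "\<forall>j<m. cf v j = s j"
        using cf(1)[OF vW] by (intro uniq vW) (simp_all add: s_def sym_polys_hcomp)
      then have eq: "\<Phi> v = (\<Sum>j<m. s j * ?H j)" by (simp add: \<Phi>_def)
      have ssym: "\<forall>j<m. s j \<in> sym_polys n" using cf(1)[OF vW] by (simp add: s_def sym_polys_hcomp)
      have "\<Phi> v = ysig n rw cl (\<Sum>j<m. s j * a j)" using ssym by (simp add: eq ysig_sum ysig_sym_mult)
      moreover have "(\<Sum>j<m. s j * a j) \<in> polys n" using ssym a(1) by (intro polys_closed) (auto intro: sym_polys_imp_polys)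
      ultimately have "\<Phi> v \<in> W" unfolding W_def by blast
      moreover have "homog d (\<Phi> v)"
        unfolding eq
      proof (rule homog_sum)
        fix j
        show "homog d (s j * ?H j)"
          using homog_mult[of "d - e j" "hcomp (d - e j) (cf v j)" "e j" "?H j"] homog_ysig[OF a(2)[of j], of n rw cl]
          by (cases "e j \<le> d") (simp_all add: s_def)
      qed
      ultimately show ?thesis by (simp add: V_def)
    qed
    ultimately have "V \<subseteq> \<Phi> ` V"
      using VW by (intro mp.injective_endomorphism_surj) (blast intro: \<Phi>_add \<Phi>_scale \<Phi>_inj)+
    moreover have "ysig n rw cl f \<in> V" using f unfolding V_def W_def by (simp add: homog_ysig)
    ultimately obtain v where "v \<in> V" "ysig n rw cl f = \<Phi> v" by blast
    then show ?thesis using \<Phi>_span VW by auto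
  qed
  have "f = (\<Sum>d\<in>tdeg ` Poly_Mapping.keys f. hcomp d f)" by (rule sum_hcomp) simp_all
  then have "ysig n rw cl f = (\<Sum>d\<in>tdeg ` Poly_Mapping.keys f. ysig n rw cl (hcomp d f))"
    by (metis ysig_sum)
  also have "\<dots> \<in> sym_span n m ?H"
    by (intro sym_span_sum homog_case[OF polys_hcomp[OF f] homog_hcomp])
  finally show ?thesis .
qed

end


subsection \<open>Tableaux as pairs of coordinate functions\<close>

lemma initial_segment_card:
  fixes S :: "nat set"
  assumes "finite S" "\<And>p q. q \<in> S \<Longrightarrow> p \<le> q \<Longrightarrow> p \<in> S"
  shows "S = {..<card S}"
proof -
  define m where "m = (LEAST x. x \<notin> S)"
  have "\<exists>x. x \<notin> S" using ex_new_if_finite[OF infinite_UNIV_nat assms(1)] .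
  then have "m \<notin> S" unfolding m_def by (metis LeastI)
  moreover have "x \<in> S" if "x < m" for x using not_less_Least that unfolding m_def by blast
  ultimately have "S = {..<m}" using assms(2) by (metis lessThan_iff linorder_not_less subsetI subset_antisym)
  then show ?thesis by simp
qed

lemma diagram_Sigma: "diagram lam = Sigma {..<length lam} (\<lambda>r. {..<lam ! r})"
  by (auto simp: diagram_def)

lemma card_diagram: "card (diagram lam) = sum_list lam"
  unfolding diagram_Sigma by (simp add: card_SigmaI sum_list_sum_nth atLeast0LessThan)

lemma diagram_down:
  assumes "is_partition lam n" "(r, c) \<in> diagram lam" "r' \<le> r" "c' \<le> c"
  shows "(r', c') \<in> diagram lam"
proof -
  have r: "r < length lam" "c < lam ! r" using assms(2) by (simp_all add: diagram_def)
  have "lam ! r \<le> lam ! r'"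
  proof (cases "r' = r")
    case False
    then show ?thesis
      using sorted_wrt_nth_less[of "(\<ge>)" lam r' r] assms(1,3) r by (simp add: is_partition_def)
  qed simp
  then show ?thesis using r assms(3,4) by (simp add: diagram_def)
qed

text \<open>Row lengths weakly decrease, so the rows meeting a column form an initial segment whose
  size is the corresponding conjugate part.\<close>

lemma conj_partition_props:
  assumes lam: "is_partition lam n"
  shows diagram_conj_partition: "diagram (conj_partition lam) = {(c, r). (r, c) \<in> diagram lam}"
    and is_partition_conj: "is_partition (conj_partition lam) n"
proof -
  define col where "col c = {r. r < length lam \<and> c < lam ! r}" for c
  have col: "col c = {..<card (col c)}" for c
  proof (rule initial_segment_card)
    show "finite (col c)" unfolding col_def by simp
    fix p q assume "q \<in> col c" "p \<le> q"
    then show "p \<in> col c" using diagram_down[OF lam, of q c p c] by (simp add: col_def diagram_def)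
  qed
  have max: "c < foldr max l 0 \<longleftrightarrow> (\<exists>x\<in>set l. c < x)" for c and l :: "nat list"
    by (induction l) (auto simp: less_max_iff_disj)
  have len: "c < length (conj_partition lam) \<longleftrightarrow> col c \<noteq> {}" for c
    by (simp add: conj_partition_def max col_def) (metis in_set_conv_nth)
  have nth: "conj_partition lam ! c = card (col c)" if "c < length (conj_partition lam)" for c
    using that by (simp add: conj_partition_def col_def)
  show diag: "diagram (conj_partition lam) = {(c, r). (r, c) \<in> diagram lam}"
  proof (intro equalityI subsetI)
    fix p assume "p \<in> diagram (conj_partition lam)"
    then obtain c r where p: "p = (c, r)" "c < length (conj_partition lam)" "r < conj_partition lam ! c"
      by (auto simp: diagram_def)
    then have "r \<in> col c" using col[of c] nth by auto
    then show "p \<in> {(c, r). (r, c) \<in> diagram lam}" using p by (simp add: col_def diagram_def)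
  next
    fix p assume "p \<in> {(c, r). (r, c) \<in> diagram lam}"
    then obtain c r where p: "p = (c, r)" "r \<in> col c" by (auto simp: diagram_def col_def)
    then have c: "c < length (conj_partition lam)" using len by blast
    moreover have "r < conj_partition lam ! c" using p col[of c] nth[OF c] by auto
    ultimately show "p \<in> diagram (conj_partition lam)" using p by (simp add: diagram_def)
  qed
  have "sorted_wrt (\<ge>) (conj_partition lam)"
  proof (rule sorted_wrt_iff_nth_less[THEN iffD2], intro allI impI)
    fix i j assume ij: "i < j" "j < length (conj_partition lam)"
    have "col j \<subseteq> col i" unfolding col_def using ij by auto
    then have "card (col j) \<le> card (col i)" by (rule card_mono[rotated]) (simp add: col_def)
    then show "conj_partition lam ! i \<ge> conj_partition lam ! j" using nth ij by simp
  qed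
  moreover have "0 \<notin> set (conj_partition lam)"
  proof
    assume "0 \<in> set (conj_partition lam)"
    then obtain c where c: "c < length (conj_partition lam)" "conj_partition lam ! c = 0" by (auto simp: in_set_conv_nth)
    then have "card (col c) = 0" using nth by simp
    then have "col c = {}" using col[of c] by simp
    then show False using c len by blast
  qed
  moreover have "sum_list (conj_partition lam) = n"
  proof -
    have "diagram (conj_partition lam) = prod.swap ` diagram lam" unfolding diag by force
    then have "card (diagram (conj_partition lam)) = card (diagram lam)"
      by (simp add: card_image)
    then show ?thesis using lam by (simp add: card_diagram is_partition_def)
  qed
  ultimately show "is_partition (conj_partition lam) n" by (simp add: is_partition_def)
qed

lemma ST_bij: "P \<in> ST lam \<Longrightarrow> bij_betw P (diagram lam) {1..sum_list lam}"
  by (simp add: ST_def young_tableaux_def)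

lemma cell_of_props:
  assumes "P \<in> ST lam" "q \<in> {1..sum_list lam}"
  shows "cell_of lam P q \<in> diagram lam" "P (cell_of lam P q) = q"
proof -
  have "q \<in> P ` diagram lam" using ST_bij[OF assms(1)] assms(2) by (simp add: bij_betw_def)
  then show "cell_of lam P q \<in> diagram lam" "P (cell_of lam P q) = q"
    unfolding cell_of_def by (simp_all add: inv_into_into f_inv_into_f)
qed

lemma cell_of_eq: "P \<in> ST lam \<Longrightarrow> c \<in> diagram lam \<Longrightarrow> cell_of lam P (P c) = c"
  unfolding cell_of_def using ST_bij[of P lam] by (simp add: bij_betw_def)

lemma ST_in_range: "P \<in> ST lam \<Longrightarrow> c \<in> diagram lam \<Longrightarrow> P c \<in> {1..sum_list lam}"
  using bij_betwE[OF ST_bij] by blast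

text \<open>A fixed value 0 outside the labels makes the exchange of rows and columns under
  transposition an equality of functions.\<close>

definition tab_row :: "nat list \<Rightarrow> tableau \<Rightarrow> nat \<Rightarrow> nat" where
  "tab_row lam T x = (if x \<in> {1..sum_list lam} then fst (cell_of lam T x) else 0)"

definition tab_col :: "nat list \<Rightarrow> tableau \<Rightarrow> nat \<Rightarrow> nat" where
  "tab_col lam T x = (if x \<in> {1..sum_list lam} then snd (cell_of lam T x) else 0)"

text \<open>The permutation that carries the entry of T in a cell to the entry of P there; it
  translates P into an element of \<open>std_perms\<close>.\<close>

definition tab_perm :: "nat list \<Rightarrow> tableau \<Rightarrow> tableau \<Rightarrow> nat \<Rightarrow> nat" where
  "tab_perm lam T P x = (if x \<in> {1..sum_list lam} then P (cell_of lam T x) else x)"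

lemma transpose_tab_transpose_tab [simp]: "transpose_tab (transpose_tab T) = T"
  by (auto simp: transpose_tab_def)

lemma transpose_tab_apply [simp]: "transpose_tab T (r, c) = T (c, r)"
  by (simp add: transpose_tab_def)

lemma transpose_tab_ST:
  assumes lam: "is_partition lam n" and P: "P \<in> ST lam"
  shows "transpose_tab P \<in> ST (conj_partition lam)"
proof -
  have d: "diagram (conj_partition lam) = {(c, r). (r, c) \<in> diagram lam}"
    by (rule diagram_conj_partition[OF lam])
  have s: "sum_list (conj_partition lam) = sum_list lam"
    using is_partition_conj[OF lam] lam by (simp add: is_partition_def)
  have ext: "P \<in> extensional (diagram lam)" using P by (simp add: ST_def young_tableaux_def)
  have "transpose_tab P \<in> extensional (diagram (conj_partition lam))"
    unfolding extensional_def mem_Collect_eq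
  proof (intro allI impI)
    fix x assume "x \<notin> diagram (conj_partition lam)"
    then have "(snd x, fst x) \<notin> diagram lam" by (cases x) (simp add: d)
    then show "transpose_tab P x = undefined"
      using extensional_arb[OF ext] by (cases x) simp
  qed
  moreover have "bij_betw (transpose_tab P) (diagram (conj_partition lam)) {1..sum_list (conj_partition lam)}"
  proof -
    have swap: "bij_betw prod.swap (diagram (conj_partition lam)) (diagram lam)"
      by (rule bij_betw_byWitness[where f' = prod.swap]) (auto simp: d)
    have eq: "transpose_tab P = P \<circ> prod.swap" by (auto simp: transpose_tab_def)
    show ?thesis unfolding eq s by (rule bij_betw_trans[OF swap ST_bij[OF P]])
  qed
  ultimately show ?thesis
    using P unfolding ST_def young_tableaux_def by (auto simp: d)
qed

text \<open>\<open>ST\<close> depends on the shape only through its diagram and its size, and both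
  are unchanged by conjugating twice.\<close>

lemma transpose_tab_conj_ST:
  assumes lam: "is_partition lam n" and P: "P \<in> ST (conj_partition lam)"
  shows "transpose_tab P \<in> ST lam"
proof -
  let ?lam' = "conj_partition lam"
  have d: "diagram (conj_partition ?lam') = diagram lam"
    unfolding diagram_conj_partition[OF is_partition_conj[OF lam]] diagram_conj_partition[OF lam] by auto
  have s: "sum_list (conj_partition ?lam') = sum_list lam"
    using is_partition_conj[OF is_partition_conj[OF lam]] lam by (simp add: is_partition_def)
  have "transpose_tab P \<in> ST (conj_partition ?lam')" by (rule transpose_tab_ST[OF is_partition_conj[OF lam] P])
  then show ?thesis unfolding ST_def young_tableaux_def by (simp add: d s)
qed

lemma ST_conj_partition:
  assumes "is_partition lam n"
  shows "ST (conj_partition lam) = transpose_tab ` ST lam"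
proof (intro equalityI subsetI)
  fix P assume "P \<in> ST (conj_partition lam)"
  then show "P \<in> transpose_tab ` ST lam"
    using transpose_tab_conj_ST[OF assms] by (intro image_eqI[of _ _ "transpose_tab P"]) simp_all
qed (use transpose_tab_ST[OF assms] in blast)

lemma card_ST_conj_partition:
  assumes "is_partition lam n"
  shows "card (ST (conj_partition lam)) = card (ST lam)"
  unfolding ST_conj_partition[OF assms]
  by (rule card_image) (metis inj_onI transpose_tab_transpose_tab)

lemma cell_of_transpose_tab:
  assumes lam: "is_partition lam n" and P: "P \<in> ST lam" and q: "q \<in> {1..sum_list lam}"
  shows "cell_of (conj_partition lam) (transpose_tab P) q = prod.swap (cell_of lam P q)"
proof -
  obtain r c where rc: "cell_of lam P q = (r, c)" by (cases "cell_of lam P q")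
  have "(r, c) \<in> diagram lam" "P (r, c) = q" using cell_of_props[OF P q] rc by simp_all
  then have "(c, r) \<in> diagram (conj_partition lam)" "transpose_tab P (c, r) = q"
    by (simp_all add: diagram_conj_partition[OF lam])
  then show ?thesis using cell_of_eq[OF transpose_tab_ST[OF lam P], of "(c, r)"] rc by simp
qed

lemma sum_list_conj_partition: "is_partition lam n \<Longrightarrow> sum_list (conj_partition lam) = sum_list lam"
  using is_partition_conj by (simp add: is_partition_def)

lemma tab_row_transpose: "is_partition lam n \<Longrightarrow> T \<in> ST lam \<Longrightarrow>
    tab_row (conj_partition lam) (transpose_tab T) = tab_col lam T"
  and tab_col_transpose: "is_partition lam n \<Longrightarrow> T \<in> ST lam \<Longrightarrow>
    tab_col (conj_partition lam) (transpose_tab T) = tab_row lam T"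
  by (simp_all add: fun_eq_iff tab_row_def tab_col_def sum_list_conj_partition cell_of_transpose_tab)

lemma tab_perm_transpose:
  assumes "is_partition lam n" "T \<in> ST lam"
  shows "tab_perm (conj_partition lam) (transpose_tab T) (transpose_tab P) = tab_perm lam T P"
proof
  fix x
  obtain r c where "cell_of lam T x = (r, c)" by (cases "cell_of lam T x")
  then show "tab_perm (conj_partition lam) (transpose_tab T) (transpose_tab P) x = tab_perm lam T P x"
    using assms by (simp add: tab_perm_def sum_list_conj_partition cell_of_transpose_tab)
qed


subsection \<open>Reading words and indices\<close>

definition reading_cells :: "nat list \<Rightarrow> (nat \<times> nat) list" where
  "reading_cells lam = concat (map (\<lambda>c. map (\<lambda>r. (r, c)) (rev [0..<conj_partition lam ! c]))
     [0..<length (conj_partition lam)])"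

definition reads_before :: "nat \<times> nat \<Rightarrow> nat \<times> nat \<Rightarrow> bool" where
  "reads_before x y \<longleftrightarrow> snd x < snd y \<or> snd x = snd y \<and> fst y < fst x"

lemma tab_word_reading_cells: "tab_word lam P = map P (reading_cells lam)"
  by (simp add: tab_word_def reading_cells_def map_concat comp_def)

lemma set_reading_cells: "is_partition lam n \<Longrightarrow> set (reading_cells lam) = diagram lam"
proof -
  assume lam: "is_partition lam n"
  have "(r, c) \<in> set (reading_cells lam) \<longleftrightarrow> (c, r) \<in> diagram (conj_partition lam)" for r c
    by (auto simp: reading_cells_def diagram_def image_iff)
  then show ?thesis by (auto simp: diagram_conj_partition[OF lam])
qed

lemma sorted_reading_cells: "sorted_wrt reads_before (reading_cells lam)"
proof -
  have "sorted_wrt reads_before (concat (map (\<lambda>c. map (\<lambda>r. (r, c)) (rev [0..<h c])) [0..<k]))"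
    for h :: "nat \<Rightarrow> nat" and k
  proof (induction k)
    case (Suc k)
    have "sorted_wrt (\<lambda>r r'. r' < r) (rev [0..<j])" for j :: nat
      by (simp add: sorted_wrt_rev)
    then have "sorted_wrt reads_before (map (\<lambda>r. (r, k)) (rev [0..<h k]))"
      by (simp only: sorted_wrt_map reads_before_def fst_conv snd_conv less_irrefl simp_thms)
    moreover have "reads_before x y"
      if "x \<in> set (concat (map (\<lambda>c. map (\<lambda>r. (r, c)) (rev [0..<h c])) [0..<k]))"
        "y \<in> set (map (\<lambda>r. (r, k)) (rev [0..<h k]))" for x y
      using that by (auto simp: reads_before_def)
    moreover have "concat (map (\<lambda>c. map (\<lambda>r. (r, c)) (rev [0..<h c])) [0..<Suc k]) =
        concat (map (\<lambda>c. map (\<lambda>r. (r, c)) (rev [0..<h c])) [0..<k]) @ map (\<lambda>r. (r, k)) (rev [0..<h k])"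
      by simp
    ultimately show ?case using Suc by (simp only: sorted_wrt_append) blast
  qed simp
  then show ?thesis unfolding reading_cells_def .
qed

lemma right_of_tab_word:
  assumes lam: "is_partition lam n" and P: "P \<in> ST lam" and xy: "x \<in> diagram lam" "y \<in> diagram lam"
  shows "right_of (tab_word lam P) (P x) (P y) \<longleftrightarrow> reads_before y x"
proof -
  let ?W = "reading_cells lam"
  have inj: "inj_on P (diagram lam)" using ST_bij[OF P] by (simp add: bij_betw_def)
  have W: "?W ! i \<in> diagram lam" if "i < length ?W" for i
    using nth_mem[OF that] set_reading_cells[OF lam] by simp
  have ord: "reads_before (?W ! i) (?W ! j)" if "i < j" "j < length ?W" for i j
    using sorted_reading_cells that by (rule sorted_wrt_nth_less)
  show ?thesis
  proof
    assume "right_of (tab_word lam P) (P x) (P y)"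
    then obtain p q where pq: "q < p" "p < length ?W" "P (?W ! p) = P x" "P (?W ! q) = P y"
      unfolding right_of_def tab_word_reading_cells by auto
    then have "?W ! p = x" "?W ! q = y"
      using inj_onD[OF inj _ W[of p] xy(1)] inj_onD[OF inj _ W[of q] xy(2)] by simp_all
    then show "reads_before y x" using ord pq by blast
  next
    assume b: "reads_before y x"
    obtain p q where pq: "p < length ?W" "?W ! p = x" "q < length ?W" "?W ! q = y"
      using xy set_reading_cells[OF lam] by (metis in_set_conv_nth)
    have "q < p"
    proof (rule ccontr)
      assume "\<not> q < p"
      then have "p = q \<or> reads_before x y" using ord[of p q] pq by (metis linorder_neqE_nat)
      then show False using b pq by (auto simp: reads_before_def)
    qed
    then show "right_of (tab_word lam P) (P x) (P y)"
      unfolding right_of_def tab_word_reading_cells using pq by (intro exI[of _ p] exI[of _ q]) simp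
  qed
qed

text \<open>A letter to the right in the reading word lies in a later column, or higher in the same
  column. The latter cannot happen for q+1 after q in a standard tableau, so the index depends on
  the columns alone.\<close>

lemma letter_index_desc:
  assumes lam: "is_partition lam n" and P: "P \<in> ST lam"
  shows "q \<le> sum_list lam \<Longrightarrow> letter_index (tab_word lam P) q = desc (tab_col lam P) q"
proof (induction q)
  case (Suc q)
  show ?case
  proof (cases q)
    case (Suc j)
    have in_n: "q \<in> {1..sum_list lam}" "Suc q \<in> {1..sum_list lam}" using Suc Suc.prems by simp_all
    let ?x = "cell_of lam P q" and ?y = "cell_of lam P (Suc q)"
    note x = cell_of_props[OF P in_n(1)] and y = cell_of_props[OF P in_n(2)]
    have "\<not> (snd ?x = snd ?y \<and> fst ?y < fst ?x)"
    proof
      assume *: "snd ?x = snd ?y \<and> fst ?y < fst ?x"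
      have "\<forall>r r' c. r < r' \<and> (r', c) \<in> diagram lam \<longrightarrow> P (r, c) < P (r', c)" using P unfolding ST_def by blast
      moreover obtain a b a' where "?x = (a, b)" "?y = (a', b)" "a' < a"
        using * by (metis prod.collapse)
      ultimately have "P ?y < P ?x" using x(1) by simp
      then show False using x(2) y(2) by simp
    qed
    then have "right_of (tab_word lam P) (Suc q) q \<longleftrightarrow> tab_col lam P q < tab_col lam P (Suc q)"
      using right_of_tab_word[OF lam P y(1) x(1)] x(2) y(2) in_n by (auto simp: reads_before_def tab_col_def)
    then show ?thesis using Suc.IH Suc.prems by (simp add: \<open>q = Suc j\<close>)
  qed (simp add: One_nat_def)
qed simp

text \<open>The index never decreases with the letter, so sorting changes nothing.\<close>

lemma index_seq_desc:
  assumes lam: "is_partition lam n" and P: "P \<in> ST lam"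
  shows "index_seq lam P = map (desc (tab_col lam P)) [1..<Suc n]"
proof -
  have n: "sum_list lam = n" using lam by (simp add: is_partition_def)
  have eq: "map (letter_index (tab_word lam P)) [1..<Suc n] = map (desc (tab_col lam P)) [1..<Suc n]"
    using letter_index_desc[OF lam P] n by (intro map_cong) auto
  moreover have "sorted (map (desc (tab_col lam P)) [1..<Suc n])"
    by (rule sorted_map_mono) (simp_all del: upt_Suc add: mono_onI desc_mono)
  ultimately show ?thesis unfolding index_seq_def n eq by (intro sorted_sort_id) simp
qed


subsection \<open>Higher Specht polynomials in terms of coordinate functions\<close>

lemma permutes_preserves_fibres_iff:
  assumes \<pi>: "\<pi> permutes {1..n::nat}"
  shows "(\<forall>r. \<pi> ` {x\<in>{1..n}. f x = r} = {x\<in>{1..n}. f x = r}) \<longleftrightarrow> (\<forall>x\<in>{1..n}. f (\<pi> x) = f x)"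
proof
  assume *: "\<forall>r. \<pi> ` {x\<in>{1..n}. f x = r} = {x\<in>{1..n}. f x = r}"
  show "\<forall>x\<in>{1..n}. f (\<pi> x) = f x"
  proof
    fix x assume "x \<in> {1..n}"
    then have "\<pi> x \<in> \<pi> ` {y\<in>{1..n}. f y = f x}" by blast
    then show "f (\<pi> x) = f x" using * by blast
  qed
next
  assume *: "\<forall>x\<in>{1..n}. f (\<pi> x) = f x"
  show "\<forall>r. \<pi> ` {x\<in>{1..n}. f x = r} = {x\<in>{1..n}. f x = r}"
  proof
    fix r
    have "\<pi> ` {x\<in>{1..n}. f x = r} \<subseteq> {x\<in>{1..n}. f x = r}"
    proof
      fix y assume "y \<in> \<pi> ` {x\<in>{1..n}. f x = r}"
      then obtain x where "x \<in> {1..n}" "f x = r" "y = \<pi> x" by blast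
      then show "y \<in> {x\<in>{1..n}. f x = r}" using * permutes_in_image[OF \<pi>, of x] by simp
    qed
    then show "\<pi> ` {x\<in>{1..n}. f x = r} = {x\<in>{1..n}. f x = r}"
      using permutes_inj[OF \<pi>] by (intro endo_inj_surj) (auto intro: inj_on_subset)
  qed
qed

lemma tab_row_set:
  assumes T: "T \<in> ST lam"
  shows "{T (r, c) | c. (r, c) \<in> diagram lam} = {x\<in>{1..sum_list lam}. tab_row lam T x = r}"
proof (intro equalityI subsetI)
  fix x assume "x \<in> {T (r, c) | c. (r, c) \<in> diagram lam}"
  then obtain c where c: "(r, c) \<in> diagram lam" "x = T (r, c)" by blast
  then show "x \<in> {x\<in>{1..sum_list lam}. tab_row lam T x = r}"
    using ST_in_range[OF T c(1)] cell_of_eq[OF T c(1)] by (simp add: tab_row_def)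
next
  fix x assume "x \<in> {x\<in>{1..sum_list lam}. tab_row lam T x = r}"
  then have x: "x \<in> {1..sum_list lam}" "fst (cell_of lam T x) = r" by (auto simp: tab_row_def)
  then have "(r, snd (cell_of lam T x)) = cell_of lam T x" by auto
  then show "x \<in> {T (r, c) | c. (r, c) \<in> diagram lam}"
    using cell_of_props[OF T x(1)] by (intro CollectI exI[of _ "snd (cell_of lam T x)"]) simp
qed

lemma tab_col_set:
  assumes T: "T \<in> ST lam"
  shows "{T (r, c) | r. (r, c) \<in> diagram lam} = {x\<in>{1..sum_list lam}. tab_col lam T x = c}"
proof (intro equalityI subsetI)
  fix x assume "x \<in> {T (r, c) | r. (r, c) \<in> diagram lam}"
  then obtain r where r: "(r, c) \<in> diagram lam" "x = T (r, c)" by blast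
  then show "x \<in> {x\<in>{1..sum_list lam}. tab_col lam T x = c}"
    using ST_in_range[OF T r(1)] cell_of_eq[OF T r(1)] by (simp add: tab_col_def)
next
  fix x assume "x \<in> {x\<in>{1..sum_list lam}. tab_col lam T x = c}"
  then have x: "x \<in> {1..sum_list lam}" "snd (cell_of lam T x) = c" by (auto simp: tab_col_def)
  then have "(fst (cell_of lam T x), c) = cell_of lam T x" by auto
  then show "x \<in> {T (r, c) | r. (r, c) \<in> diagram lam}"
    using cell_of_props[OF T x(1)] by (intro CollectI exI[of _ "fst (cell_of lam T x)"]) simp
qed

lemma row_group_grp: "T \<in> ST lam \<Longrightarrow> row_group lam T = grp (sum_list lam) (tab_row lam T)"
  unfolding row_group_def grp_def tab_row_set
  by (intro Collect_cong conj_cong refl permutes_preserves_fibres_iff)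

lemma col_group_grp: "T \<in> ST lam \<Longrightarrow> col_group lam T = grp (sum_list lam) (tab_col lam T)"
  unfolding col_group_def grp_def tab_col_set
  by (intro Collect_cong conj_cong refl permutes_preserves_fibres_iff)

lemma Const_sum: "Const (sum h A) = (\<Sum>x\<in>A. Const (h x))"
  by (induction A rule: infinite_finite_induct) (simp_all add: Const_add)

lemma ga_act_scale: "ga_act n (\<lambda>\<tau>. c * a \<tau>) f = Const c * ga_act n a f"
  by (simp add: ga_act_def Const_mult sum_distrib_left mult.assoc)

lemma ga_act_mult: "ga_act n (ga_mult n a b) f = ga_act n a (ga_act n b f)"
proof -
  let ?g = "\<lambda>p. Const (a (fst p) * b (snd p)) * perm_act (fst p \<circ> snd p) f"
  have "ga_act n (ga_mult n a b) f =
      (\<Sum>\<tau>\<in>perms n. \<Sum>p\<in>{p\<in>perms n \<times> perms n. fst p \<circ> snd p = \<tau>}. ?g p)"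
    unfolding ga_act_def
  proof (rule sum.cong[OF refl])
    fix \<tau>
    have "{(\<pi>, \<rho>). \<pi> permutes {1..n} \<and> \<rho> permutes {1..n} \<and> \<pi> \<circ> \<rho> = \<tau>} = {p\<in>perms n \<times> perms n. fst p \<circ> snd p = \<tau>}"
      by auto
    then show "Const (ga_mult n a b \<tau>) * perm_act \<tau> f = (\<Sum>p\<in>{p\<in>perms n \<times> perms n. fst p \<circ> snd p = \<tau>}. ?g p)"
      unfolding ga_mult_def Const_sum sum_distrib_right
      by (intro sum.cong) (auto simp: case_prod_unfold)
  qed
  also have "\<dots> = (\<Sum>p\<in>perms n \<times> perms n. ?g p)"
  proof (rule sum.group)
    show "finite (perms n \<times> perms n)" "finite (perms n)" by simp_all
    show "(\<lambda>p. fst p \<circ> snd p) ` (perms n \<times> perms n) \<subseteq> perms n"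
    proof (intro image_subsetI CollectI)
      fix p assume "p \<in> perms n \<times> perms n"
      then show "fst p \<circ> snd p permutes {1..n}" by (intro permutes_compose) auto
    qed
  qed
  also have "\<dots> = (\<Sum>\<pi>\<in>perms n. \<Sum>\<rho>\<in>perms n. Const (a \<pi> * b \<rho>) * perm_act (\<pi> \<circ> \<rho>) f)"
    by (simp add: sum.cartesian_product case_prod_unfold)
  also have "\<dots> = ga_act n a (ga_act n b f)"
    by (simp add: ga_act_def perm_act_sum perm_act_mult perm_act_comp sum_distrib_left Const_mult mult.assoc)
  finally show ?thesis .
qed

lemma ga_act_row_sum: "T \<in> ST lam \<Longrightarrow> ga_act (sum_list lam) (row_sum lam T) f = symm (sum_list lam) (tab_row lam T) f"
proof -
  assume T: "T \<in> ST lam"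
  have sub: "grp (sum_list lam) (tab_row lam T) \<subseteq> perms (sum_list lam)" using grp_permutes by blast
  have "ga_act (sum_list lam) (row_sum lam T) f =
      (\<Sum>\<pi>\<in>perms (sum_list lam). if \<pi> \<in> grp (sum_list lam) (tab_row lam T) then perm_act \<pi> f else 0)"
    unfolding ga_act_def row_sum_def row_group_grp[OF T] by (intro sum.cong refl) simp
  also have "\<dots> = symm (sum_list lam) (tab_row lam T) f"
    unfolding symm_def sum.inter_restrict[OF finite_perms, symmetric] by (simp only: Int_absorb1[OF sub])
  finally show ?thesis .
qed

lemma ga_act_col_sum: "T \<in> ST lam \<Longrightarrow> ga_act (sum_list lam) (col_sum lam T) f = alt (sum_list lam) (tab_col lam T) f"
proof -
  assume T: "T \<in> ST lam"
  have sub: "grp (sum_list lam) (tab_col lam T) \<subseteq> perms (sum_list lam)" using grp_permutes by blast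
  have "ga_act (sum_list lam) (col_sum lam T) f =
      (\<Sum>\<pi>\<in>perms (sum_list lam). if \<pi> \<in> grp (sum_list lam) (tab_col lam T) then sg \<pi> * perm_act \<pi> f else 0)"
    unfolding ga_act_def col_sum_def col_group_grp[OF T] by (intro sum.cong refl) (simp add: Const_of_int)
  also have "\<dots> = alt (sum_list lam) (tab_col lam T) f"
    unfolding alt_def sum.inter_restrict[OF finite_perms, symmetric] by (simp only: Int_absorb1[OF sub])
  finally show ?thesis .
qed

context
  fixes lam :: "nat list" and n :: nat and T :: tableau
  assumes lam: "is_partition lam n" and T: "T \<in> ST lam"
begin

lemma sum_list_lam: "sum_list lam = n"
  using lam by (simp add: is_partition_def)

lemma tab_row_T: "c \<in> diagram lam \<Longrightarrow> tab_row lam T (T c) = fst c"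
  and tab_col_T: "c \<in> diagram lam \<Longrightarrow> tab_col lam T (T c) = snd c"
  using ST_in_range[OF T] by (simp_all add: tab_row_def tab_col_def cell_of_eq[OF T])

lemma tab_locale:
  assumes "n \<ge> 2" "of_nat (fact n) \<noteq> (0 :: 'k::field)"
  shows "tab TYPE('k) n (tab_row lam T) (tab_col lam T)"
proof (intro tab.intro tab_axioms.intro good_char.intro assms)
  show "inj_on (\<lambda>x. (tab_row lam T x, tab_col lam T x)) {1..n}"
  proof (rule inj_onI)
    fix x y assume xy: "x \<in> {1..n}" "y \<in> {1..n}" "(tab_row lam T x, tab_col lam T x) = (tab_row lam T y, tab_col lam T y)"
    then have "cell_of lam T x = cell_of lam T y"
      by (intro prod_eqI) (simp_all add: tab_row_def tab_col_def sum_list_lam)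
    moreover have "T (cell_of lam T x) = x" "T (cell_of lam T y) = y"
      using xy(1,2) by (intro cell_of_props(2)[OF T]; simp add: sum_list_lam)+
    ultimately show "x = y" by metis
  qed
next
  fix x r c assume x: "x \<in> {1..n}" "r \<le> tab_row lam T x" "c \<le> tab_col lam T x"
  have "cell_of lam T x = (tab_row lam T x, tab_col lam T x)"
    using x(1) by (simp add: tab_row_def tab_col_def sum_list_lam)
  then have "(r, c) \<in> diagram lam"
    using diagram_down[OF lam, of "tab_row lam T x" "tab_col lam T x" r c] cell_of_props(1)[OF T, of x] x sum_list_lam by simp
  then show "\<exists>y\<in>{1..n}. tab_row lam T y = r \<and> tab_col lam T y = c"
    using ST_in_range[OF T] tab_row_T tab_col_T sum_list_lam by (intro bexI[of _ "T (r, c)"]) simp_all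
qed

lemma tab_perm_T: "c \<in> diagram lam \<Longrightarrow> tab_perm lam T P (T c) = P c"
  using ST_in_range[OF T] by (simp add: tab_perm_def cell_of_eq[OF T])

lemma tab_perm_permutes:
  assumes P: "P \<in> ST lam"
  shows "tab_perm lam T P permutes {1..n}"
proof (rule bij_imp_permutes)
  have "bij_betw (cell_of lam T) {1..n} (diagram lam)"
    unfolding cell_of_def sum_list_lam[symmetric] by (rule bij_betw_inv_into[OF ST_bij[OF T]])
  then have "bij_betw (P \<circ> cell_of lam T) {1..n} {1..n}"
    by (rule bij_betw_trans) (use ST_bij[OF P] sum_list_lam in simp)
  then show "bij_betw (tab_perm lam T P) {1..n} {1..n}"
    by (rule bij_betw_cong[THEN iffD1, rotated]) (simp add: tab_perm_def sum_list_lam)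
qed (simp add: tab_perm_def sum_list_lam del: atLeastAtMost_iff)

lemma inv_tab_perm:
  assumes P: "P \<in> ST lam" and q: "q \<in> {1..n}"
  shows "Hilbert_Choice.inv (tab_perm lam T P) q = T (cell_of lam P q)"
proof -
  have c: "cell_of lam P q \<in> diagram lam" "P (cell_of lam P q) = q"
    using q by (intro cell_of_props[OF P]; simp add: sum_list_lam)+
  have "tab_perm lam T P (T (cell_of lam P q)) = q" using tab_perm_T[OF c(1), of P] c(2) by (rule trans)
  then show ?thesis using permutes_inverses(2)[OF tab_perm_permutes[OF P], of "T (cell_of lam P q)"] by metis
qed

lemma tab_row_inv_tab_perm:
  assumes P: "P \<in> ST lam"
  shows "(\<lambda>q. tab_row lam T (Hilbert_Choice.inv (tab_perm lam T P) q)) = tab_row lam P"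
    and "(\<lambda>q. tab_col lam T (Hilbert_Choice.inv (tab_perm lam T P) q)) = tab_col lam P"
proof -
  have "tab_row lam T (Hilbert_Choice.inv (tab_perm lam T P) q) = tab_row lam P q \<and>
      tab_col lam T (Hilbert_Choice.inv (tab_perm lam T P) q) = tab_col lam P q" for q
  proof (cases "q \<in> {1..n}")
    case True
    then show ?thesis
      using cell_of_props(1)[OF P, of q] sum_list_lam tab_row_T[of "cell_of lam P q"] tab_col_T[of "cell_of lam P q"]
      by (simp add: inv_tab_perm[OF P] tab_row_def[of lam P] tab_col_def[of lam P])
  next
    case False
    then have "Hilbert_Choice.inv (tab_perm lam T P) q = q"
      by (rule permutes_not_in[OF permutes_inv[OF tab_perm_permutes[OF P]]])
    then show ?thesis using False by (simp add: tab_row_def tab_col_def sum_list_lam del: atLeastAtMost_iff)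
  qed
  then show "(\<lambda>q. tab_row lam T (Hilbert_Choice.inv (tab_perm lam T P) q)) = tab_row lam P"
    "(\<lambda>q. tab_col lam T (Hilbert_Choice.inv (tab_perm lam T P) q)) = tab_col lam P" by blast+
qed

lemma tab_monom_spec_mon:
  assumes P: "P \<in> ST lam"
  shows "tab_monom lam T P = spec_mon n (tab_col lam T) (tab_perm lam T P)"
proof -
  have "spec_mon n (tab_col lam T) (tab_perm lam T P) =
      (\<Prod>x\<in>{1..n}. X x ^ desc (tab_col lam P) (tab_perm lam T P x))"
    by (simp only: spec_mon_def mon_def tab_row_inv_tab_perm[OF P])
  also have "\<dots> = (\<Prod>c\<in>diagram lam. X (T c) ^ desc (tab_col lam P) (tab_perm lam T P (T c)))"
    by (rule prod.reindex_bij_betw[symmetric]) (use ST_bij[OF T] sum_list_lam in simp)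
  also have "\<dots> = tab_monom lam T P"
    unfolding tab_monom_def
  proof (intro prod.cong refl)
    fix c assume c: "c \<in> diagram lam"
    have "index_tab lam P c = desc (tab_col lam P) (P c)"
      using letter_index_desc[OF lam P, of "P c"] ST_in_range[OF P c] by (simp add: index_tab_def)
    then show "X (T c) ^ desc (tab_col lam P) (tab_perm lam T P (T c)) = X (T c) ^ index_tab lam P c"
      using tab_perm_T[OF c] by simp
  qed
  finally show ?thesis ..
qed

text \<open>The scalar is moved inside the operator, so that F is literally a value of the
  symmetrizer at a homogeneous polynomial.\<close>

lemma F_poly_ysym:
  assumes P: "P \<in> ST lam"
  shows "F_poly lam T P = ysym n (tab_row lam T) (tab_col lam T)
    (Const (of_nat (card (ST lam)) / of_nat (fact n)) * spec_mon n (tab_col lam T) (tab_perm lam T P))"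
proof -
  let ?g = "Const (of_nat (card (ST lam)) / of_nat (fact (sum_list lam))) :: 'a mpoly"
  have "F_poly lam T P = ?g * ga_act (sum_list lam) (col_sum lam T) (ga_act (sum_list lam) (row_sum lam T) (tab_monom lam T P))"
    by (simp only: F_poly_def young_eps_def ga_act_scale ga_act_mult)
  also have "\<dots> = ?g * ysym (sum_list lam) (tab_row lam T) (tab_col lam T) (tab_monom lam T P)"
    by (simp only: ga_act_row_sum[OF T] ga_act_col_sum[OF T] ysym_def)
  also have "\<dots> = ysym (sum_list lam) (tab_row lam T) (tab_col lam T) (?g * tab_monom lam T P)"
    by (simp only: ysym_sym_mult[OF sym_polys_Const])
  finally show ?thesis by (simp only: tab_monom_spec_mon[OF P] sum_list_lam)
qed

lemma H_poly_ysig: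
  assumes P: "P \<in> ST lam"
  shows "H_poly lam T P = ysig n (tab_row lam T) (tab_col lam T)
    (Const (of_nat (card (ST lam)) / of_nat (fact n)) * spec_mon n (tab_col lam T) (tab_perm lam T P))"
proof -
  let ?g = "Const (of_nat (card (ST lam)) / of_nat (fact (sum_list lam))) :: 'a mpoly"
  have "H_poly lam T P = ?g * ga_act (sum_list lam) (row_sum lam T) (ga_act (sum_list lam) (col_sum lam T) (tab_monom lam T P))"
    by (simp only: H_poly_def young_sigma_def ga_act_scale ga_act_mult)
  also have "\<dots> = ?g * ysig (sum_list lam) (tab_row lam T) (tab_col lam T) (tab_monom lam T P)"
    by (simp only: ga_act_row_sum[OF T] ga_act_col_sum[OF T] ysig_def)
  also have "\<dots> = ysig (sum_list lam) (tab_row lam T) (tab_col lam T) (?g * tab_monom lam T P)"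
    by (simp only: ysig_sym_mult[OF sym_polys_Const])
  finally show ?thesis by (simp only: tab_monom_spec_mon[OF P] sum_list_lam)
qed

lemma tab_perm_std:
  assumes P: "P \<in> ST lam"
  shows "tab_perm lam T P \<in> std_perms n (tab_row lam T) (tab_col lam T)"
  unfolding std_perms_def mem_Collect_eq
proof (intro conjI ballI impI tab_perm_permutes[OF P])
  have row: "\<forall>r c c'. c < c' \<and> (r, c') \<in> diagram lam \<longrightarrow> P (r, c) < P (r, c')"
    and col: "\<forall>r r' c. r < r' \<and> (r', c) \<in> diagram lam \<longrightarrow> P (r, c) < P (r', c)"
    using P unfolding ST_def by blast+
  fix x y assume xy: "x \<in> {1..n}" "y \<in> {1..n}"
  obtain r c where x: "cell_of lam T x = (r, c)" by (cases "cell_of lam T x")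
  obtain r' c' where y: "cell_of lam T y = (r', c')" by (cases "cell_of lam T y")
  have y': "(r', c') \<in> diagram lam" using cell_of_props(1)[OF T, of y] xy sum_list_lam y by simp
  show "tab_perm lam T P x < tab_perm lam T P y"
    if "tab_row lam T x = tab_row lam T y \<and> tab_col lam T x < tab_col lam T y"
    using that xy x y y' row by (simp add: tab_perm_def tab_row_def tab_col_def sum_list_lam)
  show "tab_perm lam T P x < tab_perm lam T P y"
    if "tab_col lam T x = tab_col lam T y \<and> tab_row lam T x < tab_row lam T y"
    using that xy x y y' col by (simp add: tab_perm_def tab_row_def tab_col_def sum_list_lam)
qed

lemma tab_perm_inj:
  assumes "P \<in> ST lam" "Q \<in> ST lam" "tab_perm lam T P = tab_perm lam T Q"
  shows "P = Q"
proof (rule extensionalityI)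
  show "P \<in> extensional (diagram lam)" "Q \<in> extensional (diagram lam)"
    using assms by (simp_all add: ST_def young_tableaux_def)
  show "P c = Q c" if "c \<in> diagram lam" for c
    using tab_perm_T[OF that, of P] tab_perm_T[OF that, of Q] assms(3) by simp
qed

lemma tab_perm_surj:
  assumes \<tau>: "\<tau> \<in> std_perms n (tab_row lam T) (tab_col lam T)"
  shows "\<exists>P\<in>ST lam. tab_perm lam T P = \<tau>"
proof -
  define P where "P = restrict (\<tau> \<circ> T) (diagram lam)"
  have p: "\<tau> permutes {1..n}" using \<tau> by (rule std_perms_permutes)
  have std: "(\<forall>x\<in>{1..n}. \<forall>y\<in>{1..n}. (tab_row lam T x = tab_row lam T y \<and> tab_col lam T x < tab_col lam T y \<longrightarrow> \<tau> x < \<tau> y) \<and>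
      (tab_col lam T x = tab_col lam T y \<and> tab_row lam T x < tab_row lam T y \<longrightarrow> \<tau> x < \<tau> y))"
    using \<tau> unfolding std_perms_def by blast
  have in_n: "T c \<in> {1..n}" if "c \<in> diagram lam" for c using ST_in_range[OF T that] sum_list_lam by simp
  have "bij_betw (\<tau> \<circ> T) (diagram lam) {1..sum_list lam}"
    by (rule bij_betw_trans[OF ST_bij[OF T]]) (use permutes_imp_bij[OF p] sum_list_lam in simp)
  then have "bij_betw P (diagram lam) {1..sum_list lam}"
    by (rule bij_betw_cong[THEN iffD1, rotated]) (simp add: P_def)
  moreover have "P \<in> extensional (diagram lam)" by (simp add: P_def)
  moreover have "P (r, c) < P (r, c')" if "c < c'" "(r, c') \<in> diagram lam" for r c c'
  proof -
    have "(r, c) \<in> diagram lam" using diagram_down[OF lam that(2)] that(1) by simp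
    then show ?thesis using std in_n[of "(r, c)"] in_n[of "(r, c')"] that
      by (simp add: P_def tab_row_T tab_col_T)
  qed
  moreover have "P (r, c) < P (r', c)" if "r < r'" "(r', c) \<in> diagram lam" for r r' c
  proof -
    have "(r, c) \<in> diagram lam" using diagram_down[OF lam that(2)] that(1) by simp
    then show ?thesis using std in_n[of "(r, c)"] in_n[of "(r', c)"] that
      by (simp add: P_def tab_row_T tab_col_T)
  qed
  ultimately have PST: "P \<in> ST lam" unfolding ST_def young_tableaux_def by simp
  have "tab_perm lam T P x = \<tau> x" for x
  proof (cases "x \<in> {1..n}")
    case True
    then show ?thesis using cell_of_props[OF T, of x] sum_list_lam by (simp add: tab_perm_def P_def)
  next
    case False
    then have "\<tau> x = x" by (rule permutes_not_in[OF p])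
    then show ?thesis using False by (simp add: tab_perm_def sum_list_lam del: atLeastAtMost_iff)
  qed
  then show ?thesis using PST by blast
qed

lemma card_std_perms: "card (std_perms n (tab_row lam T) (tab_col lam T)) = card (ST lam)"
proof -
  have "bij_betw (tab_perm lam T) (ST lam) (std_perms n (tab_row lam T) (tab_col lam T))"
    unfolding bij_betw_def
  proof
    show "inj_on (tab_perm lam T) (ST lam)" using tab_perm_inj by (rule inj_onI)
    show "tab_perm lam T ` ST lam = std_perms n (tab_row lam T) (tab_col lam T)"
      using tab_perm_std tab_perm_surj by blast
  qed
  then show ?thesis by (simp add: bij_betw_same_card)
qed

lemma tab_less_perm_less:
  assumes P: "P \<in> ST lam" and Q: "Q \<in> ST lam" and less: "tab_less lam P Q"
  shows "perm_less n (tab_row lam T) (tab_col lam T) (tab_perm lam T P) (tab_perm lam T Q)"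
proof -
  have n: "sum_list lam = n" by (rule sum_list_lam)
  let ?a = "desc (tab_col lam P)" and ?b = "desc (tab_col lam Q)"
  have tot: "sum_list (index_seq lam S) = (\<Sum>q\<in>{1..n}. desc (tab_col lam S) q)" if "S \<in> ST lam" for S
    unfolding index_seq_desc[OF lam that] by (simp only: interv_sum_list_conv_sum_set_nat set_upt atLeastLessThanSuc_atLeastAtMost)
  have len: "length (index_seq lam S) = n" if "S \<in> ST lam" for S
    unfolding index_seq_desc[OF lam that] by simp
  \<comment> \<open>Positions in the sequence count from 0, letters from 1.\<close>
  have nth: "index_seq lam S ! p = desc (tab_col lam S) (Suc p)" if "S \<in> ST lam" "p < n" for S p
    unfolding index_seq_desc[OF lam that(1)] using that(2) by (simp add: plus_1_eq_Suc del: upt_Suc)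
  have rows: "tab_row lam T (Hilbert_Choice.inv (tab_perm lam T S) q) = tab_row lam S q" if "S \<in> ST lam" for S q
    using fun_cong[OF tab_row_inv_tab_perm(1)[OF that], of q] .
  have goal_eq: "perm_less n (tab_row lam T) (tab_col lam T) (tab_perm lam T P) (tab_perm lam T Q) \<longleftrightarrow>
     (\<Sum>q\<in>{1..n}. ?a q) < (\<Sum>q\<in>{1..n}. ?b q) \<or>
     (\<Sum>q\<in>{1..n}. ?a q) = (\<Sum>q\<in>{1..n}. ?b q) \<and>
     ((\<exists>p\<in>{1..n}. ?a p < ?b p \<and> (\<forall>q\<in>{p<..n}. ?a q = ?b q)) \<or>
      (\<forall>q\<in>{1..n}. ?a q = ?b q) \<and> (\<exists>t\<in>{1..n}. tab_row lam Q t < tab_row lam P t \<and>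
         (\<forall>q\<in>{t<..n}. Hilbert_Choice.inv (tab_perm lam T P) q = Hilbert_Choice.inv (tab_perm lam T Q) q)))"
    unfolding perm_less_def by (simp only: tab_row_inv_tab_perm(2)[OF P] tab_row_inv_tab_perm(2)[OF Q] rows[OF P] rows[OF Q])
  from less consider (deg) "(\<Sum>q\<in>{1..n}. ?a q) < (\<Sum>q\<in>{1..n}. ?b q)"
    | (revlex) "(\<Sum>q\<in>{1..n}. ?a q) = (\<Sum>q\<in>{1..n}. ?b q)" "revlex_less (index_seq lam P) (index_seq lam Q)"
    | (last) "(\<Sum>q\<in>{1..n}. ?a q) = (\<Sum>q\<in>{1..n}. ?b q)" "index_seq lam P = index_seq lam Q" "last_letter_less lam P Q"
    unfolding tab_less_def tot[OF P] tot[OF Q] by blast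
  then show ?thesis
  proof cases
    case deg
    then show ?thesis unfolding goal_eq by (rule disjI1)
  next
    case revlex
    obtain p where p: "p < n" "index_seq lam P ! p < index_seq lam Q ! p"
      "\<forall>q. p < q \<and> q < n \<longrightarrow> index_seq lam P ! q = index_seq lam Q ! q"
      using revlex(2) unfolding revlex_less_def len[OF P] by blast
    have "?a (Suc p) < ?b (Suc p)" using p(1,2) nth[OF P] nth[OF Q] by simp
    moreover have "?a q = ?b q" if q: "q \<in> {Suc p<..n}" for q
    proof -
      obtain j where j: "q = Suc j" "p < j" "j < n" using q by (cases q) auto
      then show ?thesis using p(3) nth[OF P] nth[OF Q] by simp
    qed
    moreover have "Suc p \<in> {1..n}" using p(1) by simp
    ultimately show ?thesis unfolding goal_eq using revlex(1) by blast
  next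
    case last
    have eq: "?a q = ?b q" if q: "q \<in> {1..n}" for q
    proof -
      obtain j where j: "q = Suc j" "j < n" using q by (cases q) auto
      then show ?thesis using last(2) nth[OF P, of j] nth[OF Q, of j] by simp
    qed
    obtain t where t: "t \<in> {1..n}" "\<forall>q\<in>{t<..n}. cell_of lam P q = cell_of lam Q q"
      "fst (cell_of lam Q t) < fst (cell_of lam P t)"
      using last(3) unfolding last_letter_less_def n by blast
    have "tab_row lam Q t < tab_row lam P t" using t(1,3) n by (simp add: tab_row_def)
    moreover have "Hilbert_Choice.inv (tab_perm lam T P) q = Hilbert_Choice.inv (tab_perm lam T Q) q" if q: "q \<in> {t<..n}" for q
    proof -
      have "q \<in> {1..n}" using q t(1) by auto
      then show ?thesis using t(2) q by (simp add: inv_tab_perm[OF P] inv_tab_perm[OF Q])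
    qed
    ultimately show ?thesis unfolding goal_eq using last(1) eq t(1) by blast
  qed
qed

end


subsection \<open>The first syzygy of a matrix factorization\<close>

definition ring_on :: "'a::comm_ring_1 set \<Rightarrow> 'a ring" where
  "ring_on C = \<lparr>carrier = C, monoid.mult = (*), one = 1, zero = 0, add = (+)\<rparr>"

text \<open>The syzygy argument uses of R only that it is a subring of a domain; vectors and
  matrices keep the operations of the ambient type, and C restricts their entries.\<close>

locale subring_set =
  fixes C :: "'a::idom set"
  assumes zero_in: "0 \<in> C" and one_in: "1 \<in> C"
    and add_in: "x \<in> C \<Longrightarrow> y \<in> C \<Longrightarrow> x + y \<in> C"
    and mult_in: "x \<in> C \<Longrightarrow> y \<in> C \<Longrightarrow> x * y \<in> C"
    and uminus_in: "x \<in> C \<Longrightarrow> - x \<in> C"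
begin

lemma diff_in: "x \<in> C \<Longrightarrow> y \<in> C \<Longrightarrow> x - y \<in> C"
  using add_in[of x "- y"] uminus_in by simp

lemma sum_in: "(\<And>x. x \<in> S \<Longrightarrow> f x \<in> C) \<Longrightarrow> sum f S \<in> C"
  by (induction S rule: infinite_finite_induct) (simp_all add: zero_in add_in)

lemma cring_ring_on: "cring (ring_on C)"
  by (rule cringI; (rule abelian_groupI | rule comm_monoidI)?)
     (auto simp: ring_on_def add_in mult_in zero_in one_in algebra_simps
       intro!: bexI[of _ "- _"] uminus_in)

definition vecs :: "nat \<Rightarrow> 'a vec set" where
  "vecs m = {v \<in> carrier_vec m. \<forall>i<m. v $ i \<in> C}"

definition mat_in :: "nat \<Rightarrow> 'a mat \<Rightarrow> bool" where
  "mat_in m A \<longleftrightarrow> A \<in> carrier_mat m m \<and> (\<forall>i<m. \<forall>j<m. A $$ (i, j) \<in> C)"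

lemma vecs_dim: "v \<in> vecs m \<Longrightarrow> v \<in> carrier_vec m"
  and vecs_nth: "v \<in> vecs m \<Longrightarrow> i < m \<Longrightarrow> v $ i \<in> C"
  by (simp_all add: vecs_def)

lemma vecs_add: "u \<in> vecs m \<Longrightarrow> v \<in> vecs m \<Longrightarrow> u + v \<in> vecs m"
  and vecs_diff: "u \<in> vecs m \<Longrightarrow> v \<in> vecs m \<Longrightarrow> u - v \<in> vecs m"
  and vecs_smult: "a \<in> C \<Longrightarrow> v \<in> vecs m \<Longrightarrow> a \<cdot>\<^sub>v v \<in> vecs m"
  and vecs_zero: "0\<^sub>v m \<in> vecs m"
  by (auto simp: vecs_def add_in diff_in mult_in zero_in)

lemma mat_in_carrier: "mat_in m A \<Longrightarrow> A \<in> carrier_mat m m"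
  and mat_in_dim: "mat_in m A \<Longrightarrow> dim_row A = m"
  by (auto simp: mat_in_def)

lemma mat_vec_smult:
  fixes A :: "'a mat"
  assumes A: "A \<in> carrier_mat m m" and v: "v \<in> carrier_vec m"
  shows "A *\<^sub>v (c \<cdot>\<^sub>v v) = c \<cdot>\<^sub>v (A *\<^sub>v v)"
proof (rule eq_vecI)
  fix i assume "i < dim_vec (c \<cdot>\<^sub>v (A *\<^sub>v v))"
  then have i: "i < m" using A by simp
  then have "row A i \<in> carrier_vec m" using A by simp
  then have "row A i \<bullet> (c \<cdot>\<^sub>v v) = c * (row A i \<bullet> v)" using v by (rule scalar_prod_smult_distrib)
  then show "(A *\<^sub>v (c \<cdot>\<^sub>v v)) $ i = (c \<cdot>\<^sub>v (A *\<^sub>v v)) $ i" using i A by simp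
qed simp

lemma vecs_mult:
  assumes A: "mat_in m A" and v: "v \<in> vecs m"
  shows "A *\<^sub>v v \<in> vecs m"
  unfolding vecs_def
proof (intro CollectI conjI allI impI)
  show "A *\<^sub>v v \<in> carrier_vec m" using mat_in_carrier[OF A] v by (intro mult_mat_vec_carrier) (auto simp: vecs_def)
  fix i assume i: "i < m"
  have "(A *\<^sub>v v) $ i = (\<Sum>j = 0..<m. A $$ (i, j) * v $ j)"
    using A v i by (auto simp: mat_in_def vecs_def scalar_prod_def)
  also have "\<dots> \<in> C" using A v i by (intro sum_in mult_in) (auto simp: mat_in_def vecs_def)
  finally show "(A *\<^sub>v v) $ i \<in> C" .
qed

lemma carrier_free_module: "carrier (free_module (ring_on C) m) = vecs m"
  by (simp add: free_module_def ring_on_def vecs_def)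

lemma mat_image_eq: "mat_in m A \<Longrightarrow> mat_image (ring_on C) A = (*\<^sub>v) A ` vecs m"
  unfolding mat_image_def mat_in_def by (auto simp: carrier_free_module)

definition coset :: "nat \<Rightarrow> 'a mat \<Rightarrow> 'a vec \<Rightarrow> 'a vec set" where
  "coset m A v = (\<lambda>w. A *\<^sub>v w + v) ` vecs m"

lemma a_r_coset_free_module:
  assumes A: "mat_in m A" and v: "v \<in> vecs m"
  shows "mat_image (ring_on C) A +>\<^bsub>free_module (ring_on C) m\<^esub> v = coset m A v"
proof -
  have "vec m (\<lambda>i. (A *\<^sub>v w) $ i + v $ i) = A *\<^sub>v w + v" if "w \<in> vecs m" for w
    using vecs_dim[OF vecs_mult[OF A that]] vecs_dim[OF v] by (intro eq_vecI) auto
  then show ?thesis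
    unfolding a_r_coset_def' mat_image_eq[OF A] coset_def
    by (auto simp: free_module_def ring_on_def)
qed

lemma coset_self:
  assumes A: "mat_in m A" and v: "v \<in> vecs m"
  shows "v \<in> coset m A v"
proof -
  have "A *\<^sub>v 0\<^sub>v m + v = v"
    using mat_in_carrier[OF A] vecs_dim[OF v] by (intro eq_vecI) auto
  then show ?thesis unfolding coset_def using vecs_zero by (metis image_eqI)
qed

lemma coset_eq_iff:
  assumes A: "mat_in m A" and v: "v \<in> vecs m" and v': "v' \<in> vecs m"
  shows "coset m A v = coset m A v' \<longleftrightarrow> (\<exists>w\<in>vecs m. v = A *\<^sub>v w + v')"
proof
  assume "coset m A v = coset m A v'"
  then have "v \<in> coset m A v'" using coset_self[OF A v] by simp
  then show "\<exists>w\<in>vecs m. v = A *\<^sub>v w + v'" unfolding coset_def by blast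
next
  assume "\<exists>w\<in>vecs m. v = A *\<^sub>v w + v'"
  then obtain w where w: "w \<in> vecs m" "v = A *\<^sub>v w + v'" by blast
  have Ad: "A \<in> carrier_mat m m" using A by (simp add: mat_in_def)
  have shift: "A *\<^sub>v u + v = A *\<^sub>v (u + w) + v'" if "u \<in> vecs m" for u
  proof -
    have "A *\<^sub>v (u + w) = A *\<^sub>v u + A *\<^sub>v w"
      using mult_add_distrib_mat_vec[OF Ad vecs_dim[OF that] vecs_dim[OF w(1)]] .
    then show ?thesis
      using w(2) assoc_add_vec[OF vecs_dim[OF vecs_mult[OF A that]] vecs_dim[OF vecs_mult[OF A w(1)]] vecs_dim[OF v']]
      by simp
  qed
  show "coset m A v = coset m A v'"
  proof (intro equalityI subsetI)
    fix x assume "x \<in> coset m A v"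
    then obtain u where u: "u \<in> vecs m" "x = A *\<^sub>v u + v" unfolding coset_def by blast
    show "x \<in> coset m A v'"
      unfolding coset_def by (rule image_eqI[of _ _ "u + w"]) (simp_all add: u shift vecs_add w(1))
  next
    fix x assume "x \<in> coset m A v'"
    then obtain u where u: "u \<in> vecs m" "x = A *\<^sub>v u + v'" unfolding coset_def by blast
    have "u - w + w = u" using vecs_dim[OF u(1)] vecs_dim[OF w(1)] by (intro eq_vecI) auto
    then show "x \<in> coset m A v"
      unfolding coset_def by (intro image_eqI[of _ _ "u - w"]) (simp_all add: u shift vecs_diff w(1))
  qed
qed

lemma carrier_coker:
  assumes A: "mat_in m A"
  shows "carrier (coker (ring_on C) A) = coset m A ` vecs m"
proof -
  have d: "dim_row A = m" by (rule mat_in_dim[OF A])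
  show ?thesis
    unfolding coker_def quotient_module_def A_RCOSETS_def' d
    using a_r_coset_free_module[OF A] by (auto simp: carrier_free_module)
qed

lemma add_coker:
  assumes A: "mat_in m A" and v: "v \<in> vecs m" "v' \<in> vecs m"
  shows "coset m A v \<oplus>\<^bsub>coker (ring_on C) A\<^esub> coset m A v' = coset m A (v + v')"
proof -
  have Ad: "A \<in> carrier_mat m m" using A by (simp add: mat_in_def)
  have eq: "vec m (\<lambda>i. (A *\<^sub>v w + v) $ i + (A *\<^sub>v w' + v') $ i) = A *\<^sub>v (w + w') + (v + v')"
    if "w \<in> vecs m" "w' \<in> vecs m" for w w'
    unfolding mult_add_distrib_mat_vec[OF Ad vecs_dim[OF that(1)] vecs_dim[OF that(2)]]
    using vecs_dim[OF vecs_mult[OF A that(1)]] vecs_dim[OF vecs_mult[OF A that(2)]] vecs_dim[OF v(1)] vecs_dim[OF v(2)]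
    by (intro eq_vecI) auto
  have d: "dim_row A = m" by (rule mat_in_dim[OF A])
  have "coset m A v \<oplus>\<^bsub>coker (ring_on C) A\<^esub> coset m A v' =
      (\<Union>w\<in>vecs m. \<Union>w'\<in>vecs m. {vec m (\<lambda>i. (A *\<^sub>v w + v) $ i + (A *\<^sub>v w' + v') $ i)})"
    by (simp add: coker_def quotient_module_def d set_add_def' coset_def free_module_def ring_on_def)
  also have "\<dots> = (\<Union>w\<in>vecs m. \<Union>w'\<in>vecs m. {A *\<^sub>v (w + w') + (v + v')})"
    using eq by simp
  also have "\<dots> = coset m A (v + v')"
  proof (intro equalityI subsetI)
    fix x assume "x \<in> (\<Union>w\<in>vecs m. \<Union>w'\<in>vecs m. {A *\<^sub>v (w + w') + (v + v')})"
    then show "x \<in> coset m A (v + v')" unfolding coset_def using vecs_add by blast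
  next
    fix x assume "x \<in> coset m A (v + v')"
    then obtain w where w: "w \<in> vecs m" "x = A *\<^sub>v w + (v + v')" unfolding coset_def by blast
    have "w + 0\<^sub>v m = w" using vecs_dim[OF w(1)] by simp
    then show "x \<in> (\<Union>w\<in>vecs m. \<Union>w'\<in>vecs m. {A *\<^sub>v (w + w') + (v + v')})"
      using w vecs_zero[of m] by (intro UN_I[of w] UN_I[of "0\<^sub>v m"]) simp_all
  qed
  finally show ?thesis .
qed

lemma smult_coker:
  assumes A: "mat_in m A" and v: "v \<in> vecs m" and a: "a \<in> C"
  shows "a \<odot>\<^bsub>coker (ring_on C) A\<^esub> coset m A v = coset m A (a \<cdot>\<^sub>v v)"
proof -
  have Ad: "A \<in> carrier_mat m m" using A by (simp add: mat_in_def)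
  have d: "dim_row A = m" by (rule mat_in_dim[OF A])
  have el: "mat_image (ring_on C) A +>\<^bsub>free_module (ring_on C) m\<^esub> (a \<odot>\<^bsub>free_module (ring_on C) m\<^esub> x) = coset m A (a \<cdot>\<^sub>v v)"
    if x: "x \<in> coset m A v" for x
  proof -
    obtain w where w: "w \<in> vecs m" "x = A *\<^sub>v w + v" using x unfolding coset_def by blast
    have x: "x \<in> vecs m" using w(2) vecs_add[OF vecs_mult[OF A w(1)] v] by simp
    have "a \<odot>\<^bsub>free_module (ring_on C) m\<^esub> x = a \<cdot>\<^sub>v x"
      using vecs_dim[OF x] by (intro eq_vecI) (auto simp: free_module_def ring_on_def)
    moreover have "a \<cdot>\<^sub>v x = A *\<^sub>v (a \<cdot>\<^sub>v w) + a \<cdot>\<^sub>v v"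
      unfolding w(2) using smult_add_distrib_vec[OF vecs_dim[OF vecs_mult[OF A w(1)]] vecs_dim[OF v], of a]
        mat_vec_smult[OF Ad vecs_dim[OF w(1)], of a] by simp
    then have "coset m A (a \<cdot>\<^sub>v x) = coset m A (a \<cdot>\<^sub>v v)"
      using coset_eq_iff[OF A vecs_smult[OF a x] vecs_smult[OF a v]] vecs_smult[OF a w(1)] by blast
    ultimately show ?thesis using a_r_coset_free_module[OF A vecs_smult[OF a x]] by simp
  qed
  have "a \<odot>\<^bsub>coker (ring_on C) A\<^esub> coset m A v = (\<Union>x\<in>coset m A v. coset m A (a \<cdot>\<^sub>v v))"
    unfolding coker_def quotient_module_def d by (simp add: el)
  then show ?thesis using coset_self[OF A v] by auto
qed

lemma residue_class_eq: "residue_class (ring_on C) d x = (\<lambda>r. r * d + x) ` C"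
  unfolding residue_class_def a_r_coset_def' cgenideal_def by (auto simp: ring_on_def)

lemma residue_class_eq_iff:
  "residue_class (ring_on C) d x = residue_class (ring_on C) d y \<longleftrightarrow> (\<exists>r\<in>C. x = r * d + y)"
proof
  assume "residue_class (ring_on C) d x = residue_class (ring_on C) d y"
  moreover have "x \<in> residue_class (ring_on C) d x"
    unfolding residue_class_eq by (rule image_eqI[of _ _ 0]) (simp_all add: zero_in)
  ultimately show "\<exists>r\<in>C. x = r * d + y" unfolding residue_class_eq by blast
next
  assume "\<exists>r\<in>C. x = r * d + y"
  then obtain r where r: "r \<in> C" "x = r * d + y" by blast
  show "residue_class (ring_on C) d x = residue_class (ring_on C) d y"
    unfolding residue_class_eq
  proof (intro equalityI subsetI)
    fix z assume "z \<in> (\<lambda>r. r * d + x) ` C"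
    then obtain s where "s \<in> C" "z = s * d + x" by blast
    then show "z \<in> (\<lambda>r. r * d + y) ` C"
      using r by (intro image_eqI[of _ _ "s + r"]) (simp_all add: add_in algebra_simps)
  next
    fix z assume "z \<in> (\<lambda>r. r * d + y) ` C"
    then obtain s where "s \<in> C" "z = s * d + y" by blast
    then show "z \<in> (\<lambda>r. r * d + x) ` C"
      using r by (intro image_eqI[of _ _ "s - r"]) (simp_all add: diff_in algebra_simps)
  qed
qed

lemma residue_class_add:
  "residue_class (ring_on C) d x \<oplus>\<^bsub>ring_on C Quot (PIdl\<^bsub>ring_on C\<^esub> d)\<^esub> residue_class (ring_on C) d y =
    residue_class (ring_on C) d (x + y)"
proof -
  have "residue_class (ring_on C) d x \<oplus>\<^bsub>ring_on C Quot (PIdl\<^bsub>ring_on C\<^esub> d)\<^esub> residue_class (ring_on C) d y =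
    (\<Union>r\<in>C. \<Union>s\<in>C. {(r * d + x) + (s * d + y)})"
    unfolding residue_class_eq by (simp add: FactRing_def set_add_def' ring_on_def)
  also have "\<dots> = (\<lambda>r. r * d + (x + y)) ` C"
  proof (intro equalityI subsetI)
    fix z assume "z \<in> (\<Union>r\<in>C. \<Union>s\<in>C. {(r * d + x) + (s * d + y)})"
    then obtain r s where "r \<in> C" "s \<in> C" "z = (r * d + x) + (s * d + y)" by blast
    then show "z \<in> (\<lambda>r. r * d + (x + y)) ` C"
      by (intro image_eqI[of _ _ "r + s"]) (simp_all add: add_in algebra_simps)
  next
    fix z assume "z \<in> (\<lambda>r. r * d + (x + y)) ` C"
    then obtain r where "r \<in> C" "z = r * d + (x + y)" by blast
    then show "z \<in> (\<Union>r\<in>C. \<Union>s\<in>C. {(r * d + x) + (s * d + y)})"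
      using zero_in by (intro UN_I[of r] UN_I[of 0]) (simp_all add: algebra_simps)
  qed
  finally show ?thesis by (simp only: residue_class_eq)
qed

lemma residue_class_mult:
  assumes "x \<in> C" "y \<in> C" "d \<in> C"
  shows "residue_class (ring_on C) d x \<otimes>\<^bsub>ring_on C Quot (PIdl\<^bsub>ring_on C\<^esub> d)\<^esub> residue_class (ring_on C) d y =
    residue_class (ring_on C) d (x * y)"
proof -
  have el: "residue_class (ring_on C) d (a * b) = residue_class (ring_on C) d (x * y)"
    if ab: "a \<in> residue_class (ring_on C) d x" "b \<in> residue_class (ring_on C) d y" for a b
  proof -
    obtain r s where rs: "r \<in> C" "s \<in> C" "a = r * d + x" "b = s * d + y"
      using ab unfolding residue_class_eq by blast
    have "a * b = (r * (s * d + y) + x * s) * d + x * y" by (simp add: rs algebra_simps)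
    moreover have "r * (s * d + y) + x * s \<in> C" using rs assms by (intro add_in mult_in)
    ultimately show ?thesis unfolding residue_class_eq_iff by blast
  qed
  have ne: "z \<in> residue_class (ring_on C) d z" for z
    unfolding residue_class_eq by (rule image_eqI[of _ _ 0]) (simp_all add: zero_in)
  have "residue_class (ring_on C) d x \<otimes>\<^bsub>ring_on C Quot (PIdl\<^bsub>ring_on C\<^esub> d)\<^esub> residue_class (ring_on C) d y =
    (\<Union>a\<in>residue_class (ring_on C) d x. \<Union>b\<in>residue_class (ring_on C) d y. residue_class (ring_on C) d (a * b))"
    by (simp add: FactRing_def rcoset_mult_def residue_class_def[symmetric]) (simp add: ring_on_def)
  also have "\<dots> = residue_class (ring_on C) d (x * y)" using el ne by blast
  finally show ?thesis .
qed

lemma carrier_Quot: "carrier (ring_on C Quot (PIdl\<^bsub>ring_on C\<^esub> d)) = residue_class (ring_on C) d ` C"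
  unfolding FactRing_def A_RCOSETS_def' residue_class_def by (auto simp: ring_on_def)

lemma map_residue_eq_iff:
  assumes x: "x \<in> vecs m" and y: "y \<in> vecs m"
  shows "map_vec (residue_class (ring_on C) d) x = map_vec (residue_class (ring_on C) d) y \<longleftrightarrow>
    (\<exists>u\<in>vecs m. x = d \<cdot>\<^sub>v u + y)"
proof
  assume eq: "map_vec (residue_class (ring_on C) d) x = map_vec (residue_class (ring_on C) d) y"
  have "\<exists>r\<in>C. x $ i = r * d + y $ i" if "i < m" for i
  proof -
    have "map_vec (residue_class (ring_on C) d) x $ i = map_vec (residue_class (ring_on C) d) y $ i" using eq by simp
    then have "residue_class (ring_on C) d (x $ i) = residue_class (ring_on C) d (y $ i)"
      using that vecs_dim[OF x] vecs_dim[OF y] by simp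
    then show ?thesis by (simp only: residue_class_eq_iff)
  qed
  then obtain r where r: "\<And>i. i < m \<Longrightarrow> r i \<in> C \<and> x $ i = r i * d + y $ i" by metis
  have "vec m r \<in> vecs m" using r by (simp add: vecs_def)
  moreover have "x = d \<cdot>\<^sub>v vec m r + y"
    using r vecs_dim[OF x] vecs_dim[OF y] by (intro eq_vecI) (auto simp: mult.commute)
  ultimately show "\<exists>u\<in>vecs m. x = d \<cdot>\<^sub>v u + y" by blast
next
  assume "\<exists>u\<in>vecs m. x = d \<cdot>\<^sub>v u + y"
  then obtain u where u: "u \<in> vecs m" "x = d \<cdot>\<^sub>v u + y" by blast
  show "map_vec (residue_class (ring_on C) d) x = map_vec (residue_class (ring_on C) d) y"
  proof (rule eq_vecI)
    show "dim_vec (map_vec (residue_class (ring_on C) d) x) = dim_vec (map_vec (residue_class (ring_on C) d) y)"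
      using vecs_dim[OF x] vecs_dim[OF y] by simp
    fix i assume "i < dim_vec (map_vec (residue_class (ring_on C) d) y)"
    then have i: "i < m" using vecs_dim[OF y] by simp
    have "x $ i = u $ i * d + y $ i"
      using i u vecs_dim[OF u(1)] vecs_dim[OF y] by (simp add: mult.commute)
    then have "residue_class (ring_on C) d (x $ i) = residue_class (ring_on C) d (y $ i)"
      unfolding residue_class_eq_iff using vecs_nth[OF u(1) i] by blast
    then show "map_vec (residue_class (ring_on C) d) x $ i = map_vec (residue_class (ring_on C) d) y $ i"
      using i vecs_dim[OF x] vecs_dim[OF y] by simp
  qed
qed

text \<open>A vector v represents an element of the kernel exactly when it lies in the image of A,
  which gives surjectivity. Injectivity modulo the image of B comes from \<open>B * A = d\<close>
  and the cancellation of d in a domain.\<close>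

lemma first_syzygyI:
  assumes A: "mat_in m A" and B: "mat_in m B" and d: "d \<in> C" "d \<noteq> 0"
    and AB: "A * B = d \<cdot>\<^sub>m 1\<^sub>m m" and BA: "B * A = d \<cdot>\<^sub>m 1\<^sub>m m"
  shows "first_syzygy (ring_on C) d m A B"
proof -
  let ?R = "ring_on C"
  let ?res = "residue_class ?R d"
  have Ad: "A \<in> carrier_mat m m" and Bd: "B \<in> carrier_mat m m" and dimA: "dim_row A = m"
    using mat_in_carrier[OF A] mat_in_carrier[OF B] mat_in_dim[OF A] by simp_all
  have dI: "(d \<cdot>\<^sub>m 1\<^sub>m m) *\<^sub>v w = d \<cdot>\<^sub>v w" if w: "w \<in> vecs m" for w
  proof (rule eq_vecI)
    fix i assume "i < dim_vec (d \<cdot>\<^sub>v w)"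
    then have i: "i < m" using vecs_dim[OF w] by simp
    have "((d \<cdot>\<^sub>m 1\<^sub>m m) *\<^sub>v w) $ i = (\<Sum>j = 0..<m. (if i = j then d else 0) * w $ j)"
      using i vecs_dim[OF w] by (auto simp: scalar_prod_def intro!: sum.cong)
    also have "\<dots> = (\<Sum>j = 0..<m. if i = j then d * w $ j else 0)" by (intro sum.cong) auto
    also have "\<dots> = d * w $ i" using i by simp
    finally show "((d \<cdot>\<^sub>m 1\<^sub>m m) *\<^sub>v w) $ i = (d \<cdot>\<^sub>v w) $ i" using i vecs_dim[OF w] by simp
  qed (use vecs_dim[OF w] in simp)
  have ABw: "A *\<^sub>v (B *\<^sub>v w) = d \<cdot>\<^sub>v w" if w: "w \<in> vecs m" for w
    using assoc_mult_mat_vec[OF Ad Bd vecs_dim[OF w]] dI[OF w] AB by simp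
  have BAw: "B *\<^sub>v (A *\<^sub>v w) = d \<cdot>\<^sub>v w" if w: "w \<in> vecs m" for w
    using assoc_mult_mat_vec[OF Bd Ad vecs_dim[OF w]] dI[OF w] BA by simp
  have Aadd: "A *\<^sub>v (v + w) = A *\<^sub>v v + A *\<^sub>v w" if "v \<in> vecs m" "w \<in> vecs m" for v w
    using mult_add_distrib_mat_vec[OF Ad vecs_dim[OF that(1)] vecs_dim[OF that(2)]] .
  have Badd: "B *\<^sub>v (v + w) = B *\<^sub>v v + B *\<^sub>v w" if "v \<in> vecs m" "w \<in> vecs m" for v w
    using mult_add_distrib_mat_vec[OF Bd vecs_dim[OF that(1)] vecs_dim[OF that(2)]] .
  define k where "k v = map_vec ?res (A *\<^sub>v v)" for v
  have k_eq: "k v = k v' \<longleftrightarrow> coset m B v = coset m B v'" if v: "v \<in> vecs m" "v' \<in> vecs m" for v v'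
  proof -
    have "k v = k v' \<longleftrightarrow> (\<exists>u\<in>vecs m. A *\<^sub>v v = d \<cdot>\<^sub>v u + A *\<^sub>v v')"
      unfolding k_def using vecs_mult[OF A v(1)] vecs_mult[OF A v(2)] by (rule map_residue_eq_iff)
    also have "\<dots> \<longleftrightarrow> (\<exists>u\<in>vecs m. v = B *\<^sub>v u + v')"
    proof (intro bex_cong refl iffI)
      fix u assume u: "u \<in> vecs m"
      assume "A *\<^sub>v v = d \<cdot>\<^sub>v u + A *\<^sub>v v'"
      \<comment> \<open>Applying B turns the congruence modulo d into d times the wanted
        identity.\<close>
      then have "B *\<^sub>v (A *\<^sub>v v) = B *\<^sub>v (d \<cdot>\<^sub>v u) + B *\<^sub>v (A *\<^sub>v v')"
        using Badd[OF vecs_smult[OF d(1) u] vecs_mult[OF A v(2)]] by simp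
      then have eq: "d \<cdot>\<^sub>v v = d \<cdot>\<^sub>v (B *\<^sub>v u) + d \<cdot>\<^sub>v v'"
        using BAw[OF v(1)] BAw[OF v(2)] mat_vec_smult[OF Bd vecs_dim[OF u], of d] by simp
      define y where "y = B *\<^sub>v u"
      have y: "y \<in> vecs m" unfolding y_def by (rule vecs_mult[OF B u])
      have dims: "dim_vec v = m" "dim_vec v' = m" "dim_vec y = m"
        using vecs_dim[OF v(1)] vecs_dim[OF v(2)] vecs_dim[OF y] by simp_all
      have "v = y + v'"
      proof (rule eq_vecI)
        show "dim_vec v = dim_vec (y + v')" using dims by simp
        fix i assume "i < dim_vec (y + v')"
        then have i: "i < m" using dims by simp
        have "(d \<cdot>\<^sub>v v) $ i = (d \<cdot>\<^sub>v y + d \<cdot>\<^sub>v v') $ i" using eq by (simp only: y_def)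
        then have "d * v $ i = d * (y $ i + v' $ i)" using i dims by (simp add: distrib_left)
        then show "v $ i = (y + v') $ i" using d(2) i dims by simp
      qed
      then show "v = B *\<^sub>v u + v'" by (simp only: y_def)
    next
      fix u assume u: "u \<in> vecs m" and "v = B *\<^sub>v u + v'"
      then show "A *\<^sub>v v = d \<cdot>\<^sub>v u + A *\<^sub>v v'"
        using Aadd[OF vecs_mult[OF B u] v(2)] ABw[OF u] by simp
    qed
    also have "\<dots> \<longleftrightarrow> coset m B v = coset m B v'" using coset_eq_iff[OF B v] by simp
    finally show ?thesis .
  qed
  \<comment> \<open>The map on cosets takes an arbitrary representative; \<open>k_eq\<close> makes
    it well defined and injective at once.\<close>
  define h where "h U = k (SOME v. v \<in> vecs m \<and> U = coset m B v)" for U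
  have h: "h (coset m B v) = k v" if v: "v \<in> vecs m" for v
  proof -
    have "\<exists>w. w \<in> vecs m \<and> coset m B v = coset m B w" using v by blast
    from someI_ex[OF this] show ?thesis unfolding h_def using k_eq[OF v] by metis
  qed
  have free_res: "carrier (free_residue_module ?R d m) = map_vec ?res ` vecs m"
  proof (intro equalityI subsetI)
    fix W assume "W \<in> carrier (free_residue_module ?R d m)"
    then have W: "W \<in> carrier_vec m" "\<And>i. i < m \<Longrightarrow> W $ i \<in> ?res ` C"
      by (simp_all add: free_residue_module_def restrict_scalars_def free_module_def carrier_Quot)
    define w where "w i = (SOME x. x \<in> C \<and> W $ i = ?res x)" for i
    have w: "w i \<in> C \<and> W $ i = ?res (w i)" if i: "i < m" for i
    proof -
      have "\<exists>x. x \<in> C \<and> W $ i = ?res x" using W(2)[OF i] by (rule imageE) blast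
      then show ?thesis unfolding w_def by (rule someI_ex)
    qed
    have "W = map_vec ?res (vec m w)"
    proof (rule eq_vecI)
      show "dim_vec W = dim_vec (map_vec ?res (vec m w))" using W(1) by simp
      fix i assume "i < dim_vec (map_vec ?res (vec m w))"
      then have i: "i < m" by simp
      then have "map_vec ?res (vec m w) $ i = ?res (w i)" by simp
      then show "W $ i = map_vec ?res (vec m w) $ i" by (rule trans[OF conjunct2[OF w[OF i]] sym])
    qed
    moreover have "vec m w \<in> vecs m" using w by (simp add: vecs_def)
    ultimately show "W \<in> map_vec ?res ` vecs m" by blast
  next
    fix W assume "W \<in> map_vec ?res ` vecs m"
    then obtain w where "w \<in> vecs m" "W = map_vec ?res w" by blast
    then show "W \<in> carrier (free_residue_module ?R d m)"
      by (auto simp: free_residue_module_def restrict_scalars_def free_module_def carrier_Quot vecs_def)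
  qed
  have zero_coker: "\<zero>\<^bsub>coker ?R A\<^esub> = coset m A (0\<^sub>v m)"
  proof -
    have "coset m A (0\<^sub>v m) = (*\<^sub>v) A ` vecs m"
      unfolding coset_def using vecs_dim[OF vecs_mult[OF A]] by (intro image_cong refl) simp
    then show ?thesis by (simp add: coker_def quotient_module_def mat_image_eq[OF A])
  qed
  have nat_surj: "natural_surj ?R d A (map_vec ?res v) = coset m A v" if v: "v \<in> vecs m" for v
  proof -
    \<comment> \<open>Because \<open>A * B = d\<close>, multiples of d lie in the image of A, so all
      cosets in the union defining \<open>natural_surj\<close> coincide.\<close>
    have same: "coset m A w = coset m A v" if w: "w \<in> vecs m" "map_vec ?res w = map_vec ?res v" for w
    proof -
      obtain u where u: "u \<in> vecs m" "w = d \<cdot>\<^sub>v u + v" using map_residue_eq_iff[OF w(1) v] w(2) by blast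
      then have "w = A *\<^sub>v (B *\<^sub>v u) + v" using ABw by simp
      then show ?thesis using coset_eq_iff[OF A w(1) v] vecs_mult[OF B u(1)] by blast
    qed
    have "natural_surj ?R d A (map_vec ?res v) =
        \<Union> {coset m A w | w. w \<in> vecs m \<and> map_vec ?res w = map_vec ?res v}"
    proof -
      have "{mat_image ?R A +>\<^bsub>free_module ?R m\<^esub> w | w. w \<in> vecs m \<and> map_vec ?res w = map_vec ?res v} =
          {coset m A w | w. w \<in> vecs m \<and> map_vec ?res w = map_vec ?res v}"
        using a_r_coset_free_module[OF A] by blast
      then show ?thesis by (simp add: natural_surj_def dimA carrier_free_module)
    qed
    also have "{coset m A w | w. w \<in> vecs m \<and> map_vec ?res w = map_vec ?res v} = {coset m A v}"
      using same v by blast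
    finally show ?thesis by simp
  qed
  have ker: "carrier (natural_kernel ?R d A) = k ` vecs m"
  proof (intro equalityI subsetI)
    fix W assume "W \<in> carrier (natural_kernel ?R d A)"
    then have W: "W \<in> map_vec ?res ` vecs m" "natural_surj ?R d A W = \<zero>\<^bsub>coker ?R A\<^esub>"
      by (simp_all add: natural_kernel_def dimA free_res)
    then obtain v where v: "v \<in> vecs m" "W = map_vec ?res v" by blast
    then have "coset m A v = coset m A (0\<^sub>v m)" using W(2) nat_surj zero_coker by simp
    then obtain w where w: "w \<in> vecs m" "v = A *\<^sub>v w + 0\<^sub>v m"
      using coset_eq_iff[OF A v(1) vecs_zero] by blast
    then have "v = A *\<^sub>v w" using vecs_dim[OF vecs_mult[OF A w(1)]] by simp
    then show "W \<in> k ` vecs m" using v(2) w(1) by (simp add: k_def)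
  next
    fix W assume "W \<in> k ` vecs m"
    then obtain w where w: "w \<in> vecs m" "W = map_vec ?res (A *\<^sub>v w)" by (auto simp: k_def)
    have "A *\<^sub>v w = A *\<^sub>v w + 0\<^sub>v m" using vecs_dim[OF vecs_mult[OF A w(1)]] by simp
    then have "coset m A (A *\<^sub>v w) = coset m A (0\<^sub>v m)"
      using coset_eq_iff[OF A vecs_mult[OF A w(1)] vecs_zero] w(1) by blast
    then have "natural_surj ?R d A W = \<zero>\<^bsub>coker ?R A\<^esub>"
      using w(2) nat_surj[OF vecs_mult[OF A w(1)]] zero_coker by simp
    then show "W \<in> carrier (natural_kernel ?R d A)"
      using w(2) vecs_mult[OF A w(1)] by (simp add: natural_kernel_def dimA free_res)
  qed
  have k_add: "k (v + w) = k v \<oplus>\<^bsub>natural_kernel ?R d A\<^esub> k w" if vw: "v \<in> vecs m" "w \<in> vecs m" for v w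
  proof (rule eq_vecI)
    show "dim_vec (k (v + w)) = dim_vec (k v \<oplus>\<^bsub>natural_kernel ?R d A\<^esub> k w)"
      using Ad by (simp add: k_def natural_kernel_def free_residue_module_def restrict_scalars_def free_module_def)
    fix i assume "i < dim_vec (k v \<oplus>\<^bsub>natural_kernel ?R d A\<^esub> k w)"
    then have i: "i < m"
      using Ad by (simp add: k_def natural_kernel_def free_residue_module_def restrict_scalars_def free_module_def)
    show "k (v + w) $ i = (k v \<oplus>\<^bsub>natural_kernel ?R d A\<^esub> k w) $ i"
      using i Ad vecs_dim[OF vecs_mult[OF A vw(1)]] vecs_dim[OF vecs_mult[OF A vw(2)]]
      by (simp add: k_def natural_kernel_def free_residue_module_def restrict_scalars_def free_module_def
          Aadd[OF vw] residue_class_add del: index_mult_mat_vec)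
  qed
  have k_smult: "k (a \<cdot>\<^sub>v v) = a \<odot>\<^bsub>natural_kernel ?R d A\<^esub> k v" if a: "a \<in> C" and v: "v \<in> vecs m" for a v
  proof (rule eq_vecI)
    show "dim_vec (k (a \<cdot>\<^sub>v v)) = dim_vec (a \<odot>\<^bsub>natural_kernel ?R d A\<^esub> k v)"
      using Ad by (simp add: k_def natural_kernel_def free_residue_module_def restrict_scalars_def free_module_def)
    fix i assume "i < dim_vec (a \<odot>\<^bsub>natural_kernel ?R d A\<^esub> k v)"
    then have i: "i < m"
      using Ad by (simp add: k_def natural_kernel_def free_residue_module_def restrict_scalars_def free_module_def)
    show "k (a \<cdot>\<^sub>v v) $ i = (a \<odot>\<^bsub>natural_kernel ?R d A\<^esub> k v) $ i"
      using i Ad vecs_dim[OF vecs_mult[OF A v]] mat_vec_smult[OF Ad vecs_dim[OF v], of a]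
        residue_class_mult[OF a vecs_nth[OF vecs_mult[OF A v] i] d(1)]
      by (simp add: k_def natural_kernel_def free_residue_module_def restrict_scalars_def free_module_def
          del: index_mult_mat_vec)
  qed
  have "h \<in> linear_maps ?R (coker ?R B) (natural_kernel ?R d A)"
    unfolding linear_maps_def mem_Collect_eq
  proof (intro conjI ballI funcsetI)
    fix U assume "U \<in> carrier (coker ?R B)"
    then obtain v where "v \<in> vecs m" "U = coset m B v" unfolding carrier_coker[OF B] by blast
    then show "h U \<in> carrier (natural_kernel ?R d A)" using h ker by simp
  next
    fix U U' assume "U \<in> carrier (coker ?R B)" "U' \<in> carrier (coker ?R B)"
    then obtain v v' where "v \<in> vecs m" "U = coset m B v" "v' \<in> vecs m" "U' = coset m B v'"
      unfolding carrier_coker[OF B] by blast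
    then show "h (U \<oplus>\<^bsub>coker ?R B\<^esub> U') = h U \<oplus>\<^bsub>natural_kernel ?R d A\<^esub> h U'"
      by (simp add: add_coker[OF B] h vecs_add k_add)
  next
    fix a U assume "a \<in> carrier ?R" "U \<in> carrier (coker ?R B)"
    then obtain v where "a \<in> C" "v \<in> vecs m" "U = coset m B v"
      unfolding carrier_coker[OF B] by (auto simp: ring_on_def)
    then show "h (a \<odot>\<^bsub>coker ?R B\<^esub> U) = a \<odot>\<^bsub>natural_kernel ?R d A\<^esub> h U"
      by (simp add: smult_coker[OF B] h vecs_smult k_smult)
  qed
  moreover have "bij_betw h (carrier (coker ?R B)) (carrier (natural_kernel ?R d A))"
    unfolding bij_betw_def
  proof
    show "inj_on h (carrier (coker ?R B))"
    proof (rule inj_onI)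
      fix U U' assume "U \<in> carrier (coker ?R B)" "U' \<in> carrier (coker ?R B)" "h U = h U'"
      then show "U = U'" unfolding carrier_coker[OF B] using h k_eq by auto
    qed
    show "h ` carrier (coker ?R B) = carrier (natural_kernel ?R d A)"
      unfolding carrier_coker[OF B] ker image_image by (intro image_cong refl h)
  qed
  ultimately show ?thesis
    unfolding first_syzygy_def modules_isomorphic_def using AB BA by blast
qed

end


subsection \<open>Submodules of the polynomial ring over the symmetric polynomials\<close>

lemma sym_ring_ring_on: "sym_ring n = ring_on (sym_polys n)"
  by (simp add: sym_ring_def ring_on_def)

lemma subring_set_sym_polys: "subring_set (sym_polys n)"
  by unfold_locales (simp_all add: sym_polys_closed)

lemma module_poly_module: "module (sym_ring n) (poly_module n)"
proof (rule moduleI)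
  show "cring (sym_ring n)"
    unfolding sym_ring_ring_on by (rule subring_set.cring_ring_on[OF subring_set_sym_polys])
  show "abelian_group (poly_module n)"
  proof (rule abelian_groupI)
    fix x assume "x \<in> carrier (poly_module n)"
    then show "\<exists>y\<in>carrier (poly_module n). y \<oplus>\<^bsub>poly_module n\<^esub> x = \<zero>\<^bsub>poly_module n\<^esub>"
      by (intro bexI[of _ "- x"]) (simp_all add: poly_module_def polys_uminus)
  qed (simp_all add: poly_module_def polys_add algebra_simps)
qed (simp_all add: poly_module_def sym_ring_def polys_mult sym_polys_imp_polys algebra_simps)

lemma sym_span_scale:
  assumes "a \<in> sym_polys n" "f \<in> sym_span n m V"
  shows "a * f \<in> sym_span n m V"
proof -
  obtain r where "\<forall>j<m. r j \<in> sym_polys n" "f = (\<Sum>j<m. r j * V j)"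
    using assms(2) unfolding sym_span_def by blast
  then show ?thesis unfolding sym_span_def using assms(1)
    by (intro CollectI exI[of _ "\<lambda>j. a * r j"]) (simp add: sym_polys_mult sum_distrib_left mult.assoc)
qed

lemma sym_span_base:
  assumes "i < m"
  shows "V i \<in> sym_span n m V"
proof -
  have "(\<Sum>j<m. (if j = i then 1 else 0) * V j) = (\<Sum>j<m. if j = i then V j else 0)"
    by (intro sum.cong) auto
  also have "\<dots> = V i" using assms by simp
  finally show ?thesis unfolding sym_span_def
    by (intro CollectI exI[of _ "\<lambda>j. if j = i then 1 else 0"]) simp
qed

lemma sym_span_polys:
  assumes "\<And>j. j < m \<Longrightarrow> V j \<in> polys n"
  shows "sym_span n m V \<subseteq> polys n"
proof
  fix f assume "f \<in> sym_span n m V"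
  then obtain r where r: "\<forall>j<m. r j \<in> sym_polys n" "f = (\<Sum>j<m. r j * V j)"
    unfolding sym_span_def by blast
  show "f \<in> polys n" unfolding r(2)
    by (intro polys_sum polys_mult) (use assms sym_polys_imp_polys[OF r(1)[rule_format]] in auto)
qed

lemma sym_span_cong: "(\<And>j. j < m \<Longrightarrow> V j = W j) \<Longrightarrow> sym_span n m V = sym_span n m W"
  unfolding sym_span_def by simp

lemma sym_indep_cong: "(\<And>j. j < m \<Longrightarrow> V j = W j) \<Longrightarrow> sym_indep n m V = sym_indep n m W"
  unfolding sym_indep_def by simp

lemma poly_module_a_inv:
  assumes "x \<in> polys n"
  shows "\<ominus>\<^bsub>poly_module n\<^esub> x = - x"
proof -
  interpret module "sym_ring n" "poly_module n" by (rule module_poly_module)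
  show ?thesis
    by (rule minus_equality) (use assms in \<open>simp_all add: poly_module_def polys_uminus\<close>)
qed

lemma submodule_sym_span:
  assumes "\<And>j. j < m \<Longrightarrow> V j \<in> polys n"
  shows "submodule (sym_span n m V) (sym_ring n) (poly_module n)"
proof (rule module.submoduleI[OF module_poly_module])
  show "sym_span n m V \<subseteq> carrier (poly_module n)" using sym_span_polys[of m V n, OF assms] by (simp add: poly_module_def)
  show "\<zero>\<^bsub>poly_module n\<^esub> \<in> sym_span n m V" by (simp add: poly_module_def sym_span_0)
  fix f assume f: "f \<in> sym_span n m V"
  then have "f \<in> polys n" using sym_span_polys[of m V n, OF assms] by blast
  then have "\<ominus>\<^bsub>poly_module n\<^esub> f = (- 1) * f" using poly_module_a_inv by simp
  then show "\<ominus>\<^bsub>poly_module n\<^esub> f \<in> sym_span n m V"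
    using sym_span_scale[OF sym_polys_uminus[OF sym_polys_1] f] by simp
  show "f \<oplus>\<^bsub>poly_module n\<^esub> g \<in> sym_span n m V" if "g \<in> sym_span n m V" for g
    using sym_span_add[OF f that] by (simp add: poly_module_def)
  show "a \<odot>\<^bsub>poly_module n\<^esub> f \<in> sym_span n m V" if "a \<in> carrier (sym_ring n)" for a
    using sym_span_scale[OF _ f, of a] that by (simp add: poly_module_def sym_ring_def)
qed

lemma generated_submodule_sym_span:
  assumes bs: "set bs \<subseteq> polys n"
  shows "generated_submodule (sym_ring n) (poly_module n) (set bs) =
    poly_module n\<lparr>carrier := sym_span n (length bs) (nth bs)\<rparr>"
proof -
  let ?S = "sym_span n (length bs) (nth bs)"
  have nth: "bs ! j \<in> polys n" if "j < length bs" for j using bs nth_mem[OF that] by blast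
  have "(\<lambda>N. submodule N (sym_ring n) (poly_module n)) hull set bs = ?S"
  proof (rule subset_antisym)
    show "(\<lambda>N. submodule N (sym_ring n) (poly_module n)) hull set bs \<subseteq> ?S"
    proof (rule hull_minimal)
      show "set bs \<subseteq> ?S" using sym_span_base[of _ "length bs" "nth bs" n] by (auto simp: in_set_conv_nth)
      show "submodule ?S (sym_ring n) (poly_module n)" by (rule submodule_sym_span) (rule nth)
    qed
    show "?S \<subseteq> (\<lambda>N. submodule N (sym_ring n) (poly_module n)) hull set bs"
      unfolding hull_def
    proof (intro Inter_greatest subsetI)
      fix N f assume "N \<in> {N. submodule N (sym_ring n) (poly_module n) \<and> set bs \<subseteq> N}" and f: "f \<in> ?S"
      then have N: "submodule N (sym_ring n) (poly_module n)" "set bs \<subseteq> N" by auto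
      obtain r where r: "\<forall>j<length bs. r j \<in> sym_polys n" "f = (\<Sum>j<length bs. r j * bs ! j)"
        using f unfolding sym_span_def by blast
      have zero: "0 \<in> N"
        using subgroup.one_closed[OF submodule.axioms(1)[OF N(1)]] by (simp add: poly_module_def)
      have add: "x + y \<in> N" if "x \<in> N" "y \<in> N" for x y
        using subgroup.m_closed[OF submodule.axioms(1)[OF N(1)] that] by (simp add: poly_module_def)
      have sc: "r j * bs ! j \<in> N" if "j < length bs" for j
        using submodule.smult_closed[OF N(1), of "r j" "bs ! j"] r(1)[rule_format, OF that]
          subsetD[OF N(2) nth_mem[OF that]]
        by (simp add: poly_module_def sym_ring_def)
      have "(\<Sum>j<k. r j * bs ! j) \<in> N" if "k \<le> length bs" for k
        using that by (induction k) (simp_all add: zero add sc)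
      then show "f \<in> N" using r(2) by simp
    qed
  qed
  then show ?thesis by (simp add: generated_submodule_def)
qed

context
  fixes n :: nat and bs :: "'k::field mpoly list" and N
  assumes bs: "set bs \<subseteq> polys n"
    and N: "N = poly_module n\<lparr>carrier := sym_span n (length bs) (nth bs)\<rparr>"
begin

lemma module_sym_span: "module (sym_ring n) N"
proof -
  have "bs ! j \<in> polys n" if "j < length bs" for j using bs nth_mem[OF that] by blast
  then have "submodule (sym_span n (length bs) (nth bs)) (sym_ring n) (poly_module n)" by (rule submodule_sym_span)
  then show ?thesis unfolding N by (rule submodule.submodule_is_module[OF _ module_poly_module])
qed

lemma sym_span_module_simps: "carrier N = sym_span n (length bs) (nth bs)" "add N = (+)" "zero N = 0" "smult N = (*)"
  by (simp_all add: N poly_module_def)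

lemma finsum_sym_span:
  assumes "finite I" "\<And>i. i \<in> I \<Longrightarrow> f i \<in> sym_span n (length bs) (nth bs)"
  shows "finsum N f I = sum f I"
proof -
  interpret module "sym_ring n" N by (rule module_sym_span)
  show ?thesis using assms
  proof (induction I rule: finite_induct)
    case (insert i I)
    have "finsum N f (insert i I) = f i \<oplus>\<^bsub>N\<^esub> finsum N f I"
      using insert by (intro finsum_insert) (auto simp: sym_span_module_simps)
    then show ?case using insert by (simp add: sym_span_module_simps)
  qed (simp add: sym_span_module_simps)
qed

lemma finsum_combination:
  assumes "\<And>i. i < length bs \<Longrightarrow> r i \<in> sym_polys n"
  shows "(\<Oplus>\<^bsub>N\<^esub> i \<in> {..<length bs}. r i \<odot>\<^bsub>N\<^esub> (bs ! i)) = (\<Sum>i<length bs. r i * bs ! i)"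
  unfolding sym_span_module_simps
proof (rule finsum_sym_span)
  fix i assume "i \<in> {..<length bs}"
  then have i: "i < length bs" by simp
  show "r i * bs ! i \<in> sym_span n (length bs) (nth bs)"
    by (rule sym_span_scale[OF assms[OF i] sym_span_base[OF i]])
qed simp

text \<open>Uniqueness in \<open>module_basis\<close> ranges over extensional coefficient families,
  which is why coefficients are compared after \<open>restrict\<close>.\<close>

lemma module_basis_iff: "module_basis (sym_ring n) N bs \<longleftrightarrow> sym_indep n (length bs) (nth bs)"
proof
  assume mb: "module_basis (sym_ring n) N bs"
  show "sym_indep n (length bs) (nth bs)"
    unfolding sym_indep_def
  proof (intro allI impI, elim conjE)
    fix r j assume r: "\<forall>j<length bs. r j \<in> sym_polys n" "(\<Sum>j<length bs. r j * bs ! j) = 0" and j: "j < length bs"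
    have ex1: "\<exists>!a. a \<in> {..<length bs} \<rightarrow>\<^sub>E carrier (sym_ring n) \<and>
        0 = (\<Oplus>\<^bsub>N\<^esub> i \<in> {..<length bs}. a i \<odot>\<^bsub>N\<^esub> (bs ! i))"
      using mb sym_span_0[of n "length bs" "nth bs"] unfolding module_basis_def sym_span_module_simps(1) by blast
    have cand: "restrict s {..<length bs} \<in> {..<length bs} \<rightarrow>\<^sub>E carrier (sym_ring n) \<and>
        0 = (\<Oplus>\<^bsub>N\<^esub> i \<in> {..<length bs}. restrict s {..<length bs} i \<odot>\<^bsub>N\<^esub> (bs ! i))"
      if s: "\<And>j. j < length bs \<Longrightarrow> s j \<in> sym_polys n" "(\<Sum>j<length bs. s j * bs ! j) = 0" for s
    proof
      show "restrict s {..<length bs} \<in> {..<length bs} \<rightarrow>\<^sub>E carrier (sym_ring n)"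
        using s(1) by (auto simp: sym_ring_def)
      have "(\<Oplus>\<^bsub>N\<^esub> i \<in> {..<length bs}. restrict s {..<length bs} i \<odot>\<^bsub>N\<^esub> (bs ! i)) =
          (\<Sum>i<length bs. restrict s {..<length bs} i * bs ! i)"
        using s(1) by (intro finsum_combination) simp
      also have "\<dots> = 0" using s(2) by simp
      finally show "0 = (\<Oplus>\<^bsub>N\<^esub> i \<in> {..<length bs}. restrict s {..<length bs} i \<odot>\<^bsub>N\<^esub> (bs ! i))" ..
    qed
    have "restrict r {..<length bs} = restrict (\<lambda>_. 0) {..<length bs}"
    proof (rule ex1E[OF ex1])
      fix a assume "\<forall>y. y \<in> {..<length bs} \<rightarrow>\<^sub>E carrier (sym_ring n) \<and>
        0 = (\<Oplus>\<^bsub>N\<^esub> i \<in> {..<length bs}. y i \<odot>\<^bsub>N\<^esub> (bs ! i)) \<longrightarrow> y = a"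
      note uniq = this[THEN spec, THEN mp]
      have "restrict r {..<length bs} = a" by (rule uniq, rule cand) (use r in simp_all)
      moreover have "restrict (\<lambda>_. 0) {..<length bs} = a" by (rule uniq, rule cand) simp_all
      ultimately show ?thesis by (rule trans[OF _ sym])
    qed
    then have "restrict r {..<length bs} j = restrict (\<lambda>_. 0) {..<length bs} j" by (rule fun_cong)
    then show "r j = 0" using j by simp
  qed
next
  assume ind: "sym_indep n (length bs) (nth bs)"
  show "module_basis (sym_ring n) N bs"
    unfolding module_basis_def
  proof (intro conjI ballI)
    show "set bs \<subseteq> carrier N"
      using sym_span_base[of _ "length bs" "nth bs" n] by (auto simp: sym_span_module_simps in_set_conv_nth)
    fix x assume "x \<in> carrier N"
    then obtain r where r: "\<forall>j<length bs. r j \<in> sym_polys n" "x = (\<Sum>j<length bs. r j * bs ! j)"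
      unfolding sym_span_module_simps sym_span_def by blast
    show "\<exists>!a. a \<in> {..<length bs} \<rightarrow>\<^sub>E carrier (sym_ring n) \<and>
        x = (\<Oplus>\<^bsub>N\<^esub> i \<in> {..<length bs}. a i \<odot>\<^bsub>N\<^esub> (bs ! i))"
    proof (rule ex1I[of _ "restrict r {..<length bs}"])
      have "(\<Oplus>\<^bsub>N\<^esub> i \<in> {..<length bs}. restrict r {..<length bs} i \<odot>\<^bsub>N\<^esub> (bs ! i)) =
          (\<Sum>i<length bs. restrict r {..<length bs} i * bs ! i)"
        using r(1) by (intro finsum_combination) simp
      then have "x = (\<Oplus>\<^bsub>N\<^esub> i \<in> {..<length bs}. restrict r {..<length bs} i \<odot>\<^bsub>N\<^esub> (bs ! i))"
        using r(2) by simp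
      then show "restrict r {..<length bs} \<in> {..<length bs} \<rightarrow>\<^sub>E carrier (sym_ring n) \<and>
        x = (\<Oplus>\<^bsub>N\<^esub> i \<in> {..<length bs}. restrict r {..<length bs} i \<odot>\<^bsub>N\<^esub> (bs ! i))"
        using r(1) by (auto simp: sym_ring_def)
      fix a assume a: "a \<in> {..<length bs} \<rightarrow>\<^sub>E carrier (sym_ring n) \<and>
        x = (\<Oplus>\<^bsub>N\<^esub> i \<in> {..<length bs}. a i \<odot>\<^bsub>N\<^esub> (bs ! i))"
      then have as: "a i \<in> sym_polys n" if "i < length bs" for i
        using that by (auto simp: sym_ring_def)
      have xa: "x = (\<Sum>i<length bs. a i * bs ! i)" using a finsum_combination[of a] as by simp
      have "a i = r i" if "i < length bs" for i
      proof -
        have "(\<Sum>j<length bs. (a j - r j) * bs ! j) = 0"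
          using xa r(2) by (simp add: left_diff_distrib sum_subtractf)
        moreover have "\<forall>j<length bs. a j - r j \<in> sym_polys n" using as r(1) by (simp add: sym_polys_diff)
        ultimately have "a i - r i = 0" using sym_indepD[OF ind, of "\<lambda>j. a j - r j" i] that by blast
        then show ?thesis by simp
      qed
      then show "a = restrict r {..<length bs}"
        using a by (intro extensionalityI[of _ "{..<length bs}"]) (auto simp: PiE_def)
    qed
  qed
qed

lemma free_of_rank_sym_span:
  "sym_indep n (length bs) (nth bs) \<Longrightarrow> free_of_rank (sym_ring n) N (length bs)"
  unfolding free_of_rank_def using module_sym_span module_basis_iff by blast

end

lemma vandermonde_mult_linear_map:
  assumes "\<And>x. x \<in> S \<Longrightarrow> f * x \<in> S'"
  shows "(\<lambda>x. f * x) \<in> linear_maps R (poly_module n\<lparr>carrier := S\<rparr>) (poly_module n\<lparr>carrier := S'\<rparr>)"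
  unfolding linear_maps_def using assms by (auto simp: poly_module_def distrib_left mult.left_commute)

lemma mat_mult_mat:
  "mat m m f * mat m m g = mat m m (\<lambda>(i, j). \<Sum>l<m. f (i, l) * g (l, j))"
  by (rule eq_matI) (simp_all add: scalar_prod_def atLeast0LessThan)


subsection \<open>The matrix of multiplication by the Vandermonde polynomial\<close>

context good_char
begin

text \<open>After the earlier terms are subtracted, \<open>U j\<close> annihilates all later ones,
  and both pairings in the quotient carry the same constant c.\<close>

lemma triangular_coefficient:
  fixes U V \<alpha> :: "nat \<Rightarrow> 'k mpoly"
  assumes tri: "triangular_pairing m U V" and \<alpha>: "\<And>l. l < m \<Longrightarrow> \<alpha> l \<in> sym_polys n"
    and f: "f = (\<Sum>l<m. \<alpha> l * V l)" and j: "j < m"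
  shows "exact_quot n (form n (U j) (f - (\<Sum>l<j. \<alpha> l * V l))) (form n (U j) (V j)) = \<alpha> j"
proof -
  obtain c where c: "c \<noteq> 0" "alt_sum n (U j * V j) = Const c * vandermonde n"
    using tri j unfolding triangular_pairing_def by blast
  have zero: "alt_sum n (U j * V l) = 0" if "l < m" "j < l" for l
    using tri that unfolding triangular_pairing_def by blast
  have "f = (\<Sum>l<j. \<alpha> l * V l) + (\<Sum>l\<in>{j..<m}. \<alpha> l * V l)"
    unfolding f lessThan_atLeast0
    by (rule sum.atLeastLessThan_concat[symmetric]) (use j in simp_all)
  then have "f - (\<Sum>l<j. \<alpha> l * V l) = (\<Sum>l\<in>{j..<m}. \<alpha> l * V l)" by (simp only: add_diff_cancel_left')
  then have "alt_sum n (U j * (f - (\<Sum>l<j. \<alpha> l * V l))) = alt_sum n (\<Sum>l\<in>{j..<m}. \<alpha> l * (U j * V l))"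
    by (simp only: sum_distrib_left mult.left_commute)
  also have "\<dots> = (\<Sum>l\<in>{j..<m}. \<alpha> l * alt_sum n (U j * V l))"
    unfolding alt_sum_sum by (intro sum.cong refl alt_sum_sym_mult \<alpha>) simp
  also have "\<dots> = (\<Sum>l\<in>{j..<m}. if l = j then \<alpha> j * alt_sum n (U j * V j) else 0)"
    by (intro sum.cong refl) (simp add: zero)
  also have "\<dots> = \<alpha> j * Const c * vandermonde n" using j c(2) by (simp add: mult.assoc)
  finally have "form n (U j) (f - (\<Sum>l<j. \<alpha> l * V l)) = \<alpha> j * Const c"
    by (rule form_eq) (use \<alpha>[OF j] in \<open>simp add: polys_mult sym_polys_imp_polys\<close>)
  moreover have "form n (U j) (V j) = Const c" using c(2) by (rule form_eq) simp
  ultimately show ?thesis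
    using exact_quot_eq[of "\<alpha> j" "Const c"] \<alpha>[OF j] c(1) by (simp add: sym_polys_imp_polys)
qed

text \<open>Multiplying a basis element by the Vandermonde polynomial twice and comparing
  coordinates gives the product of the matrices. Exchanging the two families yields the product in
  the other order.\<close>

lemma factorization_matrix_mult:
  fixes H F :: "nat \<Rightarrow> 'k mpoly"
  assumes indep: "sym_indep n m F"
    and \<alpha>: "\<And>i l. i < m \<Longrightarrow> l < m \<Longrightarrow> \<alpha> i l \<in> sym_polys n"
    and \<beta>: "\<And>i l. i < m \<Longrightarrow> l < m \<Longrightarrow> \<beta> i l \<in> sym_polys n"
    and H: "\<And>i. i < m \<Longrightarrow> vandermonde n * H i = (\<Sum>l<m. \<alpha> i l * F l)"
    and F: "\<And>i. i < m \<Longrightarrow> vandermonde n * F i = (\<Sum>l<m. \<beta> i l * H l)"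
  shows "mat m m (\<lambda>(j, i). \<alpha> i j) * mat m m (\<lambda>(j, i). \<beta> i j) = (vandermonde n)\<^sup>2 \<cdot>\<^sub>m 1\<^sub>m m"
proof -
  let ?z = "vandermonde n :: 'k mpoly"
  have entry: "(\<Sum>l<m. \<alpha> l j * \<beta> i l) = (if j = i then ?z\<^sup>2 else 0)" if i: "i < m" and j: "j < m" for i j
  proof -
    define r where "r k = (\<Sum>l<m. \<alpha> l k * \<beta> i l) - (if k = i then ?z\<^sup>2 else 0)" for k
    have "?z\<^sup>2 * F i = ?z * (\<Sum>l<m. \<beta> i l * H l)" by (simp only: power2_eq_square mult.assoc F[OF i])
    also have "\<dots> = (\<Sum>l<m. \<beta> i l * (?z * H l))" by (simp add: sum_distrib_left mult.left_commute)
    also have "\<dots> = (\<Sum>l<m. \<beta> i l * (\<Sum>k<m. \<alpha> l k * F k))" by (intro sum.cong refl) (simp add: H)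
    also have "\<dots> = (\<Sum>l<m. \<Sum>k<m. \<alpha> l k * \<beta> i l * F k)"
      by (simp add: sum_distrib_left mult.commute mult.left_commute)
    also have "\<dots> = (\<Sum>k<m. \<Sum>l<m. \<alpha> l k * \<beta> i l * F k)" by (rule sum.swap)
    finally have 1: "?z\<^sup>2 * F i = (\<Sum>k<m. (\<Sum>l<m. \<alpha> l k * \<beta> i l) * F k)" by (simp only: sum_distrib_right)
    have "(\<Sum>k<m. (if k = i then ?z\<^sup>2 else 0) * F k) = (\<Sum>k<m. if k = i then ?z\<^sup>2 * F i else 0)"
      by (intro sum.cong refl) simp
    also have "\<dots> = ?z\<^sup>2 * F i" using i by simp
    finally have sum: "(\<Sum>k<m. r k * F k) = 0" using 1 by (simp only: r_def left_diff_distrib sum_subtractf diff_self)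
    have "\<forall>k<m. r k \<in> sym_polys n"
      unfolding r_def using i by (auto intro!: sym_polys_diff sym_polys_sum sym_polys_mult \<alpha> \<beta> vandermonde_sq_sym)
    then have "r j = 0" using sum j by (rule sym_indepD[OF indep])
    then show ?thesis by (simp add: r_def)
  qed
  show ?thesis unfolding mat_mult_mat by (rule eq_matI) (simp_all add: entry)
qed

end

context tab
begin

context
  fixes \<gamma> :: 'k and m :: nat and P :: "nat \<Rightarrow> nat \<Rightarrow> nat"
  assumes \<gamma>: "\<gamma> \<noteq> 0" and m: "m = card (std_perms n rw cl)"
    and P: "\<And>j. j < m \<Longrightarrow> P j \<in> std_perms n rw cl"
    and less: "\<And>j l. l < m \<Longrightarrow> j < l \<Longrightarrow> perm_less n rw cl (P j) (P l)"
begin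

abbreviation (input) "fam_U j \<equiv> ysym n rw cl (Const \<gamma> * spec_mon n cl (P j))"
abbreviation (input) "fam_V j \<equiv> ysym n cl rw (Const \<gamma> * spec_mon n rw (P j))"
abbreviation (input) "fam_H j \<equiv> ysig n rw cl (Const \<gamma> * spec_mon n cl (P j))"

lemma specht_triangular: "triangular_pairing m (\<lambda>j. fam_U j) (\<lambda>j. fam_V j)"
  unfolding triangular_pairing_def
proof (intro conjI allI impI)
  have scale: "alt_sum n (fam_U j * fam_V l) = Const (\<gamma> * \<gamma>) *
      alt_sum n (ysym n rw cl (spec_mon n cl (P j)) * ysym n cl rw (spec_mon n rw (P l)))" for j l
  proof -
    have "fam_U j * fam_V l = Const (\<gamma> * \<gamma>) *
        (ysym n rw cl (spec_mon n cl (P j)) * ysym n cl rw (spec_mon n rw (P l)))"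
      by (simp add: ysym_sym_mult Const_mult algebra_simps)
    then show ?thesis by (simp only: alt_sum_Const)
  qed
  show "\<exists>c\<noteq>0. alt_sum n (fam_U j * fam_V j) = Const c * vandermonde n" if j: "j < m" for j
  proof -
    obtain c :: 'k where c: "c \<noteq> 0"
      "alt_sum n (ysym n rw cl (spec_mon n cl (P j)) * ysym n cl rw (spec_mon n rw (P j))) = Const c * vandermonde n"
      using P[OF j] by (rule pairing_diagonal)
    have "alt_sum n (fam_U j * fam_V j) = Const (\<gamma> * \<gamma> * c) * vandermonde n"
      unfolding scale c(2) by (simp add: Const_mult mult.assoc)
    then show ?thesis using c(1) \<gamma> by (intro exI[of _ "\<gamma> * \<gamma> * c"]) simp
  qed
  show "alt_sum n (fam_U j * fam_V l) = 0" if l: "l < m" and j: "j < l" for l j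
  proof -
    have "alt_sum n (ysym n rw cl (spec_mon n cl (P j)) * ysym n cl rw (spec_mon n rw (P l))) = (0 :: 'k mpoly)"
      by (rule pairing_zero[OF P[OF less_trans[OF j l]] P[OF l] less[OF l j]])
    then show ?thesis unfolding scale by simp
  qed
qed

lemma polys_specht_arg: "Const \<gamma> * spec_mon n c (P j) \<in> polys n"
  unfolding spec_mon_def by (rule polys_mult[OF polys_Const polys_mon])

lemma specht_ysym_span:
  assumes "f \<in> polys n"
  shows "ysym n cl rw f \<in> sym_span n m (\<lambda>j. fam_V j)"
  by (rule ysym_span[OF m polys_specht_arg polys_specht_arg specht_triangular assms])

lemma specht_ysig_span:
  assumes indep: "sym_indep n m (\<lambda>j. fam_H j)" and f: "f \<in> polys n"
  shows "ysig n rw cl f \<in> sym_span n m (\<lambda>j. fam_H j)"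
proof (rule ysig_span[OF _ _ _ _ indep f])
  interpret tr: tab n "TYPE('k)" cl rw by (rule tab_transposed)
  note tri = triangular_pairing_rev[OF specht_triangular]
  show "sym_indep n m (\<lambda>j. fam_U j)"
    by (rule sym_indep_rev, rule triangular_pairing_indep[OF tri])
  show "ysym n rw cl f \<in> sym_span n m (\<lambda>j. fam_U j)" if f: "f \<in> polys n" for f
  proof -
    \<comment> \<open>The spanning result for the transposed tableau, applied to the pairing with
      both families exchanged and reversed.\<close>
    have "ysym n rw cl f \<in> sym_span n m (\<lambda>j. fam_U (m - Suc j))"
      by (rule tr.ysym_span[OF _ polys_specht_arg polys_specht_arg tri f])
         (simp only: m std_perms_transposed)
    then show ?thesis using sym_span_rev[of n m "\<lambda>j. fam_U j"] by (rule subsetD[rotated])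
  qed
  show "homog (\<Sum>x\<in>{1..n}. letter_desc cl (P j) (P j x)) (Const \<gamma> * spec_mon n cl (P j))" for j
    unfolding spec_mon_def by (rule homog_Const_mult[OF homog_mon])
qed (rule polys_specht_arg)

end

end

text \<open>The freeness of the first module on the given generators enters as a hypothesis; it
  supplies the independence from which the span of the H is shown to be the full image of r c. The
  basis property for the second module is part of the conclusion. Indices of tableaux and matrix
  entries start at 0.\<close>

theorem theorem3p19:
  fixes n m :: nat and lam lam' :: "nat list"
    and T T' :: tableau and Ts :: "tableau list"
    and R :: "'k::field mpoly ring" and z :: "'k mpoly"
    and M N :: "('k mpoly, 'k mpoly) module"
    and Hs Fs :: "'k mpoly list"
  assumes "n \<ge> 3"
    and "\<not> CHAR('k) dvd fact n"
    and "is_partition lam n"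
    and "T \<in> ST lam"
    and "m = card (ST lam)"
    and "set Ts = ST lam" and "sorted_wrt (tab_less lam) Ts"
    and "R = sym_ring n" and "z = vandermonde n"
    and "lam' = conj_partition lam" and "T' = transpose_tab T"
    and "M = M_module lam T" and "N = N_module lam' T'"
    and "Hs = map (H_poly lam T) Ts"
    and "Fs = map (\<lambda>P. F_poly lam' T' (transpose_tab P)) Ts"
    and "module_basis R M Hs"
  shows "module_basis R N Fs \<and>
    matrix_factorization R (z ^ 2) M N (\<lambda>f. z * f) (\<lambda>f. z * f) \<and>
    (\<exists>A B. A = mat m m (\<lambda>(j, i). g_coeff lam T Ts i j) \<and>
       represents R N Hs Fs (\<lambda>f. z * f) A \<and>
       represents R M Fs Hs (\<lambda>f. z * f) B \<and>
       first_syzygy R (z ^ 2) m A B)"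
proof -
  note lam = assms(3) and T = assms(4) and R = assms(8) and z = assms(9)
  have n2: "n \<ge> 2" using assms(1) by simp
  have fact: "of_nat (fact n) \<noteq> (0 :: 'k)" using assms(2) by (simp only: of_nat_eq_0_iff_char_dvd not_False_eq_True)
  have nlam: "sum_list lam = n" by (rule sum_list_lam[OF lam T])
  have lam': "is_partition lam' n" unfolding assms(10) by (rule is_partition_conj[OF lam])
  have T': "T' \<in> ST lam'" unfolding assms(10,11) by (rule transpose_tab_ST[OF lam T])
  have nlam': "sum_list lam' = n" by (rule sum_list_lam[OF lam' T'])
  define rw where "rw = tab_row lam T"
  define cl where "cl = tab_col lam T"
  interpret t: tab n "TYPE('k)" rw cl unfolding rw_def cl_def by (rule tab_locale[OF lam T n2 fact])
  have T'_simps: "tab_row lam' T' = cl" "tab_col lam' T' = rw" "tab_perm lam' T' (transpose_tab P) = tab_perm lam T P" for P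
    unfolding assms(10,11) rw_def cl_def
    by (rule tab_row_transpose[OF lam T] tab_col_transpose[OF lam T] tab_perm_transpose[OF lam T])+
  define P where "P i = tab_perm lam T (Ts ! i)" for i
  have Ts_ST: "Ts ! i \<in> ST lam" if "i < length Ts" for i using nth_mem[OF that] assms(6) by (simp only:)
  have less: "perm_less n rw cl (P i) (P j)" if j: "j < length Ts" and i: "i < j" for i j
    unfolding P_def rw_def cl_def
    by (rule tab_less_perm_less[OF lam T Ts_ST[OF less_trans[OF i j]] Ts_ST[OF j] sorted_wrt_nth_less[OF assms(7) i j]])
  \<comment> \<open>Irreflexivity makes the increasing list \<open>Ts\<close> free of repetitions,
    so its length is the number of standard tableaux.\<close>
  have irrefl: "\<not> perm_less n rw cl p p" for p unfolding perm_less_def by simp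
  have "distinct Ts"
    unfolding distinct_conv_nth
  proof (intro allI impI notI)
    fix i j assume ij: "i < length Ts" "j < length Ts" "i \<noteq> j" "Ts ! i = Ts ! j"
    then have "P i = P j" by (simp only: P_def)
    then show False using less[OF ij(1), of j] less[OF ij(2), of i] ij(3) irrefl[of "P i"] by (metis nat_neq_iff)
  qed
  then have len: "length Ts = m" using distinct_card[of Ts] assms(5,6) by simp
  have m0: "0 < m" using T assms(6) len by (metis length_greater_0_conv empty_iff list.set(1))
  have mstd: "m = card (std_perms n rw cl)" unfolding rw_def cl_def card_std_perms[OF lam T] by (rule assms(5))
  define \<gamma> :: 'k where "\<gamma> = of_nat (card (ST lam)) / of_nat (fact n)"
  define U where "U j = ysym n rw cl (Const \<gamma> * spec_mon n cl (P j))" for j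
  define V where "V j = ysym n cl rw (Const \<gamma> * spec_mon n rw (P j))" for j
  define H where "H j = ysig n rw cl (Const \<gamma> * spec_mon n cl (P j))" for j
  have F_U: "F_poly lam T (Ts ! i) = U i" if "i < m" for i
    using F_poly_ysym[OF lam T Ts_ST[of i], where ?'a = 'k] that
    by (simp only: len U_def P_def rw_def cl_def \<gamma>_def simp_thms)
  have F_V: "F_poly lam' T' (transpose_tab (Ts ! i)) = V i" if i: "i < m" for i
  proof -
    have "transpose_tab (Ts ! i) \<in> ST lam'"
      unfolding assms(10) by (rule transpose_tab_ST[OF lam Ts_ST]) (simp only: len i)
    moreover have "card (ST lam') = card (ST lam)" unfolding assms(10) by (rule card_ST_conj_partition[OF lam])
    ultimately show ?thesis
      using F_poly_ysym[OF lam' T', of "transpose_tab (Ts ! i)", where ?'a = 'k]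
      by (simp only: T'_simps V_def P_def \<gamma>_def)
  qed
  have H_H: "H_poly lam T (Ts ! i) = H i" if "i < m" for i
    using H_poly_ysig[OF lam T Ts_ST[of i], where ?'a = 'k] that
    by (simp only: len H_def P_def rw_def cl_def \<gamma>_def simp_thms)
  have lens: "length Hs = m" "length Fs = m" unfolding assms(14,15) by (simp_all only: length_map len)
  have Hs: "Hs ! i = H i" and Fs: "Fs ! i = V i" if "i < m" for i
    unfolding assms(14,15) using that by (simp_all add: len H_H F_V)
  have polys_arg: "Const \<gamma> * spec_mon n c (P j) \<in> polys n" for c j
    unfolding spec_mon_def by (rule polys_mult[OF polys_Const polys_mon])
  have polys_fam: "U j \<in> polys n" "V j \<in> polys n" "H j \<in> polys n" for j
    unfolding U_def V_def H_def by (rule polys_ysym polys_ysig, rule polys_arg)+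
  have Hs_polys: "set Hs \<subseteq> polys n" and Fs_polys: "set Fs \<subseteq> polys n"
    using Hs Fs polys_fam lens by (auto simp: in_set_conv_nth)
  have HsM: "set Hs = H_poly lam T ` ST lam" unfolding assms(14) by (simp only: set_map assms(6))
  have FsN: "set Fs = F_poly lam' T' ` ST lam'"
    unfolding assms(15) by (simp only: set_map assms(6) assms(10) ST_conj_partition[OF lam] image_image)
  have M: "M = poly_module n\<lparr>carrier := sym_span n (length Hs) (nth Hs)\<rparr>"
    unfolding assms(12) M_module_def nlam HsM[symmetric] by (rule generated_submodule_sym_span[OF Hs_polys])
  have N: "N = poly_module n\<lparr>carrier := sym_span n (length Fs) (nth Fs)\<rparr>"
    unfolding assms(13) N_module_def nlam' FsN[symmetric] by (rule generated_submodule_sym_span[OF Fs_polys])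
  have spanH_eq: "sym_span n (length Hs) (nth Hs) = sym_span n m H"
    unfolding lens by (rule sym_span_cong) (rule Hs)
  have spanF_eq: "sym_span n (length Fs) (nth Fs) = sym_span n m V"
    unfolding lens by (rule sym_span_cong) (rule Fs)
  have "sym_indep n m (nth Hs)"
    using assms(16) module_basis_iff[OF Hs_polys M] unfolding R lens by blast
  then have indepH: "sym_indep n m H" using sym_indep_cong[of m "nth Hs" H n, OF Hs] by blast
  \<comment> \<open>The scalar in the symmetrizers is nonzero because a zero scalar would make the
    first basis element H vanish.\<close>
  have gamma: "\<gamma> \<noteq> 0"
  proof
    assume "\<gamma> = 0"
    then have "H 0 = 0" unfolding H_def by simp
    then have "(\<Sum>j<m. (if j = 0 then 1 else 0) * H j) = 0" by (intro sum.neutral) auto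
    moreover have "\<forall>j<m. (if j = 0 then 1 else 0) \<in> (sym_polys n :: 'k mpoly set)" by simp
    ultimately show False using sym_indepD[OF indepH, of "\<lambda>j. if j = 0 then 1 else 0" 0] m0 by simp
  qed
  have P_std: "P j \<in> std_perms n rw cl" if "j < m" for j
    unfolding P_def rw_def cl_def by (rule tab_perm_std[OF lam T Ts_ST]) (simp only: len that)
  have less_m: "perm_less n rw cl (P j) (P l)" if "l < m" "j < l" for j l
    by (rule less) (simp_all only: len that)
  note specht = gamma mstd P_std less_m
  have tri: "t.triangular_pairing m U V"
    using t.specht_triangular[of \<gamma> m P, OF specht] unfolding U_def V_def by blast
  have spanV: "ysym n cl rw f \<in> sym_span n m V" if "f \<in> polys n" for f
    using t.specht_ysym_span[of \<gamma> m P, OF specht that] unfolding V_def by blast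
  have spanH: "ysig n rw cl f \<in> sym_span n m H" if "f \<in> polys n" for f
    using t.specht_ysig_span[of \<gamma> m P, OF specht indepH[unfolded H_def] that] unfolding H_def by blast
  have indepV: "sym_indep n m V" by (rule t.triangular_pairing_indep[OF tri])
  have indepV_Fs: "sym_indep n (length Fs) (nth Fs)"
    unfolding lens using indepV sym_indep_cong[of m "nth Fs" V n, OF Fs] by blast
  have basisN: "module_basis R N Fs" unfolding R module_basis_iff[OF Fs_polys N] by (rule indepV_Fs)
  have zpoly: "z \<in> polys n" unfolding z by (rule polys_vandermonde)
  \<comment> \<open>The product is again a value of the transposed symmetrizer, now at
    \<open>z\<close> times the old argument, so the spanning result applies.\<close>
  have zH: "z * H i \<in> sym_span n m V" for i
    unfolding H_def z t.vandermonde_mult_ysig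
    by (rule spanV[OF polys_mult[OF polys_vandermonde polys_arg]])
  have zV: "z * V i \<in> sym_span n m H" for i
    unfolding V_def z t.vandermonde_mult_ysym
    by (rule spanH[OF polys_mult[OF polys_vandermonde polys_arg]])
  have zspan: "z * f \<in> sym_span n m W'" if f: "f \<in> sym_span n m W" and W: "\<And>i. z * W i \<in> sym_span n m W'" for f W W'
  proof -
    obtain r where r: "\<forall>j<m. r j \<in> sym_polys n" "f = (\<Sum>j<m. r j * W j)"
      using f unfolding sym_span_def by blast
    have "z * f = (\<Sum>j<m. r j * (z * W j))" unfolding r(2) by (simp only: sum_distrib_left mult.left_commute)
    also have "\<dots> \<in> sym_span n m W'"
      by (rule sym_span_sum) (use r(1) W in \<open>simp add: sym_span_scale\<close>)
    finally show ?thesis .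
  qed
  obtain \<alpha> where \<alpha>: "\<And>i j. j < m \<Longrightarrow> \<alpha> i j \<in> sym_polys n" "\<And>i. z * H i = (\<Sum>j<m. \<alpha> i j * V j)"
  proof -
    have "\<forall>i. \<exists>r. (\<forall>j<m. r j \<in> sym_polys n) \<and> z * H i = (\<Sum>j<m. r j * V j)"
      using zH unfolding sym_span_def by blast
    from choice[OF this] show ?thesis using that by blast
  qed
  obtain \<beta> where \<beta>: "\<And>i j. j < m \<Longrightarrow> \<beta> i j \<in> sym_polys n" "\<And>i. z * V i = (\<Sum>j<m. \<beta> i j * H j)"
  proof -
    have "\<forall>i. \<exists>r. (\<forall>j<m. r j \<in> sym_polys n) \<and> z * V i = (\<Sum>j<m. r j * H j)"
      using zV unfolding sym_span_def by blast
    from choice[OF this] show ?thesis using that by blast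
  qed
  \<comment> \<open>Strong induction on j: the recursion calls the coefficients with smaller j,
    which are already known to be coordinates.\<close>
  have g: "g_coeff lam T Ts i j = \<alpha> i j" if i: "i < m" and j: "j < m" for i j
    using j
  proof (induction j rule: less_induct)
    case (less j)
    have sum: "(\<Sum>l<j. g_coeff lam T Ts i l * F_poly lam' T' (transpose_tab (Ts ! l))) = (\<Sum>l<j. \<alpha> i l * V l)"
    proof (rule sum.cong[OF refl])
      fix l assume "l \<in> {..<j}"
      then have l: "l < j" "l < m" using less.prems by simp_all
      show "g_coeff lam T Ts i l * F_poly lam' T' (transpose_tab (Ts ! l)) = \<alpha> i l * V l"
        unfolding less.IH[OF l] F_V[OF l(2)] by (rule refl)
    qed
    have "g_coeff lam T Ts i j = exact_quot n (form n (U j) (z * H i - (\<Sum>l<j. \<alpha> i l * V l))) (form n (U j) (V j))"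
      unfolding g_coeff.simps[of lam T Ts i j] nlam assms(10)[symmetric] assms(11)[symmetric] z[symmetric]
        sum F_U[OF less.prems] F_V[OF less.prems] H_H[OF i] by (rule refl)
    also have "\<dots> = \<alpha> i j"
      by (rule t.triangular_coefficient[OF tri \<alpha>(1) \<alpha>(2) less.prems])
    finally show ?case .
  qed
  define A where "A = mat m m (\<lambda>(j, i). g_coeff lam T Ts i j :: 'k mpoly)"
  define B where "B = mat m m (\<lambda>(j, i). \<beta> i j)"
  have A: "A = mat m m (\<lambda>(j, i). \<alpha> i j)" unfolding A_def by (rule eq_matI) (simp_all add: g del: g_coeff.simps)
  have AB: "A * B = z\<^sup>2 \<cdot>\<^sub>m 1\<^sub>m m"
    unfolding A B_def z by (rule t.factorization_matrix_mult[OF indepV \<alpha>(1) \<beta>(1) \<alpha>(2)[unfolded z] \<beta>(2)[unfolded z]])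
  have BA: "B * A = z\<^sup>2 \<cdot>\<^sub>m 1\<^sub>m m"
    unfolding A B_def z by (rule t.factorization_matrix_mult[OF indepH \<beta>(1) \<alpha>(1) \<beta>(2)[unfolded z] \<alpha>(2)[unfolded z]])
  have syz: "first_syzygy R (z ^ 2) m A B"
    unfolding R sym_ring_ring_on
  proof (rule subring_set.first_syzygyI[OF subring_set_sym_polys _ _ _ _ AB BA])
    show "subring_set.mat_in (sym_polys n) m A" "subring_set.mat_in (sym_polys n) m B"
      unfolding subring_set.mat_in_def[OF subring_set_sym_polys] A B_def by (simp_all add: \<alpha>(1) \<beta>(1))
    show "z\<^sup>2 \<in> sym_polys n" unfolding z by (rule t.vandermonde_sq_sym)
    show "z\<^sup>2 \<noteq> 0" unfolding z by simp
  qed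
  have repA: "represents R N Hs Fs (\<lambda>f. z * f) A"
    unfolding represents_def
  proof (intro conjI allI impI)
    show "A \<in> carrier_mat (length Fs) (length Hs)" unfolding A lens by simp
    show "A $$ (j, i) \<in> carrier R" if "j < length Fs" "i < length Hs" for i j
      using that unfolding A lens R sym_ring_def by (simp add: \<alpha>(1))
    fix i assume "i < length Hs"
    then have i: "i < m" unfolding lens .
    have "(\<Oplus>\<^bsub>N\<^esub>j\<in>{..<length Fs}. A $$ (j, i) \<odot>\<^bsub>N\<^esub> Fs ! j) = (\<Sum>j<length Fs. A $$ (j, i) * Fs ! j)"
      by (rule finsum_combination[OF Fs_polys N]) (simp add: lens A i \<alpha>(1))
    also have "\<dots> = z * Hs ! i"
      unfolding lens Hs[OF i] \<alpha>(2) by (rule sum.cong[OF refl]) (simp add: A i Fs)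
    finally show "z * Hs ! i = (\<Oplus>\<^bsub>N\<^esub>j\<in>{..<length Fs}. A $$ (j, i) \<odot>\<^bsub>N\<^esub> Fs ! j)" by (rule sym)
  qed
  have repB: "represents R M Fs Hs (\<lambda>f. z * f) B"
    unfolding represents_def
  proof (intro conjI allI impI)
    show "B \<in> carrier_mat (length Hs) (length Fs)" unfolding B_def lens by simp
    show "B $$ (j, i) \<in> carrier R" if "j < length Hs" "i < length Fs" for i j
      using that unfolding B_def lens R sym_ring_def by (simp add: \<beta>(1))
    fix i assume "i < length Fs"
    then have i: "i < m" unfolding lens .
    have "(\<Oplus>\<^bsub>M\<^esub>j\<in>{..<length Hs}. B $$ (j, i) \<odot>\<^bsub>M\<^esub> Hs ! j) = (\<Sum>j<length Hs. B $$ (j, i) * Hs ! j)"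
      by (rule finsum_combination[OF Hs_polys M]) (simp add: lens B_def i \<beta>(1))
    also have "\<dots> = z * Fs ! i"
      unfolding lens Fs[OF i] \<beta>(2) by (rule sum.cong[OF refl]) (simp add: B_def i Hs)
    finally show "z * Fs ! i = (\<Oplus>\<^bsub>M\<^esub>j\<in>{..<length Hs}. B $$ (j, i) \<odot>\<^bsub>M\<^esub> Hs ! j)" by (rule sym)
  qed
  have mf: "matrix_factorization R (z ^ 2) M N (\<lambda>f. z * f) (\<lambda>f. z * f)"
    unfolding matrix_factorization_def
  proof (intro conjI exI[of _ m] ballI)
    show "free_of_rank R M m" "free_of_rank R N m"
      using free_of_rank_sym_span[OF Hs_polys M] free_of_rank_sym_span[OF Fs_polys N] indepV_Fs
        \<open>sym_indep n m (nth Hs)\<close> unfolding R lens by blast+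
    show "(\<lambda>f. z * f) \<in> linear_maps R M N"
      unfolding M N spanH_eq spanF_eq by (rule vandermonde_mult_linear_map) (rule zspan[OF _ zH])
    show "(\<lambda>f. z * f) \<in> linear_maps R N M"
      unfolding M N spanH_eq spanF_eq by (rule vandermonde_mult_linear_map) (rule zspan[OF _ zV])
    show "z * (z * x) = z\<^sup>2 \<odot>\<^bsub>M\<^esub> x" for x
      unfolding sym_span_module_simps[OF Hs_polys M] by (simp only: power2_eq_square mult.assoc)
    show "z * (z * x) = z\<^sup>2 \<odot>\<^bsub>N\<^esub> x" for x
      unfolding sym_span_module_simps[OF Fs_polys N] by (simp only: power2_eq_square mult.assoc)
  qed
  show ?thesis using basisN mf A_def repA repB syz by blast
qed

end
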